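(* Let $Y$ be a quasi-Banach space for which the decoupling inequality holds. Let $(S,\Sigma,\mu)$ be a nonzero measure space and let $q\in(0,\infty)$. Then $X=L^q(S;Y)$ satisfies the decoupling inequality. Moreover, $D_p(L^p(S;Y))=D_p(Y)$ for $p\in(0,\infty)$.
   Context: A quasi-Banach space is defined like a Banach space, with the triangle inequality replaced by $\|x+y\|\le C(\|x\|+\|y\|)$ for some constant $C$. $X$-valued random variables are Borel measurable maps with separable range. Let $(\Omega,\mathcal{A},(\mathcal{F}_n)_{n\ge1},\mathbb{P})$ be a complete probability space with a filtration, $\mathcal{F}_0=\{\Omega,\varnothing\}$, $\mathcal{F}_\infty=\sigma(\mathcal{F}_n:n\ge1)$. For an $(\mathcal{F}_n)$-adapted sequence $(d_n)_{n\ge1}$ of $X$-valued random variables, an $\mathcal{F}_\infty$-decoupled tangent sequence is a sequence $(e_n)_{n\ge1}$ of $X$-valued random variables on $(\Omega,\mathcal{A},\mathbb{P})$ with (a) $\mathbb{P}(d_n\in B\,|\,\mathcal{F}_{n-1})=\mathbb{P}(e_n\in B\,|\,\mathcal{F}_\infty)$ for all $n\ge1$, Borel $B\subseteq X$, and (b) $\mathbb{P}(e_1\in B_1,\dots,e_n\in B_n\,|\,\mathcal{F}_\infty)=\prod_{k=1}^n\mathbb{P}(e_k\in B_k\,|\,\mathcal{F}_\infty)$ for all $n$ and Borel $B_k$. A sequence $g$ is an $\mathcal{F}_\infty$-decoupled sum sequence of an adapted sequence $f$ if $(g_n-g_{n-1})_{n\ge1}$ is an $\mathcal{F}_\infty$-decoupled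 tangent sequence of $(f_n-f_{n-1})_{n\ge1}$, where $f_0=g_0\equiv0$. For $p\in(0,\infty)$, the decoupling inequality holds in $X$ for $p$ if there is a constant $D_p$ such that $\|f_n\|_p\le D_p\|g_n\|_p$ for all $n\ge1$, for all complete filtered probability spaces, all $X$-valued adapted $f=(f_n)_{n\ge1}\subseteq L^p(\Omega;X)$ and $g$ an $\mathcal{F}_\infty$-decoupled sum sequence of $f$. The least such constant is $D_p(X)$. A space satisfies the decoupling inequality if it does so for some, equivalently (a known fact) for all, $p\in(0,\infty)$.
   Formalization: The equality of constants assumes a set of finite positive measure (it fails if μ takes only values 0 and ∞); the quasi-norm of Y is assumed Borel, so that ‖f‖_p makes sense; sample spaces are subsets of one arbitrary set of at least continuum size. *)

theory Defs
  imports "HOL-Probability.Probability" "HOL-Algebra.Module"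
begin

section \<open>Quasi-Banach spaces\<close>

definition real_scalars :: "real ring" where
  "real_scalars = \<lparr>carrier = UNIV, mult = (*), one = 1, zero = 0, add = (+)\<rparr>"

lemma cring_real_scalars: "cring real_scalars"
  unfolding real_scalars_def
  by (rule cringI, rule abelian_groupI, auto intro: comm_monoidI simp: algebra_simps)
     (metis add.commute add.right_inverse)

text \<open>
  The scalars are real; a complex quasi-Banach space is also a real one, and nothing below
  uses more than the real structure. The fields \<open>mult\<close> and \<open>one\<close> inherited from
  \<open>module\<close> play no role.
\<close>

record 'a qnormed = "(real, 'a) module" +
  qnorm :: "'a \<Rightarrow> real"

locale quasi_banach = module real_scalars V for V :: "'a qnormed" (structure) +
  assumes qnorm_nonneg: "x \<in> carrier V \<Longrightarrow> 0 \<le> qnorm V x"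
    and qnorm_eq_0_iff: "x \<in> carrier V \<Longrightarrow> qnorm V x = 0 \<longleftrightarrow> x = \<zero>"
    and qnorm_smult: "x \<in> carrier V \<Longrightarrow> qnorm V (c \<odot> x) = \<bar>c\<bar> * qnorm V x"
    and quasi_triangle:
      "\<exists>C. \<forall>x\<in>carrier V. \<forall>y\<in>carrier V. qnorm V (x \<oplus> y) \<le> C * (qnorm V x + qnorm V y)"
    and complete:
      "\<lbrakk>\<And>n :: nat. u n \<in> carrier V;
        \<And>\<epsilon>. 0 < \<epsilon> \<Longrightarrow> \<exists>N. \<forall>m\<ge>N. \<forall>n\<ge>N. qnorm V (u m \<ominus> u n) < \<epsilon>\<rbrakk>
       \<Longrightarrow> \<exists>l\<in>carrier V. (\<lambda>n. qnorm V (u n \<ominus> l)) \<longlonglongrightarrow> 0"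

text \<open>
  Balls of a quasi-norm need not be open, so the topology is given by: a set is open iff it
  contains a ball around each of its points.
\<close>

definition qtopology :: "'a qnormed \<Rightarrow> 'a topology" where
  "qtopology V = topology (\<lambda>U. U \<subseteq> carrier V \<and>
     (\<forall>x\<in>U. \<exists>\<epsilon>>0. \<forall>y\<in>carrier V. qnorm V (y \<ominus>\<^bsub>V\<^esub> x) < \<epsilon> \<longrightarrow> y \<in> U))"

lemma openin_qtopology:
  "openin (qtopology V) U \<longleftrightarrow> U \<subseteq> carrier V \<and>
     (\<forall>x\<in>U. \<exists>\<epsilon>>0. \<forall>y\<in>carrier V. qnorm V (y \<ominus>\<^bsub>V\<^esub> x) < \<epsilon> \<longrightarrow> y \<in> U)"
proof -
  let ?L = "\<lambda>U. U \<subseteq> carrier V \<and>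
     (\<forall>x\<in>U. \<exists>\<epsilon>>0. \<forall>y\<in>carrier V. qnorm V (y \<ominus>\<^bsub>V\<^esub> x) < \<epsilon> \<longrightarrow> y \<in> U)"
  have "istopology ?L"
    unfolding istopology_def
  proof (intro conjI allI impI)
    fix A B assume A: "?L A" and B: "?L B"
    show "A \<inter> B \<subseteq> carrier V" using A by blast
    show "\<forall>x\<in>A \<inter> B. \<exists>\<epsilon>>0. \<forall>y\<in>carrier V. qnorm V (y \<ominus>\<^bsub>V\<^esub> x) < \<epsilon> \<longrightarrow> y \<in> A \<inter> B"
    proof
      fix x assume "x \<in> A \<inter> B"
      then obtain a b where
        "a > 0" "\<forall>y\<in>carrier V. qnorm V (y \<ominus>\<^bsub>V\<^esub> x) < a \<longrightarrow> y \<in> A"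
        "b > 0" "\<forall>y\<in>carrier V. qnorm V (y \<ominus>\<^bsub>V\<^esub> x) < b \<longrightarrow> y \<in> B"
        using A B by blast
      then show "\<exists>\<epsilon>>0. \<forall>y\<in>carrier V. qnorm V (y \<ominus>\<^bsub>V\<^esub> x) < \<epsilon> \<longrightarrow> y \<in> A \<inter> B"
        by (intro exI[of _ "min a b"]) auto
    qed
  next
    fix K assume "\<forall>A\<in>K. ?L A"
    then show "\<Union> K \<subseteq> carrier V"
      and "\<forall>x\<in>\<Union> K. \<exists>\<epsilon>>0. \<forall>y\<in>carrier V. qnorm V (y \<ominus>\<^bsub>V\<^esub> x) < \<epsilon> \<longrightarrow> y \<in> \<Union> K"
      by (blast, meson UnionE UnionI)
  qed
  then show ?thesis by (simp add: qtopology_def topology_inverse')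
qed

lemma topspace_qtopology: "topspace (qtopology V) = carrier V"
proof (rule subset_antisym)
  show "topspace (qtopology V) \<subseteq> carrier V"
    unfolding topspace_def openin_qtopology by blast
  have "openin (qtopology V) (carrier V)"
    unfolding openin_qtopology using zero_less_one by blast
  then show "carrier V \<subseteq> topspace (qtopology V)" by (rule openin_subset)
qed

definition qborel :: "'a qnormed \<Rightarrow> 'a measure" where
  "qborel V = sigma (carrier V) {U. openin (qtopology V) U}"

definition separably_valued :: "'w measure \<Rightarrow> 'a qnormed \<Rightarrow> ('w \<Rightarrow> 'a) \<Rightarrow> bool" where
  "separably_valued M V f \<longleftrightarrow>
     f \<in> M \<rightarrow>\<^sub>M qborel V \<and> separable_space (subtopology (qtopology V) (f ` space M))"

definition Lp_norm :: "real \<Rightarrow> 'w measure \<Rightarrow> 'a qnormed \<Rightarrow> ('w \<Rightarrow> 'a) \<Rightarrow> ennreal" where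
  "Lp_norm p M V f =
     (let I = \<integral>\<^sup>+\<omega>. ennreal (qnorm V (f \<omega>) powr p) \<partial>M
      in if I = \<infinity> then \<infinity> else ennreal (enn2real I powr (1 / p)))"


section \<open>The space $L^q(S;Y)$\<close>

definition Lq_functions :: "real \<Rightarrow> 's measure \<Rightarrow> 'y qnormed \<Rightarrow> ('s \<Rightarrow> 'y) set" where
  "Lq_functions q S Y = {f. separably_valued S Y f \<and> Lp_norm q S Y f < \<infinity>}"

definition ae_rel :: "real \<Rightarrow> 's measure \<Rightarrow> 'y qnormed \<Rightarrow> (('s \<Rightarrow> 'y) \<times> ('s \<Rightarrow> 'y)) set" where
  "ae_rel q S Y =
     {(f, g). f \<in> Lq_functions q S Y \<and> g \<in> Lq_functions q S Y \<and> (AE s in S. f s = g s)}"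

text \<open>
  Elements are almost-everywhere classes. Each union below ranges over representatives and is
  a single class, independent of the representatives.
\<close>

definition Lq_space :: "real \<Rightarrow> 's measure \<Rightarrow> 'y qnormed \<Rightarrow> ('s \<Rightarrow> 'y) set qnormed" where
  "Lq_space q S Y =
     \<lparr>carrier = Lq_functions q S Y // ae_rel q S Y,
      mult = undefined,
      one = undefined,
      zero = ae_rel q S Y `` {\<lambda>s. \<zero>\<^bsub>Y\<^esub>},
      add = (\<lambda>A B. \<Union>f\<in>A. \<Union>g\<in>B. ae_rel q S Y `` {\<lambda>s. f s \<oplus>\<^bsub>Y\<^esub> g s}),
      smult = (\<lambda>c A. \<Union>f\<in>A. ae_rel q S Y `` {\<lambda>s. c \<odot>\<^bsub>Y\<^esub> f s}),
      qnorm = (\<lambda>A. the_elem ((\<lambda>f. enn2real (Lp_norm q S Y f)) ` A))\<rparr>"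


section \<open>Decoupling\<close>

definition complete_filtered_prob_space :: "'w measure \<Rightarrow> (nat \<Rightarrow> 'w measure) \<Rightarrow> bool" where
  "complete_filtered_prob_space M F \<longleftrightarrow>
     prob_space M \<and> complete_measure M \<and> filtration (space M) F \<and>
     (\<forall>n. subalgebra M (F n)) \<and> sets (F 0) = {{}, space M}"

definition F_infinity :: "'w measure \<Rightarrow> (nat \<Rightarrow> 'w measure) \<Rightarrow> 'w measure" where
  "F_infinity M F = sigma (space M) (\<Union>n\<in>{1..}. sets (F n))"

definition conditional_prob :: "'w measure \<Rightarrow> 'w measure \<Rightarrow> 'w set \<Rightarrow> 'w \<Rightarrow> real" where
  "conditional_prob M G A = real_cond_exp M G (indicator A)"

text \<open>Sequences are indexed by positive integers; for sums, index 0 carries the value zero.\<close>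

definition adapted :: "(nat \<Rightarrow> 'w measure) \<Rightarrow> 'a qnormed \<Rightarrow> (nat \<Rightarrow> 'w \<Rightarrow> 'a) \<Rightarrow> bool" where
  "adapted F V d \<longleftrightarrow> (\<forall>n\<ge>1. separably_valued (F n) V (d n))"

definition decoupled_tangent ::
  "'w measure \<Rightarrow> (nat \<Rightarrow> 'w measure) \<Rightarrow> 'a qnormed \<Rightarrow>
     (nat \<Rightarrow> 'w \<Rightarrow> 'a) \<Rightarrow> (nat \<Rightarrow> 'w \<Rightarrow> 'a) \<Rightarrow> bool" where
  "decoupled_tangent M F V d e \<longleftrightarrow>
     adapted F V d \<and> (\<forall>n\<ge>1. separably_valued M V (e n)) \<and>
     (\<forall>n\<ge>1. \<forall>B\<in>sets (qborel V). AE \<omega> in M.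
        conditional_prob M (F (n - 1)) (d n -` B \<inter> space M) \<omega> =
        conditional_prob M (F_infinity M F) (e n -` B \<inter> space M) \<omega>) \<and>
     (\<forall>n\<ge>1. \<forall>B. (\<forall>k\<in>{1..n}. B k \<in> sets (qborel V)) \<longrightarrow> (AE \<omega> in M.
        conditional_prob M (F_infinity M F) {\<omega>\<in>space M. \<forall>k\<in>{1..n}. e k \<omega> \<in> B k} \<omega> =
        (\<Prod>k\<in>{1..n}. conditional_prob M (F_infinity M F) (e k -` B k \<inter> space M) \<omega>)))"

definition decoupled_sum ::
  "'w measure \<Rightarrow> (nat \<Rightarrow> 'w measure) \<Rightarrow> 'a qnormed \<Rightarrow>
     (nat \<Rightarrow> 'w \<Rightarrow> 'a) \<Rightarrow> (nat \<Rightarrow> 'w \<Rightarrow> 'a) \<Rightarrow> bool" where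
  "decoupled_sum M F V f g \<longleftrightarrow>
     adapted F V f \<and> (\<forall>n\<ge>1. separably_valued M V (g n)) \<and>
     f 0 = (\<lambda>\<omega>. \<zero>\<^bsub>V\<^esub>) \<and> g 0 = (\<lambda>\<omega>. \<zero>\<^bsub>V\<^esub>) \<and>
     decoupled_tangent M F V
       (\<lambda>n \<omega>. f n \<omega> \<ominus>\<^bsub>V\<^esub> f (n - 1) \<omega>) (\<lambda>n \<omega>. g n \<omega> \<ominus>\<^bsub>V\<^esub> g (n - 1) \<omega>)"

text \<open>
  A formula cannot quantify over all probability spaces of all types. The type argument
  \<open>'w\<close> fixes the type of the outcomes; sample spaces are arbitrary subsets of it.
\<close>

definition decoupling_bound :: "'w itself \<Rightarrow> 'a qnormed \<Rightarrow> real \<Rightarrow> real \<Rightarrow> bool" where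
  "decoupling_bound T V p D \<longleftrightarrow> 0 \<le> D \<and>
     (\<forall>(M :: 'w measure) F f g.
        complete_filtered_prob_space M F \<longrightarrow>
        decoupled_sum M F V f g \<longrightarrow>
        (\<forall>n\<ge>1. Lp_norm p M V (f n) < \<infinity>) \<longrightarrow>
        (\<forall>n\<ge>1. Lp_norm p M V (f n) \<le> ennreal D * Lp_norm p M V (g n)))"

definition decoupling_inequality_for :: "'w itself \<Rightarrow> 'a qnormed \<Rightarrow> real \<Rightarrow> bool" where
  "decoupling_inequality_for T V p \<longleftrightarrow> (\<exists>D. decoupling_bound T V p D)"

definition decoupling_inequality :: "'w itself \<Rightarrow> 'a qnormed \<Rightarrow> bool" where
  "decoupling_inequality T V \<longleftrightarrow> (\<exists>p>0. decoupling_inequality_for T V p)"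

text \<open>The infimum is attained if finite; it is \<open>\<infinity>\<close> if there is no admissible constant.\<close>

definition decoupling_const :: "'w itself \<Rightarrow> 'a qnormed \<Rightarrow> real \<Rightarrow> ennreal" where
  "decoupling_const T V p = Inf {ennreal D |D. decoupling_bound T V p D}"

end

theory Submission
  imports Defs
begin

text \<open>
  The constant for \<open>L\<^sup>p(S;Y)\<close> at the exponent \<open>p\<close> is obtained by Fubini: Borel-measurable choices of
  representatives allow one to evaluate tangent sequences at every single point \<open>s\<close>, where they are
  tangent in \<open>Y\<close>; integrating over \<open>s\<close> gives \<open>D\<^sub>p(L\<^sup>p(S;Y)) \<le> D\<^sub>p(Y)\<close>, and \<open>y \<mapsto> 1\<^sub>A y\<close> for a set \<open>A\<close> of finite
  positive measure gives the converse.

  It remains to pass from one exponent to another in \<open>Y\<close>. Replace the quasi-norm by an equivalent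
  power that is subadditive, and the filtered probability space by a finite tree, on which the
  conditionally independent copies are explicit. On trees with symmetric steps a good-\<open>\<lambda>\<close> inequality
  holds: the given inequality is applied to the steps between two passage times that are small and
  for which the decoupled sum is likely small, and the moment of the decoupled sum on the right is
  controlled by the Hoffmann-Joergensen inequality. General steps are symmetrized by subtracting an
  independent copy. Conversely, steps of finitely many values on an arbitrary space are compared
  with a tree whose letters record the step and the rounded conditional law of the next one.
\<close>

section \<open>Subadditive powers of a quasi-norm\<close>

text \<open>The hypothesis supplies an inequality in \<open>Y\<close> for one exponent, while
  integrating over \<open>s\<close> needs it for the exponent \<open>q\<close> of the space itself.
  This gap is what forces the extrapolation, and the extrapolation loses constants. The equality of
  constants is untouched by the loss, since both exponents agree there. The obstacle to
  extrapolating on the given filtered space is that it may have no room for the extra independent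
  copies that symmetrization needs. On a finite tree every law is an explicit finite average, every
  moment is finite, so that terms can be absorbed, and the finite sample space can be coded inside
  the fixed type \<open>'w\<close> of outcomes. A quasi-norm need not be continuous, so Borel and
  separability arguments run through the subadditive \<open>N\<close>, which induces a
  metric.\<close>

locale quasi_normed_group = abelian_group V for V :: "'a qnormed" (structure) +
  assumes qnorm_ge_0: "x \<in> carrier V \<Longrightarrow> 0 \<le> qnorm V x"
    and qnorm_0_iff: "x \<in> carrier V \<Longrightarrow> qnorm V x = 0 \<longleftrightarrow> x = \<zero>"
    and qnorm_minus: "x \<in> carrier V \<Longrightarrow> qnorm V (\<ominus> x) = qnorm V x"
    and qnorm_triangle:
      "\<exists>C. \<forall>x\<in>carrier V. \<forall>y\<in>carrier V. qnorm V (x \<oplus> y) \<le> C * (qnorm V x + qnorm V y)"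

lemma (in abelian_group) minus_shift:
  assumes "x \<in> carrier G" "y \<in> carrier G" "z \<in> carrier G"
  shows "x \<ominus> z = (x \<ominus> y) \<oplus> (y \<ominus> z)"
proof -
  have "\<ominus> y \<oplus> (y \<oplus> \<ominus> z) = \<ominus> z" using assms by (simp add: a_assoc[symmetric] l_neg)
  then show ?thesis using assms by (simp add: minus_eq a_assoc)
qed

lemma (in abelian_group) add_minus_cancel:
  assumes "x \<in> carrier G" "y \<in> carrier G"
  shows "(x \<ominus> y) \<oplus> y = x"
  using assms by (simp add: minus_eq a_assoc l_neg)

lemma (in abelian_group) add_minus_cancel':
  assumes "x \<in> carrier G" "y \<in> carrier G"
  shows "(y \<oplus> x) \<ominus> y = x"
  using assms a_comm[of y x] by (simp add: minus_eq a_assoc r_neg)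

lemma (in abelian_group) minus_self: "x \<in> carrier G \<Longrightarrow> x \<ominus> x = \<zero>"
  by (simp add: minus_eq r_neg)

lemma (in abelian_group) inv_zero: "\<ominus> \<zero> = \<zero>"
  using r_neg[OF zero_closed] l_zero[of "\<ominus> \<zero>"] by simp

lemma (in abelian_group) minus_zero_right: "x \<in> carrier G \<Longrightarrow> x \<ominus> \<zero> = x"
  by (simp add: minus_eq inv_zero)

lemma (in abelian_group) minus_swap:
  assumes "x \<in> carrier G" "y \<in> carrier G"
  shows "\<ominus> (x \<ominus> y) = y \<ominus> x"
  using assms by (simp add: minus_eq minus_add minus_minus a_comm)

lemma (in abelian_group) add_minus_add:
  assumes "x \<in> carrier G" "y \<in> carrier G" "z \<in> carrier G" "w \<in> carrier G"
  shows "(x \<oplus> y) \<ominus> (z \<oplus> w) = (x \<ominus> z) \<oplus> (y \<ominus> w)"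
  using assms by (simp add: minus_eq minus_add a_ac)

lemma split_half_sum:
  fixes m :: "'a \<Rightarrow> real"
  assumes "\<And>x. x \<in> set xs \<Longrightarrow> 0 \<le> m x" "xs \<noteq> []" "0 \<le> t" "t \<le> sum_list (map m xs)"
  shows "\<exists>ys x zs. xs = ys @ x # zs \<and> sum_list (map m ys) \<le> t \<and> t \<le> sum_list (map m ys) + m x"
  using assms
proof (induction xs arbitrary: t)
  case (Cons x xs)
  show ?case
  proof (cases "t \<le> m x")
    case True
    then show ?thesis using Cons.prems by (intro exI[of _ "[]"] exI[of _ x] exI[of _ xs]) auto
  next
    case False
    then have "xs \<noteq> []" using Cons.prems by auto
    then obtain ys y zs where "xs = ys @ y # zs" "sum_list (map m ys) \<le> t - m x"
      "t - m x \<le> sum_list (map m ys) + m y"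
      using Cons.IH[of "t - m x"] Cons.prems False by auto
    then show ?thesis by (intro exI[of _ "x # ys"] exI[of _ y] exI[of _ zs]) auto
  qed
qed simp

context quasi_normed_group
begin

abbreviation lsum :: "'a list \<Rightarrow> 'a" where
  "lsum xs \<equiv> foldr (add V) xs \<zero>"

lemma lsum_closed: "set xs \<subseteq> carrier V \<Longrightarrow> lsum xs \<in> carrier V"
  by (induction xs) auto

lemma lsum_append:
  "\<lbrakk>set xs \<subseteq> carrier V; set ys \<subseteq> carrier V\<rbrakk> \<Longrightarrow> lsum (xs @ ys) = lsum xs \<oplus> lsum ys"
proof (induction xs)
  case Nil
  then show ?case using lsum_closed[of ys] by simp
next
  case (Cons x xs)
  then show ?case using lsum_closed[of ys] lsum_closed[of xs] by (simp add: a_assoc del: foldr_append)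
qed

lemma lsum_minus: "set xs \<subseteq> carrier V \<Longrightarrow> lsum (map (\<lambda>x. \<ominus> x) xs) = \<ominus> lsum xs"
  using lsum_closed by (induction xs) (auto simp: minus_add inv_zero)

text \<open>Frink's metrization lemma: split the list where the partial sums of \<open>m\<close> pass half of the total.\<close>

lemma frink:
  assumes nonneg: "\<And>x. x \<in> carrier V \<Longrightarrow> 0 \<le> m x" and "m \<zero> = (0::real)"
    and three: "\<And>x y z. \<lbrakk>x \<in> carrier V; y \<in> carrier V; z \<in> carrier V\<rbrakk>
      \<Longrightarrow> m (x \<oplus> (y \<oplus> z)) \<le> 2 * max (m x) (max (m y) (m z))"
  shows "set xs \<subseteq> carrier V \<Longrightarrow> m (lsum xs) \<le> 2 * sum_list (map m xs)"
proof (induction xs rule: length_induct)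
  case (1 xs)
  show ?case
  proof (cases "xs = []")
    case True
    then show ?thesis using \<open>m \<zero> = 0\<close> by simp
  next
    case False
    define a where "a = sum_list (map m xs)"
    have "0 \<le> a" unfolding a_def using 1 nonneg by (intro sum_list_nonneg) auto
    then have "\<exists>ys x zs. xs = ys @ x # zs \<and> sum_list (map m ys) \<le> a / 2 \<and>
        a / 2 \<le> sum_list (map m ys) + m x"
      by (intro split_half_sum) (use False nonneg 1(2) in \<open>auto simp: a_def\<close>)
    then obtain ys x zs where xs: "xs = ys @ x # zs"
      and ys: "sum_list (map m ys) \<le> a / 2" and x: "a / 2 \<le> sum_list (map m ys) + m x"
      by blast
    have sums: "0 \<le> sum_list (map m ys)" "0 \<le> sum_list (map m zs)"
      using 1(2) xs by (auto simp: subset_iff intro!: sum_list_nonneg nonneg)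
    \<comment> \<open>The outer lists have total at most \<open>a / 2\<close>, so the factor 2 of
      the induction hypothesis brings them back to \<open>a\<close>. All three pieces are then
      bounded by \<open>a\<close>, and \<open>three\<close> reproduces the factor 2.\<close>
    have zs: "sum_list (map m zs) \<le> a / 2" and "m x \<le> a"
      using x ys sums unfolding a_def xs by auto
    have "m (lsum ys) \<le> a" "m (lsum zs) \<le> a"
      using 1(1)[rule_format, of ys] 1(1)[rule_format, of zs] 1(2) ys zs unfolding xs by auto
    moreover have "m (lsum xs) = m (lsum ys \<oplus> (x \<oplus> lsum zs))"
      unfolding xs using 1(2) xs by (subst lsum_append) auto
    moreover have "lsum ys \<in> carrier V" "lsum zs \<in> carrier V" "x \<in> carrier V"
      using 1(2) xs by (auto intro!: lsum_closed)
    ultimately show ?thesis using three[of "lsum ys" x "lsum zs"] \<open>m x \<le> a\<close> unfolding a_def by auto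
  qed
qed

end

text \<open>\<open>N (x \<ominus> y)\<close> is a translation invariant metric for the topology of
  \<open>V\<close>, and moments of \<open>qnorm\<close> of order \<open>p\<close> are comparable to
  moments of \<open>N\<close> of order \<open>p / r\<close>. The factor 2 is the one of Frink's
  lemma.\<close>

locale f_normed_group = quasi_normed_group V for V :: "'a qnormed" (structure) +
  fixes N :: "'a \<Rightarrow> real" and r :: real
  assumes r_pos: "0 < r"
    and N_nonneg: "x \<in> carrier V \<Longrightarrow> 0 \<le> N x"
    and N_add: "\<lbrakk>x \<in> carrier V; y \<in> carrier V\<rbrakk> \<Longrightarrow> N (x \<oplus> y) \<le> N x + N y"
    and N_minus: "x \<in> carrier V \<Longrightarrow> N (\<ominus> x) = N x"
    and N_le_qnorm: "x \<in> carrier V \<Longrightarrow> N x \<le> qnorm V x powr r"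
    and qnorm_le_N: "x \<in> carrier V \<Longrightarrow> qnorm V x powr r \<le> 2 * N x"

text \<open>Aoki--Rolewicz: a small power of the quasi-norm satisfies the hypothesis of Frink's lemma.\<close>

lemma (in quasi_normed_group) f_norm_exists: "\<exists>N r. f_normed_group V N r"
proof -
  obtain C0 where C0: "\<And>x y. \<lbrakk>x \<in> carrier V; y \<in> carrier V\<rbrakk> \<Longrightarrow>
      qnorm V (x \<oplus> y) \<le> C0 * (qnorm V x + qnorm V y)"
    using qnorm_triangle by auto
  define C where "C = max C0 1"
  have C: "qnorm V (x \<oplus> y) \<le> C * (qnorm V x + qnorm V y)" if "x \<in> carrier V" "y \<in> carrier V" for x y
    using C0[OF that] qnorm_ge_0 that unfolding C_def
    by (meson add_nonneg_nonneg max.cobounded1 mult_right_mono order_trans)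
  have "C \<ge> 1" by (simp add: C_def)
  \<comment> \<open>\<open>K\<close> is the constant of the quasi-triangle inequality for three
    summands, namely C(M + C(M + M)) = (C + 2C^2) M. The exponent \<open>r\<close> is the one for
    which the \<open>r\<close>-th power of \<open>K\<close> equals 2, the constant in Frink's
    lemma.\<close>
  define K where "K = C + 2 * C\<^sup>2"
  have "K > 1" using \<open>C \<ge> 1\<close> unfolding K_def by (smt (verit) zero_less_power)
  define r where "r = ln 2 / ln K"
  have "r > 0" using \<open>K > 1\<close> by (simp add: r_def)
  have Kr: "K powr r = 2" using \<open>K > 1\<close> by (simp add: r_def powr_def)
  define m where "m = (\<lambda>x. qnorm V x powr r)"
  have m0: "m x \<ge> 0" for x by (simp add: m_def)
  have mz: "m \<zero> = 0" using qnorm_0_iff[of \<zero>] \<open>r > 0\<close> by (simp add: m_def)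
  have three: "m (x \<oplus> (y \<oplus> z)) \<le> 2 * max (m x) (max (m y) (m z))"
    if xyz: "x \<in> carrier V" "y \<in> carrier V" "z \<in> carrier V" for x y z
  proof -
    define M where "M = max (qnorm V x) (max (qnorm V y) (qnorm V z))"
    have M: "qnorm V x \<le> M" "qnorm V y \<le> M" "qnorm V z \<le> M" by (auto simp: M_def)
    have M0: "0 \<le> M" using M(1) qnorm_ge_0[OF xyz(1)] by linarith
    have "qnorm V (y \<oplus> z) \<le> C * (M + M)"
      using C[OF xyz(2,3)] M \<open>C \<ge> 1\<close> by (smt (verit) mult_left_mono)
    then have "qnorm V (x \<oplus> (y \<oplus> z)) \<le> C * (M + C * (M + M))"
      using C[of x "y \<oplus> z"] xyz M \<open>C \<ge> 1\<close> by (smt (verit) add.m_closed mult_left_mono)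
    also have "\<dots> = K * M" by (simp add: K_def algebra_simps power2_eq_square)
    finally have "m (x \<oplus> (y \<oplus> z)) \<le> (K * M) powr r"
      unfolding m_def using qnorm_ge_0 xyz \<open>r > 0\<close> by (intro powr_mono2) auto
    also have "\<dots> = 2 * M powr r" using \<open>K > 1\<close> M0 by (simp add: powr_mult Kr)
    also have "M powr r = max (m x) (max (m y) (m z))"
    proof -
      have "max a b powr r = max (a powr r) (b powr r)" if "0 \<le> a" "0 \<le> b" for a b :: real
        using that \<open>r > 0\<close> powr_mono2[of r a b] powr_mono2[of r b a] by (cases "a \<le> b") (auto simp: max_def)
      then show ?thesis using qnorm_ge_0 xyz by (simp add: M_def m_def le_max_iff_disj)
    qed
    finally show ?thesis by simp
  qed
  \<comment> \<open>\<open>N\<close> is to be the largest subadditive minorant of \<open>m\<close>: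
    the infimum of the sums of \<open>m\<close> over all decompositions of \<open>x\<close>.
    Concatenating decompositions gives subadditivity, and Frink's lemma prevents the infimum from
    dropping below \<open>m x / 2\<close>.\<close>
  define SS where "SS = (\<lambda>x. {sum_list (map m xs) |xs. set xs \<subseteq> carrier V \<and> lsum xs = x})"
  define N where "N = (\<lambda>x. Inf (SS x))"
  have bdd: "bdd_below (SS x)" for x
    unfolding SS_def by (rule bdd_belowI[of _ 0]) (auto intro!: sum_list_nonneg m0)
  have single: "m x \<in> SS x" if "x \<in> carrier V" for x
    unfolding SS_def using that by (auto intro!: exI[of _ "[x]"])
  have lower: "b \<le> N x"
    if "x \<in> carrier V" "\<And>xs. set xs \<subseteq> carrier V \<Longrightarrow> lsum xs = x \<Longrightarrow> b \<le> sum_list (map m xs)" for x b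
    unfolding N_def using single[OF that(1)] that(2) by (intro cInf_greatest) (auto simp: SS_def)
  have upper: "N x \<le> sum_list (map m xs)" if "set xs \<subseteq> carrier V" "lsum xs = x" for x xs
    unfolding N_def using that by (intro cInf_lower bdd) (auto simp: SS_def)
  have "f_normed_group V N r"
  proof
    fix x y assume x: "x \<in> carrier V" and y: "y \<in> carrier V"
    have "N (x \<oplus> y) - sum_list (map m xs) \<le> N y" if "set xs \<subseteq> carrier V" "lsum xs = x" for xs
    proof (rule lower[OF y])
      fix ys assume "set ys \<subseteq> carrier V" "lsum ys = y"
      then show "N (x \<oplus> y) - sum_list (map m xs) \<le> sum_list (map m ys)"
        using upper[of "xs @ ys" "x \<oplus> y"] that lsum_append[of xs ys] by simp
    qed
    then have "N (x \<oplus> y) - N y \<le> N x" by (intro lower[OF x]) (auto simp: algebra_simps)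
    then show "N (x \<oplus> y) \<le> N x + N y" by simp
  next
    fix x assume x: "x \<in> carrier V"
    have le: "N (\<ominus> x) \<le> N x" if x: "x \<in> carrier V" for x
    proof (rule lower[OF x])
      fix xs assume xs: "set xs \<subseteq> carrier V" "lsum xs = x"
      then have "map m (map (\<lambda>x. \<ominus> x) xs) = map m xs" using qnorm_minus by (auto simp: m_def)
      moreover have "N (\<ominus> x) \<le> sum_list (map m (map (\<lambda>x. \<ominus> x) xs))"
        using xs lsum_minus[OF xs(1)] by (intro upper) auto
      ultimately show "N (\<ominus> x) \<le> sum_list (map m xs)" by (simp only:)
    qed
    show "N (\<ominus> x) = N x" using le[OF x] le[of "\<ominus> x"] x by (simp add: minus_minus)
    show "N x \<le> qnorm V x powr r"
      using single[OF x] bdd unfolding N_def m_def by (intro cInf_lower) auto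
    have "m x / 2 \<le> N x" using frink[of m] m0 mz three by (intro lower[OF x]) (auto simp: field_simps)
    then show "qnorm V x powr r \<le> 2 * N x" by (simp add: m_def)
    show "0 \<le> N x" by (intro lower[OF x]) (auto intro!: sum_list_nonneg m0)
  qed fact
  then show ?thesis by blast
qed

text \<open>This is the structure that \<open>Y\<close> and \<open>Lq_space\<close> share, so the
  results on metrics and separability below apply to both. The only trace of the scalars is the
  multiple -1, which gives invariance under \<open>\<ominus>\<close>.\<close>

lemma (in quasi_banach) quasi_normed_group: "quasi_normed_group V"
proof -
  have "a_inv real_scalars 1 = - 1"
  proof -
    interpret R: cring real_scalars by (rule cring_real_scalars)
    show ?thesis by (rule R.minus_equality) (auto simp: real_scalars_def)
  qed
  then have "\<ominus> x = (- 1) \<odot> x" if "x \<in> carrier V" for x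
    using that smult_l_minus[of 1 x] smult_one[of x] by (simp add: real_scalars_def)
  then show ?thesis
    using qnorm_nonneg qnorm_eq_0_iff qnorm_smult[of _ "-1"] quasi_triangle
    by unfold_locales auto
qed

section \<open>The metric topology and separability\<close>

context f_normed_group
begin

lemma N_zero: "N \<zero> = 0"
  using N_le_qnorm[of \<zero>] N_nonneg[of \<zero>] qnorm_0_iff[of \<zero>] r_pos by simp

lemma N_eq_0D: "x \<in> carrier V \<Longrightarrow> N x = 0 \<Longrightarrow> x = \<zero>"
  using qnorm_le_N[of x] qnorm_0_iff[of x] by simp

lemma N_diff: "\<lbrakk>x \<in> carrier V; y \<in> carrier V\<rbrakk> \<Longrightarrow> N (x \<ominus> y) \<le> N x + N y"
  using N_add[of x "\<ominus> y"] N_minus[of y] by (simp add: minus_eq)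

lemma N_diff_commute: "\<lbrakk>x \<in> carrier V; y \<in> carrier V\<rbrakk> \<Longrightarrow> N (x \<ominus> y) = N (y \<ominus> x)"
  using N_minus[of "x \<ominus> y"] minus_swap by simp

lemma N_diff_triangle:
  "\<lbrakk>x \<in> carrier V; y \<in> carrier V; z \<in> carrier V\<rbrakk> \<Longrightarrow> N (x \<ominus> z) \<le> N (x \<ominus> y) + N (y \<ominus> z)"
  using N_add[of "x \<ominus> y" "y \<ominus> z"] minus_shift[of x y z] by simp

lemma N_le_add_diff: "\<lbrakk>x \<in> carrier V; y \<in> carrier V\<rbrakk> \<Longrightarrow> N x \<le> N (x \<ominus> y) + N y"
  using N_add[of "x \<ominus> y" y] add_minus_cancel[of x y] by simp

text \<open>Unlike balls of \<open>qnorm\<close>, these are open by subadditivity, and they generate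
  the same topology.\<close>

definition nball :: "'a \<Rightarrow> real \<Rightarrow> 'a set" where
  "nball x e = {y \<in> carrier V. N (y \<ominus> x) < e}"

lemma nball_subset: "nball x e \<subseteq> carrier V" by (auto simp: nball_def)

lemma qnorm_less_iff_powr:
  "\<lbrakk>x \<in> carrier V; 0 < e\<rbrakk> \<Longrightarrow> qnorm V x < e \<longleftrightarrow> qnorm V x powr r < e powr r"
  using r_pos qnorm_ge_0[of x] powr_less_mono2[of r "qnorm V x" e] powr_mono2[of r e "qnorm V x"]
  by (cases "qnorm V x < e") auto

lemma qnorm_lessI: "\<lbrakk>x \<in> carrier V; 0 < e; 2 * N x < e powr r\<rbrakk> \<Longrightarrow> qnorm V x < e"
  using qnorm_less_iff_powr[of x e] qnorm_le_N[of x] by simp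

lemma N_lessI: "\<lbrakk>x \<in> carrier V; 0 < e; qnorm V x < e powr (1 / r)\<rbrakk> \<Longrightarrow> N x < e"
proof -
  assume x: "x \<in> carrier V" and e: "0 < e" "qnorm V x < e powr (1 / r)"
  then have "qnorm V x powr r < (e powr (1 / r)) powr r"
    using r_pos qnorm_ge_0[OF x] by (intro powr_less_mono2) auto
  then show "N x < e" using N_le_qnorm[OF x] r_pos e by (simp add: powr_powr)
qed

lemma openin_qtopology_N:
  "openin (qtopology V) U \<longleftrightarrow> U \<subseteq> carrier V \<and> (\<forall>x\<in>U. \<exists>e>0. nball x e \<subseteq> U)"
proof -
  have "(\<exists>\<epsilon>>0. \<forall>y\<in>carrier V. qnorm V (y \<ominus> x) < \<epsilon> \<longrightarrow> y \<in> U) \<longleftrightarrow> (\<exists>e>0. nball x e \<subseteq> U)"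
    if x: "x \<in> carrier V" for x
  proof
    assume "\<exists>\<epsilon>>0. \<forall>y\<in>carrier V. qnorm V (y \<ominus> x) < \<epsilon> \<longrightarrow> y \<in> U"
    then obtain e where e: "e > 0" "\<And>y. y \<in> carrier V \<Longrightarrow> qnorm V (y \<ominus> x) < e \<Longrightarrow> y \<in> U" by blast
    show "\<exists>e>0. nball x e \<subseteq> U"
      using e x by (intro exI[of _ "e powr r / 2"]) (auto simp: nball_def intro!: e(2) qnorm_lessI)
  next
    assume "\<exists>e>0. nball x e \<subseteq> U"
    then obtain e where e: "e > 0" "nball x e \<subseteq> U" by blast
    show "\<exists>\<epsilon>>0. \<forall>y\<in>carrier V. qnorm V (y \<ominus> x) < \<epsilon> \<longrightarrow> y \<in> U"
      using e x by (intro exI[of _ "e powr (1 / r)"]) (auto simp: nball_def intro!: N_lessI subsetD[OF e(2)])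
  qed
  then show ?thesis unfolding openin_qtopology by blast
qed

lemma openin_nball: "x \<in> carrier V \<Longrightarrow> openin (qtopology V) (nball x e)"
  unfolding openin_qtopology_N
proof (intro conjI ballI nball_subset)
  fix y assume x: "x \<in> carrier V" and y: "y \<in> nball x e"
  have "nball y (e - N (y \<ominus> x)) \<subseteq> nball x e"
  proof
    fix z assume "z \<in> nball y (e - N (y \<ominus> x))"
    then show "z \<in> nball x e" using N_diff_triangle[of z y x] x y by (auto simp: nball_def)
  qed
  then show "\<exists>e'>0. nball y e' \<subseteq> nball x e" using y by (intro exI[of _ "e - N (y \<ominus> x)"]) (auto simp: nball_def)
qed

text \<open>The dense set need not be contained in \<open>R\<close>, so that separability passes to subsets at once.\<close>

definition dense_for :: "'a set \<Rightarrow> 'a set \<Rightarrow> bool" where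
  "dense_for C R \<longleftrightarrow> countable C \<and> C \<subseteq> carrier V \<and> R \<subseteq> carrier V \<and> (\<forall>x\<in>R. \<forall>e>0. \<exists>c\<in>C. N (x \<ominus> c) < e)"

lemma separable_subtopology_iff:
  assumes R: "R \<subseteq> carrier V"
  shows "separable_space (subtopology (qtopology V) R) \<longleftrightarrow> (\<exists>C. dense_for C R)"
proof
  assume "separable_space (subtopology (qtopology V) R)"
  then obtain C where C: "countable C" "C \<subseteq> R"
    "subtopology (qtopology V) R closure_of C = R"
    unfolding separable_space_def using R by (auto simp: topspace_qtopology inf_absorb2)
  have "\<exists>c\<in>C. N (x \<ominus> c) < e" if "x \<in> R" "e > 0" for x e
  proof -
    have "x \<in> R \<inter> qtopology V closure_of (R \<inter> C)"
      using C(3) that(1) by (simp add: closure_of_subtopology)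
    then have *: "\<forall>T. x \<in> T \<and> openin (qtopology V) T \<longrightarrow> (\<exists>y\<in>C. y \<in> T)"
      unfolding closure_of_def by auto
    have "x \<in> nball x e" using that R N_zero by (auto simp: nball_def minus_self)
    then obtain y where "y \<in> C" "y \<in> nball x e"
      using *[rule_format, of "nball x e"] openin_nball[of x e] subsetD[OF R \<open>x \<in> R\<close>] by auto
    then show ?thesis
      using subsetD[OF R \<open>x \<in> R\<close>] N_diff_commute[of x y] by (intro bexI[of _ y]) (auto simp: nball_def)
  qed
  then have "dense_for C R" unfolding dense_for_def using C(1,2) R by auto
  then show "\<exists>C. dense_for C R" ..
next
  assume "\<exists>C. dense_for C R"
  then obtain C where C: "countable C" "C \<subseteq> carrier V" "\<And>x e. x \<in> R \<Longrightarrow> e > 0 \<Longrightarrow> \<exists>c\<in>C. N (x \<ominus> c) < e"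
    unfolding dense_for_def by blast
  \<comment> \<open>The points of \<open>C\<close> may lie outside \<open>R\<close>, whereas
    separability of the subspace asks for points of \<open>R\<close>. Each \<open>c\<close> is
    replaced by nearby points of \<open>R\<close>, one for every scale \<open>k\<close> at which
    there is one.\<close>
  define pick where "pick = (\<lambda>(c, k). SOME x. x \<in> R \<and> N (x \<ominus> c) < 1 / real (Suc k))"
  define P where "P = {(c, k). c \<in> C \<and> (\<exists>x\<in>R. N (x \<ominus> c) < 1 / real (Suc k))}"
  define D where "D = pick ` P"
  have pick: "pick (c, k) \<in> R \<and> N (pick (c, k) \<ominus> c) < 1 / real (Suc k)" if "(c, k) \<in> P" for c k
    using that unfolding pick_def P_def by (auto intro: someI2_ex)
  have "countable P" by (rule countable_subset[of _ "C \<times> UNIV"]) (use C in \<open>auto simp: P_def\<close>)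
  then have "countable D" unfolding D_def by simp
  moreover have "D \<subseteq> R" unfolding D_def using pick by auto
  moreover have "R \<subseteq> subtopology (qtopology V) R closure_of D"
  proof
    fix x assume x: "x \<in> R"
    have near: "\<exists>y\<in>D. y \<in> T" if T: "x \<in> T" "openin (qtopology V) T" for T
    proof -
      obtain e where e: "e > 0" "nball x e \<subseteq> T" using T unfolding openin_qtopology_N by blast
      obtain k :: nat where k: "1 / real (Suc k) < e / 2" using e(1) by (meson half_gt_zero nat_approx_posE)
      obtain c where c: "c \<in> C" "N (x \<ominus> c) < 1 / real (Suc k)" using C(3)[OF x, of "1 / real (Suc k)"] by auto
      then have "(c, k) \<in> P" using x by (auto simp: P_def)
      note p = pick[OF this]
      have "N (pick (c, k) \<ominus> x) < e"
        using N_diff_triangle[of "pick (c, k)" c x] N_diff_commute[of x c] p c k C(2) R x by (auto simp: subset_iff)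
      then have "pick (c, k) \<in> T" using e(2) p R by (auto simp: nball_def)
      then show ?thesis using \<open>(c, k) \<in> P\<close> unfolding D_def by blast
    qed
    have "\<exists>y\<in>D. y \<in> T" if T: "x \<in> T" "openin (subtopology (qtopology V) R) T" for T
    proof -
      obtain T' where T': "openin (qtopology V) T'" "T = T' \<inter> R"
        using T(2) by (auto simp: openin_subtopology)
      then show ?thesis using near[of T'] T(1) \<open>D \<subseteq> R\<close> by auto
    qed
    then show "x \<in> subtopology (qtopology V) R closure_of D"
      using x R by (auto simp: closure_of_def topspace_qtopology)
  qed
  ultimately show "separable_space (subtopology (qtopology V) R)"
    unfolding separable_space_def using R
    by (intro exI[of _ D]) (auto simp: topspace_qtopology inf_absorb2 closure_of_subtopology)
qed

lemma dense_for_subset: "dense_for C R \<Longrightarrow> R' \<subseteq> R \<Longrightarrow> dense_for C R'"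
  unfolding dense_for_def by blast

lemma dense_for_countable: "countable R \<Longrightarrow> R \<subseteq> carrier V \<Longrightarrow> dense_for R R"
  unfolding dense_for_def
proof (intro conjI ballI allI impI)
  fix x :: 'a and e :: real assume "x \<in> R" "R \<subseteq> carrier V" "e > 0"
  then show "\<exists>c\<in>R. N (x \<ominus> c) < e" using N_zero by (intro bexI[of _ x]) (auto simp: minus_self)
qed

lemma dense_for_UN:
  assumes "countable I" "\<And>i. i \<in> I \<Longrightarrow> dense_for (C i) (R i)"
  shows "dense_for (\<Union>i\<in>I. C i) (\<Union>i\<in>I. R i)"
  unfolding dense_for_def
proof (intro conjI ballI allI impI)
  show "countable (\<Union>i\<in>I. C i)" "(\<Union>i\<in>I. C i) \<subseteq> carrier V" "(\<Union>i\<in>I. R i) \<subseteq> carrier V"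
    using assms unfolding dense_for_def by (auto, blast+)
  fix x :: 'a and e :: real assume "x \<in> (\<Union>i\<in>I. R i)" "e > 0"
  then obtain i where "i \<in> I" "x \<in> R i" by blast
  then show "\<exists>c\<in>\<Union>i\<in>I. C i. N (x \<ominus> c) < e"
    using assms(2)[of i] \<open>e > 0\<close> unfolding dense_for_def by fastforce
qed

lemma dense_for_add:
  assumes "dense_for C R" "dense_for C' R'"
  shows "dense_for ((\<lambda>(c, c'). c \<oplus> c') ` (C \<times> C')) ((\<lambda>(x, y). x \<oplus> y) ` (R \<times> R'))"
proof -
  have "\<exists>c\<in>C. \<exists>c'\<in>C'. N ((x \<oplus> y) \<ominus> (c \<oplus> c')) < e" if xye: "x \<in> R" "y \<in> R'" "e > 0" for x y e
  proof -
    obtain c where "c \<in> C" "N (x \<ominus> c) < e / 2"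
      using assms(1) xye half_gt_zero[of e] unfolding dense_for_def by blast
    moreover obtain c' where "c' \<in> C'" "N (y \<ominus> c') < e / 2"
      using assms(2) xye half_gt_zero[of e] unfolding dense_for_def by blast
    ultimately have cc: "c \<in> C" "c' \<in> C'" "N (x \<ominus> c) < e / 2" "N (y \<ominus> c') < e / 2" by auto
    then have "N ((x \<oplus> y) \<ominus> (c \<oplus> c')) \<le> N (x \<ominus> c) + N (y \<ominus> c')"
      using assms that unfolding dense_for_def by (subst add_minus_add) (auto intro!: N_add)
    then have "N ((x \<oplus> y) \<ominus> (c \<oplus> c')) < e" using cc by linarith
    then show ?thesis using cc by blast
  qed
  then have "\<forall>z\<in>(\<lambda>(x, y). x \<oplus> y) ` (R \<times> R'). \<forall>e>0. \<exists>c\<in>(\<lambda>(c, c'). c \<oplus> c') ` (C \<times> C'). N (z \<ominus> c) < e"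
    by fastforce
  moreover have "(\<lambda>(c, c'). c \<oplus> c') ` (C \<times> C') \<subseteq> carrier V" "(\<lambda>(x, y). x \<oplus> y) ` (R \<times> R') \<subseteq> carrier V"
    using assms unfolding dense_for_def by auto
  ultimately show ?thesis using assms unfolding dense_for_def by auto
qed

lemma dense_for_minus:
  assumes "dense_for C R"
  shows "dense_for (a_inv V ` C) (a_inv V ` R)"
proof -
  have "N (\<ominus> x \<ominus> \<ominus> c) = N (x \<ominus> c)" if "x \<in> carrier V" "c \<in> carrier V" for x c
    using that N_minus[of "x \<ominus> c"] by (simp add: minus_eq minus_add)
  then show ?thesis using assms unfolding dense_for_def by (auto simp: subset_iff)
qed

end

section \<open>Separably valued functions and tangent sequences\<close>

lemma space_qborel: "space (qborel V) = carrier V"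
  unfolding qborel_def by (rule space_measure_of) (auto simp: openin_qtopology)

lemma openin_sets_qborel: "openin (qtopology V) U \<Longrightarrow> U \<in> sets (qborel V)"
  unfolding qborel_def by (subst sets_measure_of) (auto simp: openin_qtopology)

lemma measurable_qborelI:
  assumes "\<And>x. x \<in> space M \<Longrightarrow> f x \<in> carrier V"
    and "\<And>U. openin (qtopology V) U \<Longrightarrow> f -` U \<inter> space M \<in> sets M"
  shows "f \<in> M \<rightarrow>\<^sub>M qborel V"
  unfolding qborel_def using assms by (intro measurable_measure_of) (auto simp: openin_qtopology)

lemma measurable_qborel_carrier: "f \<in> M \<rightarrow>\<^sub>M qborel V \<Longrightarrow> x \<in> space M \<Longrightarrow> f x \<in> carrier V"
  using measurable_space[of f M "qborel V" x] by (simp add: space_qborel)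

lemma separably_valued_carrier: "separably_valued M V f \<Longrightarrow> x \<in> space M \<Longrightarrow> f x \<in> carrier V"
  using measurable_qborel_carrier[of f M V x] by (simp add: separably_valued_def)

lemma separably_valued_measurable: "separably_valued M V f \<Longrightarrow> f \<in> M \<rightarrow>\<^sub>M qborel V"
  by (simp add: separably_valued_def)

context f_normed_group
begin

lemma separably_valued_iff:
  "separably_valued M V f \<longleftrightarrow> f \<in> M \<rightarrow>\<^sub>M qborel V \<and> (\<exists>C. dense_for C (f ` space M))"
proof -
  have "f ` space M \<subseteq> carrier V" if "f \<in> M \<rightarrow>\<^sub>M qborel V"
    using measurable_qborel_carrier[OF that] by blast
  then show ?thesis unfolding separably_valued_def using separable_subtopology_iff by blast
qed

lemma dense_for_carrier: "dense_for C R \<Longrightarrow> c \<in> C \<Longrightarrow> c \<in> carrier V"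
  unfolding dense_for_def by blast

lemma dense_forD: "dense_for C R \<Longrightarrow> x \<in> R \<Longrightarrow> e > 0 \<Longrightarrow> \<exists>c\<in>C. N (x \<ominus> c) < e"
  unfolding dense_for_def by blast

lemma separably_valued_compose:
  assumes "separably_valued M' V f" "g \<in> M \<rightarrow>\<^sub>M M'"
  shows "separably_valued M V (\<lambda>x. f (g x))"
proof -
  obtain C where "dense_for C (f ` space M')" using assms(1) unfolding separably_valued_iff by blast
  then have "dense_for C ((\<lambda>x. f (g x)) ` space M)"
    by (rule dense_for_subset) (use measurable_space[OF assms(2)] in auto)
  then show ?thesis
    using assms unfolding separably_valued_iff by (blast intro: measurable_compose)
qed

lemma separably_valued_countable_range:
  assumes "f \<in> M \<rightarrow>\<^sub>M qborel V" "countable (f ` space M)"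
  shows "separably_valued M V f"
  unfolding separably_valued_iff
  using assms(1) dense_for_countable[OF assms(2)] measurable_qborel_carrier[OF assms(1)] by auto

lemma separably_valued_const: "c \<in> carrier V \<Longrightarrow> separably_valued M V (\<lambda>x. c)"
  by (rule separably_valued_countable_range) (auto simp: space_qborel image_constant_conv)

lemma separably_valued_if:
  assumes f: "separably_valued M V f" and g: "separably_valued M V g" and P: "Measurable.pred M P"
  shows "separably_valued M V (\<lambda>x. if P x then f x else g x)"
proof -
  obtain C D where CD: "dense_for C (f ` space M)" "dense_for D (g ` space M)"
    using f g unfolding separably_valued_iff by blast
  have "dense_for (\<Union>i. if i then C else D) (\<Union>i. if i then f ` space M else g ` space M)"
    by (rule dense_for_UN) (use CD in auto)
  then have "dense_for (\<Union>i. if i then C else D) ((\<lambda>x. if P x then f x else g x) ` space M)"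
    by (rule dense_for_subset) auto
  moreover have "(\<lambda>x. if P x then f x else g x) \<in> M \<rightarrow>\<^sub>M qborel V"
    using P f g separably_valued_measurable by (intro measurable_If) (auto simp: pred_def)
  ultimately show ?thesis unfolding separably_valued_iff by blast
qed

lemma nat_ex_less: "(e::real) > 0 \<Longrightarrow> \<exists>k. 1 / real (Suc k) < e"
  using nat_approx_posE[of e] by blast

text \<open>Without separability the Borel sets of a product may exceed the product of the Borel
  sets, so continuity of addition is not enough. The separable ranges allow the preimage of an open
  set to be written as a countable union of preimages of rectangles with centres in dense
  sets.\<close>

lemma separably_valued_add:
  assumes f: "separably_valued M V f" and g: "separably_valued M V g"
  shows "separably_valued M V (\<lambda>x. f x \<oplus> g x)"
proof -
  obtain C D where C: "dense_for C (f ` space M)" and D: "dense_for D (g ` space M)"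
    using f g unfolding separably_valued_iff by blast
  note fc = separably_valued_carrier[OF f] and gc = separably_valued_carrier[OF g]
  have "dense_for ((\<lambda>(c, c'). c \<oplus> c') ` (C \<times> D)) ((\<lambda>x. f x \<oplus> g x) ` space M)"
    by (rule dense_for_subset[OF dense_for_add[OF C D]]) auto
  moreover have "(\<lambda>x. f x \<oplus> g x) \<in> M \<rightarrow>\<^sub>M qborel V"
  proof (rule measurable_qborelI)
    fix U assume U: "openin (qtopology V) U"
    define I where "I = {(c, d, k :: nat). c \<in> C \<and> d \<in> D \<and>
      (\<forall>u\<in>nball c (1 / real (Suc k)). \<forall>v\<in>nball d (1 / real (Suc k)). u \<oplus> v \<in> U)}"
    have "countable I"
      by (rule countable_subset[of _ "C \<times> D \<times> UNIV"]) (use C D in \<open>auto simp: I_def dense_for_def\<close>)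
    have "(\<lambda>x. f x \<oplus> g x) -` U \<inter> space M = (\<Union>(c, d, k)\<in>I.
      (f -` nball c (1 / real (Suc k)) \<inter> space M) \<inter> (g -` nball d (1 / real (Suc k)) \<inter> space M))"
    proof (intro subset_antisym subsetI)
      fix x assume "x \<in> (\<lambda>x. f x \<oplus> g x) -` U \<inter> space M"
      then have x: "x \<in> space M" "f x \<oplus> g x \<in> U" by auto
      obtain e where e: "e > 0" "nball (f x \<oplus> g x) e \<subseteq> U" using U x unfolding openin_qtopology_N by blast
      \<comment> \<open>Four distances add up below: from \<open>u\<close> and \<open>v\<close> to
        the two centres, and from the centres to \<open>f x\<close> and \<open>g x\<close>.\<close>
      obtain k where k: "1 / real (Suc k) < e / 4" using nat_ex_less[of "e / 4"] e by auto
      let ?d = "1 / real (Suc k)"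
      obtain c where c: "c \<in> C" "N (f x \<ominus> c) < ?d" using dense_forD[OF C, of "f x" ?d] x by auto
      obtain d where d: "d \<in> D" "N (g x \<ominus> d) < ?d" using dense_forD[OF D, of "g x" ?d] x by auto
      have cd: "c \<in> carrier V" "d \<in> carrier V" using c d C D dense_for_carrier by auto
      have "u \<oplus> v \<in> U" if u: "u \<in> nball c ?d" and v: "v \<in> nball d ?d" for u v
      proof -
        have uv: "u \<in> carrier V" "v \<in> carrier V" using u v by (auto simp: nball_def)
        have "N ((u \<oplus> v) \<ominus> (f x \<oplus> g x)) \<le> N (u \<ominus> f x) + N (v \<ominus> g x)"
          using uv fc gc x by (subst add_minus_add) (auto intro!: N_add)
        moreover have "N (u \<ominus> f x) \<le> N (u \<ominus> c) + N (c \<ominus> f x)" "N (v \<ominus> g x) \<le> N (v \<ominus> d) + N (d \<ominus> g x)"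
          using uv fc gc x cd by (auto intro!: N_diff_triangle)
        moreover have "N (c \<ominus> f x) < ?d" "N (d \<ominus> g x) < ?d" "N (u \<ominus> c) < ?d" "N (v \<ominus> d) < ?d"
          using c d u v cd fc gc x N_diff_commute by (auto simp: nball_def)
        ultimately have "N ((u \<oplus> v) \<ominus> (f x \<oplus> g x)) < e" using k by linarith
        then show ?thesis using e(2) uv by (auto simp: nball_def)
      qed
      then have "(c, d, k) \<in> I" using c d by (auto simp: I_def)
      moreover have "f x \<in> nball c ?d" "g x \<in> nball d ?d" using c d fc gc x by (auto simp: nball_def)
      ultimately show "x \<in> (\<Union>(c, d, k)\<in>I.
        (f -` nball c (1 / real (Suc k)) \<inter> space M) \<inter> (g -` nball d (1 / real (Suc k)) \<inter> space M))"
        using x by (intro UN_I[of "(c, d, k)"]) auto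
    qed (auto simp: I_def)
    also have "\<dots> \<in> sets M"
    proof (rule sets.countable_UN''[OF \<open>countable I\<close>])
      fix i assume "i \<in> I"
      then obtain c d k where i: "i = (c, d, k)" "c \<in> C" "d \<in> D" by (auto simp: I_def)
      have "nball c (1 / real (Suc k)) \<in> sets (qborel V)" "nball d (1 / real (Suc k)) \<in> sets (qborel V)"
        using i C D dense_for_carrier openin_nball openin_sets_qborel by blast+
      then show "(case i of (c, d, k) \<Rightarrow> (f -` nball c (1 / real (Suc k)) \<inter> space M) \<inter>
          (g -` nball d (1 / real (Suc k)) \<inter> space M)) \<in> sets M"
        using f g separably_valued_measurable i(1) by (auto intro!: sets.Int measurable_sets)
    qed
    finally show "(\<lambda>x. f x \<oplus> g x) -` U \<inter> space M \<in> sets M" .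
  qed (use fc gc in auto)
  ultimately show ?thesis unfolding separably_valued_iff by blast
qed

lemma separably_valued_minus:
  assumes f: "separably_valued M V f"
  shows "separably_valued M V (\<lambda>x. \<ominus> f x)"
proof -
  obtain C where C: "dense_for C (f ` space M)" using f unfolding separably_valued_iff by blast
  note fc = separably_valued_carrier[OF f]
  have "dense_for (a_inv V ` C) ((\<lambda>x. \<ominus> f x) ` space M)"
    by (rule dense_for_subset[OF dense_for_minus[OF C]]) auto
  moreover have "(\<lambda>x. \<ominus> f x) \<in> M \<rightarrow>\<^sub>M qborel V"
  proof (rule measurable_qborelI)
    fix U assume U: "openin (qtopology V) U"
    have "openin (qtopology V) {x \<in> carrier V. \<ominus> x \<in> U}"
      unfolding openin_qtopology_N
    proof (intro conjI ballI)
      fix x assume x: "x \<in> {x \<in> carrier V. \<ominus> x \<in> U}"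
      then obtain e where e: "e > 0" "nball (\<ominus> x) e \<subseteq> U" using U unfolding openin_qtopology_N by blast
      have "N (\<ominus> y \<ominus> \<ominus> x) = N (y \<ominus> x)" if "y \<in> carrier V" for y
        using that x N_minus[of "y \<ominus> x"] by (simp add: minus_eq minus_add)
      then have "nball x e \<subseteq> {x \<in> carrier V. \<ominus> x \<in> U}" using e(2) by (auto simp: nball_def)
      then show "\<exists>e>0. nball x e \<subseteq> {x \<in> carrier V. \<ominus> x \<in> U}" using e(1) by blast
    qed auto
    then have "f -` {x \<in> carrier V. \<ominus> x \<in> U} \<inter> space M \<in> sets M"
      using separably_valued_measurable[OF f] openin_sets_qborel by (intro measurable_sets) auto
    also have "f -` {x \<in> carrier V. \<ominus> x \<in> U} \<inter> space M = (\<lambda>x. \<ominus> f x) -` U \<inter> space M"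
      using fc by auto
    finally show "(\<lambda>x. \<ominus> f x) -` U \<inter> space M \<in> sets M" .
  qed (use fc in auto)
  ultimately show ?thesis unfolding separably_valued_iff by blast
qed

lemma separably_valued_diff:
  "\<lbrakk>separably_valued M V f; separably_valued M V g\<rbrakk> \<Longrightarrow> separably_valued M V (\<lambda>x. f x \<ominus> g x)"
  unfolding minus_eq by (intro separably_valued_add separably_valued_minus)

lemma measurable_N: "N \<in> borel_measurable (qborel V)"
proof (rule borel_measurableI_less)
  fix a
  have "{x \<in> carrier V. N x < a} = nball \<zero> a"
    by (auto simp: nball_def minus_zero_right)
  then show "{x \<in> space (qborel V). N x < a} \<in> sets (qborel V)"
    using openin_sets_qborel[OF openin_nball[of \<zero> a]] by (simp add: space_qborel)
qed

lemma measurable_N_compose: "separably_valued M V f \<Longrightarrow> (\<lambda>x. N (f x)) \<in> borel_measurable M"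
  using measurable_compose[OF separably_valued_measurable measurable_N] by blast

text \<open>The limit lies in an open \<open>U\<close> iff the sequence is eventually close to some
  \<open>c\<close> of a countable dense set around which a ball of twice that radius lies in
  \<open>U\<close>. The doubled radius leaves room for passing to the limit.\<close>

lemma separably_valued_lim:
  assumes u: "\<And>k::nat. separably_valued M V (u k)"
    and fc: "\<And>x. x \<in> space M \<Longrightarrow> f x \<in> carrier V"
    and lim: "\<And>x. x \<in> space M \<Longrightarrow> (\<lambda>k. N (u k x \<ominus> f x)) \<longlonglongrightarrow> 0"
  shows "separably_valued M V f"
proof -
  have "\<exists>C. \<forall>k. dense_for (C k) (u k ` space M)"
    using u unfolding separably_valued_iff by metis
  then obtain C' where C': "\<And>k. dense_for (C' k) (u k ` space M)" by blast
  define C where "C = (\<Union>k. C' k)"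
  note uc = separably_valued_carrier[OF u]
  have "countable C" "C \<subseteq> carrier V"
    using C' unfolding C_def dense_for_def by (auto, blast)
  have near: "\<exists>c\<in>C. N (f x \<ominus> c) < e" if x: "x \<in> space M" and e: "e > 0" for x e
  proof -
    have "\<forall>\<^sub>F k in sequentially. N (u k x \<ominus> f x) < e / 2"
      using order_tendstoD(2)[OF lim[OF x], of "e / 2"] e by simp
    then obtain k where k: "N (u k x \<ominus> f x) < e / 2" by (auto simp: eventually_sequentially)
    obtain c where c: "c \<in> C' k" "N (u k x \<ominus> c) < e / 2"
      using dense_forD[OF C', of "u k x" k "e / 2"] x e by auto
    have "c \<in> C" using c C_def by auto
    then have "N (f x \<ominus> c) \<le> N (f x \<ominus> u k x) + N (u k x \<ominus> c)"
      using x fc uc \<open>C \<subseteq> carrier V\<close> by (intro N_diff_triangle) auto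
    then show ?thesis using k c \<open>c \<in> C\<close> N_diff_commute[OF fc[OF x] uc[OF x]] by (intro bexI[of _ c]) auto
  qed
  have C: "dense_for C (f ` space M)"
    unfolding dense_for_def using near \<open>countable C\<close> \<open>C \<subseteq> carrier V\<close> fc by auto
  moreover have "f \<in> M \<rightarrow>\<^sub>M qborel V"
  proof (rule measurable_qborelI)
    fix U assume U: "openin (qtopology V) U"
    define I where "I = {(c, j :: nat). c \<in> C \<and> nball c (2 / real (Suc j)) \<subseteq> U}"
    have "countable I"
      by (rule countable_subset[of _ "C \<times> UNIV"]) (use \<open>countable C\<close> in \<open>auto simp: I_def\<close>)
    define A where "A = (\<lambda>(c, j). {x \<in> space M. \<exists>K. \<forall>k\<ge>K. N (u k x \<ominus> c) < 1 / real (Suc j)})"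
    have "f -` U \<inter> space M = (\<Union>i\<in>I. A i)"
    proof (intro subset_antisym subsetI)
      fix x assume "x \<in> f -` U \<inter> space M"
      then have x: "x \<in> space M" "f x \<in> U" by auto
      obtain e where e: "e > 0" "nball (f x) e \<subseteq> U" using U x unfolding openin_qtopology_N by blast
      obtain j where j: "1 / real (Suc j) < e / 3" using nat_ex_less[of "e / 3"] e by auto
      let ?d = "1 / real (Suc j)"
      obtain c where c: "c \<in> C" "N (f x \<ominus> c) < ?d / 2" using near[OF x(1), of "?d / 2"] by auto
      have cc: "c \<in> carrier V" using c \<open>C \<subseteq> carrier V\<close> by auto
      have "nball c (2 / real (Suc j)) \<subseteq> U"
      proof
        fix y assume y: "y \<in> nball c (2 / real (Suc j))"
        then have "N (y \<ominus> f x) \<le> N (y \<ominus> c) + N (c \<ominus> f x)"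
          using fc x cc by (intro N_diff_triangle) (auto simp: nball_def)
        also have "\<dots> < 2 * ?d + ?d / 2"
          using y c N_diff_commute[OF fc[OF x(1)] cc] by (auto simp: nball_def)
        also have "\<dots> \<le> e"
        proof -
          have "2 * D + D / 2 \<le> e" if "0 < D" "D < e / 3" for D :: real
            using that by linarith
          from this[of ?d] show ?thesis using j by (simp only: zero_less_divide_1_iff of_nat_0_less_iff zero_less_Suc)
        qed
        finally show "y \<in> U" using y e(2) by (auto simp: nball_def)
      qed
      then have "(c, j) \<in> I" using c by (auto simp: I_def)
      have "\<forall>\<^sub>F k in sequentially. N (u k x \<ominus> f x) < ?d / 2"
        using order_tendstoD(2)[OF lim[OF x(1)], of "?d / 2"] by simp
      then obtain K where K: "\<And>k. k \<ge> K \<Longrightarrow> N (u k x \<ominus> f x) < ?d / 2" by (auto simp: eventually_sequentially)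
      have "N (u k x \<ominus> c) < ?d" if "k \<ge> K" for k
        using K[OF that] c N_diff_triangle[OF uc[OF x(1)] fc[OF x(1)] cc, of k] by linarith
      then have "x \<in> A (c, j)" using x by (auto simp: A_def)
      then show "x \<in> (\<Union>i\<in>I. A i)" using \<open>(c, j) \<in> I\<close> by blast
    next
      fix x assume "x \<in> (\<Union>i\<in>I. A i)"
      then obtain c j K where i: "c \<in> C" "nball c (2 / real (Suc j)) \<subseteq> U" "x \<in> space M"
        and K: "\<And>k. k \<ge> K \<Longrightarrow> N (u k x \<ominus> c) < 1 / real (Suc j)"
        by (auto simp: I_def A_def)
      have cc: "c \<in> carrier V" using i \<open>C \<subseteq> carrier V\<close> by auto
      have "\<forall>\<^sub>F k in sequentially. N (u k x \<ominus> f x) < 1 / real (Suc j)"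
        using order_tendstoD(2)[OF lim[OF i(3)], of "1 / real (Suc j)"] by simp
      then obtain L where L: "\<And>k. k \<ge> L \<Longrightarrow> N (u k x \<ominus> f x) < 1 / real (Suc j)"
        by (auto simp: eventually_sequentially)
      let ?k = "max K L"
      have "N (f x \<ominus> c) \<le> N (f x \<ominus> u ?k x) + N (u ?k x \<ominus> c)"
        using fc uc i(3) cc by (intro N_diff_triangle) auto
      also have "\<dots> < 2 / real (Suc j)"
        using K[of ?k] L[of ?k] N_diff_commute[OF fc[OF i(3)] uc[OF i(3), of ?k]] by simp
      finally show "x \<in> f -` U \<inter> space M" using i fc by (auto simp: nball_def)
    qed
    also have "\<dots> \<in> sets M"
    proof (rule sets.countable_UN''[OF \<open>countable I\<close>])
      fix i assume "i \<in> I"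
      then obtain c j where i: "i = (c, j)" "c \<in> C" by (auto simp: I_def)
      have [measurable]: "(\<lambda>x. N (u k x \<ominus> c)) \<in> borel_measurable M" for k
        using i \<open>C \<subseteq> carrier V\<close>
        by (intro measurable_N_compose separably_valued_diff u separably_valued_const) auto
      show "A i \<in> sets M" unfolding A_def i by simp
    qed
    finally show "f -` U \<inter> space M \<in> sets M" .
  qed (use fc in auto)
  ultimately show ?thesis unfolding separably_valued_iff by blast
qed

end

section \<open>Filtered spaces and images of tangent sequences\<close>

lemma complete_filtered_prob_spaceD:
  assumes "complete_filtered_prob_space M F"
  shows "prob_space M" "\<And>n. subalgebra M (F n)" "\<And>n. space (F n) = space M"
    "\<And>m n. m \<le> n \<Longrightarrow> subalgebra (F n) (F m)" "sets (F 0) = {{}, space M}"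
  using assms unfolding complete_filtered_prob_space_def filtration_def
  by (auto simp: subalgebra_def)

text \<open>Both conditions of tangency speak only of events that a step lies in a Borel set, and
  preimages under \<open>h\<close> are such events again. The lemma serves for rounding to finitely
  many values, for evaluation at a point of \<open>S\<close> and for the embedding of
  \<open>Y\<close>.\<close>

lemma decoupled_tangent_map:
  assumes "complete_filtered_prob_space M F" "decoupled_tangent M F V d e"
    and h: "h \<in> qborel V \<rightarrow>\<^sub>M qborel W"
    and d: "\<And>n. n \<ge> 1 \<Longrightarrow> separably_valued (F n) W (\<lambda>\<omega>. h (d n \<omega>))"
    and e: "\<And>n. n \<ge> 1 \<Longrightarrow> separably_valued M W (\<lambda>\<omega>. h (e n \<omega>))"
  shows "decoupled_tangent M F W (\<lambda>n \<omega>. h (d n \<omega>)) (\<lambda>n \<omega>. h (e n \<omega>))"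
proof -
  note sp = complete_filtered_prob_spaceD(3)[OF assms(1)]
  have dm: "d n \<omega> \<in> carrier V" and em: "e n \<omega> \<in> carrier V" if "n \<ge> 1" "\<omega> \<in> space M" for n \<omega>
    using assms(2) that separably_valued_carrier sp unfolding decoupled_tangent_def adapted_def by metis+
  have pre: "h -` B \<inter> carrier V \<in> sets (qborel V)" if "B \<in> sets (qborel W)" for B
    using measurable_sets[OF h that] by (simp add: space_qborel)
  have deq: "(\<lambda>\<omega>. h (d n \<omega>)) -` B \<inter> space M = d n -` (h -` B \<inter> carrier V) \<inter> space M" if "n \<ge> 1" for n B
    using dm that by auto
  have eeq: "(\<lambda>\<omega>. h (e n \<omega>)) -` B \<inter> space M = e n -` (h -` B \<inter> carrier V) \<inter> space M" if "n \<ge> 1" for n B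
    using em that by auto
  have alleq: "{\<omega> \<in> space M. \<forall>k\<in>{1..n}. h (e k \<omega>) \<in> B k} =
      {\<omega> \<in> space M. \<forall>k\<in>{1..n}. e k \<omega> \<in> h -` B k \<inter> carrier V}" for n :: nat and B
    using em by auto
  show ?thesis
    unfolding decoupled_tangent_def
  proof (intro conjI allI impI ballI)
    show "adapted F W (\<lambda>n \<omega>. h (d n \<omega>))" using d by (simp add: adapted_def)
  next
    fix n :: nat assume "n \<ge> 1"
    then show "separably_valued M W (\<lambda>\<omega>. h (e n \<omega>))" by (rule e)
  next
    fix n :: nat and B assume "n \<ge> 1" "B \<in> sets (qborel W)"
    then show "AE \<omega> in M. conditional_prob M (F (n - 1)) ((\<lambda>\<omega>. h (d n \<omega>)) -` B \<inter> space M) \<omega> =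
        conditional_prob M (F_infinity M F) ((\<lambda>\<omega>. h (e n \<omega>)) -` B \<inter> space M) \<omega>"
      using assms(2) pre unfolding decoupled_tangent_def deq[OF \<open>n \<ge> 1\<close>] eeq[OF \<open>n \<ge> 1\<close>] by blast
  next
    fix n :: nat and B assume n: "n \<ge> 1" and B: "\<forall>k\<in>{1..n}. B k \<in> sets (qborel W)"
    have b: "AE \<omega> in M. conditional_prob M (F_infinity M F)
         {\<omega> \<in> space M. \<forall>k\<in>{1..n}. e k \<omega> \<in> B k} \<omega> =
       (\<Prod>k\<in>{1..n}. conditional_prob M (F_infinity M F) (e k -` B k \<inter> space M) \<omega>)"
      if "\<forall>k\<in>{1..n}. B k \<in> sets (qborel V)" for B
      using assms(2) n that unfolding decoupled_tangent_def by simp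
    have "AE \<omega> in M. conditional_prob M (F_infinity M F)
         {\<omega> \<in> space M. \<forall>k\<in>{1..n}. e k \<omega> \<in> h -` B k \<inter> carrier V} \<omega> =
       (\<Prod>k\<in>{1..n}. conditional_prob M (F_infinity M F) (e k -` (h -` B k \<inter> carrier V) \<inter> space M) \<omega>)"
      by (rule b) (use pre B in auto)
    moreover have "(\<Prod>k\<in>{1..n}. conditional_prob M (F_infinity M F) ((\<lambda>\<omega>. h (e k \<omega>)) -` B k \<inter> space M) \<omega>) =
      (\<Prod>k\<in>{1..n}. conditional_prob M (F_infinity M F) (e k -` (h -` B k \<inter> carrier V) \<inter> space M) \<omega>)" for \<omega>
      by (intro prod.cong refl) (simp add: eeq)
    ultimately show "AE \<omega> in M. conditional_prob M (F_infinity M F)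
         {\<omega> \<in> space M. \<forall>k\<in>{1..n}. h (e k \<omega>) \<in> B k} \<omega> =
       (\<Prod>k\<in>{1..n}. conditional_prob M (F_infinity M F) ((\<lambda>\<omega>. h (e k \<omega>)) -` B k \<inter> space M) \<omega>)"
      unfolding alleq by simp
  qed
qed

section \<open>Trees and independent copies\<close>

text \<open>
  Histories of a discrete process are lists with the most recent letter first, and \<open>K h\<close> is the
  law of the next letter given the history \<open>h\<close>. Given the path \<open>h\<close>, the list \<open>copies K h\<close> consists
  of conditionally independent copies of its letters.
\<close>

primrec paths :: "('c list \<Rightarrow> 'c pmf) \<Rightarrow> nat \<Rightarrow> 'c list pmf" where
  "paths K 0 = return_pmf []"
| "paths K (Suc n) = bind_pmf (paths K n) (\<lambda>h. map_pmf (\<lambda>a. a # h) (K h))"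

primrec copies :: "('c list \<Rightarrow> 'c pmf) \<Rightarrow> 'c list \<Rightarrow> 'c list pmf" where
  "copies K [] = return_pmf []"
| "copies K (a # h) = bind_pmf (copies K h) (\<lambda>bs. map_pmf (\<lambda>b. b # bs) (K h))"

lemma length_paths: "h \<in> set_pmf (paths K n) \<Longrightarrow> length h = n"
  by (induction n arbitrary: h) (auto simp: set_bind_pmf)

lemma length_copies: "bs \<in> set_pmf (copies K h) \<Longrightarrow> length bs = length h"
  by (induction h arbitrary: bs) (auto simp: set_bind_pmf)

lemma finite_paths: "(\<And>h. finite (set_pmf (K h))) \<Longrightarrow> finite (set_pmf (paths K n))"
  by (induction n) (auto simp: set_bind_pmf)

lemma finite_copies: "(\<And>h. finite (set_pmf (K h))) \<Longrightarrow> finite (set_pmf (copies K h))"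
  by (induction h) (auto simp: set_bind_pmf)

lemma nn_integral_paths_Suc:
  "(\<integral>\<^sup>+h. f h \<partial>paths K (Suc n)) = (\<integral>\<^sup>+h. \<integral>\<^sup>+a. f (a # h) \<partial>K h \<partial>paths K n)"
  by simp

lemma nn_integral_copies_Cons:
  "(\<integral>\<^sup>+bs. f bs \<partial>copies K (a # h)) = (\<integral>\<^sup>+bs. \<integral>\<^sup>+b. f (b # bs) \<partial>K h \<partial>copies K h)"
  by simp

lemma nn_integral_copies_tl:
  "(\<integral>\<^sup>+bs. f (tl bs) \<partial>copies K (a # h)) = (\<integral>\<^sup>+bs. f bs \<partial>copies K h)"
  by simp

lemma nn_integral_pmf_finite:
  assumes "finite (set_pmf M)" "\<And>x. x \<in> set_pmf M \<Longrightarrow> f x < (\<infinity> :: ennreal)"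
  shows "(\<integral>\<^sup>+x. f x \<partial>measure_pmf M) < \<infinity>"
  using assms by (subst nn_integral_measure_pmf_finite) (auto simp: ennreal_mult_less_top)

text \<open>Since \<open>P\<close> is invariant under \<open>\<sigma>\<close>, the conditional flip
  is itself an involution, and it moves a point only to one of equal mass.\<close>

lemma map_pmf_involution_if:
  assumes \<sigma>: "\<And>b. \<sigma> (\<sigma> b) = b" "map_pmf \<sigma> M = M" and P: "\<And>b. P (\<sigma> b) = P b"
  shows "map_pmf (\<lambda>b. if P b then b else \<sigma> b) M = M"
proof (rule pmf_eqI)
  fix x
  let ?f = "\<lambda>b. if P b then b else \<sigma> b"
  have ff: "?f (?f b) = b" for b using \<sigma>(1) P by auto
  have "inj ?f" by (rule inj_on_inverseI[where g = ?f]) (rule ff)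
  have "inj \<sigma>" by (rule inj_on_inverseI[where g = \<sigma>]) (rule \<sigma>(1))
  have "pmf M (\<sigma> b) = pmf M b" for b using pmf_map_inj'[OF \<open>inj \<sigma>\<close>, of M b] \<sigma>(2) by simp
  then have "pmf M (?f x) = pmf M x" by simp
  moreover have "pmf (map_pmf ?f M) (?f (?f x)) = pmf M (?f x)" by (rule pmf_map_inj'[OF \<open>inj ?f\<close>])
  ultimately show "pmf (map_pmf ?f M) x = pmf M x" unfolding ff by simp
qed

abbreviation iv :: "bool \<Rightarrow> ennreal" where
  "iv P \<equiv> (if P then 1 else 0)"

lemma powr_add_le:
  assumes "0 \<le> x" "0 \<le> y" "0 < a" shows "(x + y) powr a \<le> 2 powr a * (x powr a + y powr (a::real))"
proof -
  have "(x + y) powr a \<le> (2 * max x y) powr a" using assms by (intro powr_mono2) auto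
  also have "\<dots> = 2 powr a * max x y powr a" using assms by (simp add: powr_mult)
  also have "max x y powr a \<le> x powr a + y powr a" by (auto simp: max_def)
  finally show ?thesis by simp
qed

lemma ennreal_mult3:
  "\<lbrakk>0 \<le> p; 0 \<le> q; 0 \<le> r\<rbrakk> \<Longrightarrow> ennreal p * (ennreal q * (ennreal r * X)) = ennreal (p * (q * r)) * X"
  by (simp add: ennreal_mult mult.assoc)

text \<open>Subtracting the multiple of \<open>X\<close> is legitimate only if \<open>X\<close> is
  finite; on finite trees this holds for every moment.\<close>

lemma ennreal_absorb:
  fixes X R :: ennreal
  assumes "X \<le> R + ennreal e * X" "e \<le> 1 / 2" "X < \<infinity>"
  shows "X \<le> 2 * R"
proof (cases "R = \<infinity>")
  case False
  obtain x where x: "X = ennreal x" "x \<ge> 0" using assms(3) by (cases X) auto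
  obtain y where y: "R = ennreal y" "y \<ge> 0" using False by (cases R) auto
  have "X \<le> R + ennreal (1 / 2) * X"
    using assms by (meson add_left_mono ennreal_leI mult_right_mono order_trans zero_le)
  moreover have "R + ennreal (1 / 2) * X = ennreal (y + 1 / 2 * x)"
  proof -
    have "ennreal (1 / 2) * ennreal x = ennreal (1 / 2 * x)" by (rule ennreal_mult[symmetric]) (use x in auto)
    moreover have "ennreal y + ennreal (1 / 2 * x) = ennreal (y + 1 / 2 * x)"
      by (rule ennreal_plus[symmetric]) (use x y in auto)
    ultimately show ?thesis by (simp only: x(1) y(1))
  qed
  ultimately have "ennreal x \<le> ennreal (y + 1 / 2 * x)" by (simp only: x)
  then have "x \<le> y + 1 / 2 * x" using x y by (subst (asm) ennreal_le_iff) auto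
  then have "x \<le> 2 * y" by simp
  then show ?thesis using x y by (simp add: ennreal_leI ennreal_mult''[symmetric] flip: ennreal_numeral)
qed (simp add: ennreal_mult_top)

text \<open>\<open>N\<close> is not homogeneous and elements of a group cannot be halved. This
  inequality is the substitute that allows an average of two sums to be estimated by their
  sum.\<close>

locale f_normed_double = f_normed_group +
  assumes N_double: "x \<in> carrier V \<Longrightarrow> N x \<le> 2 * N (x \<oplus> x)"
begin

text \<open>The list \<open>h\<close> supplies the history that each step sees, and
  \<open>bs\<close> the newest letter that is plugged into it. Thus \<open>walk d h h\<close> is the
  process itself, and \<open>walk d h bs\<close> with \<open>bs\<close> drawn from
  \<open>copies K h\<close> is its decoupled sum. The predicates \<open>passed\<close> and
  \<open>jumped\<close> follow the same convention.\<close>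

primrec walk :: "('c list \<Rightarrow> 'a) \<Rightarrow> 'c list \<Rightarrow> 'c list \<Rightarrow> 'a" where
  "walk d [] bs = \<zero>"
| "walk d (a # h) bs = walk d h (tl bs) \<oplus> d (hd bs # h)"

text \<open>In \<open>c h bs\<close> the list \<open>h\<close> is the history before the step, and
  \<open>bs\<close> includes the copy used in the step. A mask may hence depend on the current
  letter, which the masks selecting steps by their size require.\<close>

primrec masked_walk :: "('c list \<Rightarrow> 'c list \<Rightarrow> bool) \<Rightarrow> ('c list \<Rightarrow> 'a) \<Rightarrow> 'c list \<Rightarrow> 'c list \<Rightarrow> 'a" where
  "masked_walk c d [] bs = \<zero>"
| "masked_walk c d (a # h) bs = masked_walk c d h (tl bs) \<oplus> (if c h bs then d (hd bs # h) else \<zero>)"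

primrec passed :: "('c list \<Rightarrow> 'a) \<Rightarrow> real \<Rightarrow> 'c list \<Rightarrow> 'c list \<Rightarrow> bool" where
  "passed d s [] bs = False"
| "passed d s (a # h) bs = (passed d s h (tl bs) \<or> s < N (walk d (a # h) bs))"

primrec jumped :: "('c list \<Rightarrow> 'a) \<Rightarrow> real \<Rightarrow> 'c list \<Rightarrow> 'c list \<Rightarrow> bool" where
  "jumped d s [] bs = False"
| "jumped d s (a # h) bs = (jumped d s h (tl bs) \<or> s < N (d (hd bs # h)))"

definition process_moment :: "('c list \<Rightarrow> 'c pmf) \<Rightarrow> ('c list \<Rightarrow> 'a) \<Rightarrow> nat \<Rightarrow> real \<Rightarrow> ennreal" where
  "process_moment K d n b = (\<integral>\<^sup>+h. ennreal (N (walk d h h) powr b) \<partial>paths K n)"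

definition decoupled_moment :: "('c list \<Rightarrow> 'c pmf) \<Rightarrow> ('c list \<Rightarrow> 'a) \<Rightarrow> nat \<Rightarrow> real \<Rightarrow> ennreal" where
  "decoupled_moment K d n b = (\<integral>\<^sup>+h. \<integral>\<^sup>+bs. ennreal (N (walk d h bs) powr b) \<partial>copies K h \<partial>paths K n)"

lemma step_closed: "range d \<subseteq> carrier V \<Longrightarrow> d l \<in> carrier V"
  by auto

lemma walk_closed: "range d \<subseteq> carrier V \<Longrightarrow> walk d h bs \<in> carrier V"
  by (induction h arbitrary: bs) (auto simp: image_subset_iff)

lemma masked_walk_closed: "range d \<subseteq> carrier V \<Longrightarrow> masked_walk c d h bs \<in> carrier V"
  by (induction h arbitrary: bs) (auto simp: image_subset_iff)

lemma masked_walk_cong: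
  "(\<And>h' bs. length h' < length h \<Longrightarrow> c h' bs = c' h' bs) \<Longrightarrow> masked_walk c d h bs = masked_walk c' d h bs"
  by (induction h arbitrary: bs) auto

lemma walk_eq_masked: "range d \<subseteq> carrier V \<Longrightarrow>
    walk (\<lambda>l. if C l then d l else \<zero>) h bs = masked_walk (\<lambda>h bs. C (hd bs # h)) d h bs"
  by (induction h arbitrary: bs) auto

lemma masked_walk_True: "masked_walk (\<lambda>_ _. True) d h bs = walk d h bs"
  by (induction h arbitrary: bs) auto

lemma masked_walk_split:
  assumes "range d \<subseteq> carrier V"
  shows "walk d h bs = masked_walk c d h bs \<oplus> masked_walk (\<lambda>h bs. \<not> c h bs) d h bs"
proof (induction h arbitrary: bs)
  case (Cons a h)
  then show ?case
    using masked_walk_closed[OF assms] step_closed[OF assms] by (simp add: a_ac)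
qed simp

lemma not_passed: "\<not> passed d s h bs \<Longrightarrow> 0 \<le> s \<Longrightarrow> N (walk d h bs) \<le> s"
  by (cases h) (auto simp: N_zero)

end

text \<open>In the application the letters are pairs of conditionally independent letters, and
  \<open>\<sigma>\<close> exchanges the components.\<close>

locale symmetric_tree = f_normed_double +
  fixes K :: "'c list \<Rightarrow> 'c pmf" and \<sigma> :: "'c \<Rightarrow> 'c"
  assumes fin: "finite (set_pmf (K h))"
    and \<sigma>_\<sigma>: "\<sigma> (\<sigma> b) = b"
    and K_\<sigma>: "map_pmf \<sigma> (K h) = K h"
begin

definition symmetric_steps :: "('c list \<Rightarrow> 'a) \<Rightarrow> bool" where
  "symmetric_steps d \<longleftrightarrow> range d \<subseteq> carrier V \<and> (\<forall>b h. d (\<sigma> b # h) = \<ominus> d (b # h))"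

definition flip_invariant :: "('c list \<Rightarrow> 'c list \<Rightarrow> bool) \<Rightarrow> bool" where
  "flip_invariant c \<longleftrightarrow> (\<forall>h b bs. c h (\<sigma> b # bs) = c h (b # bs))"

primrec flip :: "('c list \<Rightarrow> 'c list \<Rightarrow> bool) \<Rightarrow> 'c list \<Rightarrow> 'c list \<Rightarrow> 'c list" where
  "flip c [] bs = []"
| "flip c (a # h) bs = (if c h bs then hd bs else \<sigma> (hd bs)) # flip c h (tl bs)"

text \<open>Given the earlier copies, the decision whether to flip is
  \<open>\<sigma>\<close>-invariant in the current letter, so each letter keeps its conditional law.
  The decision is taken from the unflipped earlier copies, which is why the conditioning comes
  before the induction hypothesis.\<close>

lemma map_pmf_flip: "flip_invariant c \<Longrightarrow> map_pmf (flip c h) (copies K h) = copies K h"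
proof (induction h)
  case (Cons a h)
  have "map_pmf (flip c (a # h)) (copies K (a # h)) =
      bind_pmf (copies K h) (\<lambda>bs. map_pmf (\<lambda>b. (if c h (b # bs) then b else \<sigma> b) # flip c h bs) (K h))"
    by (simp add: map_bind_pmf map_pmf_comp cong: if_cong)
  also have "\<dots> = bind_pmf (copies K h) (\<lambda>bs. map_pmf (\<lambda>b. b # flip c h bs)
      (map_pmf (\<lambda>b. if c h (b # bs) then b else \<sigma> b) (K h)))"
    by (simp add: map_pmf_comp)
  also have "\<dots> = bind_pmf (copies K h) (\<lambda>bs. map_pmf (\<lambda>b. b # flip c h bs) (K h))"
    using Cons.prems by (subst map_pmf_involution_if) (auto simp: \<sigma>_\<sigma> K_\<sigma> flip_invariant_def)
  also have "\<dots> = bind_pmf (map_pmf (flip c h) (copies K h)) (\<lambda>bs. map_pmf (\<lambda>b. b # bs) (K h))"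
    by (simp add: bind_map_pmf)
  finally show ?case by (simp only: copies.simps Cons.IH[OF Cons.prems])
qed simp

text \<open>Steps kept by \<open>flip\<close> occur twice, and the flipped ones cancel because
  \<open>\<sigma>\<close> changes the sign of a step without touching the history it sees.\<close>

lemma walk_add_flip:
  assumes "symmetric_steps d"
  shows "walk d h bs \<oplus> walk d h (flip c h bs) = masked_walk c d h bs \<oplus> masked_walk c d h bs"
proof (induction h arbitrary: bs)
  case (Cons a h)
  have d: "range d \<subseteq> carrier V" using assms by (simp add: symmetric_steps_def)
  define x where "x = d (hd bs # h)"
  define y where "y = d ((if c h bs then hd bs else \<sigma> (hd bs)) # h)"
  have xy: "x \<in> carrier V" "y \<in> carrier V" using d by (auto simp: x_def y_def)
  have w: "walk d h bs \<in> carrier V" "masked_walk c d h bs \<in> carrier V" for bs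
    using walk_closed[OF d] masked_walk_closed[OF d] by auto
  have "walk d (a # h) bs \<oplus> walk d (a # h) (flip c (a # h) bs) =
      (walk d h (tl bs) \<oplus> x) \<oplus> (walk d h (flip c h (tl bs)) \<oplus> y)"
    by (simp add: x_def y_def)
  also have "\<dots> = (walk d h (tl bs) \<oplus> walk d h (flip c h (tl bs))) \<oplus> (x \<oplus> y)"
    using w xy by (simp add: a_ac)
  also have "\<dots> = (masked_walk c d h (tl bs) \<oplus> masked_walk c d h (tl bs)) \<oplus> (x \<oplus> y)"
    by (simp add: Cons)
  also have "x \<oplus> y = (if c h bs then x else \<zero>) \<oplus> (if c h bs then x else \<zero>)"
    using assms d xy by (auto simp: x_def y_def symmetric_steps_def r_neg)
  also have "masked_walk c d h (tl bs) \<oplus> masked_walk c d h (tl bs) \<oplus>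
      ((if c h bs then x else \<zero>) \<oplus> (if c h bs then x else \<zero>)) =
      masked_walk c d (a # h) bs \<oplus> masked_walk c d (a # h) bs"
    using w xy by (simp add: x_def a_ac)
  finally show ?case .
qed simp

text \<open>Flipping the signs of the masked steps preserves the law, so a masked sum is the average of two copies of the full sum.\<close>

lemma contraction:
  fixes \<psi> :: "real \<Rightarrow> ennreal"
  assumes d: "symmetric_steps d" and c: "flip_invariant c" and \<psi>: "mono \<psi>"
  shows "(\<integral>\<^sup>+bs. \<psi> (N (masked_walk c d h bs)) \<partial>copies K h) \<le> 2 * (\<integral>\<^sup>+bs. \<psi> (4 * N (walk d h bs)) \<partial>copies K h)"
proof -
  have dc: "range d \<subseteq> carrier V" using d by (simp add: symmetric_steps_def)
  have "\<psi> (N (masked_walk c d h bs)) \<le> \<psi> (4 * N (walk d h bs)) + \<psi> (4 * N (walk d h (flip c h bs)))" for bs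
  proof -
    let ?x = "N (walk d h bs)" and ?y = "N (walk d h (flip c h bs))"
    have "N (masked_walk c d h bs) \<le> 2 * N (walk d h bs \<oplus> walk d h (flip c h bs))"
      using N_double[OF masked_walk_closed[OF dc]] walk_add_flip[OF d, of h bs c] by simp
    also have "\<dots> \<le> 2 * (?x + ?y)"
      using N_add[OF walk_closed[OF dc, of h bs] walk_closed[OF dc, of h "flip c h bs"]] by simp
    also have "\<dots> \<le> max (4 * ?x) (4 * ?y)" by simp
    finally have "\<psi> (N (masked_walk c d h bs)) \<le> \<psi> (max (4 * ?x) (4 * ?y))" using \<psi> by (simp add: mono_def)
    also have "\<dots> \<le> \<psi> (4 * ?x) + \<psi> (4 * ?y)" by (auto simp: max_def)
    finally show ?thesis .
  qed
  then have "(\<integral>\<^sup>+bs. \<psi> (N (masked_walk c d h bs)) \<partial>copies K h) \<le>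
      (\<integral>\<^sup>+bs. \<psi> (4 * N (walk d h bs)) + \<psi> (4 * N (walk d h (flip c h bs))) \<partial>copies K h)"
    by (intro nn_integral_mono) simp
  also have "\<dots> = (\<integral>\<^sup>+bs. \<psi> (4 * N (walk d h bs)) \<partial>copies K h) +
      (\<integral>\<^sup>+bs. \<psi> (4 * N (walk d h bs)) \<partial>map_pmf (flip c h) (copies K h))"
    by (subst nn_integral_add) auto
  also have "\<dots> = 2 * (\<integral>\<^sup>+bs. \<psi> (4 * N (walk d h bs)) \<partial>copies K h)"
    by (simp only: map_pmf_flip[OF c] mult_2)
  finally show ?thesis .
qed

lemma contraction_prob:
  assumes "symmetric_steps d" "flip_invariant c"
  shows "(\<integral>\<^sup>+bs. iv (s < N (masked_walk c d h bs)) \<partial>copies K h) \<le>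
    2 * (\<integral>\<^sup>+bs. iv (s < 4 * N (walk d h bs)) \<partial>copies K h)"
  by (rule contraction[OF assms]) (auto simp: mono_def)

lemma contraction_moment:
  assumes "symmetric_steps d" "flip_invariant c" "0 < a"
  shows "(\<integral>\<^sup>+bs. ennreal (N (masked_walk c d h bs) powr a) \<partial>copies K h) \<le>
    ennreal (2 * 4 powr a) * (\<integral>\<^sup>+bs. ennreal (N (walk d h bs) powr a) \<partial>copies K h)"
proof -
  have dc: "range d \<subseteq> carrier V" using assms by (simp add: symmetric_steps_def)
  have "(\<integral>\<^sup>+bs. ennreal (max 0 (N (masked_walk c d h bs)) powr a) \<partial>copies K h) \<le>
    2 * (\<integral>\<^sup>+bs. ennreal (max 0 (4 * N (walk d h bs)) powr a) \<partial>copies K h)"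
    using assms(3) by (intro contraction[OF assms(1,2)]) (auto simp: mono_def intro!: ennreal_leI powr_mono2)
  also have "\<dots> = 2 * (\<integral>\<^sup>+bs. ennreal (4 powr a) * ennreal (N (walk d h bs) powr a) \<partial>copies K h)"
    by (simp add: max_absorb2 N_nonneg walk_closed[OF dc] powr_mult ennreal_mult')
  also have "\<dots> = ennreal (2 * 4 powr a) * (\<integral>\<^sup>+bs. ennreal (N (walk d h bs) powr a) \<partial>copies K h)"
    by (subst nn_integral_cmult) (auto simp: ennreal_mult' mult.assoc)
  finally show ?thesis by (simp add: max_absorb2 N_nonneg masked_walk_closed[OF dc])
qed

text \<open>A reflection argument: masking by "not passed before this step" turns the sum into the
  walk stopped at its first passage, which exceeds \<open>s\<close> exactly if a passage has
  occurred.\<close>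

lemma levy:
  assumes d: "symmetric_steps d" and "0 \<le> s"
  shows "(\<integral>\<^sup>+bs. iv (passed d s h bs) \<partial>copies K h) \<le> 2 * (\<integral>\<^sup>+bs. iv (s < 4 * N (walk d h bs)) \<partial>copies K h)"
proof -
  let ?c = "\<lambda>h bs. \<not> passed d s h (tl bs)"
  have dc: "range d \<subseteq> carrier V" using d by (simp add: symmetric_steps_def)
  have "(passed d s h bs \<longrightarrow> s < N (masked_walk ?c d h bs)) \<and>
      (\<not> passed d s h bs \<longrightarrow> masked_walk ?c d h bs = walk d h bs)" for bs
    by (induction h arbitrary: bs) (auto simp: masked_walk_closed[OF dc] step_closed[OF dc])
  then have "(\<integral>\<^sup>+bs. iv (passed d s h bs) \<partial>copies K h) \<le> (\<integral>\<^sup>+bs. iv (s < N (masked_walk ?c d h bs)) \<partial>copies K h)"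
    by (intro nn_integral_mono) auto
  also have "\<dots> \<le> 2 * (\<integral>\<^sup>+bs. iv (s < 4 * N (walk d h bs)) \<partial>copies K h)"
    by (rule contraction_prob[OF d]) (simp add: flip_invariant_def)
  finally show ?thesis .
qed

text \<open>The mask keeps the first step larger than \<open>s\<close> and nothing else. It is flip
  invariant although it inspects the current letter, since \<open>N\<close> does not see
  signs.\<close>

lemma jumped_le:
  assumes d: "symmetric_steps d" and "0 \<le> s"
  shows "(\<integral>\<^sup>+bs. iv (jumped d s h bs) \<partial>copies K h) \<le> 2 * (\<integral>\<^sup>+bs. iv (s < 4 * N (walk d h bs)) \<partial>copies K h)"
proof -
  let ?c = "\<lambda>h bs. \<not> jumped d s h (tl bs) \<and> s < N (d (hd bs # h))"
  have dc: "range d \<subseteq> carrier V" using d by (simp add: symmetric_steps_def)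
  have "(jumped d s h bs \<longrightarrow> s < N (masked_walk ?c d h bs)) \<and>
      (\<not> jumped d s h bs \<longrightarrow> masked_walk ?c d h bs = \<zero>)" for bs
    by (induction h arbitrary: bs) (auto simp: masked_walk_closed[OF dc] step_closed[OF dc])
  then have "(\<integral>\<^sup>+bs. iv (jumped d s h bs) \<partial>copies K h) \<le> (\<integral>\<^sup>+bs. iv (s < N (masked_walk ?c d h bs)) \<partial>copies K h)"
    by (intro nn_integral_mono) auto
  also have "\<dots> \<le> 2 * (\<integral>\<^sup>+bs. iv (s < 4 * N (walk d h bs)) \<partial>copies K h)"
    by (rule contraction_prob[OF d])
      (use d in \<open>auto simp: flip_invariant_def symmetric_steps_def N_minus step_closed[OF dc]\<close>)
  finally show ?thesis .
qed

text \<open>The sum of the steps after the first passage above \<open>s\<close>, taken along a second path of copies \<open>bs'\<close>.\<close>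

primrec after :: "('c list \<Rightarrow> 'a) \<Rightarrow> real \<Rightarrow> 'c list \<Rightarrow> 'c list \<Rightarrow> 'c list \<Rightarrow> 'a" where
  "after d s [] bs bs' = \<zero>"
| "after d s (a # h) bs bs' = after d s h (tl bs) (tl bs') \<oplus> (if passed d s h (tl bs) then d (hd bs' # h) else \<zero>)"

lemma after_not_passed: "range d \<subseteq> carrier V \<Longrightarrow> \<not> passed d s h bs \<Longrightarrow> after d s h bs bs' = \<zero>"
  by (induction h arbitrary: bs bs') auto

text \<open>For fixed \<open>bs\<close> the mask does not look at \<open>bs'\<close> at all, so it
  is trivially flip invariant and the contraction principle applies in \<open>bs'\<close>. The
  \<open>drop\<close> recovers the copies that belong to the shorter history
  \<open>h'\<close>.\<close>

lemma after_eq_masked: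
  "after d s h bs bs' = masked_walk (\<lambda>h' _. passed d s h' (drop (length h - length h') bs)) d h bs'"
proof (induction h arbitrary: bs bs')
  case (Cons a h)
  have "masked_walk (\<lambda>h' _. passed d s h' (drop (length (a # h) - length h') bs)) d h (tl bs') =
      masked_walk (\<lambda>h' _. passed d s h' (drop (length h - length h') (tl bs))) d h (tl bs')"
    by (rule masked_walk_cong) (auto simp: Suc_diff_le drop_Suc)
  then show ?case using Cons by (simp add: drop_Suc)
qed simp

lemma after_self: "after d s h bs bs = masked_walk (\<lambda>h bs. passed d s h (tl bs)) d h bs"
  by (induction h arbitrary: bs) auto

text \<open>The steps after the first passage are independent of the copies that decide when it
  occurs, so they may be drawn afresh. This is the strong Markov property, proved letter by
  letter.\<close>

lemma after_decouple:
  fixes \<phi> :: "'a \<Rightarrow> ennreal"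
  assumes dc: "range d \<subseteq> carrier V"
  shows "(\<integral>\<^sup>+bs. iv (passed d s h bs) * \<phi> (after d s h bs bs) \<partial>copies K h) =
    (\<integral>\<^sup>+bs. iv (passed d s h bs) * (\<integral>\<^sup>+bs'. \<phi> (after d s h bs bs') \<partial>copies K h) \<partial>copies K h)"
proof (induction h arbitrary: \<phi>)
  case (Cons a h)
  \<comment> \<open>The case that the current step is the one that passes \<open>s\<close>; the sum
    of later steps is still empty, whence \<open>\<phi> \<zero>\<close>.\<close>
  let ?new = "\<lambda>bs. \<integral>\<^sup>+b. iv (s < N (walk d h bs \<oplus> d (b # h))) * \<phi> \<zero> \<partial>K h"
  let ?\<phi> = "\<lambda>z. \<integral>\<^sup>+b. \<phi> (z \<oplus> d (b # h)) \<partial>K h"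
  have "(\<integral>\<^sup>+bs. iv (passed d s (a # h) bs) * \<phi> (after d s (a # h) bs bs) \<partial>copies K (a # h)) =
      (\<integral>\<^sup>+bs. iv (passed d s h bs) * ?\<phi> (after d s h bs bs) + iv (\<not> passed d s h bs) * ?new bs \<partial>copies K h)"
    unfolding nn_integral_copies_Cons
    using dc by (intro nn_integral_cong) (simp add: after_not_passed)
  also have "\<dots> = (\<integral>\<^sup>+bs. iv (passed d s h bs) * ?\<phi> (after d s h bs bs) \<partial>copies K h) +
      (\<integral>\<^sup>+bs. iv (\<not> passed d s h bs) * ?new bs \<partial>copies K h)"
    by (rule nn_integral_add) auto
  also have "\<dots> = (\<integral>\<^sup>+bs. iv (passed d s h bs) * (\<integral>\<^sup>+bs'. ?\<phi> (after d s h bs bs') \<partial>copies K h) \<partial>copies K h) +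
      (\<integral>\<^sup>+bs. iv (\<not> passed d s h bs) * ?new bs \<partial>copies K h)"
    by (rule arg_cong[where f = "\<lambda>x. x + _"]) (rule Cons.IH)
  also have "\<dots> = (\<integral>\<^sup>+bs. iv (passed d s h bs) * (\<integral>\<^sup>+bs'. ?\<phi> (after d s h bs bs') \<partial>copies K h)
      + iv (\<not> passed d s h bs) * ?new bs \<partial>copies K h)"
    by (rule nn_integral_add[symmetric]) auto
  also have "\<dots> = (\<integral>\<^sup>+bs. iv (passed d s (a # h) bs) *
      (\<integral>\<^sup>+bs'. \<phi> (after d s (a # h) bs bs') \<partial>copies K (a # h)) \<partial>copies K (a # h))"
    unfolding nn_integral_copies_Cons
    using dc by (intro nn_integral_cong) (simp add: after_not_passed)
  finally show ?case .
qed simp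

text \<open>One step of restarting the walk at its first passage above \<open>t\<close>.\<close>

lemma hoffmann_jorgensen:
  assumes d: "symmetric_steps d" and "0 < a" "0 < t"
    and jump: "\<And>l. N (d l) \<le> t"
    and prob: "(\<integral>\<^sup>+bs. iv (t < N (walk d h bs)) \<partial>copies K h) \<le> ennreal (1 / (8 * 8 powr a))"
  shows "(\<integral>\<^sup>+bs. ennreal (N (walk d h bs) powr a) \<partial>copies K h) \<le> ennreal (2 * (10 * t) powr a)"
proof -
  have dc: "range d \<subseteq> carrier V" using d by (simp add: symmetric_steps_def)
  \<comment> \<open>The inequality \<open>levy\<close> loses a factor 4 in the level; with this
    choice it returns exactly to the level \<open>t\<close> of the assumption
    \<open>prob\<close>.\<close>
  define s where "s = 4 * t"
  have "0 \<le> s" using \<open>0 < t\<close> by (simp add: s_def)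
  define X where "X = (\<integral>\<^sup>+bs. ennreal (N (walk d h bs) powr a) \<partial>copies K h)"
  have Xfin: "X < \<infinity>" unfolding X_def by (rule nn_integral_pmf_finite) (auto intro: finite_copies fin)
  have "(\<integral>\<^sup>+bs. iv (passed d s h bs) \<partial>copies K h) \<le> 2 * (\<integral>\<^sup>+bs. iv (t < N (walk d h bs)) \<partial>copies K h)"
    using levy[OF d \<open>0 \<le> s\<close>, of h] by (simp add: s_def)
  also have "\<dots> \<le> 2 * ennreal (1 / (8 * 8 powr a))" using prob by (intro mult_left_mono) auto
  finally have pass: "(\<integral>\<^sup>+bs. iv (passed d s h bs) \<partial>copies K h) \<le> ennreal (1 / (4 * 8 powr a))"
    by (simp add: ennreal_mult''[symmetric] flip: ennreal_numeral)
  \<comment> \<open>Up to and including the first passage the sum is at most \<open>s\<close> plus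
    one step, hence at most \<open>s + t\<close>.\<close>
  have before: "(\<not> passed d s h bs \<longrightarrow> masked_walk (\<lambda>h bs. \<not> passed d s h (tl bs)) d h bs = walk d h bs) \<and>
      N (masked_walk (\<lambda>h bs. \<not> passed d s h (tl bs)) d h bs) \<le> s + t" for bs
  proof (induction h arbitrary: bs)
    case (Cons a h)
    let ?m = "masked_walk (\<lambda>h bs. \<not> passed d s h (tl bs)) d"
    show ?case
    proof (cases "passed d s h (tl bs)")
      case True
      then show ?thesis using Cons[of "tl bs"] by (simp add: masked_walk_closed[OF dc])
    next
      case False
      have "N (walk d h (tl bs) \<oplus> d (hd bs # h)) \<le> N (walk d h (tl bs)) + N (d (hd bs # h))"
        by (intro N_add walk_closed step_closed dc)
      also have "\<dots> \<le> s + t" using not_passed[OF False \<open>0 \<le> s\<close>] jump[of "hd bs # h"] by simp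
      finally show ?thesis using Cons[of "tl bs"] False by simp
    qed
  qed (use \<open>0 \<le> s\<close> \<open>0 < t\<close> N_zero in auto)
  have point: "ennreal (N (walk d h bs) powr a) \<le> ennreal (2 powr a * (s + t) powr a) +
      ennreal (2 powr a) * (iv (passed d s h bs) * ennreal (N (after d s h bs bs) powr a))" for bs
  proof -
    let ?W = "masked_walk (\<lambda>h bs. \<not> passed d s h (tl bs)) d h bs" and ?Z = "after d s h bs bs"
    have cl: "?W \<in> carrier V" "?Z \<in> carrier V" using masked_walk_closed[OF dc] by (simp_all add: after_self)
    have "walk d h bs = ?Z \<oplus> ?W"
      using masked_walk_split[OF dc, of h bs "\<lambda>h bs. passed d s h (tl bs)"] by (simp add: after_self)
    then have "N (walk d h bs) \<le> N ?W + N ?Z" using N_add cl by (simp add: add.commute)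
    also have "\<dots> \<le> (s + t) + N ?Z" using before[of bs] by simp
    finally have "N (walk d h bs) powr a \<le> ((s + t) + N ?Z) powr a"
      using N_nonneg walk_closed[OF dc] \<open>0 < a\<close> by (intro powr_mono2) auto
    also have "\<dots> \<le> 2 powr a * ((s + t) powr a + N ?Z powr a)"
      using N_nonneg cl \<open>0 \<le> s\<close> \<open>0 < t\<close> \<open>0 < a\<close> by (intro powr_add_le) auto
    finally have "ennreal (N (walk d h bs) powr a) \<le> ennreal (2 powr a * (s + t) powr a + 2 powr a * N ?Z powr a)"
      by (intro ennreal_leI) (simp add: algebra_simps)
    also have "\<dots> = ennreal (2 powr a * (s + t) powr a) + ennreal (2 powr a) * ennreal (N ?Z powr a)"
      by (simp add: ennreal_plus ennreal_mult)
    also have "ennreal (N ?Z powr a) = iv (passed d s h bs) * ennreal (N ?Z powr a)"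
      using after_not_passed[OF dc] N_zero by auto
    finally show ?thesis .
  qed
  have "X \<le> (\<integral>\<^sup>+bs. ennreal (2 powr a * (s + t) powr a) +
      ennreal (2 powr a) * (iv (passed d s h bs) * ennreal (N (after d s h bs bs) powr a)) \<partial>copies K h)"
    unfolding X_def by (intro nn_integral_mono point)
  also have "\<dots> = ennreal (2 powr a * (s + t) powr a) +
      ennreal (2 powr a) * (\<integral>\<^sup>+bs. iv (passed d s h bs) * ennreal (N (after d s h bs bs) powr a) \<partial>copies K h)"
    by (subst nn_integral_add) (auto simp: nn_integral_cmult)
  also have "(\<integral>\<^sup>+bs. iv (passed d s h bs) * ennreal (N (after d s h bs bs) powr a) \<partial>copies K h) =
      (\<integral>\<^sup>+bs. iv (passed d s h bs) * (\<integral>\<^sup>+bs'. ennreal (N (after d s h bs bs') powr a) \<partial>copies K h) \<partial>copies K h)"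
    by (rule after_decouple[OF dc])
  also have "\<dots> \<le> (\<integral>\<^sup>+bs. iv (passed d s h bs) * (ennreal (2 * 4 powr a) * X) \<partial>copies K h)"
    unfolding X_def after_eq_masked
    by (intro nn_integral_mono mult_left_mono contraction_moment[OF d _ \<open>0 < a\<close>]) (auto simp: flip_invariant_def)
  also have "\<dots> = (\<integral>\<^sup>+bs. iv (passed d s h bs) \<partial>copies K h) * (ennreal (2 * 4 powr a) * X)"
    by (rule nn_integral_multc) auto
  also have "\<dots> \<le> ennreal (1 / (4 * 8 powr a)) * (ennreal (2 * 4 powr a) * X)"
    by (intro mult_right_mono pass) auto
  \<comment> \<open>Here the bound in \<open>prob\<close> is explained: \<open>powr_add_le\<close>
    costs \<open>2 powr a\<close>, the contraction \<open>2 * 4 powr a\<close> and the passage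
    probability is \<open>1 / (4 * 8 powr a)\<close>, which multiply to 1/2. The remaining level 2(s
    + t) is 10 t.\<close>
  also have "ennreal (2 powr a) * (ennreal (1 / (4 * 8 powr a)) * (ennreal (2 * 4 powr a) * X)) = ennreal (1 / 2) * X"
  proof -
    have "(8::real) powr a = 2 powr a * 4 powr a" by (simp flip: powr_mult)
    then have "2 powr a * (1 / (4 * 8 powr a) * (2 * 4 powr a)) = 1 / 2" by (simp add: field_simps)
    then show ?thesis by (subst ennreal_mult3) auto
  qed
  finally have "X \<le> ennreal (2 powr a * (s + t) powr a) + ennreal (1 / 2) * X"
    by (simp add: mult_left_mono)
  then have "X \<le> 2 * ennreal (2 powr a * (s + t) powr a)" by (rule ennreal_absorb) (use Xfin in auto)
  also have "2 powr a * (s + t) powr a = (10 * t) powr a" using \<open>0 < t\<close> by (simp add: s_def flip: powr_mult)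
  finally show ?thesis unfolding X_def by (simp add: ennreal_mult'')
qed

end

section \<open>Extrapolation on trees\<close>

lemma nn_integral_iv: "(\<integral>\<^sup>+x. iv (P x) \<partial>measure_pmf M) = ennreal (measure_pmf.prob M {x. P x})"
proof -
  have "(\<integral>\<^sup>+x. iv (P x) \<partial>measure_pmf M) = (\<integral>\<^sup>+x. indicator {x. P x} x \<partial>measure_pmf M)"
    by (intro nn_integral_cong) (simp add: indicator_def)
  then show ?thesis by (simp add: measure_pmf.emeasure_eq_measure)
qed

lemma prob_not: "measure_pmf.prob M {x. \<not> P x} = 1 - measure_pmf.prob M {x. P x}"
  using measure_pmf.prob_compl[of "{x. P x}" M] by (simp add: Collect_neg_eq Compl_eq_Diff_UNIV)

lemma layer_cake:
  fixes b x :: real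
  assumes "0 < b" "0 \<le> x"
  shows "(\<integral>\<^sup>+l. iv (l < x) * ennreal (if 0 < l then b * l powr (b - 1) else 0) \<partial>lborel) = ennreal (x powr b)"
proof -
  let ?f = "\<lambda>l. if l \<in> {0..x} then b * l powr (b - 1) else 0"
  have "((\<lambda>l. b * l powr (b - 1)) has_integral (x powr b)) {0..x}"
    using has_integral_mult_right[OF has_integral_powr_from_0[of "b - 1" x], of b] assms by simp
  then have "(?f has_integral (x powr b)) UNIV"
    by (simp only: has_integral_restrict_UNIV)
  then have "(\<integral>\<^sup>+l. ennreal (?f l) \<partial>lborel) = ennreal (x powr b)"
    using assms by (intro nn_integral_has_integral_lborel) auto
  moreover have "(\<integral>\<^sup>+l. iv (l < x) * ennreal (if 0 < l then b * l powr (b - 1) else 0) \<partial>lborel) =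
      (\<integral>\<^sup>+l. ennreal (?f l) \<partial>lborel)"
    using AE_lborel_singleton[of x] AE_lborel_singleton[of 0] by (intro nn_integral_cong_AE) auto
  ultimately show ?thesis by simp
qed

lemma borel_measurable_nn_integral_pmf_finite:
  assumes "finite (set_pmf M)" "\<And>x. f x \<in> borel_measurable L"
  shows "(\<lambda>l. \<integral>\<^sup>+x. f x l \<partial>measure_pmf M) \<in> borel_measurable L"
  using assms by (subst nn_integral_measure_pmf_finite) auto

lemma nn_integral_pmf_swap:
  assumes "finite (set_pmf M)" "\<And>x. f x \<in> borel_measurable L" "w \<in> borel_measurable L"
  shows "(\<integral>\<^sup>+l. (\<integral>\<^sup>+x. f x l \<partial>measure_pmf M) * w l \<partial>L) = (\<integral>\<^sup>+x. (\<integral>\<^sup>+l. f x l * w l \<partial>L) \<partial>measure_pmf M)"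
proof -
  have "(\<integral>\<^sup>+l. (\<integral>\<^sup>+x. f x l \<partial>measure_pmf M) * w l \<partial>L) =
      (\<integral>\<^sup>+l. (\<Sum>x\<in>set_pmf M. (f x l * w l) * ennreal (pmf M x)) \<partial>L)"
    using assms(1) by (simp add: nn_integral_measure_pmf_finite sum_distrib_right sum_distrib_left mult_ac)
  also have "\<dots> = (\<Sum>x\<in>set_pmf M. \<integral>\<^sup>+l. (f x l * w l) * ennreal (pmf M x) \<partial>L)"
    using assms by (intro nn_integral_sum) auto
  also have "\<dots> = (\<Sum>x\<in>set_pmf M. (\<integral>\<^sup>+l. f x l * w l \<partial>L) * ennreal (pmf M x))"
    using assms by (intro sum.cong refl nn_integral_multc) auto
  also have "\<dots> = (\<integral>\<^sup>+x. (\<integral>\<^sup>+l. f x l * w l \<partial>L) \<partial>measure_pmf M)"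
    using assms(1) by (simp add: nn_integral_measure_pmf_finite)
  finally show ?thesis .
qed

section \<open>Large steps of the process and of its copies\<close>

context f_normed_double
begin

lemma passed_mono: "passed d s' h bs \<Longrightarrow> s \<le> s' \<Longrightarrow> passed d s h bs"
  by (induction h arbitrary: bs) auto

text \<open>Let \<open>Q\<close> be the conditional probability, given the path, that no copy jumps;
  it decreases along the path by the factors \<open>1 - p\<close>. As long as \<open>Q\<close> stays
  at least 1/2, the chance \<open>p\<close> of a jump is at most twice the decrease of
  \<open>Q\<close>, and these decreases telescope to 1 - Q. Once \<open>Q\<close> is below 1/2, the
  copies jump with probability more than 1/2 anyway. Each case contributes a factor 2.\<close>

lemma process_jumped_le:
  fixes K :: "'c list \<Rightarrow> 'c pmf"
  shows "(\<integral>\<^sup>+h. iv (jumped d s h h) \<partial>paths K n) \<le>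
    4 * (\<integral>\<^sup>+h. \<integral>\<^sup>+bs. iv (jumped d s h bs) \<partial>copies K h \<partial>paths K n)"
proof -
  define Q where "Q = (\<lambda>h. measure_pmf.prob (copies K h) {bs. \<not> jumped d s h bs})"
  define p where "p = (\<lambda>h. measure_pmf.prob (K h) {b. s < N (d (b # h))})"
  have Q01: "0 \<le> Q h" "Q h \<le> 1" for h by (auto simp: Q_def)
  have p01: "0 \<le> p h" "p h \<le> 1" for h by (auto simp: p_def)
  have QCons: "Q (a # h) = Q h * (1 - p h)" for a h
  proof -
    have "ennreal (Q (a # h)) = (\<integral>\<^sup>+bs. iv (\<not> jumped d s (a # h) bs) \<partial>copies K (a # h))"
      by (simp add: Q_def nn_integral_iv del: copies.simps)
    also have "\<dots> = (\<integral>\<^sup>+bs. iv (\<not> jumped d s h bs) * (\<integral>\<^sup>+b. iv (\<not> s < N (d (b # h))) \<partial>K h) \<partial>copies K h)"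
      unfolding nn_integral_copies_Cons by (intro nn_integral_cong) auto
    also have "\<dots> = (\<integral>\<^sup>+bs. iv (\<not> jumped d s h bs) \<partial>copies K h) * (\<integral>\<^sup>+b. iv (\<not> s < N (d (b # h))) \<partial>K h)"
      by (rule nn_integral_multc) auto
    also have "\<dots> = ennreal (Q h) * ennreal (1 - p h)"
      unfolding nn_integral_iv prob_not[of _ "\<lambda>b. s < N (d (b # h))"] by (simp add: Q_def p_def)
    also have "\<dots> = ennreal (Q h * (1 - p h))" using Q01 by (simp add: ennreal_mult')
    finally show ?thesis using Q01 p01 by (simp add: mult_nonneg_nonneg)
  qed
  \<comment> \<open>\<open>Q (a # h)\<close> does not depend on \<open>a\<close>, so the restriction
    to \<open>1 / 2 \<le> Q\<close> is known before the step is taken.\<close>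
  have main: "(\<integral>\<^sup>+h. iv (jumped d s h h \<and> 1 / 2 \<le> Q h) \<partial>paths K n) \<le> (\<integral>\<^sup>+h. ennreal (2 * (1 - Q h)) \<partial>paths K n)"
  proof (induction n)
    case (Suc n)
    have "(\<integral>\<^sup>+a. iv (jumped d s (a # h) (a # h) \<and> 1 / 2 \<le> Q (a # h)) \<partial>K h) \<le>
        iv (jumped d s h h \<and> 1 / 2 \<le> Q h) + ennreal (2 * (Q h - Q h * (1 - p h)))" for h
    proof (cases "1 / 2 \<le> Q h * (1 - p h)")
      case True
      have "Q h * (1 - p h) \<le> Q h" using Q01 p01 mult_left_le[of "1 - p h" "Q h"] by simp
      then have half: "1 / 2 \<le> Q h" using True by linarith
      have "(\<integral>\<^sup>+a. iv (jumped d s (a # h) (a # h) \<and> 1 / 2 \<le> Q (a # h)) \<partial>K h) \<le>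
          (\<integral>\<^sup>+a. iv (jumped d s h h) + iv (s < N (d (a # h))) \<partial>K h)"
        by (intro nn_integral_mono) auto
      also have "\<dots> = iv (jumped d s h h) + ennreal (p h)"
        by (subst nn_integral_add) (auto simp: nn_integral_iv p_def)
      also have "p h \<le> 2 * (Q h - Q h * (1 - p h))"
        using mult_right_mono[OF half p01(1)[of h]] by (simp add: algebra_simps)
      finally show ?thesis using half by (simp add: add_left_mono ennreal_leI order_trans)
    qed (simp add: QCons)
    then have "(\<integral>\<^sup>+h. iv (jumped d s h h \<and> 1 / 2 \<le> Q h) \<partial>paths K (Suc n)) \<le>
        (\<integral>\<^sup>+h. iv (jumped d s h h \<and> 1 / 2 \<le> Q h) + ennreal (2 * (Q h - Q h * (1 - p h))) \<partial>paths K n)"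
      unfolding nn_integral_paths_Suc by (intro nn_integral_mono)
    also have "\<dots> = (\<integral>\<^sup>+h. iv (jumped d s h h \<and> 1 / 2 \<le> Q h) \<partial>paths K n) +
        (\<integral>\<^sup>+h. ennreal (2 * (Q h - Q h * (1 - p h))) \<partial>paths K n)"
      by (rule nn_integral_add) auto
    also have "\<dots> \<le> (\<integral>\<^sup>+h. ennreal (2 * (1 - Q h)) \<partial>paths K n) +
        (\<integral>\<^sup>+h. ennreal (2 * (Q h - Q h * (1 - p h))) \<partial>paths K n)"
      using Suc by (rule add_right_mono)
    also have "\<dots> = (\<integral>\<^sup>+h. ennreal (2 * (1 - Q h)) + ennreal (2 * (Q h - Q h * (1 - p h))) \<partial>paths K n)"
      by (rule nn_integral_add[symmetric]) auto
    also have "\<dots> = (\<integral>\<^sup>+h. ennreal (2 * (1 - Q h * (1 - p h))) \<partial>paths K n)"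
    proof (intro nn_integral_cong)
      fix h
      have "0 \<le> Q h - Q h * (1 - p h)" using Q01 p01 mult_left_le[of "1 - p h" "Q h"] by simp
      then have "ennreal (2 * (1 - Q h)) + ennreal (2 * (Q h - Q h * (1 - p h))) =
          ennreal (2 * (1 - Q h) + 2 * (Q h - Q h * (1 - p h)))"
        using Q01[of h] by (intro ennreal_plus[symmetric]) auto
      then show "ennreal (2 * (1 - Q h)) + ennreal (2 * (Q h - Q h * (1 - p h))) = ennreal (2 * (1 - Q h * (1 - p h)))"
        by (simp add: algebra_simps)
    qed
    also have "\<dots> = (\<integral>\<^sup>+h. ennreal (2 * (1 - Q h)) \<partial>paths K (Suc n))"
      unfolding nn_integral_paths_Suc QCons by simp
    finally show ?case .
  qed simp
  have "(\<integral>\<^sup>+h. iv (jumped d s h h) \<partial>paths K n) \<le>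
      (\<integral>\<^sup>+h. iv (jumped d s h h \<and> 1 / 2 \<le> Q h) + ennreal (2 * (1 - Q h)) \<partial>paths K n)"
  proof (intro nn_integral_mono)
    fix h
    have "(1::ennreal) \<le> ennreal (2 * (1 - Q h))" if "Q h < 1 / 2"
      using that by (simp flip: ennreal_1 add: ennreal_leI)
    then show "iv (jumped d s h h) \<le> iv (jumped d s h h \<and> 1 / 2 \<le> Q h) + ennreal (2 * (1 - Q h))"
      by (auto simp: not_le)
  qed
  also have "\<dots> = (\<integral>\<^sup>+h. iv (jumped d s h h \<and> 1 / 2 \<le> Q h) \<partial>paths K n) + (\<integral>\<^sup>+h. ennreal (2 * (1 - Q h)) \<partial>paths K n)"
    by (rule nn_integral_add) auto
  also have "\<dots> \<le> (\<integral>\<^sup>+h. ennreal (2 * (1 - Q h)) \<partial>paths K n) + (\<integral>\<^sup>+h. ennreal (2 * (1 - Q h)) \<partial>paths K n)"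
    using main by (rule add_right_mono)
  also have "\<dots> = 2 * (\<integral>\<^sup>+h. ennreal (2 * (1 - Q h)) \<partial>paths K n)" by (rule mult_2[symmetric])
  also have "(\<integral>\<^sup>+h. ennreal (2 * (1 - Q h)) \<partial>paths K n) = (\<integral>\<^sup>+h. 2 * ennreal (1 - Q h) \<partial>paths K n)"
    by (subst ennreal_mult') auto
  also have "\<dots> = 2 * (\<integral>\<^sup>+h. ennreal (1 - Q h) \<partial>paths K n)"
    by (rule nn_integral_cmult) simp
  also have "(\<integral>\<^sup>+h. ennreal (1 - Q h) \<partial>paths K n) = (\<integral>\<^sup>+h. \<integral>\<^sup>+bs. iv (jumped d s h bs) \<partial>copies K h \<partial>paths K n)"
    by (simp add: nn_integral_iv Q_def prob_not)
  also have "2 * (2 * (\<integral>\<^sup>+h. \<integral>\<^sup>+bs. iv (jumped d s h bs) \<partial>copies K h \<partial>paths K n)) =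
      4 * (\<integral>\<^sup>+h. \<integral>\<^sup>+bs. iv (jumped d s h bs) \<partial>copies K h \<partial>paths K n)"
    by (simp add: mult.assoc[symmetric])
  finally show ?thesis .
qed

end

section \<open>The good-\<lambda> inequality for symmetric steps\<close>

context symmetric_tree
begin

text \<open>
  The event in \<open>likely_small d t \<eta> h\<close> concerns the decoupled sum up to the letter that follows \<open>h\<close>,
  and does not depend on that letter.
\<close>

definition likely_small :: "('c list \<Rightarrow> 'a) \<Rightarrow> real \<Rightarrow> ennreal \<Rightarrow> 'c list \<Rightarrow> bool" where
  "likely_small d t \<eta> h \<longleftrightarrow> (\<integral>\<^sup>+bs. iv (t < N (walk d (undefined # h) bs)) \<partial>copies K (undefined # h)) \<le> \<eta>"

primrec always_likely_small :: "('c list \<Rightarrow> 'a) \<Rightarrow> real \<Rightarrow> ennreal \<Rightarrow> 'c list \<Rightarrow> bool" where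
  "always_likely_small d t \<eta> [] = True"
| "always_likely_small d t \<eta> (a # h) = (always_likely_small d t \<eta> h \<and> likely_small d t \<eta> h)"

text \<open>These are the steps taken after the first passage above \<open>s\<close>, up to and
  including the one that passes \<open>3 * s\<close>. All conditions but the one on the size of the
  step depend only on the history, and that one ignores signs, so the steps remain symmetric and the
  decoupled sum is masked in the same way.\<close>

definition excursion :: "('c list \<Rightarrow> 'a) \<Rightarrow> real \<Rightarrow> real \<Rightarrow> ennreal \<Rightarrow> 'c list \<Rightarrow> 'a" where
  "excursion d s t \<eta> = (\<lambda>l. if passed d s (tl l) (tl l) \<and> \<not> passed d (3 * s) (tl l) (tl l) \<and>
     likely_small d t \<eta> (tl l) \<and> N (d l) \<le> t then d l else \<zero>)"

lemma excursion_symmetric: "symmetric_steps d \<Longrightarrow> symmetric_steps (excursion d s t \<eta>)"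
  unfolding symmetric_steps_def excursion_def by (auto simp: N_minus image_subset_iff inv_zero)

text \<open>It suffices to look at the last time at which a step can be active. There the decoupled
  excursion is a masked part of a decoupled sum that is likely small, so the contraction principle
  and \<open>hoffmann_jorgensen\<close> apply at the level \<open>4 * t\<close>; twice
  \<open>\<eta>\<close> is just the probability allowed there. If no step is ever active, the moment
  is zero, which yields the factor on the right.\<close>

lemma excursion_moment:
  assumes d: "symmetric_steps d" and "0 < a" "0 < t" and \<eta>: "\<eta> = ennreal (1 / (16 * 8 powr a))"
  shows "(\<integral>\<^sup>+bs. ennreal (N (walk (excursion d s t \<eta>) h bs) powr a) \<partial>copies K h) \<le>
    ennreal (2 * (40 * t) powr a) * iv (passed d s h h)"
proof (induction h)
  case (Cons x h)
  let ?d = "excursion d s t \<eta>"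
  have dc: "range d \<subseteq> carrier V" using d by (simp add: symmetric_steps_def)
  have d'c: "range ?d \<subseteq> carrier V" using excursion_symmetric[OF d] by (simp add: symmetric_steps_def)
  \<comment> \<open>If the condition fails, the newest step vanishes whatever copy is drawn, and the
    bound is inherited from \<open>h\<close>.\<close>
  show ?case
  proof (cases "passed d s h h \<and> likely_small d t \<eta> h")
    case True
    have "(\<integral>\<^sup>+bs. iv (4 * t < N (walk ?d (x # h) bs)) \<partial>copies K (x # h)) \<le>
      2 * (\<integral>\<^sup>+bs. iv (4 * t < 4 * N (walk d (x # h) bs)) \<partial>copies K (x # h))"
      unfolding excursion_def walk_eq_masked[OF dc]
      by (rule contraction_prob[OF d])
        (use d in \<open>auto simp: flip_invariant_def symmetric_steps_def N_minus step_closed[OF dc]\<close>)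
    also have "\<dots> = 2 * (\<integral>\<^sup>+bs. iv (t < N (walk d (undefined # h) bs)) \<partial>copies K (undefined # h))"
      by simp
    also have "\<dots> \<le> 2 * \<eta>" using True by (intro mult_left_mono) (auto simp: likely_small_def)
    also have "\<dots> = ennreal (1 / (8 * 8 powr a))"
      unfolding \<eta> by (simp add: ennreal_mult''[symmetric] flip: ennreal_numeral)
    finally have "(\<integral>\<^sup>+bs. ennreal (N (walk ?d (x # h) bs) powr a) \<partial>copies K (x # h)) \<le> ennreal (2 * (10 * (4 * t)) powr a)"
      using \<open>0 < t\<close> \<open>0 < a\<close> N_zero
      by (intro hoffmann_jorgensen[OF excursion_symmetric[OF d]]) (auto simp: excursion_def)
    then show ?thesis using True by (simp del: copies.simps walk.simps)
  next
    case False
    have "(\<integral>\<^sup>+bs. ennreal (N (walk ?d (x # h) bs) powr a) \<partial>copies K (x # h)) =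
        (\<integral>\<^sup>+bs. ennreal (N (walk ?d h bs) powr a) \<partial>copies K h)"
    proof -
      have "walk ?d (x # h) bs = walk ?d h (tl bs)" for bs
      proof -
        have "?d (hd bs # h) = \<zero>" using False by (auto simp: excursion_def)
        then show ?thesis using walk_closed[OF d'c] by simp
      qed
      then show ?thesis
        using nn_integral_copies_tl[where K = K and a = x and h = h and
            f = "\<lambda>bs. ennreal (N (walk ?d h bs) powr a)"] by (simp only:)
    qed
    also have "\<dots> \<le> ennreal (2 * (40 * t) powr a) * iv (passed d s h h)" by (rule Cons)
    also have "\<dots> \<le> ennreal (2 * (40 * t) powr a) * iv (passed d s (x # h) (x # h))"
      by (intro mult_left_mono) auto
    finally show ?thesis .
  qed
qed (use N_zero \<open>0 < a\<close> in simp)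

text \<open>The walk enters the excursion with a value of at most \<open>s + t\<close>, overshoot
  included. During the excursion the walk and its excursion take the same steps, so their difference
  stays at that value. When the walk exceeds \<open>3 * s\<close>, the excursion must exceed
  \<open>3 * s - (s + t)\<close>, which is at least \<open>s\<close>, and it is frozen from then
  on.\<close>

lemma excursion_large:
  assumes d: "symmetric_steps d" and "0 \<le> s" "t \<le> s"
  shows "\<not> jumped d t h h \<Longrightarrow> always_likely_small d t \<eta> h \<Longrightarrow>
    (\<not> passed d s h h \<longrightarrow> walk (excursion d s t \<eta>) h h = \<zero>) \<and>
    (passed d s h h \<and> \<not> passed d (3 * s) h h \<longrightarrow> N (walk d h h \<ominus> walk (excursion d s t \<eta>) h h) \<le> s + t) \<and>
    (passed d (3 * s) h h \<longrightarrow> s < N (walk (excursion d s t \<eta>) h h))"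
proof (induction h)
  case (Cons x h)
  let ?e = "excursion d s t \<eta>"
  have dc: "range d \<subseteq> carrier V" using d by (simp add: symmetric_steps_def)
  have ec: "range ?e \<subseteq> carrier V" using excursion_symmetric[OF d] by (simp add: symmetric_steps_def)
  define f where "f = walk d h h"
  define g where "g = walk ?e h h"
  define y where "y = d (x # h)"
  have cl: "f \<in> carrier V" "g \<in> carrier V" "y \<in> carrier V"
    using walk_closed[OF dc] walk_closed[OF ec] step_closed[OF dc] by (auto simp: f_def g_def y_def)
  have y: "N y \<le> t" and good: "likely_small d t \<eta> h" using Cons.prems by (auto simp: y_def)
  have IH: "\<not> passed d s h h \<Longrightarrow> g = \<zero>"
      "passed d s h h \<Longrightarrow> \<not> passed d (3 * s) h h \<Longrightarrow> N (f \<ominus> g) \<le> s + t"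
      "passed d (3 * s) h h \<Longrightarrow> s < N g"
    using Cons by (auto simp: f_def g_def)
  have walk_d: "walk d (x # h) (x # h) = f \<oplus> y" by (simp add: f_def y_def)
  have passed_eq: "passed d u (x # h) (x # h) \<longleftrightarrow> passed d u h h \<or> u < N (f \<oplus> y)" for u by (simp add: f_def y_def)
  have walk_e: "walk ?e (x # h) (x # h) = g \<oplus> (if passed d s h h \<and> \<not> passed d (3 * s) h h then y else \<zero>)"
    using good y by (simp add: g_def y_def excursion_def)
  consider "\<not> passed d s h h" | "passed d s h h" "\<not> passed d (3 * s) h h" | "passed d (3 * s) h h" by blast
  then show ?case
  proof cases
    case 1
    then have n3: "\<not> passed d (3 * s) h h" using passed_mono[of d "3 * s" h h s] \<open>0 \<le> s\<close> by auto
    have "N (f \<oplus> y) \<le> N f + N y" using cl by (intro N_add)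
    also have "\<dots> \<le> s + t" using not_passed[OF 1 \<open>0 \<le> s\<close>] y by (simp add: f_def)
    finally have small: "N (f \<oplus> y) \<le> s + t" .
    then have "\<not> passed d (3 * s) (x # h) (x # h)" unfolding passed_eq using n3 \<open>0 \<le> s\<close> \<open>t \<le> s\<close> by simp
    then show ?thesis unfolding walk_e walk_d using 1 IH(1) small cl by (simp add: minus_zero_right)
  next
    case 2
    have eq: "(f \<oplus> y) \<ominus> (g \<oplus> y) = f \<ominus> g" using cl by (simp add: add_minus_add minus_self)
    have ps: "passed d s (x # h) (x # h)" using 2 by simp
    have "N (f \<oplus> y) \<le> N (f \<ominus> g) + N (g \<oplus> y)"
      using N_le_add_diff[of "f \<oplus> y" "g \<oplus> y"] cl eq by simp
    then have "N (f \<oplus> y) \<le> s + t + N (g \<oplus> y)" using IH(2)[OF 2] by simp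
    then have "s < N (g \<oplus> y)" if "3 * s < N (f \<oplus> y)" using that \<open>t \<le> s\<close> by linarith
    then show ?thesis unfolding walk_e walk_d passed_eq[of "3 * s"] using ps 2 IH(2) eq by auto
  next
    case 3
    then have "passed d s h h" using passed_mono[of d "3 * s" h h s] \<open>0 \<le> s\<close> by auto
    then show ?thesis unfolding walk_e using 3 IH(3) cl by simp
  qed
qed (use \<open>0 \<le> s\<close> in simp)

text \<open>If the bound fails at some time, then the decoupled sum truncated at that time is large
  with probability more than \<open>\<eta>\<close>. Truncation at a time depending on the path alone
  is a flip invariant mask, so the full decoupled sum is large too.\<close>

lemma not_always_likely_small:
  assumes d: "symmetric_steps d"
  shows "\<not> always_likely_small d t \<eta> h \<Longrightarrow> \<eta> \<le> 2 * (\<integral>\<^sup>+bs. iv (t < 4 * N (walk d h bs)) \<partial>copies K h)"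
proof -
  have dc: "range d \<subseteq> carrier V" using d by (simp add: symmetric_steps_def)
  have "\<not> always_likely_small d t \<eta> h \<Longrightarrow> \<exists>m\<le>length h.
      \<eta> < (\<integral>\<^sup>+bs. iv (t < N (masked_walk (\<lambda>h' _. length h' < m) d h bs)) \<partial>copies K h)"
  proof (induction h)
    case (Cons x h)
    show ?case
    proof (cases "always_likely_small d t \<eta> h")
      case True
      have "masked_walk (\<lambda>h' _. length h' < Suc (length h)) d (x # h) bs = walk d (undefined # h) bs" for bs
      proof -
        have "masked_walk (\<lambda>h' _. length h' < Suc (length h)) d (x # h) bs = masked_walk (\<lambda>_ _. True) d (x # h) bs"
          by (rule masked_walk_cong) auto
        then show ?thesis by (simp add: masked_walk_True)
      qed
      moreover have "copies K (x # h) = copies K (undefined # h)" by simp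
      moreover have "\<not> likely_small d t \<eta> h" using Cons.prems True by simp
      ultimately show ?thesis unfolding likely_small_def not_le
        by (intro exI[of _ "Suc (length h)"]) (simp del: copies.simps masked_walk.simps walk.simps)
    next
      case False
      then obtain m where m: "m \<le> length h"
        "\<eta> < (\<integral>\<^sup>+bs. iv (t < N (masked_walk (\<lambda>h' _. length h' < m) d h bs)) \<partial>copies K h)"
        using Cons.IH by blast
      have "masked_walk (\<lambda>h' _. length h' < m) d (x # h) bs = masked_walk (\<lambda>h' _. length h' < m) d h (tl bs)" for bs
        using m(1) masked_walk_closed[OF dc] by simp
      then have "\<eta> < (\<integral>\<^sup>+bs. iv (t < N (masked_walk (\<lambda>h' _. length h' < m) d (x # h) bs)) \<partial>copies K (x # h))"
        using m(2) nn_integral_copies_tl[where K = K and a = x and h = h and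
            f = "\<lambda>bs. iv (t < N (masked_walk (\<lambda>h' _. length h' < m) d h bs))"] by (simp only:)
      then show ?thesis using m(1) by (intro exI[of _ m]) simp
    qed
  qed simp
  moreover assume "\<not> always_likely_small d t \<eta> h"
  ultimately obtain m where
    m: "\<eta> < (\<integral>\<^sup>+bs. iv (t < N (masked_walk (\<lambda>h' _. length h' < m) d h bs)) \<partial>copies K h)" by blast
  show ?thesis
    by (rule order_trans[OF less_imp_le[OF m] contraction_prob[OF d]]) (simp add: flip_invariant_def)
qed

text \<open>A walk above \<open>3 * s\<close> has a large step, or a decoupled sum that fails to be
  likely small, or an excursion above \<open>s\<close>. The factor 8 comes from
  \<open>process_jumped_le\<close> and \<open>jumped_le\<close>, the factor
  \<open>32 * 8 powr a\<close> is 2 divided by \<open>\<eta>\<close>, and the excursion is treated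
  by Markov's inequality, the assumed inequality with exponent \<open>a\<close> and
  \<open>excursion_moment\<close>.\<close>

lemma good_lambda:
  assumes d: "symmetric_steps d" and a: "0 < a" and s: "0 < s" and \<delta>: "0 < \<delta>" "\<delta> \<le> 1" and "0 \<le> D"
    and tree: "\<And>d'. symmetric_steps d' \<Longrightarrow> process_moment K d' n a \<le> ennreal D * decoupled_moment K d' n a"
  shows "(\<integral>\<^sup>+h. iv (passed d (3 * s) h h) \<partial>paths K n) \<le>
    ennreal (D * (2 * (40 * \<delta>) powr a)) * (\<integral>\<^sup>+h. iv (passed d s h h) \<partial>paths K n) +
    ennreal (8 + 32 * 8 powr a) * (\<integral>\<^sup>+h. \<integral>\<^sup>+bs. iv (\<delta> * s < 4 * N (walk d h bs)) \<partial>copies K h \<partial>paths K n)"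
proof -
  define t where "t = \<delta> * s"
  have t: "0 < t" "t \<le> s" using s \<delta> by (auto simp: t_def mult_le_cancel_right1)
  define \<eta> where "\<eta> = ennreal (1 / (16 * 8 powr a))"
  let ?e = "excursion d s t \<eta>"
  let ?R = "\<integral>\<^sup>+h. \<integral>\<^sup>+bs. iv (t < 4 * N (walk d h bs)) \<partial>copies K h \<partial>paths K n"
  have dc: "range d \<subseteq> carrier V" using d by (simp add: symmetric_steps_def)
  have ec: "range ?e \<subseteq> carrier V" using excursion_symmetric[OF d] by (simp add: symmetric_steps_def)
  have "iv (passed d (3 * s) h h) \<le> iv (jumped d t h h) + iv (\<not> always_likely_small d t \<eta> h) +
      ennreal (s powr - a) * ennreal (N (walk ?e h h) powr a)" for h
  proof (cases "jumped d t h h \<or> \<not> always_likely_small d t \<eta> h \<or> \<not> passed d (3 * s) h h")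
    case False
    then have "s < N (walk ?e h h)" using excursion_large[OF d less_imp_le[OF s] t(2), of h \<eta>] by blast
    then have "s powr a \<le> N (walk ?e h h) powr a" using s a by (intro powr_mono2) auto
    then have "1 \<le> s powr - a * N (walk ?e h h) powr a" using s by (simp add: powr_minus field_simps)
    then have "ennreal 1 \<le> ennreal (s powr - a * N (walk ?e h h) powr a)" by (rule ennreal_leI)
    then show ?thesis using False by (simp add: ennreal_mult')
  qed auto
  then have "(\<integral>\<^sup>+h. iv (passed d (3 * s) h h) \<partial>paths K n) \<le>
    (\<integral>\<^sup>+h. iv (jumped d t h h) + iv (\<not> always_likely_small d t \<eta> h) +
      ennreal (s powr - a) * ennreal (N (walk ?e h h) powr a) \<partial>paths K n)"
    by (intro nn_integral_mono)
  also have "\<dots> = (\<integral>\<^sup>+h. iv (jumped d t h h) \<partial>paths K n) + (\<integral>\<^sup>+h. iv (\<not> always_likely_small d t \<eta> h) \<partial>paths K n) +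
      ennreal (s powr - a) * process_moment K ?e n a"
    unfolding process_moment_def by (simp add: nn_integral_add nn_integral_cmult)
  also have "\<dots> \<le> 8 * ?R + ennreal (32 * 8 powr a) * ?R +
      ennreal (D * (2 * (40 * \<delta>) powr a)) * (\<integral>\<^sup>+h. iv (passed d s h h) \<partial>paths K n)"
  proof (intro add_mono)
    have "(\<integral>\<^sup>+h. iv (jumped d t h h) \<partial>paths K n) \<le> 4 * (\<integral>\<^sup>+h. \<integral>\<^sup>+bs. iv (jumped d t h bs) \<partial>copies K h \<partial>paths K n)"
      by (rule process_jumped_le)
    also have "\<dots> \<le> 4 * (\<integral>\<^sup>+h. 2 * (\<integral>\<^sup>+bs. iv (t < 4 * N (walk d h bs)) \<partial>copies K h) \<partial>paths K n)"
      using t by (intro mult_left_mono nn_integral_mono jumped_le[OF d]) auto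
    also have "\<dots> = 8 * ?R" by (simp add: nn_integral_cmult flip: mult.assoc)
    finally show "(\<integral>\<^sup>+h. iv (jumped d t h h) \<partial>paths K n) \<le> 8 * ?R" .
    have "iv (\<not> always_likely_small d t \<eta> h) \<le>
        ennreal (32 * 8 powr a) * (\<integral>\<^sup>+bs. iv (t < 4 * N (walk d h bs)) \<partial>copies K h)" for h
    proof (cases "always_likely_small d t \<eta> h")
      case False
      have "1 = ennreal (16 * 8 powr a) * \<eta>" unfolding \<eta>_def by (simp add: ennreal_mult''[symmetric])
      also have "\<dots> \<le> ennreal (16 * 8 powr a) * (2 * (\<integral>\<^sup>+bs. iv (t < 4 * N (walk d h bs)) \<partial>copies K h))"
        using not_always_likely_small[OF d False] by (rule mult_left_mono) simp
      also have "\<dots> = ennreal (32 * 8 powr a) * (\<integral>\<^sup>+bs. iv (t < 4 * N (walk d h bs)) \<partial>copies K h)"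
        by (simp add: ennreal_mult' mult.assoc flip: ennreal_numeral) (simp add: mult.left_commute flip: mult.assoc)
      finally show ?thesis using False by simp
    qed simp
    then have "(\<integral>\<^sup>+h. iv (\<not> always_likely_small d t \<eta> h) \<partial>paths K n) \<le>
        (\<integral>\<^sup>+h. ennreal (32 * 8 powr a) * (\<integral>\<^sup>+bs. iv (t < 4 * N (walk d h bs)) \<partial>copies K h) \<partial>paths K n)"
      by (intro nn_integral_mono)
    then show "(\<integral>\<^sup>+h. iv (\<not> always_likely_small d t \<eta> h) \<partial>paths K n) \<le> ennreal (32 * 8 powr a) * ?R"
      by (simp add: nn_integral_cmult)
    have "decoupled_moment K ?e n a \<le> (\<integral>\<^sup>+h. ennreal (2 * (40 * t) powr a) * iv (passed d s h h) \<partial>paths K n)"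
      unfolding decoupled_moment_def by (intro nn_integral_mono excursion_moment[OF d a t(1) \<eta>_def])
    also have "\<dots> = ennreal (2 * (40 * t) powr a) * (\<integral>\<^sup>+h. iv (passed d s h h) \<partial>paths K n)"
      by (rule nn_integral_cmult) auto
    finally have "process_moment K ?e n a \<le> ennreal D * (ennreal (2 * (40 * t) powr a) * (\<integral>\<^sup>+h. iv (passed d s h h) \<partial>paths K n))"
      by (meson order_trans tree[OF excursion_symmetric[OF d]] mult_left_mono zero_le)
    then have "ennreal (s powr - a) * process_moment K ?e n a \<le>
        ennreal (s powr - a) * (ennreal D * (ennreal (2 * (40 * t) powr a) * (\<integral>\<^sup>+h. iv (passed d s h h) \<partial>paths K n)))"
      by (rule mult_left_mono) simp
    also have "\<dots> = ennreal (s powr - a * (D * (2 * (40 * t) powr a))) * (\<integral>\<^sup>+h. iv (passed d s h h) \<partial>paths K n)"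
      using \<open>0 \<le> D\<close> by (simp add: ennreal_mult' mult.assoc)
    also have "s powr - a * (D * (2 * (40 * t) powr a)) = D * (2 * (40 * \<delta>) powr a)"
      using s \<delta> by (simp add: t_def powr_mult powr_minus field_simps)
    finally show "ennreal (s powr - a) * process_moment K ?e n a \<le>
      ennreal (D * (2 * (40 * \<delta>) powr a)) * (\<integral>\<^sup>+h. iv (passed d s h h) \<partial>paths K n)" .
  qed
  also have "8 * ?R + ennreal (32 * 8 powr a) * ?R = ennreal (8 + 32 * 8 powr a) * ?R"
    by (simp add: ennreal_plus distrib_right)
  finally show ?thesis by (simp add: t_def add.commute)
qed

primrec running_max :: "('c list \<Rightarrow> 'a) \<Rightarrow> 'c list \<Rightarrow> real" where
  "running_max d [] = 0"
| "running_max d (a # h) = max (running_max d h) (N (walk d (a # h) (a # h)))"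

lemma running_max_nonneg: "0 \<le> running_max d h"
  by (induction h) auto

lemma passed_iff_running_max: "0 \<le> s \<Longrightarrow> passed d s h h \<longleftrightarrow> s < running_max d h"
  by (induction h) auto

lemma N_walk_le_running_max: "N (walk d h h) \<le> running_max d h"
  by (cases h) (auto simp: N_zero)

text \<open>Integrating the good-\<open>\<lambda>\<close> inequality against \<open>b \<lambda>\<^sup>b\<^sup>-\<^sup>1\<close>, with \<open>\<delta>\<close> so small that the first term is absorbed.\<close>

lemma symmetric_extrapolation:
  assumes d: "symmetric_steps d" and a: "0 < a" and b: "0 < b" and \<delta>: "0 < \<delta>" "\<delta> \<le> 1" and "0 \<le> D"
    and small: "3 powr b * (D * (2 * (40 * \<delta>) powr a)) \<le> 1 / 2"
    and tree: "\<And>d'. symmetric_steps d' \<Longrightarrow> process_moment K d' n a \<le> ennreal D * decoupled_moment K d' n a"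
  shows "process_moment K d n b \<le> ennreal (2 * (3 powr b * (8 + 32 * 8 powr a) * (4 / \<delta>) powr b)) * decoupled_moment K d n b"
proof -
  define w where "w = (\<lambda>l. ennreal (if 0 < l then b * l powr (b - 1) else 0))"
  have [measurable]: "w \<in> borel_measurable lborel" by (simp add: w_def)
  \<comment> \<open>Both sides of the good-\<lambda> inequality involve passage events, so the
    quantity that can be absorbed is the moment of the running maximum, not that of the final
    value.\<close>
  define X where "X = (\<integral>\<^sup>+h. ennreal (running_max d h powr b) \<partial>paths K n)"
  define e where "e = D * (2 * (40 * \<delta>) powr a)"
  define c where "c = 8 + 32 * 8 powr a"
  have "0 \<le> e" "0 \<le> c" using \<open>0 \<le> D\<close> by (auto simp: e_def c_def)
  have dc: "range d \<subseteq> carrier V" using d by (simp add: symmetric_steps_def)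
  have fp: "finite (set_pmf (paths K n))" and fc: "\<And>h. finite (set_pmf (copies K h))"
    using finite_paths finite_copies fin by blast+
  define A where "A = (\<lambda>l. \<integral>\<^sup>+h. iv (3 * l < running_max d h) \<partial>paths K n)"
  define B where "B = (\<lambda>l. \<integral>\<^sup>+h. iv (l < running_max d h) \<partial>paths K n)"
  define C where "C = (\<lambda>l. \<integral>\<^sup>+h. \<integral>\<^sup>+bs. iv (\<delta> * l < 4 * N (walk d h bs)) \<partial>copies K h \<partial>paths K n)"
  have inner: "(\<lambda>l. \<integral>\<^sup>+bs. iv (\<delta> * l < 4 * N (walk d h bs)) \<partial>copies K h) \<in> borel_measurable lborel" for h
    by (rule borel_measurable_nn_integral_pmf_finite[OF fc]) measurable
  have [measurable]: "B \<in> borel_measurable lborel"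
    unfolding B_def by (rule borel_measurable_nn_integral_pmf_finite[OF fp]) measurable
  have [measurable]: "C \<in> borel_measurable lborel"
    unfolding C_def by (rule borel_measurable_nn_integral_pmf_finite[OF fp inner])
  have LC: "(\<integral>\<^sup>+l. iv (l < x) * w l \<partial>lborel) = ennreal (x powr b)" if "0 \<le> x" for x
    using layer_cake[OF b that] by (simp add: w_def)
  have point: "A l * w l \<le> (ennreal e * B l + ennreal c * C l) * w l" for l
  proof (cases "0 < l")
    case True
    have "A l \<le> ennreal e * B l + ennreal c * C l"
      using good_lambda[OF d a True \<delta> \<open>0 \<le> D\<close> tree] True
      by (simp add: A_def B_def C_def e_def c_def passed_iff_running_max)
    then show ?thesis by (rule mult_right_mono) simp
  qed (simp add: w_def)
  have IA: "(\<integral>\<^sup>+l. A l * w l \<partial>lborel) = ennreal (3 powr - b) * X"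
  proof -
    have "(\<integral>\<^sup>+l. A l * w l \<partial>lborel) = (\<integral>\<^sup>+h. (\<integral>\<^sup>+l. iv (3 * l < running_max d h) * w l \<partial>lborel) \<partial>paths K n)"
      unfolding A_def by (rule nn_integral_pmf_swap[OF fp]) measurable
    also have "\<dots> = (\<integral>\<^sup>+h. (\<integral>\<^sup>+l. iv (l < running_max d h / 3) * w l \<partial>lborel) \<partial>paths K n)"
      by (simp add: field_simps)
    also have "\<dots> = (\<integral>\<^sup>+h. ennreal (3 powr - b) * ennreal (running_max d h powr b) \<partial>paths K n)"
      using running_max_nonneg
      by (subst LC) (auto simp: powr_divide powr_minus field_simps ennreal_mult'[symmetric] intro!: nn_integral_cong)
    finally show ?thesis unfolding X_def by (simp add: nn_integral_cmult)
  qed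
  have IB: "(\<integral>\<^sup>+l. B l * w l \<partial>lborel) = X"
    unfolding B_def X_def using running_max_nonneg by (subst nn_integral_pmf_swap[OF fp]) (auto simp: LC)
  have IC: "(\<integral>\<^sup>+l. C l * w l \<partial>lborel) = ennreal ((4 / \<delta>) powr b) * decoupled_moment K d n b"
  proof -
    have "(\<integral>\<^sup>+l. C l * w l \<partial>lborel) = (\<integral>\<^sup>+h. (\<integral>\<^sup>+l. (\<integral>\<^sup>+bs. iv (\<delta> * l < 4 * N (walk d h bs)) \<partial>copies K h) * w l \<partial>lborel) \<partial>paths K n)"
      unfolding C_def by (rule nn_integral_pmf_swap[OF fp inner]) measurable
    also have "\<dots> = (\<integral>\<^sup>+h. (\<integral>\<^sup>+bs. (\<integral>\<^sup>+l. iv (\<delta> * l < 4 * N (walk d h bs)) * w l \<partial>lborel) \<partial>copies K h) \<partial>paths K n)"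
      by (subst nn_integral_pmf_swap[OF fc]) auto
    also have "\<dots> = (\<integral>\<^sup>+h. (\<integral>\<^sup>+bs. (\<integral>\<^sup>+l. iv (l < 4 / \<delta> * N (walk d h bs)) * w l \<partial>lborel) \<partial>copies K h) \<partial>paths K n)"
      using \<delta> by (simp add: field_simps)
    also have "\<dots> = (\<integral>\<^sup>+h. (\<integral>\<^sup>+bs. ennreal ((4 / \<delta>) powr b) * ennreal (N (walk d h bs) powr b) \<partial>copies K h) \<partial>paths K n)"
    proof (intro nn_integral_cong)
      fix h bs
      let ?x = "N (walk d h bs)"
      have x: "0 \<le> ?x" by (intro N_nonneg walk_closed dc)
      have "(\<integral>\<^sup>+l. iv (l < 4 / \<delta> * ?x) * w l \<partial>lborel) = ennreal ((4 / \<delta> * ?x) powr b)"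
        using x \<delta> by (intro LC) auto
      also have "(4 / \<delta> * ?x) powr b = (4 / \<delta>) powr b * ?x powr b" using x \<delta> by (intro powr_mult)
      finally show "(\<integral>\<^sup>+l. iv (l < 4 / \<delta> * ?x) * w l \<partial>lborel) = ennreal ((4 / \<delta>) powr b) * ennreal (?x powr b)"
        by (simp add: ennreal_mult')
    qed
    finally show ?thesis unfolding decoupled_moment_def by (simp add: nn_integral_cmult)
  qed
  have "ennreal (3 powr - b) * X \<le> (\<integral>\<^sup>+l. (ennreal e * B l + ennreal c * C l) * w l \<partial>lborel)"
    unfolding IA[symmetric] by (intro nn_integral_mono point)
  also have "\<dots> = (\<integral>\<^sup>+l. ennreal e * (B l * w l) + ennreal c * (C l * w l) \<partial>lborel)"
    by (simp add: distrib_right mult.assoc)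
  also have "\<dots> = ennreal e * (\<integral>\<^sup>+l. B l * w l \<partial>lborel) + ennreal c * (\<integral>\<^sup>+l. C l * w l \<partial>lborel)"
    by (simp add: nn_integral_add nn_integral_cmult)
  finally have main: "ennreal (3 powr - b) * X \<le> ennreal e * X + ennreal c * (ennreal ((4 / \<delta>) powr b) * decoupled_moment K d n b)"
    unfolding IB IC .
  have "X = ennreal (3 powr b) * (ennreal (3 powr - b) * X)"
    by (simp add: powr_minus flip: mult.assoc ennreal_mult')
  also have "\<dots> \<le> ennreal (3 powr b) * (ennreal e * X + ennreal c * (ennreal ((4 / \<delta>) powr b) * decoupled_moment K d n b))"
    using main by (rule mult_left_mono) simp
  also have "\<dots> = ennreal (3 powr b * c * (4 / \<delta>) powr b) * decoupled_moment K d n b + ennreal (3 powr b * e) * X"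
    using \<open>0 \<le> e\<close> \<open>0 \<le> c\<close> by (simp add: ennreal_mult' distrib_left mult.assoc add.commute)
  finally have "X \<le> 2 * (ennreal (3 powr b * c * (4 / \<delta>) powr b) * decoupled_moment K d n b)"
  proof (rule ennreal_absorb)
    show "X < \<infinity>" unfolding X_def by (rule nn_integral_pmf_finite[OF fp]) simp
  qed (use small in \<open>simp add: e_def\<close>)
  moreover have "process_moment K d n b \<le> X"
    unfolding process_moment_def X_def using b N_nonneg[OF walk_closed[OF dc]] N_walk_le_running_max
    by (intro nn_integral_mono ennreal_leI powr_mono2) auto
  ultimately show ?thesis by (simp add: c_def ennreal_mult'' mult.assoc ennreal_mult')
qed

end

section \<open>Symmetrization by a conditionally independent copy\<close>

lemma nn_integral_pmf_commute:
  fixes f :: "'a \<Rightarrow> 'b \<Rightarrow> ennreal"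
  assumes "finite (set_pmf M)"
  shows "(\<integral>\<^sup>+y. \<integral>\<^sup>+x. f x y \<partial>measure_pmf M \<partial>measure_pmf L) = (\<integral>\<^sup>+x. \<integral>\<^sup>+y. f x y \<partial>measure_pmf L \<partial>measure_pmf M)"
  using nn_integral_pmf_swap[OF assms, of f "measure_pmf L" "\<lambda>_. 1"] by simp

text \<open>The differences of the two components are symmetric, which reduces extrapolation to symmetric steps.\<close>

definition pair_kernel :: "('c list \<Rightarrow> 'c pmf) \<Rightarrow> ('c \<times> 'c) list \<Rightarrow> ('c \<times> 'c) pmf" where
  "pair_kernel K H = pair_pmf (K (map fst H)) (K (map fst H))"

text \<open>The kernel looks at the first components only. These therefore form a path of the
  original tree, and given them the second components are independent copies.\<close>

lemma nn_integral_pair_paths: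
  fixes g :: "'c list \<Rightarrow> 'c list \<Rightarrow> ennreal"
  assumes fin: "\<And>h. finite (set_pmf (K h))"
  shows "(\<integral>\<^sup>+H. g (map fst H) (map snd H) \<partial>paths (pair_kernel K) n) = (\<integral>\<^sup>+h. \<integral>\<^sup>+bs. g h bs \<partial>copies K h \<partial>paths K n)"
proof (induction n arbitrary: g)
  case (Suc n)
  let ?g = "\<lambda>h bs. \<integral>\<^sup>+a. \<integral>\<^sup>+b. g (a # h) (b # bs) \<partial>K h \<partial>K h"
  have "(\<integral>\<^sup>+H. g (map fst H) (map snd H) \<partial>paths (pair_kernel K) (Suc n)) =
      (\<integral>\<^sup>+H. ?g (map fst H) (map snd H) \<partial>paths (pair_kernel K) n)"
    unfolding nn_integral_paths_Suc by (simp add: pair_kernel_def nn_integral_pair_pmf')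
  also have "\<dots> = (\<integral>\<^sup>+h. \<integral>\<^sup>+bs. ?g h bs \<partial>copies K h \<partial>paths K n)" by (rule Suc)
  also have "\<dots> = (\<integral>\<^sup>+h. \<integral>\<^sup>+a. \<integral>\<^sup>+bs. \<integral>\<^sup>+b. g (a # h) (b # bs) \<partial>K h \<partial>copies K h \<partial>K h \<partial>paths K n)"
    by (intro nn_integral_cong nn_integral_pmf_commute fin)
  also have "\<dots> = (\<integral>\<^sup>+h. \<integral>\<^sup>+bs. g h bs \<partial>copies K h \<partial>paths K (Suc n))"
    unfolding nn_integral_paths_Suc nn_integral_copies_Cons ..
  finally show ?case .
qed simp

lemma nn_integral_pair_copies:
  fixes g :: "'c list \<Rightarrow> 'c list \<Rightarrow> ennreal"
  assumes fin: "\<And>h. finite (set_pmf (K h))"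
  shows "(\<integral>\<^sup>+B. g (map fst B) (map snd B) \<partial>copies (pair_kernel K) H) =
    (\<integral>\<^sup>+bs. \<integral>\<^sup>+bs'. g bs bs' \<partial>copies K (map fst H) \<partial>copies K (map fst H))"
proof (induction H arbitrary: g)
  case (Cons p H)
  let ?h = "map fst H"
  let ?g = "\<lambda>bs bs'. \<integral>\<^sup>+a. \<integral>\<^sup>+b. g (a # bs) (b # bs') \<partial>K ?h \<partial>K ?h"
  have "(\<integral>\<^sup>+B. g (map fst B) (map snd B) \<partial>copies (pair_kernel K) (p # H)) =
      (\<integral>\<^sup>+B. ?g (map fst B) (map snd B) \<partial>copies (pair_kernel K) H)"
    unfolding nn_integral_copies_Cons by (simp add: pair_kernel_def nn_integral_pair_pmf')
  also have "\<dots> = (\<integral>\<^sup>+bs. \<integral>\<^sup>+bs'. ?g bs bs' \<partial>copies K ?h \<partial>copies K ?h)" by (rule Cons)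
  also have "\<dots> = (\<integral>\<^sup>+bs. \<integral>\<^sup>+a. \<integral>\<^sup>+bs'. \<integral>\<^sup>+b. g (a # bs) (b # bs') \<partial>K ?h \<partial>copies K ?h \<partial>K ?h \<partial>copies K ?h)"
    by (intro nn_integral_cong nn_integral_pmf_commute fin)
  also have "\<dots> = (\<integral>\<^sup>+bs. \<integral>\<^sup>+bs'. g bs bs' \<partial>copies K (map fst (p # H)) \<partial>copies K (map fst (p # H)))"
    unfolding list.map nn_integral_copies_Cons ..
  finally show ?case .
qed simp

context f_normed_double
begin

text \<open>Both terms use the same history of first components, so exchanging the newest pair
  changes the sign and nothing else. The walk of the pairs is then the process minus its decoupled
  sum.\<close>

definition pair_steps :: "('c list \<Rightarrow> 'a) \<Rightarrow> ('c \<times> 'c) list \<Rightarrow> 'a" where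
  "pair_steps d l = (case l of [] \<Rightarrow> \<zero> | p # H \<Rightarrow> d (fst p # map fst H) \<ominus> d (snd p # map fst H))"

lemma pair_steps_closed: "range d \<subseteq> carrier V \<Longrightarrow> range (pair_steps d) \<subseteq> carrier V"
  by (auto simp: pair_steps_def image_subset_iff split: list.split)

lemma walk_pair_steps:
  assumes d: "range d \<subseteq> carrier V"
  shows "length B = length H \<Longrightarrow>
    walk (pair_steps d) H B = walk d (map fst H) (map fst B) \<ominus> walk d (map fst H) (map snd B)"
proof (induction H arbitrary: B)
  case (Cons p H)
  then obtain q B' where B: "B = q # B'" "length B' = length H" by (cases B) auto
  then show ?case
    using Cons.IH[OF B(2)] walk_closed[OF d] step_closed[OF d]
    by (simp add: pair_steps_def add_minus_add)
qed (simp add: minus_self)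

lemma N_powr_add:
  assumes "x \<in> carrier V" "y \<in> carrier V" "0 < b" "N z \<le> N x + N y" "z \<in> carrier V"
  shows "ennreal (N z powr b) \<le> ennreal (2 powr b) * (ennreal (N x powr b) + ennreal (N y powr b))"
proof -
  have "N z powr b \<le> (N x + N y) powr b" using assms N_nonneg by (intro powr_mono2) auto
  also have "\<dots> \<le> 2 powr b * (N x powr b + N y powr b)" using assms N_nonneg by (intro powr_add_le) auto
  finally have "ennreal (N z powr b) \<le> ennreal (2 powr b * (N x powr b + N y powr b))" by (rule ennreal_leI)
  also have "\<dots> = ennreal (2 powr b) * (ennreal (N x powr b) + ennreal (N y powr b))"
    by (simp add: ennreal_mult ennreal_plus)
  finally show ?thesis .
qed

lemma process_moment_le_pair:
  fixes K :: "'c list \<Rightarrow> 'c pmf"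
  assumes fin: "\<And>h. finite (set_pmf (K h))" and d: "range d \<subseteq> carrier V" and b: "0 < b"
  shows "process_moment K d n b \<le> ennreal (2 powr b) *
    (process_moment (pair_kernel K) (pair_steps d) n b + decoupled_moment K d n b)"
proof -
  note wc = walk_closed[OF d]
  have "process_moment K d n b = (\<integral>\<^sup>+h. \<integral>\<^sup>+bs. ennreal (N (walk d h h) powr b) \<partial>copies K h \<partial>paths K n)"
    by (simp add: process_moment_def)
  also have "\<dots> \<le> (\<integral>\<^sup>+h. \<integral>\<^sup>+bs. ennreal (2 powr b) * (ennreal (N (walk d h h \<ominus> walk d h bs) powr b) +
      ennreal (N (walk d h bs) powr b)) \<partial>copies K h \<partial>paths K n)"
    using wc b by (intro nn_integral_mono N_powr_add N_le_add_diff minus_closed) auto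
  also have "\<dots> = ennreal (2 powr b) * ((\<integral>\<^sup>+h. \<integral>\<^sup>+bs. ennreal (N (walk d h h \<ominus> walk d h bs) powr b) \<partial>copies K h \<partial>paths K n) +
      decoupled_moment K d n b)"
    by (simp add: decoupled_moment_def nn_integral_cmult nn_integral_add)
  also have "(\<integral>\<^sup>+h. \<integral>\<^sup>+bs. ennreal (N (walk d h h \<ominus> walk d h bs) powr b) \<partial>copies K h \<partial>paths K n) =
      process_moment (pair_kernel K) (pair_steps d) n b"
    unfolding process_moment_def
    by (subst nn_integral_pair_paths[OF fin, symmetric]) (simp add: walk_pair_steps[OF d])
  finally show ?thesis .
qed

text \<open>Copies of the pairs are two independent families of copies along the same path, so the
  decoupled sum of the pairs is a difference of two decoupled sums of the original tree.\<close>

lemma decoupled_moment_pair_le: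
  fixes K :: "'c list \<Rightarrow> 'c pmf"
  assumes fin: "\<And>h. finite (set_pmf (K h))" and d: "range d \<subseteq> carrier V" and b: "0 < b"
  shows "decoupled_moment (pair_kernel K) (pair_steps d) n b \<le> ennreal (2 powr b * 2) * decoupled_moment K d n b"
proof -
  note wc = walk_closed[OF d]
  let ?E = "\<lambda>h. \<integral>\<^sup>+bs. ennreal (N (walk d h bs) powr b) \<partial>copies K h"
  have inner: "(\<integral>\<^sup>+B. ennreal (N (walk (pair_steps d) H B) powr b) \<partial>copies (pair_kernel K) H) \<le>
      ennreal (2 powr b * 2) * ?E (map fst H)" for H
  proof -
    let ?h = "map fst H"
    have "(\<integral>\<^sup>+B. ennreal (N (walk (pair_steps d) H B) powr b) \<partial>copies (pair_kernel K) H) =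
        (\<integral>\<^sup>+B. ennreal (N (walk d ?h (map fst B) \<ominus> walk d ?h (map snd B)) powr b) \<partial>copies (pair_kernel K) H)"
      by (intro nn_integral_cong_AE) (auto simp: AE_measure_pmf_iff walk_pair_steps[OF d] dest: length_copies)
    also have "\<dots> = (\<integral>\<^sup>+bs. \<integral>\<^sup>+bs'. ennreal (N (walk d ?h bs \<ominus> walk d ?h bs') powr b) \<partial>copies K ?h \<partial>copies K ?h)"
      by (rule nn_integral_pair_copies[OF fin])
    also have "\<dots> \<le> (\<integral>\<^sup>+bs. \<integral>\<^sup>+bs'. ennreal (2 powr b) *
        (ennreal (N (walk d ?h bs) powr b) + ennreal (N (walk d ?h bs') powr b)) \<partial>copies K ?h \<partial>copies K ?h)"
      using wc b by (intro nn_integral_mono N_powr_add N_diff minus_closed) auto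
    also have "\<dots> = ennreal (2 powr b) * (?E ?h + ?E ?h)"
      by (simp add: nn_integral_cmult nn_integral_add)
    also have "\<dots> = ennreal (2 powr b * 2) * ?E ?h"
      by (simp add: ennreal_mult' mult.assoc mult_2 distrib_left)
    finally show ?thesis .
  qed
  have "decoupled_moment (pair_kernel K) (pair_steps d) n b \<le>
      (\<integral>\<^sup>+H. ennreal (2 powr b * 2) * ?E (map fst H) \<partial>paths (pair_kernel K) n)"
    unfolding decoupled_moment_def by (intro nn_integral_mono inner)
  also have "\<dots> = ennreal (2 powr b * 2) * (\<integral>\<^sup>+H. ?E (map fst H) \<partial>paths (pair_kernel K) n)"
    by (rule nn_integral_cmult) auto
  also have "(\<integral>\<^sup>+H. ?E (map fst H) \<partial>paths (pair_kernel K) n) = decoupled_moment K d n b"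
    using nn_integral_pair_paths[OF fin, where g = "\<lambda>h bs. ?E h" and n = n] by (simp add: decoupled_moment_def)
  finally show ?thesis .
qed

text \<open>The inequality with exponent \<open>a\<close> is assumed for letters in
  \<open>'c \<times> 'c\<close>, because it is used for the symmetrized tree.\<close>

lemma extrapolation:
  assumes a: "0 < a" and b: "0 < b" and "0 \<le> D"
    and tree: "\<And>(K :: ('c \<times> 'c) list \<Rightarrow> ('c \<times> 'c) pmf) d n. \<lbrakk>\<And>h. finite (set_pmf (K h)); range d \<subseteq> carrier V\<rbrakk>
      \<Longrightarrow> process_moment K d n a \<le> ennreal D * decoupled_moment K d n a"
  shows "\<exists>C\<ge>0. \<forall>(K :: 'c list \<Rightarrow> 'c pmf) d n. (\<forall>h. finite (set_pmf (K h))) \<longrightarrow> range d \<subseteq> carrier V \<longrightarrow>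
    process_moment K d n b \<le> ennreal C * decoupled_moment K d n b"
proof -
  \<comment> \<open>Chosen so that \<open>3 powr b * (D * 2 * 40 powr a + 1) * q\<close> is 1/2,
    which yields the smallness that \<open>symmetric_extrapolation\<close> requires of
    \<open>\<delta>\<close>. The summand 1 keeps the denominator positive if \<open>D\<close> is
    0.\<close>
  define q where "q = 1 / (2 * 3 powr b * (D * 2 * 40 powr a + 1))"
  have "0 < D * 2 * 40 powr a + 1" using \<open>0 \<le> D\<close> by (intro add_nonneg_pos) auto
  then have "0 < q" by (simp add: q_def)
  define \<delta> where "\<delta> = min 1 (q powr (1 / a))"
  have \<delta>: "0 < \<delta>" "\<delta> \<le> 1" using \<open>0 < q\<close> by (auto simp: \<delta>_def)
  have "\<delta> powr a \<le> (q powr (1 / a)) powr a" using \<delta> a by (intro powr_mono2) (auto simp: \<delta>_def)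
  then have "\<delta> powr a \<le> q" using a \<open>0 < q\<close> by (simp add: powr_powr)
  then have "3 powr b * (D * (2 * (40 powr a * \<delta> powr a))) \<le> 3 powr b * (D * (2 * (40 powr a * q)))"
    using \<open>0 \<le> D\<close> by (intro mult_left_mono) auto
  also have "\<dots> \<le> 3 powr b * ((D * 2 * 40 powr a + 1) * q)"
    using \<open>0 < q\<close> by (intro mult_left_mono) (auto simp: algebra_simps)
  also have "\<dots> = 1 / 2" using \<open>0 < D * 2 * 40 powr a + 1\<close> by (simp add: q_def)
  finally have small: "3 powr b * (D * (2 * (40 * \<delta>) powr a)) \<le> 1 / 2" using \<delta> by (simp add: powr_mult)
  define C1 where "C1 = 2 * (3 powr b * (8 + 32 * 8 powr a) * (4 / \<delta>) powr b)"
  have "0 \<le> C1" by (simp add: C1_def)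
  define C where "C = 2 powr b * (C1 * (2 powr b * 2) + 1)"
  have "process_moment K d n b \<le> ennreal C * decoupled_moment K d n b"
    if fin: "\<And>h. finite (set_pmf (K h))" and d: "range d \<subseteq> carrier V"
    for K :: "'c list \<Rightarrow> 'c pmf" and d n
  proof -
    interpret S: symmetric_tree V N r "pair_kernel K" prod.swap
    proof
      show "finite (set_pmf (pair_kernel K h))" for h using fin by (simp add: pair_kernel_def)
      have swap: "prod.swap = (\<lambda>(x :: 'c, y :: 'c). (y, x))" by auto
      show "map_pmf prod.swap (pair_kernel K h) = pair_kernel K h" for h
        unfolding pair_kernel_def swap by (rule pair_commute_pmf[symmetric])
    qed simp
    have sym: "S.symmetric_steps (pair_steps d)"
      unfolding S.symmetric_steps_def using pair_steps_closed[OF d] step_closed[OF d]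
      by (auto simp: pair_steps_def minus_swap)
    have "process_moment (pair_kernel K) (pair_steps d) n b \<le>
        ennreal C1 * decoupled_moment (pair_kernel K) (pair_steps d) n b"
      unfolding C1_def
      by (rule S.symmetric_extrapolation[OF sym a b \<delta> \<open>0 \<le> D\<close> small])
        (auto intro!: tree S.fin simp: S.symmetric_steps_def)
    also have "\<dots> \<le> ennreal C1 * (ennreal (2 powr b * 2) * decoupled_moment K d n b)"
      by (intro mult_left_mono decoupled_moment_pair_le[OF fin d b]) auto
    finally have "process_moment K d n b \<le> ennreal (2 powr b) *
        (ennreal C1 * (ennreal (2 powr b * 2) * decoupled_moment K d n b) + decoupled_moment K d n b)"
      using process_moment_le_pair[OF fin d b, where n = n] by (meson add_right_mono mult_left_mono order_trans zero_le)
    also have "\<dots> = ennreal C * decoupled_moment K d n b"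
      using \<open>0 \<le> C1\<close> unfolding C_def
      by (simp add: ennreal_mult ennreal_plus distrib_left distrib_right mult.assoc)
    finally show ?thesis .
  qed
  moreover have "0 \<le> C" using \<open>0 \<le> C1\<close> by (simp add: C_def)
  ultimately show ?thesis by blast
qed

end

section \<open>Trees inside probability spaces\<close>

text \<open>\<open>real_cond_exp\<close> is a difference of conditional expectations of the positive
  and the negative part. Each is identified by its integrals over \<open>G\<close>, the second being
  zero for an indicator.\<close>

lemma conditional_prob_charact:
  assumes "finite_measure_subalgebra M G" and A: "A \<in> sets M" and \<rho>: "\<rho> \<in> borel_measurable G"
    and "\<And>x. 0 \<le> \<rho> x"
    and eq: "\<And>E. E \<in> sets G \<Longrightarrow> emeasure M (A \<inter> E) = (\<integral>\<^sup>+x\<in>E. ennreal (\<rho> x) \<partial>M)"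
  shows "AE x in M. conditional_prob M G A x = \<rho> x"
proof -
  interpret finite_measure_subalgebra M G by fact
  have [measurable]: "A \<in> sets M" by fact
  have G: "E \<in> sets M" if "E \<in> sets G" for E using subalg that by (auto simp: subalgebra_def)
  have "AE x in M. ennreal (\<rho> x) = nn_cond_exp M G (\<lambda>x. ennreal (indicator A x)) x"
  proof (rule nn_cond_exp_charact)
    fix E assume E: "E \<in> sets G"
    have "(\<integral>\<^sup>+x\<in>E. ennreal (indicator A x) \<partial>M) = (\<integral>\<^sup>+x. indicator (A \<inter> E) x \<partial>M)"
      by (intro nn_integral_cong) (auto simp: indicator_def)
    also have "\<dots> = emeasure M (A \<inter> E)" using G[OF E] by (intro nn_integral_indicator) auto
    finally show "(\<integral>\<^sup>+x\<in>E. ennreal (indicator A x) \<partial>M) = (\<integral>\<^sup>+x\<in>E. ennreal (\<rho> x) \<partial>M)"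
      using eq[OF E] by simp
  qed (use \<rho> in auto)
  moreover have "AE x in M. 0 = nn_cond_exp M G (\<lambda>x. ennreal (- indicator A x)) x"
  proof (rule nn_cond_exp_charact)
    have "ennreal (- indicator A x) = 0" for x by (rule ennreal_neg) simp
    then show "(\<integral>\<^sup>+x\<in>E. ennreal (- indicator A x) \<partial>M) = (\<integral>\<^sup>+x\<in>E. 0 \<partial>M)" for E by simp
  qed auto
  ultimately show ?thesis
    unfolding conditional_prob_def real_cond_exp_def
  proof eventually_elim
    case (elim x)
    then show ?case using assms(4)[of x] by (simp flip: elim)
  qed
qed

lemma prod_iv: "finite A \<Longrightarrow> (\<Prod>k\<in>A. iv (P k)) = iv (\<forall>k\<in>A. P k)"
  by (induction A rule: finite_induct) auto

lemma separably_valued_transfer: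
  "separably_valued M V f \<Longrightarrow> (\<And>x. x \<in> space M \<Longrightarrow> f x = g x) \<Longrightarrow> separably_valued M V g"
  unfolding separably_valued_def using measurable_cong[of M f g] image_cong[of "space M" "space M" f g] by simp

lemma decoupled_tangent_transfer:
  assumes cf: "complete_filtered_prob_space M F" and tang: "decoupled_tangent M F V d e"
    and d: "\<And>k \<omega>. k \<ge> 1 \<Longrightarrow> \<omega> \<in> space M \<Longrightarrow> d k \<omega> = d' k \<omega>"
    and e: "\<And>k \<omega>. k \<ge> 1 \<Longrightarrow> \<omega> \<in> space M \<Longrightarrow> e k \<omega> = e' k \<omega>"
  shows "decoupled_tangent M F V d' e'"
proof -
  note sp = complete_filtered_prob_spaceD(3)[OF cf]
  have deq: "d' n -` B \<inter> space M = d n -` B \<inter> space M" if "n \<ge> 1" for n B using d that by auto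
  have eeq: "e' n -` B \<inter> space M = e n -` B \<inter> space M" if "n \<ge> 1" for n B using e that by auto
  have alleq: "{\<omega> \<in> space M. \<forall>k\<in>{1..n}. e' k \<omega> \<in> B k} = {\<omega> \<in> space M. \<forall>k\<in>{1..n}. e k \<omega> \<in> B k}" for n :: nat and B
    using e by auto
  show ?thesis
    unfolding decoupled_tangent_def
  proof (intro conjI allI impI ballI)
    show "adapted F V d'"
      unfolding adapted_def
    proof (intro allI impI)
      fix n :: nat assume n: "n \<ge> 1"
      then have "separably_valued (F n) V (d n)" using tang by (simp add: decoupled_tangent_def adapted_def)
      then show "separably_valued (F n) V (d' n)" by (rule separably_valued_transfer) (use d n sp in auto)
    qed
  next
    fix n :: nat assume n: "n \<ge> 1"
    then have "separably_valued M V (e n)" using tang by (simp add: decoupled_tangent_def)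
    then show "separably_valued M V (e' n)" by (rule separably_valued_transfer) (use e n in auto)
  next
    fix n :: nat and B assume "n \<ge> 1" "B \<in> sets (qborel V)"
    then show "AE \<omega> in M. conditional_prob M (F (n - 1)) (d' n -` B \<inter> space M) \<omega> =
        conditional_prob M (F_infinity M F) (e' n -` B \<inter> space M) \<omega>"
      using tang unfolding decoupled_tangent_def deq[OF \<open>n \<ge> 1\<close>] eeq[OF \<open>n \<ge> 1\<close>] by blast
  next
    fix n :: nat and B assume n: "n \<ge> 1" and B: "\<forall>k\<in>{1..n}. B k \<in> sets (qborel V)"
    have "AE \<omega> in M. conditional_prob M (F_infinity M F) {\<omega> \<in> space M. \<forall>k\<in>{1..n}. e k \<omega> \<in> B k} \<omega> =
       (\<Prod>k\<in>{1..n}. conditional_prob M (F_infinity M F) (e k -` B k \<inter> space M) \<omega>)"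
      using tang n B unfolding decoupled_tangent_def by simp
    moreover have "(\<Prod>k\<in>{1..n}. conditional_prob M (F_infinity M F) (e' k -` B k \<inter> space M) \<omega>) =
      (\<Prod>k\<in>{1..n}. conditional_prob M (F_infinity M F) (e k -` B k \<inter> space M) \<omega>)" for \<omega>
      by (intro prod.cong refl) (simp add: eeq)
    ultimately show "AE \<omega> in M. conditional_prob M (F_infinity M F) {\<omega> \<in> space M. \<forall>k\<in>{1..n}. e' k \<omega> \<in> B k} \<omega> =
       (\<Prod>k\<in>{1..n}. conditional_prob M (F_infinity M F) (e' k -` B k \<inter> space M) \<omega>)"
      unfolding alleq by simp
  qed
qed

text \<open>As the newest letter stands first, this suffix consists of the \<open>k\<close> oldest
  letters; a shorter list is returned unchanged, which freezes the state after the end of the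
  path.\<close>

definition recent :: "nat \<Rightarrow> 'c list \<Rightarrow> 'c list" where
  "recent k l = drop (length l - k) l"

lemma recent_0: "recent 0 l = []"
  by (simp add: recent_def)

lemma recent_all: "length l \<le> k \<Longrightarrow> recent k l = l"
  by (simp add: recent_def)

lemma recent_recent: "k \<le> j \<Longrightarrow> recent k (recent j l) = recent k l"
  by (cases "length l \<le> j") (auto simp: recent_def)

lemma recent_Cons: "k \<le> length l \<Longrightarrow> recent k (a # l) = recent k l"
  by (simp add: recent_def Suc_diff_le)

lemma recent_Suc: "k < length l \<Longrightarrow> recent (Suc k) l = l ! (length l - Suc k) # recent k l"
  using Cons_nth_drop_Suc[of "length l - Suc k" l] by (simp add: recent_def Suc_diff_Suc)

text \<open>The lists in the definition of \<open>paths\<close> and \<open>copies\<close> start with the last letter, so the state at time \<open>k\<close> is a suffix.\<close>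

lemma map_recent_paths: "k \<le> n \<Longrightarrow> map_pmf (recent k) (paths K n) = paths K k"
proof (induction n)
  case (Suc n)
  show ?case
  proof (cases "k = Suc n")
    case True
    have "map_pmf (recent k) (paths K (Suc n)) = map_pmf id (paths K (Suc n))"
      using True by (intro map_pmf_cong refl) (auto simp: recent_all dest: length_paths simp del: paths.simps)
    then show ?thesis using True by (simp add: pmf.map_id del: paths.simps)
  next
    case False
    then have "k \<le> n" using Suc.prems by simp
    have "map_pmf (recent k) (paths K (Suc n)) = bind_pmf (paths K n) (\<lambda>h. map_pmf (\<lambda>a. recent k (a # h)) (K h))"
      by (simp add: map_bind_pmf map_pmf_comp)
    also have "\<dots> = bind_pmf (paths K n) (\<lambda>h. map_pmf (\<lambda>a. recent k h) (K h))"
      using \<open>k \<le> n\<close> by (intro bind_pmf_cong refl map_pmf_cong) (auto simp: recent_Cons dest: length_paths)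
    also have "\<dots> = map_pmf (recent k) (paths K n)" by (simp add: map_pmf_const map_pmf_def)
    finally show ?thesis using Suc.IH[OF \<open>k \<le> n\<close>] by simp
  qed
qed (simp add: recent_def)

lemma nn_integral_paths_recent:
  "k \<le> n \<Longrightarrow> (\<integral>\<^sup>+h. f (recent k h) \<partial>paths K n) = (\<integral>\<^sup>+h. f h \<partial>paths K k)"
  by (subst map_recent_paths[symmetric]) simp_all

text \<open>Conditional independence of the copies: \<open>hd (recent k bs)\<close> is the copy at
  time \<open>k\<close>, and its law is the kernel at the state of the path at time
  \<open>k - 1\<close>.\<close>

lemma copies_product:
  "(\<integral>\<^sup>+bs. iv (\<forall>k\<in>{1..length h}. P k (hd (recent k bs))) \<partial>copies K h) =
    (\<Prod>k\<in>{1..length h}. \<integral>\<^sup>+b. iv (P k b) \<partial>K (recent (k - 1) h))"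
proof (induction h)
  case (Cons a h)
  have "(\<integral>\<^sup>+bs. iv (\<forall>k\<in>{1..length (a # h)}. P k (hd (recent k bs))) \<partial>copies K (a # h)) =
      (\<integral>\<^sup>+bs. \<integral>\<^sup>+b. iv (\<forall>k\<in>{1..length h}. P k (hd (recent k bs))) * iv (P (Suc (length h)) b) \<partial>K h \<partial>copies K h)"
    unfolding nn_integral_copies_Cons
  proof (intro nn_integral_cong_AE)
    have "iv (\<forall>k\<in>{1..length (a # h)}. P k (hd (recent k (b # bs)))) =
        iv (\<forall>k\<in>{1..length h}. P k (hd (recent k bs))) * iv (P (Suc (length h)) b)" if l: "length bs = length h" for b bs
    proof -
      have "{1..length (a # h)} = insert (Suc (length h)) {1..length h}" by auto
      moreover have "recent k (b # bs) = recent k bs" if "k \<in> {1..length h}" for k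
        using that l by (intro recent_Cons) simp
      moreover have "recent (Suc (length h)) (b # bs) = b # bs" using l by (intro recent_all) simp
      ultimately show ?thesis by auto
    qed
    then show "AE bs in copies K h. (\<integral>\<^sup>+b. iv (\<forall>k\<in>{1..length (a # h)}. P k (hd (recent k (b # bs)))) \<partial>K h) =
        (\<integral>\<^sup>+b. iv (\<forall>k\<in>{1..length h}. P k (hd (recent k bs))) * iv (P (Suc (length h)) b) \<partial>K h)"
      using length_copies[of _ K h] by (intro AE_pmfI nn_integral_cong) blast
  qed
  also have "\<dots> = (\<integral>\<^sup>+bs. iv (\<forall>k\<in>{1..length h}. P k (hd (recent k bs))) \<partial>copies K h) * (\<integral>\<^sup>+b. iv (P (Suc (length h)) b) \<partial>K h)"
    by (simp add: nn_integral_cmult nn_integral_multc)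
  also have "\<dots> = (\<Prod>k\<in>{1..length h}. \<integral>\<^sup>+b. iv (P k b) \<partial>K (recent (k - 1) (a # h))) *
      (\<integral>\<^sup>+b. iv (P (Suc (length h)) b) \<partial>K (recent (length h) (a # h)))"
    unfolding Cons by (intro arg_cong2[where f = times] prod.cong refl) (auto simp: recent_Cons recent_all)
  also have "\<dots> = (\<Prod>k\<in>{1..length (a # h)}. \<integral>\<^sup>+b. iv (P k b) \<partial>K (recent (k - 1) (a # h)))"
    by simp
  finally show ?case .
qed simp

lemma Lp_norm_le_iff:
  assumes "0 < p" "0 \<le> D"
  shows "Lp_norm p M V f \<le> ennreal D * Lp_norm p M W g \<longleftrightarrow>
    (\<integral>\<^sup>+x. ennreal (qnorm V (f x) powr p) \<partial>M) \<le> ennreal (D powr p) * (\<integral>\<^sup>+x. ennreal (qnorm W (g x) powr p) \<partial>M)"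
proof -
  define I where "I = (\<integral>\<^sup>+x. ennreal (qnorm V (f x) powr p) \<partial>M)"
  define J where "J = (\<integral>\<^sup>+x. ennreal (qnorm W (g x) powr p) \<partial>M)"
  have L: "Lp_norm p M V f = (if I = \<infinity> then \<infinity> else ennreal (enn2real I powr (1 / p)))"
    "Lp_norm p M W g = (if J = \<infinity> then \<infinity> else ennreal (enn2real J powr (1 / p)))"
    by (simp_all add: Lp_norm_def I_def J_def)
  show ?thesis
    unfolding L I_def[symmetric] J_def[symmetric]
  proof (cases "J = \<infinity>")
    case True
    then show "((if I = \<infinity> then \<infinity> else ennreal (enn2real I powr (1 / p))) \<le> ennreal D * (if J = \<infinity> then \<infinity> else ennreal (enn2real J powr (1 / p)))) = (I \<le> ennreal (D powr p) * J)"
    \<comment> \<open>With \<open>D = 0\<close> and an infinite right-hand norm the product is 0,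
      and both inequalities then say that the integral on the left vanishes.\<close>
    proof (cases "D = 0")
      case False
      then show ?thesis using True \<open>0 \<le> D\<close> by (simp add: ennreal_mult_top)
    next
      case D: True
      show ?thesis using True D
        by (cases I) (auto simp: ennreal_eq_0_iff powr_eq_0_iff)
    qed
  next
    case False
    then obtain j where j: "J = ennreal j" "0 \<le> j" by (cases J) auto
    show "((if I = \<infinity> then \<infinity> else ennreal (enn2real I powr (1 / p))) \<le> ennreal D * (if J = \<infinity> then \<infinity> else ennreal (enn2real J powr (1 / p)))) = (I \<le> ennreal (D powr p) * J)"
    proof (cases "I = \<infinity>")
      case True
      then show ?thesis using j by (simp add: ennreal_mult_eq_top_iff top_unique)
    next
      case False
      then obtain i where i: "I = ennreal i" "0 \<le> i" by (cases I) auto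
      have "i powr (1 / p) \<le> D * j powr (1 / p) \<longleftrightarrow> i \<le> D powr p * j"
      proof
        assume "i powr (1 / p) \<le> D * j powr (1 / p)"
        then have "(i powr (1 / p)) powr p \<le> (D * j powr (1 / p)) powr p"
          using assms by (intro powr_mono2) auto
        then show "i \<le> D powr p * j" using assms i j by (simp add: powr_powr powr_mult)
      next
        assume "i \<le> D powr p * j"
        then have "i powr (1 / p) \<le> (D powr p * j) powr (1 / p)"
          using assms i by (intro powr_mono2) auto
        then show "i powr (1 / p) \<le> D * j powr (1 / p)" using assms i j by (simp add: powr_powr powr_mult)
      qed
      then show ?thesis using i j assms by (simp add: ennreal_mult[symmetric])
    qed
  qed
qed

lemma Lp_norm_finite_iff: "Lp_norm p M V f < \<infinity> \<longleftrightarrow> (\<integral>\<^sup>+x. ennreal (qnorm V (f x) powr p) \<partial>M) < \<infinity>"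
  by (auto simp: Lp_norm_def Let_def less_top)

lemma vimage_algebra_UNIV_sets:
  "sets (vimage_algebra UNIV f (count_space UNIV)) = {f -` A |A. True}"
  by (auto simp: sets_vimage_algebra2)

context f_normed_double
begin

text \<open>The pair of a path and its copies takes finitely many values, so its law can be
  transported to \<open>'w\<close>. The resulting \<open>pmf\<close> measures all sets and is
  complete. With the filtration generated by the path alone, the copies become a decoupled tangent
  sequence.\<close>

lemma tree_inequality_if_decoupling_bound:
  fixes K :: "'c list \<Rightarrow> 'c pmf"
  assumes inf: "(UNIV :: real set) \<lesssim> (UNIV :: 'w set)"
    and bound: "decoupling_bound TYPE('w) V p D" and p: "0 < p"
    and fin: "\<And>h. finite (set_pmf (K h))" and d: "range d \<subseteq> carrier V"
  shows "(\<integral>\<^sup>+h. ennreal (qnorm V (walk d h h) powr p) \<partial>paths K n) \<le>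
    ennreal (D powr p) * (\<integral>\<^sup>+h. \<integral>\<^sup>+bs. ennreal (qnorm V (walk d h bs) powr p) \<partial>copies K h \<partial>paths K n)"
proof (cases "n = 0")
  case True
  then show ?thesis using p qnorm_0_iff[of \<zero>] by simp
next
  case n: False
  define Q where "Q = bind_pmf (paths K n) (\<lambda>h. map_pmf (Pair h) (copies K h))"
  have "finite (set_pmf Q)"
    unfolding Q_def by (auto simp: set_bind_pmf intro!: finite_UN_I finite_imageI finite_paths finite_copies fin)
  then have "countable (set_pmf Q)" by (rule countable_finite)
  have nnQ: "(\<integral>\<^sup>+q. f q \<partial>Q) = (\<integral>\<^sup>+h. \<integral>\<^sup>+bs. f (h, bs) \<partial>copies K h \<partial>paths K n)" for f
    by (simp add: Q_def)
  obtain j :: "real \<Rightarrow> 'w" where j: "inj j" using inf unfolding lepoll_def by auto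
  define \<iota> where "\<iota> = j \<circ> real \<circ> to_nat_on (set_pmf Q)"
  have \<iota>: "inj_on \<iota> (set_pmf Q)"
    unfolding \<iota>_def by (rule comp_inj_on[OF inj_on_to_nat_on[OF \<open>countable (set_pmf Q)\<close>]])
      (rule inj_on_subset[OF inj_compose[OF j inj_of_nat]], simp)
  \<comment> \<open>Points outside the support decode to empty lists. They form a null set, but the
    sequences must be defined there too; hence the lengths \<open>n\<close> and 0 in
    \<open>len\<close> and the case distinctions on \<open>length (H w)\<close>.\<close>
  define dec where "dec = (\<lambda>w. if w \<in> \<iota> ` set_pmf Q then inv_into (set_pmf Q) \<iota> w else ([], []))"
  define P where "P = map_pmf \<iota> Q"
  have dec_\<iota>: "dec (\<iota> q) = q" if "q \<in> set_pmf Q" for q using that \<iota> by (simp add: dec_def)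
  have nnP: "(\<integral>\<^sup>+w. f (dec w) \<partial>P) = (\<integral>\<^sup>+h. \<integral>\<^sup>+bs. f (h, bs) \<partial>copies K h \<partial>paths K n)" for f :: "_ \<Rightarrow> ennreal"
  proof -
    have "(\<integral>\<^sup>+w. f (dec w) \<partial>P) = (\<integral>\<^sup>+q. f q \<partial>Q)"
      unfolding P_def by (simp, intro nn_integral_cong_AE AE_pmfI) (simp add: dec_\<iota>)
    then show ?thesis by (simp only: nnQ)
  qed
  define H where "H = (\<lambda>w. fst (dec w))"
  define Bs where "Bs = (\<lambda>w. snd (dec w))"
  have nnHB: "(\<integral>\<^sup>+w. \<phi> (H w) (Bs w) \<partial>P) = (\<integral>\<^sup>+h. \<integral>\<^sup>+bs. \<phi> h bs \<partial>copies K h \<partial>paths K n)" for \<phi> :: "_ \<Rightarrow> _ \<Rightarrow> ennreal"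
    using nnP[of "\<lambda>q. \<phi> (fst q) (snd q)"] by (simp add: H_def Bs_def)
  have nnH: "(\<integral>\<^sup>+w. \<phi> (H w) \<partial>P) = (\<integral>\<^sup>+h. \<phi> h \<partial>paths K n)" for \<phi> :: "_ \<Rightarrow> ennreal"
    using nnHB[of "\<lambda>h bs. \<phi> h"] by simp
  have decQ: "dec w \<in> set_pmf Q \<or> dec w = ([], [])" for w
    by (auto simp: dec_def inv_into_into)
  have len: "length (Bs w) = length (H w)" "length (H w) = n \<or> length (H w) = 0" for w
    using decQ[of w] by (auto simp: H_def Bs_def Q_def set_bind_pmf dest: length_paths length_copies)
  have lenn: "length (H w) \<le> n" for w using len(2)[of w] by auto
  have "range dec \<subseteq> insert ([], []) (set_pmf Q)" by (rule image_subsetI) (use decQ in blast)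
  then have "finite (range dec)" using \<open>finite (set_pmf Q)\<close> finite_subset by blast
  \<comment> \<open>Only the path enters the filtration, not the copies. At time 0 the generating
    map is constant, so \<open>F 0\<close> is trivial; from time \<open>n\<close> on the whole path
    is known.\<close>
  define F where "F = (\<lambda>k. vimage_algebra UNIV (\<lambda>w. recent k (H w)) (count_space UNIV))"
  have setsF: "sets (F k) = {(\<lambda>w. recent k (H w)) -` A |A. True}" for k
    unfolding F_def by (rule vimage_algebra_UNIV_sets)
  have spaceF: "space (F k) = UNIV" for k by (simp add: F_def)
  have measF: "(\<lambda>w. \<phi> (recent k (H w))) \<in> F k \<rightarrow>\<^sub>M L" if "\<And>h. \<phi> h \<in> space L" for \<phi> k and L :: "'z measure"
  proof (rule measurableI)
    show "\<phi> (recent k (H w)) \<in> space L" for w by (rule that)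
    show "(\<lambda>w. \<phi> (recent k (H w))) -` A \<inter> space (F k) \<in> sets (F k)" for A
      unfolding setsF spaceF by (rule CollectI, rule exI[of _ "\<phi> -` A"]) auto
  qed
  have M: "complete_filtered_prob_space (measure_pmf P) F"
    unfolding complete_filtered_prob_space_def
  proof (intro conjI allI)
    show "prob_space (measure_pmf P)" by (rule prob_space_measure_pmf)
    show "complete_measure (measure_pmf P)" by unfold_locales auto
    show "filtration (space (measure_pmf P)) F"
      unfolding filtration_def
    proof (intro conjI allI impI)
      fix i k :: nat assume "i \<le> k"
      show "sets (F i) \<subseteq> sets (F k)"
      proof
        fix E assume "E \<in> sets (F i)"
        then obtain A where "E = (\<lambda>w. recent i (H w)) -` A" unfolding setsF by auto
        then have "E = (\<lambda>w. recent k (H w)) -` (recent i -` A)"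
          using recent_recent[OF \<open>i \<le> k\<close>] by auto
        then show "E \<in> sets (F k)" unfolding setsF by blast
      qed
    qed (simp add: spaceF)
    show "subalgebra (measure_pmf P) (F k)" for k by (simp add: subalgebra_def spaceF)
    show "sets (F 0) = {{}, space (measure_pmf P)}"
      unfolding setsF by (auto simp: recent_0 vimage_const split: if_splits)
  qed
  have setsInf: "\<exists>A. E = H -` A" if "E \<in> sets (F_infinity (measure_pmf P) F)" for E
  proof -
    have "E \<in> sigma_sets UNIV (\<Union>k\<in>{1..}. sets (F k))" using that by (simp add: F_infinity_def)
    then show ?thesis
    proof induction
      case (Basic a)
      then obtain k A where "a = (\<lambda>w. recent k (H w)) -` A" by (auto simp: setsF)
      then have "a = H -` (recent k -` A)" by auto
      then show ?case by blast
    next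
      case Empty
      then show ?case by (intro exI[of _ "{}"]) simp
    next
      case (Compl a)
      then obtain A where "a = H -` A" by auto
      then show ?case by (intro exI[of _ "- A"]) auto
    next
      case (Union a)
      then obtain A where "\<And>i. a i = H -` A i" by metis
      then show ?case by (intro exI[of _ "\<Union>i. A i"]) auto
    qed
  qed
  have spaceInf: "space (F_infinity (measure_pmf P) F) = UNIV" by (simp add: F_infinity_def)
  have measInf: "(\<lambda>w. \<phi> (H w)) \<in> borel_measurable (F_infinity (measure_pmf P) F)" for \<phi> :: "_ \<Rightarrow> real"
  proof (rule measurableI)
    fix A :: "real set"
    have "(\<lambda>w. \<phi> (H w)) -` A \<in> sets (F n)"
      unfolding setsF using recent_all[OF lenn] by (intro CollectI exI[of _ "\<phi> -` A"]) auto
    then have "(\<lambda>w. \<phi> (H w)) -` A \<in> sigma_sets UNIV (\<Union>k\<in>{1..}. sets (F k))"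
      using n by (intro sigma_sets.Basic) (auto intro!: bexI[of _ n])
    then show "(\<lambda>w. \<phi> (H w)) -` A \<inter> space (F_infinity (measure_pmf P) F) \<in> sets (F_infinity (measure_pmf P) F)"
      by (simp add: F_infinity_def)
  qed simp
  have subF: "finite_measure_subalgebra (measure_pmf P) (F k)" for k
    by unfold_locales (simp add: subalgebra_def spaceF)
  have subInf: "finite_measure_subalgebra (measure_pmf P) (F_infinity (measure_pmf P) F)"
    by unfold_locales (simp add: subalgebra_def spaceInf)
  define f where "f = (\<lambda>k w. walk d (recent k (H w)) (recent k (H w)))"
  define g where "g = (\<lambda>k w. walk d (recent k (H w)) (recent k (Bs w)))"
  \<comment> \<open>The tree ends at time \<open>n\<close> while the sequences are indexed by all
    positive integers, so both differences are continued by zero.\<close>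
  define dd where "dd = (\<lambda>k w. if k \<le> length (H w) then d (recent k (H w)) else \<zero>)"
  define ee where "ee = (\<lambda>k w. if k \<le> length (H w) then d (hd (recent k (Bs w)) # recent (k - 1) (H w)) else \<zero>)"
  have fd: "f k w \<ominus> f (k - 1) w = dd k w" and ge: "g k w \<ominus> g (k - 1) w = ee k w" if k: "k \<ge> 1" for k w
  proof -
    obtain m where m: "k = Suc m" using k by (cases k) auto
    have "f k w \<ominus> f (k - 1) w = dd k w \<and> g k w \<ominus> g (k - 1) w = ee k w"
    proof (cases "k \<le> length (H w)")
      case True
      then have eq: "recent k (H w) = H w ! (length (H w) - Suc m) # recent m (H w)"
          "recent k (Bs w) = Bs w ! (length (H w) - Suc m) # recent m (Bs w)"
        using recent_Suc[of m "H w"] recent_Suc[of m "Bs w"] len(1)[of w] m by auto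
      show ?thesis
        unfolding f_def g_def dd_def ee_def using True m eq walk_closed[OF d] step_closed[OF d]
        by (auto intro!: add_minus_cancel')
    next
      case False
      then have "recent k (H w) = H w" "recent m (H w) = H w" "recent k (Bs w) = Bs w" "recent m (Bs w) = Bs w"
        using len(1)[of w] m by (auto intro!: recent_all)
      then show ?thesis unfolding f_def g_def dd_def ee_def using False m walk_closed[OF d] by (simp add: minus_self)
    qed
    then show "f k w \<ominus> f (k - 1) w = dd k w" "g k w \<ominus> g (k - 1) w = ee k w" by auto
  qed
  have ddc: "dd k w \<in> carrier V" and eec: "ee k w \<in> carrier V" and fc: "f k w \<in> carrier V" and gc: "g k w \<in> carrier V" for k w
    using walk_closed[OF d] step_closed[OF d] by (auto simp: dd_def ee_def f_def g_def)
  have svM: "separably_valued (measure_pmf P) V (\<lambda>w. \<phi> (dec w))" if "\<And>q. \<phi> q \<in> carrier V" for \<phi>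
    using that \<open>finite (range dec)\<close>
    by (intro separably_valued_countable_range)
      (auto simp: space_qborel image_image[symmetric] intro!: countable_finite measurable_qborelI)
  have rangeH: "finite (range H)" unfolding H_def using \<open>finite (range dec)\<close> by (simp flip: image_image[of fst dec UNIV])
  have svF: "separably_valued (F k) V (\<lambda>w. \<phi> (recent k (H w)))" if "\<And>h. \<phi> h \<in> carrier V" for \<phi> k
    using that rangeH
    by (intro separably_valued_countable_range measF)
      (auto simp: space_qborel spaceF image_image[symmetric, of "\<lambda>x. \<phi> (recent k x)" H UNIV] intro!: countable_finite)
  have adf: "adapted F V f" unfolding adapted_def f_def using walk_closed[OF d] by (intro allI impI svF)
  \<comment> \<open>The common value of both conditional probabilities: the law of the next step
    given the state, and the point mass at zero after the end of the path.\<close>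
  define \<rho> where "\<rho> = (\<lambda>k B h. if k \<le> length h then measure_pmf.prob (K (recent (k - 1) h)) {b. d (b # recent (k - 1) h) \<in> B}
      else indicator B \<zero>)"
  have \<rho>0: "0 \<le> \<rho> k B h" for k B h by (simp add: \<rho>_def)
  have condd: "AE w in P. conditional_prob P (F (k - 1)) (dd k -` B \<inter> space P) w = \<rho> k B (H w)"
    if k: "k \<ge> 1" and B: "B \<in> sets (qborel V)" for k B
  proof -
    \<comment> \<open>A version of \<open>\<rho>\<close> that depends on the state at time
      \<open>k - 1\<close> only. Comparing \<open>k\<close> with \<open>n\<close> instead of the
      length of the path makes it measurable for \<open>F (k - 1)\<close>; the two agree almost
      everywhere.\<close>
    define \<rho>' where "\<rho>' = (\<lambda>h. if k \<le> n then measure_pmf.prob (K h) {b. d (b # h) \<in> B} else indicator B \<zero>)"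
    have "AE w in P. conditional_prob P (F (k - 1)) (dd k -` B \<inter> space P) w = \<rho>' (recent (k - 1) (H w))"
    proof (rule conditional_prob_charact[OF subF])
      show "(\<lambda>w. \<rho>' (recent (k - 1) (H w))) \<in> borel_measurable (F (k - 1))" by (rule measF) simp
      fix E assume "E \<in> sets (F (k - 1))"
      then obtain A where E: "E = (\<lambda>w. recent (k - 1) (H w)) -` A" unfolding setsF by auto
      have "emeasure P (dd k -` B \<inter> space P \<inter> E) = (\<integral>\<^sup>+w. iv (dd k w \<in> B \<and> recent (k - 1) (H w) \<in> A) \<partial>P)"
        unfolding nn_integral_iv E by (auto simp: measure_pmf.emeasure_eq_measure intro!: arg_cong[where f = "measure_pmf.prob P"])
      also have "\<dots> = (\<integral>\<^sup>+h. iv ((if k \<le> length h then d (recent k h) else \<zero>) \<in> B \<and> recent (k - 1) h \<in> A) \<partial>paths K n)"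
        unfolding dd_def
        by (rule nnH[of "\<lambda>h. iv ((if k \<le> length h then d (recent k h) else \<zero>) \<in> B \<and> recent (k - 1) h \<in> A)"])
      also have "\<dots> = (\<integral>\<^sup>+h. iv ((if k \<le> n then d (recent k h) else \<zero>) \<in> B \<and> recent (k - 1) h \<in> A) \<partial>paths K n)"
        using length_paths[of _ K n] by (intro nn_integral_cong_AE AE_pmfI) simp
      also have "\<dots> = (\<integral>\<^sup>+h. ennreal (\<rho>' (recent (k - 1) h)) * iv (recent (k - 1) h \<in> A) \<partial>paths K n)"
      proof (cases "k \<le> n")
        case True
        obtain m where m: "k = Suc m" using k by (cases k) auto
        have "(\<integral>\<^sup>+h. iv (d (recent k h) \<in> B \<and> recent m h \<in> A) \<partial>paths K n) =
            (\<integral>\<^sup>+h. iv (d (recent k h) \<in> B \<and> recent m (recent k h) \<in> A) \<partial>paths K n)"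
          using m by (simp add: recent_recent)
        also have "\<dots> = (\<integral>\<^sup>+h. iv (d h \<in> B \<and> recent m h \<in> A) \<partial>paths K (Suc m))"
          using nn_integral_paths_recent[OF True, where K = K and f = "\<lambda>h. iv (d h \<in> B \<and> recent m h \<in> A)"] m by simp
        also have "\<dots> = (\<integral>\<^sup>+h. ennreal (\<rho>' h) * iv (h \<in> A) \<partial>paths K m)"
          unfolding nn_integral_paths_Suc
        proof (intro nn_integral_cong_AE AE_pmfI)
          fix h assume "h \<in> set_pmf (paths K m)"
          then have "recent m (b # h) = h" for b using length_paths[of h K m] by (simp add: recent_Cons recent_all)
          then have "(\<integral>\<^sup>+b. iv (d (b # h) \<in> B \<and> recent m (b # h) \<in> A) \<partial>K h) = (\<integral>\<^sup>+b. iv (d (b # h) \<in> B) * iv (h \<in> A) \<partial>K h)"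
            by (intro nn_integral_cong) auto
          also have "\<dots> = ennreal (\<rho>' h) * iv (h \<in> A)"
            using True by (subst nn_integral_multc) (auto simp: nn_integral_iv \<rho>'_def)
          finally show "(\<integral>\<^sup>+b. iv (d (b # h) \<in> B \<and> recent m (b # h) \<in> A) \<partial>K h) = ennreal (\<rho>' h) * iv (h \<in> A)" .
        qed
        also have "\<dots> = (\<integral>\<^sup>+h. ennreal (\<rho>' (recent m h)) * iv (recent m h \<in> A) \<partial>paths K n)"
          using nn_integral_paths_recent[where k = m and n = n and K = K and f = "\<lambda>h. ennreal (\<rho>' h) * iv (h \<in> A)"] True m by simp
        finally show ?thesis using True m by simp
      next
        case False
        then show ?thesis by (intro nn_integral_cong) (auto simp: \<rho>'_def)
      qed
      also have "\<dots> = (\<integral>\<^sup>+w. ennreal (\<rho>' (recent (k - 1) (H w))) * iv (recent (k - 1) (H w) \<in> A) \<partial>P)"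
        by (rule nnH[of "\<lambda>h. ennreal (\<rho>' (recent (k - 1) h)) * iv (recent (k - 1) h \<in> A)", symmetric])
      also have "\<dots> = (\<integral>\<^sup>+w\<in>E. ennreal (\<rho>' (recent (k - 1) (H w))) \<partial>P)"
        unfolding E by (intro nn_integral_cong) (auto simp: indicator_def)
      finally show "emeasure P (dd k -` B \<inter> space P \<inter> E) = (\<integral>\<^sup>+w\<in>E. ennreal (\<rho>' (recent (k - 1) (H w))) \<partial>P)" .
    qed (auto simp: \<rho>'_def)
    moreover have "AE w in P. length (H w) = n"
    proof (rule AE_pmfI)
      fix w assume "w \<in> set_pmf P"
      then obtain q where q: "q \<in> set_pmf Q" "w = \<iota> q" by (auto simp: P_def)
      then show "length (H w) = n" using dec_\<iota>[OF q(1)] by (auto simp: H_def Q_def set_bind_pmf dest: length_paths)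
    qed
    ultimately show ?thesis by eventually_elim (auto simp: \<rho>_def \<rho>'_def)
  qed
  \<comment> \<open>Stated for any finite set of times, so that singletons give the conditional law
    of one copy and initial segments give the product formula.\<close>
  have conde: "AE w in P. conditional_prob P (F_infinity P F) {w \<in> space P. \<forall>k\<in>I. ee k w \<in> B k} w = (\<Prod>k\<in>I. \<rho> k (B k) (H w))"
    if I: "finite I" "I \<subseteq> {1..}" for I B
  proof (rule conditional_prob_charact[OF subInf])
    show "(\<lambda>w. \<Prod>k\<in>I. \<rho> k (B k) (H w)) \<in> borel_measurable (F_infinity P F)" by (rule measInf)
    show "0 \<le> (\<Prod>k\<in>I. \<rho> k (B k) (H w))" for w by (intro prod_nonneg \<rho>0 ballI)
    have copy: "(\<integral>\<^sup>+bs. iv (\<forall>k\<in>I. (if k \<le> length h then d (hd (recent k bs) # recent (k - 1) h) else \<zero>) \<in> B k) \<partial>copies K h) =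
        ennreal (\<Prod>k\<in>I. \<rho> k (B k) h)" for h
    proof -
      let ?L = "{1..length h}"
      define R where "R = (\<lambda>k b. k \<in> I \<longrightarrow> d (b # recent (k - 1) h) \<in> B k)"
      have "(\<integral>\<^sup>+bs. iv (\<forall>k\<in>I. (if k \<le> length h then d (hd (recent k bs) # recent (k - 1) h) else \<zero>) \<in> B k) \<partial>copies K h) =
        (\<integral>\<^sup>+bs. iv (\<forall>k\<in>?L. R k (hd (recent k bs))) * iv (\<forall>k\<in>I - ?L. \<zero> \<in> B k) \<partial>copies K h)"
        using I by (intro nn_integral_cong) (auto simp: R_def)
      also have "\<dots> = (\<integral>\<^sup>+bs. iv (\<forall>k\<in>?L. R k (hd (recent k bs))) \<partial>copies K h) * iv (\<forall>k\<in>I - ?L. \<zero> \<in> B k)"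
        by (rule nn_integral_multc) simp
      also have "(\<integral>\<^sup>+bs. iv (\<forall>k\<in>?L. R k (hd (recent k bs))) \<partial>copies K h) = (\<Prod>k\<in>?L. \<integral>\<^sup>+b. iv (R k b) \<partial>K (recent (k - 1) h))"
        by (rule copies_product)
      also have "(\<Prod>k\<in>?L. \<integral>\<^sup>+b. iv (R k b) \<partial>K (recent (k - 1) h)) = (\<Prod>k\<in>I \<inter> ?L. \<integral>\<^sup>+b. iv (R k b) \<partial>K (recent (k - 1) h))"
      proof (rule prod.mono_neutral_right)
        show "\<forall>k\<in>?L - I \<inter> ?L. (\<integral>\<^sup>+b. iv (R k b) \<partial>K (recent (k - 1) h)) = 1"
        proof
          fix k assume "k \<in> ?L - I \<inter> ?L"
          then have "k \<notin> I" by blast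
          then show "(\<integral>\<^sup>+b. iv (R k b) \<partial>K (recent (k - 1) h)) = 1" by (simp add: R_def)
        qed
      qed auto
      also have "\<dots> = (\<Prod>k\<in>I \<inter> ?L. ennreal (\<rho> k (B k) h))"
        by (intro prod.cong refl) (auto simp: R_def \<rho>_def nn_integral_iv)
      also have "iv (\<forall>k\<in>I - ?L. \<zero> \<in> B k) = (\<Prod>k\<in>I - ?L. ennreal (\<rho> k (B k) h))"
      proof -
        have "(\<Prod>k\<in>I - ?L. ennreal (\<rho> k (B k) h)) = (\<Prod>k\<in>I - ?L. iv (\<zero> \<in> B k))"
          using I by (intro prod.cong refl) (auto simp: \<rho>_def indicator_def)
        also have "\<dots> = iv (\<forall>k\<in>I - ?L. \<zero> \<in> B k)"
          by (rule prod_iv) (use I(1) in simp)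
        finally show ?thesis by simp
      qed
      also have "(\<Prod>k\<in>I \<inter> ?L. ennreal (\<rho> k (B k) h)) * (\<Prod>k\<in>I - ?L. ennreal (\<rho> k (B k) h)) = (\<Prod>k\<in>I. ennreal (\<rho> k (B k) h))"
        using I(1) by (subst prod.union_disjoint[symmetric]) (auto simp: Int_Diff_Un)
      also have "\<dots> = ennreal (\<Prod>k\<in>I. \<rho> k (B k) h)" by (rule prod_ennreal) (rule \<rho>0)
      finally show ?thesis .
    qed
    fix E assume "E \<in> sets (F_infinity P F)"
    then obtain A where E: "E = H -` A" using setsInf by auto
    have "emeasure P ({w \<in> space P. \<forall>k\<in>I. ee k w \<in> B k} \<inter> E) = (\<integral>\<^sup>+w. iv ((\<forall>k\<in>I. ee k w \<in> B k) \<and> H w \<in> A) \<partial>P)"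
      unfolding nn_integral_iv E by (auto simp: measure_pmf.emeasure_eq_measure intro!: arg_cong[where f = "measure_pmf.prob P"])
    also have "\<dots> = (\<integral>\<^sup>+h. \<integral>\<^sup>+bs. iv ((\<forall>k\<in>I. (if k \<le> length h then d (hd (recent k bs) # recent (k - 1) h) else \<zero>) \<in> B k) \<and> h \<in> A) \<partial>copies K h \<partial>paths K n)"
      unfolding ee_def
      by (rule nnHB[of "\<lambda>h bs. iv ((\<forall>k\<in>I. (if k \<le> length h then d (hd (recent k bs) # recent (k - 1) h) else \<zero>) \<in> B k) \<and> h \<in> A)"])
    also have "\<dots> = (\<integral>\<^sup>+h. ennreal (\<Prod>k\<in>I. \<rho> k (B k) h) * iv (h \<in> A) \<partial>paths K n)"
    proof (intro nn_integral_cong)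
      fix h
      show "(\<integral>\<^sup>+bs. iv ((\<forall>k\<in>I. (if k \<le> length h then d (hd (recent k bs) # recent (k - 1) h) else \<zero>) \<in> B k) \<and> h \<in> A) \<partial>copies K h) =
          ennreal (\<Prod>k\<in>I. \<rho> k (B k) h) * iv (h \<in> A)"
        unfolding copy[symmetric] by (cases "h \<in> A") (simp_all cong: if_cong)
    qed
    also have "\<dots> = (\<integral>\<^sup>+w. ennreal (\<Prod>k\<in>I. \<rho> k (B k) (H w)) * iv (H w \<in> A) \<partial>P)"
      by (rule nnH[of "\<lambda>h. ennreal (\<Prod>k\<in>I. \<rho> k (B k) h) * iv (h \<in> A)", symmetric])
    also have "\<dots> = (\<integral>\<^sup>+w\<in>E. ennreal (\<Prod>k\<in>I. \<rho> k (B k) (H w)) \<partial>P)"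
      unfolding E by (intro nn_integral_cong) (auto simp: indicator_def)
    finally show "emeasure P ({w \<in> space P. \<forall>k\<in>I. ee k w \<in> B k} \<inter> E) = (\<integral>\<^sup>+w\<in>E. ennreal (\<Prod>k\<in>I. \<rho> k (B k) (H w)) \<partial>P)" .
  qed simp
  have conde1: "AE w in P. conditional_prob P (F_infinity P F) (ee k -` B \<inter> space P) w = \<rho> k B (H w)" if "k \<ge> 1" for k B
  proof -
    have "ee k -` B \<inter> space P = {w \<in> space P. \<forall>i\<in>{k}. ee i w \<in> B}" by auto
    then show ?thesis using conde[of "{k}" "\<lambda>_. B"] that by simp
  qed
  have svg: "separably_valued P V (g k)" for k
    unfolding g_def H_def Bs_def
    by (rule svM[of "\<lambda>q. walk d (recent k (fst q)) (recent k (snd q))"]) (rule walk_closed[OF d])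
  have sve: "separably_valued P V (ee k)" for k
    unfolding ee_def H_def Bs_def
    by (rule svM[of "\<lambda>q. if k \<le> length (fst q) then d (hd (recent k (snd q)) # recent (k - 1) (fst q)) else \<zero>"])
      (simp add: step_closed[OF d])
  have tang: "decoupled_tangent P F V dd ee"
    unfolding decoupled_tangent_def
  proof (intro conjI allI impI ballI)
    show "adapted F V dd"
      unfolding adapted_def
    proof (intro allI impI)
      fix k :: nat assume k: "1 \<le> k"
      have eq: "dd k = (\<lambda>w. (\<lambda>h. if length h = k then d h else \<zero>) (recent k (H w)))"
        unfolding dd_def recent_def by (auto simp: fun_eq_iff)
      show "separably_valued (F k) V (dd k)"
        unfolding eq by (rule svF[of "\<lambda>h. if length h = k then d h else \<zero>"]) (simp add: step_closed[OF d])
    qed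
    show "separably_valued P V (ee k)" for k by (rule sve)
    fix k :: nat assume k: "1 \<le> k"
    show "AE w in P. conditional_prob P (F (k - 1)) (dd k -` B \<inter> space P) w =
        conditional_prob P (F_infinity P F) (ee k -` B \<inter> space P) w" if "B \<in> sets (qborel V)" for B
      using condd[OF k that] conde1[OF k, of B] by eventually_elim simp
    fix B assume "\<forall>i\<in>{1..k}. B i \<in> sets (qborel V)"
    have "AE w in P. \<forall>i\<in>{1..k}. conditional_prob P (F_infinity P F) (ee i -` B i \<inter> space P) w = \<rho> i (B i) (H w)"
      using conde1 by (intro AE_finite_allI) auto
    moreover have "AE w in P. conditional_prob P (F_infinity P F) {w \<in> space P. \<forall>i\<in>{1..k}. ee i w \<in> B i} w =
        (\<Prod>i\<in>{1..k}. \<rho> i (B i) (H w))" by (rule conde) auto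
    ultimately show "AE w in P. conditional_prob P (F_infinity P F) {w \<in> space P. \<forall>i\<in>{1..k}. ee i w \<in> B i} w =
        (\<Prod>i\<in>{1..k}. conditional_prob P (F_infinity P F) (ee i -` B i \<inter> space P) w)"
      by eventually_elim simp
  qed
  have zero: "f 0 = (\<lambda>w. \<zero>)" "g 0 = (\<lambda>w. \<zero>)" by (auto simp: f_def g_def recent_0)
  have dsum: "decoupled_sum P F V f g"
  proof -
    have "decoupled_tangent P F V (\<lambda>k w. f k w \<ominus> f (k - 1) w) (\<lambda>k w. g k w \<ominus> g (k - 1) w)"
      by (rule decoupled_tangent_transfer[OF M tang]) (use fd ge in auto)
    then show ?thesis unfolding decoupled_sum_def using adf svg zero by blast
  qed
  have "finite (set_pmf P)" using \<open>finite (set_pmf Q)\<close> by (simp add: P_def)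
  then have finite_norm: "Lp_norm p P V (f k) < \<infinity>" for k
    unfolding Lp_norm_finite_iff by (intro nn_integral_pmf_finite) auto
  have "Lp_norm p P V (f n) \<le> ennreal D * Lp_norm p P V (g n)"
    using bound M dsum finite_norm n unfolding decoupling_bound_def by auto
  moreover have "0 \<le> D" using bound by (simp add: decoupling_bound_def)
  ultimately have "(\<integral>\<^sup>+w. ennreal (qnorm V (f n w) powr p) \<partial>P) \<le> ennreal (D powr p) * (\<integral>\<^sup>+w. ennreal (qnorm V (g n w) powr p) \<partial>P)"
    using Lp_norm_le_iff[OF p] by blast
  moreover have "(\<integral>\<^sup>+w. ennreal (qnorm V (f n w) powr p) \<partial>P) = (\<integral>\<^sup>+h. ennreal (qnorm V (walk d h h) powr p) \<partial>paths K n)"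
    using nnH[of "\<lambda>h. ennreal (qnorm V (walk d h h) powr p)"] recent_all[OF lenn]
    by (simp add: f_def)
  moreover have "(\<integral>\<^sup>+w. ennreal (qnorm V (g n w) powr p) \<partial>P) = (\<integral>\<^sup>+h. \<integral>\<^sup>+bs. ennreal (qnorm V (walk d h bs) powr p) \<partial>copies K h \<partial>paths K n)"
    using nnHB[of "\<lambda>h bs. ennreal (qnorm V (walk d h bs) powr p)"] lenn len(1)
    by (simp add: g_def recent_all)
  ultimately show ?thesis by simp
qed

end

section \<open>Approximation by trees\<close>

text \<open>A conditional probability lies in the unit interval only almost everywhere. This version
  does so everywhere, which makes its rounding finite-valued without exceptional sets.\<close>

definition cond_prob01 :: "'w measure \<Rightarrow> 'w measure \<Rightarrow> 'w set \<Rightarrow> 'w \<Rightarrow> real" where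
  "cond_prob01 M G A \<omega> = max 0 (min 1 (conditional_prob M G A \<omega>))"

lemma cond_prob01_bounds: "0 \<le> cond_prob01 M G A \<omega>" "cond_prob01 M G A \<omega> \<le> 1"
  by (auto simp: cond_prob01_def)

lemma cond_prob01_measurable [measurable]: "cond_prob01 M G A \<in> borel_measurable G"
  unfolding cond_prob01_def conditional_prob_def by measurable

lemma cond_prob01:
  assumes "finite_measure_subalgebra M G" and A: "A \<in> sets M"
  shows "AE \<omega> in M. cond_prob01 M G A \<omega> = conditional_prob M G A \<omega>"
    and "E \<in> sets G \<Longrightarrow> emeasure M (A \<inter> E) = (\<integral>\<^sup>+\<omega>\<in>E. ennreal (cond_prob01 M G A \<omega>) \<partial>M)"
proof -
  interpret finite_measure_subalgebra M G by fact
  have int: "integrable M (indicator A :: _ \<Rightarrow> real)"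
    by (rule integrable_const_bound[where B = 1]) (use A in \<open>auto simp: indicator_def\<close>)
  have "AE \<omega> in M. 0 \<le> conditional_prob M G A \<omega>"
    unfolding conditional_prob_def using A by (intro real_cond_exp_pos) auto
  moreover have "AE \<omega> in M. conditional_prob M G A \<omega> \<le> real_cond_exp M G (\<lambda>_. 1) \<omega>"
    unfolding conditional_prob_def using int by (intro real_cond_exp_mono) (auto simp: indicator_def)
  moreover have "AE \<omega> in M. real_cond_exp M G (\<lambda>_. 1) \<omega> = 1"
    by (rule real_cond_exp_F_meas) auto
  ultimately show AE: "AE \<omega> in M. cond_prob01 M G A \<omega> = conditional_prob M G A \<omega>"
    by eventually_elim (auto simp: cond_prob01_def)
  assume E: "E \<in> sets G"
  then have EM: "E \<in> sets M" using subalg by (auto simp: subalgebra_def)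
  have [measurable]: "cond_prob01 M G A \<in> borel_measurable M"
    by (rule measurable_from_subalg[OF subalg]) measurable
  have int1: "integrable M (cond_prob01 M G A)"
    by (rule integrable_const_bound[where B = 1]) (auto simp: cond_prob01_bounds)
  have "(\<integral>\<omega>\<in>E. indicator A \<omega> \<partial>M) = (\<integral>\<omega>\<in>E. conditional_prob M G A \<omega> \<partial>M)"
    unfolding conditional_prob_def by (rule real_cond_exp_intA[OF int E])
  also have "\<dots> = (\<integral>\<omega>\<in>E. cond_prob01 M G A \<omega> \<partial>M)"
    unfolding set_lebesgue_integral_def conditional_prob_def
    using AE EM by (intro integral_cong_AE) (auto simp: conditional_prob_def)
  also have "(\<integral>\<omega>\<in>E. indicator A \<omega> \<partial>M) = measure M (A \<inter> E)"
    unfolding set_lebesgue_integral_def using A EM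
    by (simp add: indicator_inter_arith[symmetric] Int_commute)
  finally have eq: "measure M (A \<inter> E) = (\<integral>\<omega>\<in>E. cond_prob01 M G A \<omega> \<partial>M)" .
  have "(\<integral>\<^sup>+\<omega>\<in>E. ennreal (cond_prob01 M G A \<omega>) \<partial>M) = (\<integral>\<^sup>+\<omega>. ennreal (indicator E \<omega> * cond_prob01 M G A \<omega>) \<partial>M)"
    by (intro nn_integral_cong) (auto simp: indicator_def)
  also have "\<dots> = ennreal (\<integral>\<omega>. indicator E \<omega> * cond_prob01 M G A \<omega> \<partial>M)"
    using int1 EM integrable_mult_indicator[OF EM int1]
    by (intro nn_integral_eq_integral) (auto simp: cond_prob01_bounds)
  also have "\<dots> = ennreal (measure M (A \<inter> E))"
    unfolding eq by (simp add: set_lebesgue_integral_def)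
  finally show "emeasure M (A \<inter> E) = (\<integral>\<^sup>+\<omega>\<in>E. ennreal (cond_prob01 M G A \<omega>) \<partial>M)"
    by (simp add: emeasure_eq_measure)
qed

text \<open>There are finitely many values, so those of mass zero form a null set and the law is
  discrete.\<close>

lemma (in prob_space) simple_function_pmf:
  assumes X: "simple_function M X"
  shows "\<exists>Q. measure_pmf Q = distr M (count_space UNIV) X"
proof -
  let ?D = "distr M (count_space UNIV) X"
  have Xm: "X \<in> M \<rightarrow>\<^sub>M count_space UNIV" using X by (rule measurable_simple_function)
  interpret D: prob_space ?D using Xm by (rule prob_space_distr)
  have fin: "finite (X ` space M)" using X by (rule simple_functionD)
  let ?Z = "{x \<in> X ` space M. measure ?D {x} = 0}"
  have "AE x in ?D. x \<notin> ?Z"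
  proof (rule AE_not_in)
    show "?Z \<in> null_sets ?D"
    proof
      have "emeasure ?D ?Z \<le> (\<Sum>x\<in>?Z. emeasure ?D {x})"
      proof -
        have "emeasure ?D (\<Union>x\<in>?Z. {x}) \<le> (\<Sum>x\<in>?Z. emeasure ?D {x})"
          using fin by (intro emeasure_subadditive_finite) auto
        then show ?thesis by simp
      qed
      also have "\<dots> = 0" by (simp add: D.emeasure_eq_measure)
      finally show "emeasure ?D ?Z = 0" by simp
    qed simp
  qed
  moreover have "AE x in ?D. x \<in> X ` space M"
    using Xm by (subst AE_distr_iff) auto
  ultimately have "AE x in ?D. measure ?D {x} \<noteq> 0" by eventually_elim auto
  then have "measure_pmf (Abs_pmf ?D) = ?D"
    by (intro Abs_pmf_inverse) (simp add: D.prob_space_axioms)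
  then show ?thesis by blast
qed

lemma simple_function_subalgebra: "subalgebra M G \<Longrightarrow> simple_function G f \<Longrightarrow> simple_function M f"
  unfolding simple_function_def subalgebra_def by auto

lemma simple_function_map:
  "(\<And>x. x \<in> set xs \<Longrightarrow> simple_function G (\<lambda>\<omega>. f x \<omega>)) \<Longrightarrow> simple_function G (\<lambda>\<omega>. map (\<lambda>x. f x \<omega>) xs)"
  by (induction xs) (auto intro: simple_function_compose2)

lemma borel_measurable_trivial_const:
  fixes f :: "'a \<Rightarrow> real"
  assumes "f \<in> borel_measurable G" "sets G = {{}, space G}" "x \<in> space G" "y \<in> space G"
  shows "f x = f y"
proof -
  have "f -` {f x} \<inter> space G \<in> sets G" using assms(1) by (intro measurable_sets) auto
  then have "f -` {f x} \<inter> space G = {} \<or> f -` {f x} \<inter> space G = space G"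
    by (simp only: assms(2) insert_iff empty_iff simp_thms)
  moreover have "x \<in> f -` {f x} \<inter> space G" using assms(3) by simp
  ultimately have "f -` {f x} \<inter> space G = space G" by (metis empty_iff)
  then have "y \<in> f -` {f x}" using assms(4) by blast
  then show ?thesis by simp
qed

text \<open>A one-sided comparison suffices, since it serves to bound the decoupled moment of the
  approximating tree from above.\<close>

lemma prod_le_add:
  fixes p a :: "'i \<Rightarrow> real"
  assumes "finite I" "\<And>i. i \<in> I \<Longrightarrow> 0 \<le> p i \<and> p i \<le> 1 \<and> 0 \<le> a i \<and> a i \<le> 1 \<and> a i \<le> p i + \<delta>" "0 \<le> \<delta>"
  shows "(\<Prod>i\<in>I. a i) \<le> (\<Prod>i\<in>I. p i) + real (card I) * \<delta>"
  using assms
proof (induction I)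
  case (insert i I)
  have p: "0 \<le> (\<Prod>i\<in>I. p i)" "(\<Prod>i\<in>I. p i) \<le> 1" and a: "0 \<le> (\<Prod>i\<in>I. a i)" "(\<Prod>i\<in>I. a i) \<le> 1"
    using insert by (auto intro!: prod_nonneg prod_le_1)
  have "a i * (\<Prod>i\<in>I. a i) \<le> (p i + \<delta>) * (\<Prod>i\<in>I. a i)"
    using insert a by (intro mult_right_mono) auto
  also have "\<dots> \<le> p i * (\<Prod>i\<in>I. a i) + \<delta>"
    using a \<open>0 \<le> \<delta>\<close> by (simp add: distrib_right mult_left_le)
  also have "p i * (\<Prod>i\<in>I. a i) \<le> p i * ((\<Prod>i\<in>I. p i) + real (card I) * \<delta>)"
    using insert by (intro mult_left_mono) auto
  also have "\<dots> \<le> p i * (\<Prod>i\<in>I. p i) + real (card I) * \<delta>"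
    using insert by (simp add: distrib_left mult_left_le_one_le)
  finally show ?case using insert by (simp add: algebra_simps)
qed simp

lemma (in prob_space) finite_measure_subalgebraI:
  "subalgebra M G \<Longrightarrow> finite_measure_subalgebra M G"
  by unfold_locales

lemma subalgebra_F_infinity:
  assumes "complete_filtered_prob_space M F"
  shows "subalgebra M (F_infinity M F)" "\<And>k. k \<ge> 1 \<Longrightarrow> subalgebra (F_infinity M F) (F k)"
proof -
  note D = complete_filtered_prob_spaceD[OF assms]
  have sub: "sets (F k) \<subseteq> sets M" for k using D(2)[of k] by (simp add: subalgebra_def)
  have "(\<Union>k\<in>{1..}. sets (F k)) \<subseteq> Pow (space M)" using sub sets.sets_into_space by blast
  then have sets: "sets (F_infinity M F) = sigma_sets (space M) (\<Union>k\<in>{1..}. sets (F k))"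
    and sp: "space (F_infinity M F) = space M"
    by (auto simp: F_infinity_def)
  show "subalgebra M (F_infinity M F)"
    unfolding subalgebra_def sets sp using sub by (auto intro!: sets.sigma_sets_subset)
  show "subalgebra (F_infinity M F) (F k)" if "k \<ge> 1" for k
    unfolding subalgebra_def sets sp using that D(3) by (auto intro!: sigma_sets.Basic)
qed

context f_normed_double
begin

lemma singleton_sets_qborel: "x \<in> carrier V \<Longrightarrow> {x} \<in> sets (qborel V)"
proof -
  assume x: "x \<in> carrier V"
  have "openin (qtopology V) (carrier V - {x})"
    unfolding openin_qtopology_N
  proof (intro conjI ballI)
    fix y assume y: "y \<in> carrier V - {x}"
    have "x \<ominus> y \<noteq> \<zero>" using y x add_minus_cancel[of x y] by auto
    then have "N (x \<ominus> y) \<noteq> 0" using N_eq_0D x y by blast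
    then have "0 < N (x \<ominus> y)" using N_nonneg[of "x \<ominus> y"] x y by simp
    then show "\<exists>e>0. nball y e \<subseteq> carrier V - {x}"
      by (intro exI[of _ "N (x \<ominus> y)"]) (auto simp: nball_def)
  qed auto
  then have "carrier V - {x} \<in> sets (qborel V)" by (rule openin_sets_qborel)
  then have "space (qborel V) - (carrier V - {x}) \<in> sets (qborel V)" by (rule sets.compl_sets)
  moreover have "space (qborel V) - (carrier V - {x}) = {x}" using x by (auto simp: space_qborel)
  ultimately show ?thesis by simp
qed

primrec vsum :: "(nat \<Rightarrow> 'a) \<Rightarrow> nat \<Rightarrow> 'a" where
  "vsum x 0 = \<zero>"
| "vsum x (Suc n) = vsum x n \<oplus> x (Suc n)"

lemma vsum_cong: "(\<And>k. k \<in> {1..n} \<Longrightarrow> x k = y k) \<Longrightarrow> vsum x n = vsum y n"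
  by (induction n) auto

lemma vsum_closed: "(\<And>k. k \<in> {1..n} \<Longrightarrow> x k \<in> carrier V) \<Longrightarrow> vsum x n \<in> carrier V"
  by (induction n) auto

text \<open>Exactly one tuple of values matches \<open>y\<close>; extensionality of the functions in
  \<open>PiE\<close> makes it unique. Moments thereby become finite sums weighted by joint
  probabilities of the steps.\<close>

lemma vsum_decompose:
  fixes \<Phi> :: "'a \<Rightarrow> ennreal"
  assumes "finite W" "\<And>k. k \<in> {1..n} \<Longrightarrow> y k \<in> W"
  shows "\<Phi> (vsum y n) = (\<Sum>x\<in>{1..n} \<rightarrow>\<^sub>E W. iv (\<forall>k\<in>{1..n}. y k = x k) * \<Phi> (vsum x n))"
proof -
  have fin: "finite ({1..n} \<rightarrow>\<^sub>E W)" using assms(1) by (intro finite_PiE) auto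
  let ?y = "restrict y {1..n}"
  have y: "?y \<in> {1..n} \<rightarrow>\<^sub>E W" using assms(2) by auto
  have "(\<Sum>x\<in>{1..n} \<rightarrow>\<^sub>E W. iv (\<forall>k\<in>{1..n}. y k = x k) * \<Phi> (vsum x n)) =
      (\<Sum>x\<in>{1..n} \<rightarrow>\<^sub>E W. if x = ?y then \<Phi> (vsum y n) else 0)"
  proof (rule sum.cong[OF refl])
    fix x assume x: "x \<in> {1..n} \<rightarrow>\<^sub>E W"
    have "(\<forall>k\<in>{1..n}. y k = x k) \<longleftrightarrow> x = ?y"
      using x by (auto simp: fun_eq_iff PiE_def extensional_def restrict_def)
    moreover have "vsum ?y n = vsum y n" by (rule vsum_cong) simp
    ultimately show "iv (\<forall>k\<in>{1..n}. y k = x k) * \<Phi> (vsum x n) = (if x = ?y then \<Phi> (vsum y n) else 0)"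
      by simp
  qed
  also have "\<dots> = \<Phi> (vsum y n)" using fin y by simp
  finally show ?thesis by simp
qed

text \<open>
  The letters of the approximating tree are the current step together with the conditional
  probabilities of the values of the next step, rounded to multiples of \<open>1/m\<close>.
\<close>

lemma finite_valued_moment:
  fixes W :: "'a set" and C :: real and M :: "'w measure"
  assumes tree: "\<And>(K :: ('a \<times> nat list) list \<Rightarrow> ('a \<times> nat list) pmf) D n.
      \<lbrakk>\<And>h. finite (set_pmf (K h)); range D \<subseteq> carrier V\<rbrakk>
      \<Longrightarrow> process_moment K D n b \<le> ennreal C * decoupled_moment K D n b"
    and "0 \<le> C" "0 < b"
    and cf: "complete_filtered_prob_space M F" and tang: "decoupled_tangent M F V d e"
    and W: "finite W" "W \<subseteq> carrier V" "\<zero> \<in> W"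
    and dW: "\<And>k \<omega>. k \<ge> 1 \<Longrightarrow> \<omega> \<in> space M \<Longrightarrow> d k \<omega> \<in> W"
    and eW: "\<And>k \<omega>. k \<ge> 1 \<Longrightarrow> \<omega> \<in> space M \<Longrightarrow> e k \<omega> \<in> W"
  shows "(\<integral>\<^sup>+\<omega>. ennreal (N (vsum (\<lambda>k. d k \<omega>) n) powr b) \<partial>M) \<le>
    ennreal C * (\<integral>\<^sup>+\<omega>. ennreal (N (vsum (\<lambda>k. e k \<omega>) n) powr b) \<partial>M)"
proof (cases "n = 0")
  case True
  then show ?thesis using \<open>0 < b\<close> by (simp add: N_zero)
next
  case False
  then have n: "1 \<le> n" by simp
  note cfD = complete_filtered_prob_spaceD[OF cf]
  interpret prob_space M by (rule cfD)
  have subF: "finite_measure_subalgebra M (F k)" for k by (intro finite_measure_subalgebraI cfD)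
  let ?I = "F_infinity M F"
  have subI: "finite_measure_subalgebra M ?I"
    by (intro finite_measure_subalgebraI subalgebra_F_infinity[OF cf])
  have setsF: "E \<in> sets M" if "E \<in> sets (F k)" for E k using cfD(2)[of k] that by (auto simp: subalgebra_def)
  have dF: "d k \<in> F k \<rightarrow>\<^sub>M qborel V" and eM: "e k \<in> M \<rightarrow>\<^sub>M qborel V" if "k \<ge> 1" for k
    using tang that separably_valued_measurable unfolding decoupled_tangent_def adapted_def by blast+
  have dset: "d k -` {x} \<inter> space M \<in> sets (F k)" and eset: "e k -` {x} \<inter> space M \<in> sets M"
    if "k \<ge> 1" "x \<in> W" for k x
    using measurable_sets[OF dF[OF that(1)] singleton_sets_qborel[of x]]
      measurable_sets[OF eM[OF that(1)] singleton_sets_qborel[of x]] that W cfD(3) by auto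
  define p where "p = (\<lambda>k x. cond_prob01 M (F (k - 1)) (d k -` {x} \<inter> space M))"
  have p01: "0 \<le> p k x \<omega>" "p k x \<omega> \<le> 1" for k x \<omega> by (auto simp: p_def cond_prob01_bounds)
  have pF: "p k x \<in> borel_measurable (F (k - 1))" for k x by (simp add: p_def cond_prob01_measurable)
  have pM [measurable]: "p k x \<in> borel_measurable M" for k x
    using pF cfD(2) measurable_from_subalg by blast
  have pint: "emeasure M (d k -` {x} \<inter> space M \<inter> E) = (\<integral>\<^sup>+\<omega>\<in>E. ennreal (p k x \<omega>) \<partial>M)"
    if "k \<ge> 1" "x \<in> W" "E \<in> sets (F (k - 1))" for k x E
    unfolding p_def using that by (intro cond_prob01(2)[OF subF] setsF[OF dset])
  \<comment> \<open>The product formula given \<open>F_infinity\<close>, followed by tangency factor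
    by factor, expresses the joint law of the copies through the predictable probabilities
    \<open>p\<close> of the original steps.\<close>
  have joint: "emeasure M {\<omega> \<in> space M. \<forall>k\<in>{1..n}. e k \<omega> = x k} = (\<integral>\<^sup>+\<omega>. ennreal (\<Prod>k\<in>{1..n}. p k (x k) \<omega>) \<partial>M)"
    if x: "x \<in> {1..n} \<rightarrow>\<^sub>E W" for x
  proof -
    have xW: "x k \<in> W" if "k \<in> {1..n}" for k using x that by auto
    let ?A = "{\<omega> \<in> space M. \<forall>k\<in>{1..n}. e k \<omega> = x k}"
    have "?A = space M \<inter> (\<Inter>k\<in>{1..n}. e k -` {x k} \<inter> space M)" using n by auto
    also have "\<dots> \<in> sets M"
      by (rule sets.Int[OF sets.top], rule sets.finite_INT) (use n eset xW in auto)
    finally have A: "?A \<in> sets M" .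
    have "AE \<omega> in M. \<forall>k\<in>{1..n}. p k (x k) \<omega> = conditional_prob M ?I (e k -` {x k} \<inter> space M) \<omega>"
    proof (intro AE_finite_allI)
      fix k assume k: "k \<in> {1..n}"
      have "AE \<omega> in M. p k (x k) \<omega> = conditional_prob M (F (k - 1)) (d k -` {x k} \<inter> space M) \<omega>"
        unfolding p_def using k xW by (intro cond_prob01(1)[OF subF] setsF[OF dset]) auto
      moreover have "AE \<omega> in M. conditional_prob M (F (k - 1)) (d k -` {x k} \<inter> space M) \<omega> =
          conditional_prob M ?I (e k -` {x k} \<inter> space M) \<omega>"
        using tang k xW[OF k] W singleton_sets_qborel[of "x k"] unfolding decoupled_tangent_def by auto
      ultimately show "AE \<omega> in M. p k (x k) \<omega> = conditional_prob M ?I (e k -` {x k} \<inter> space M) \<omega>"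
        by eventually_elim simp
    qed simp
    moreover have "AE \<omega> in M. conditional_prob M ?I {\<omega> \<in> space M. \<forall>k\<in>{1..n}. e k \<omega> \<in> {x k}} \<omega> =
        (\<Prod>k\<in>{1..n}. conditional_prob M ?I (e k -` {x k} \<inter> space M) \<omega>)"
    proof -
      have "\<forall>k\<in>{1..n}. {x k} \<in> sets (qborel V)"
        by (intro ballI singleton_sets_qborel subsetD[OF W(2)] xW)
      then show ?thesis using tang n unfolding decoupled_tangent_def by (elim conjE allE[of _ n] allE[of _ "\<lambda>k. {x k}"]) auto
    qed
    moreover have "AE \<omega> in M. cond_prob01 M ?I ?A \<omega> = conditional_prob M ?I ?A \<omega>" by (rule cond_prob01(1)[OF subI A])
    ultimately have AE: "AE \<omega> in M. cond_prob01 M ?I ?A \<omega> = (\<Prod>k\<in>{1..n}. p k (x k) \<omega>)"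
      by eventually_elim simp
    have "emeasure M ?A = emeasure M (?A \<inter> space M)" by (rule arg_cong[where f = "emeasure M"]) auto
    also have "\<dots> = (\<integral>\<^sup>+\<omega>\<in>space M. ennreal (cond_prob01 M ?I ?A \<omega>) \<partial>M)"
      using subalgebra_F_infinity(1)[OF cf] sets.top[of ?I] by (intro cond_prob01(2)[OF subI A]) (simp add: subalgebra_def)
    also have "\<dots> = (\<integral>\<^sup>+\<omega>. ennreal (\<Prod>k\<in>{1..n}. p k (x k) \<omega>) \<partial>M)"
      using AE by (intro nn_integral_cong_AE) auto
    finally show ?thesis .
  qed
  define X where "X = {1..n} \<rightarrow>\<^sub>E W"
  have finX: "finite X" unfolding X_def using W(1) by (intro finite_PiE) auto
  define \<Phi> where "\<Phi> = (\<lambda>x. ennreal (N (vsum x n) powr b))"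
  have e_moment: "(\<integral>\<^sup>+\<omega>. ennreal (N (vsum (\<lambda>k. e k \<omega>) n) powr b) \<partial>M) =
      (\<Sum>x\<in>X. (\<integral>\<^sup>+\<omega>. ennreal (\<Prod>k\<in>{1..n}. p k (x k) \<omega>) \<partial>M) * \<Phi> x)"
  proof -
    let ?A = "\<lambda>x. {\<omega> \<in> space M. \<forall>k\<in>{1..n}. e k \<omega> = x k}"
    have A: "?A x \<in> sets M" if "x \<in> X" for x
    proof -
      have "?A x = space M \<inter> (\<Inter>k\<in>{1..n}. e k -` {x k} \<inter> space M)" using n by auto
      also have "\<dots> \<in> sets M"
        by (rule sets.Int[OF sets.top], rule sets.finite_INT) (use n eset that in \<open>auto simp: X_def PiE_iff\<close>)
      finally show ?thesis .
    qed
    have "(\<integral>\<^sup>+\<omega>. ennreal (N (vsum (\<lambda>k. e k \<omega>) n) powr b) \<partial>M) =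
        (\<integral>\<^sup>+\<omega>. (\<Sum>x\<in>X. indicator (?A x) \<omega> * \<Phi> x) \<partial>M)"
    proof (intro nn_integral_cong)
      fix \<omega> assume \<omega>: "\<omega> \<in> space M"
      have "ennreal (N (vsum (\<lambda>k. e k \<omega>) n) powr b) = (\<Sum>x\<in>X. iv (\<forall>k\<in>{1..n}. e k \<omega> = x k) * \<Phi> x)"
        unfolding X_def \<Phi>_def using eW \<omega>
        by (intro vsum_decompose[OF W(1), of n "\<lambda>k. e k \<omega>" "\<lambda>v. ennreal (N v powr b)"]) auto
      also have "\<dots> = (\<Sum>x\<in>X. indicator (?A x) \<omega> * \<Phi> x)" using \<omega> by (intro sum.cong refl) (simp add: indicator_def)
      finally show "ennreal (N (vsum (\<lambda>k. e k \<omega>) n) powr b) = (\<Sum>x\<in>X. indicator (?A x) \<omega> * \<Phi> x)" .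
    qed
    also have "\<dots> = (\<Sum>x\<in>X. emeasure M (?A x) * \<Phi> x)"
      using A by (subst nn_integral_sum) (auto simp: nn_integral_multc)
    also have "\<dots> = (\<Sum>x\<in>X. (\<integral>\<^sup>+\<omega>. ennreal (\<Prod>k\<in>{1..n}. p k (x k) \<omega>) \<partial>M) * \<Phi> x)"
      by (intro sum.cong refl arg_cong2[where f = times] joint) (simp add: X_def)
    finally show ?thesis .
  qed
  obtain ws where ws: "set ws = W" using finite_list[OF W(1)] by blast
  define S where "S = (\<Sum>x\<in>X. \<Phi> x)"
  have S: "S < \<infinity>" unfolding S_def \<Phi>_def using finX by (auto simp: less_top)
  have approx: "(\<integral>\<^sup>+\<omega>. ennreal (N (vsum (\<lambda>k. d k \<omega>) n) powr b) \<partial>M) \<le>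
    ennreal C * ((\<integral>\<^sup>+\<omega>. ennreal (N (vsum (\<lambda>k. e k \<omega>) n) powr b) \<partial>M) + ennreal (real n / real m) * S)"
    if m: "m \<ge> 1" for m :: nat
  proof -
    define r where "r = (\<lambda>k \<omega>. map (\<lambda>x. nat \<lfloor>real m * p k x \<omega>\<rfloor>) ws)"
    \<comment> \<open>The letter at time k contains the step \<open>d k\<close> and the rounded law
      of the step at time k + 1, both known at time k. The law of the first step is not recorded,
      being constant because \<open>F 0\<close> is trivial.\<close>
    define hist where "hist = rec_nat (\<lambda>\<omega>. []) (\<lambda>k h \<omega>. (d (Suc k) \<omega>, r (Suc (Suc k)) \<omega>) # h \<omega>)"
    have hist: "hist 0 = (\<lambda>\<omega>. [])" "hist (Suc k) = (\<lambda>\<omega>. (d (Suc k) \<omega>, r (Suc (Suc k)) \<omega>) # hist k \<omega>)" for k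
      by (simp_all add: hist_def)
    have length_hist: "length (hist k \<omega>) = k" for k \<omega> by (induction k) (auto simp: hist)
    have recent_hist: "recent j (hist k \<omega>) = hist j \<omega>" if "j \<le> k" for j k \<omega>
      using that
    proof (induction k)
      case (Suc k)
      then show ?case
        by (cases "j = Suc k") (auto simp: recent_all length_hist hist(2)[of k] recent_Cons simp del: hist(2))
    qed (simp add: hist recent_def)
    have sfr: "simple_function (F k) (r (Suc k))" for k
      unfolding r_def
    proof (rule simple_function_map)
      fix x
      have [measurable]: "p (Suc k) x \<in> borel_measurable (F k)" using pF[of "Suc k" x] by simp
      have "(\<lambda>\<omega>. nat \<lfloor>real m * p (Suc k) x \<omega>\<rfloor>) \<in> F k \<rightarrow>\<^sub>M count_space UNIV" by measurable
      moreover have "nat \<lfloor>real m * p (Suc k) x \<omega>\<rfloor> \<le> m" for \<omega>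
      proof -
        have "real m * p (Suc k) x \<omega> \<le> real m" using p01(2)[of "Suc k" x \<omega>] by (simp add: mult_left_le)
        then have "\<lfloor>real m * p (Suc k) x \<omega>\<rfloor> \<le> int m" by linarith
        then show ?thesis by linarith
      qed
      then have "(\<lambda>\<omega>. nat \<lfloor>real m * p (Suc k) x \<omega>\<rfloor>) ` space (F k) \<subseteq> {..m}" by auto
      then have "finite ((\<lambda>\<omega>. nat \<lfloor>real m * p (Suc k) x \<omega>\<rfloor>) ` space (F k))" by (rule finite_subset) simp
      ultimately show "simple_function (F k) (\<lambda>\<omega>. nat \<lfloor>real m * p (Suc k) x \<omega>\<rfloor>)"
        by (simp add: simple_function_eq_measurable)
    qed
    have sfd: "simple_function (F k) (d k)" if "k \<ge> 1" for k
      unfolding simple_function_def cfD(3)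
    proof
      have "d k ` space M \<subseteq> W" using dW that by auto
      then show "finite (d k ` space M)" using W(1) finite_subset by blast
      show "\<forall>x\<in>d k ` space M. d k -` {x} \<inter> space M \<in> sets (F k)" using dset that dW by auto
    qed
    have sfh: "simple_function (F k) (hist k)" for k
    proof (induction k)
      case (Suc k)
      have "simple_function (F (Suc k)) (hist k)"
        by (rule simple_function_subalgebra[OF cfD(4) Suc]) simp
      moreover have "simple_function (F (Suc k)) (\<lambda>\<omega>. (d (Suc k) \<omega>, r (Suc (Suc k)) \<omega>))"
        by (intro simple_function_Pair sfd sfr) simp
      ultimately show ?case unfolding hist by (intro simple_function_compose2[where h = Cons])
    qed (simp add: hist)
    have sfhM: "simple_function M (hist k)" for k by (rule simple_function_subalgebra[OF cfD(2) sfh])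
    have "\<forall>k. \<exists>Q. measure_pmf Q = distr M (count_space UNIV) (hist k)" using simple_function_pmf[OF sfhM] by blast
    then obtain Q where Q: "\<And>k. measure_pmf (Q k) = distr M (count_space UNIV) (hist k)" by metis
    have histm: "hist k \<in> M \<rightarrow>\<^sub>M count_space UNIV" for k by (rule measurable_simple_function[OF sfhM])
    have law: "(\<integral>\<^sup>+h. g h \<partial>Q k) = (\<integral>\<^sup>+\<omega>. g (hist k \<omega>) \<partial>M)" for g :: "_ \<Rightarrow> ennreal" and k
      unfolding Q by (rule nn_integral_distr[OF histm]) simp
    have lawp: "ennreal (measure_pmf.prob (Q k) {h. R h}) = emeasure M {\<omega> \<in> space M. R (hist k \<omega>)}" for R k
      unfolding measure_pmf.emeasure_eq_measure[symmetric] unfolding Q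
      by (subst emeasure_distr[OF histm]) (auto intro!: arg_cong[where f = "emeasure M"])
    have hist_supp: "AE \<omega> in M. hist k \<omega> \<in> set_pmf (Q k)" for k
    proof -
      have "AE h in Q k. h \<in> set_pmf (Q k)" by (rule AE_pmfI)
      then show ?thesis unfolding Q by (subst (asm) AE_distr_iff[OF histm]) (auto simp flip: Q)
    qed
    have supp_hist: "\<exists>\<omega>\<in>space M. h = hist k \<omega>" if "h \<in> set_pmf (Q k)" for h k
    proof (rule ccontr)
      assume "\<not> (\<exists>\<omega>\<in>space M. h = hist k \<omega>)"
      then have emp: "{\<omega> \<in> space M. hist k \<omega> = h} = {}" by auto
      have "ennreal (measure_pmf.prob (Q k) {h'. h' = h}) = 0" unfolding lawp emp by simp
      then show False using that by (simp add: measure_pmf_single set_pmf_iff)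
    qed
    have finQ: "finite (set_pmf (Q k))" for k
    proof (rule finite_subset)
      show "set_pmf (Q k) \<subseteq> hist k ` space M" using supp_hist by auto
      show "finite (hist k ` space M)" using sfhM by (rule simple_functionD)
    qed
    have tlQ: "map_pmf tl (Q (Suc k)) = Q k" for k
    proof (rule pmf_eqI)
      fix h
      have "ennreal (pmf (map_pmf tl (Q (Suc k))) h) = ennreal (measure_pmf.prob (Q (Suc k)) {l. tl l = h})"
        by (simp add: pmf_map vimage_def)
      also have "\<dots> = ennreal (measure_pmf.prob (Q k) {l. l = h})" unfolding lawp by (simp add: hist)
      also have "\<dots> = ennreal (pmf (Q k) h)" by (simp add: measure_pmf_single)
      finally show "pmf (map_pmf tl (Q (Suc k))) h = pmf (Q k) h" by simp
    qed
    define cond where "cond = (\<lambda>h. cond_pmf (Q (Suc (length h))) {l. tl l = h})"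
    \<comment> \<open>The law of \<open>hist\<close> is disintegrated: outside its support the
      kernel is arbitrary, and on it consistency of the laws under \<open>tl\<close> makes
      \<open>paths K k\<close> the law of \<open>hist k\<close>.\<close>
    define K where "K = (\<lambda>h. if h \<in> set_pmf (Q (length h)) then map_pmf hd (cond h) else return_pmf undefined)"
    have lenQ: "length h = k" if "h \<in> set_pmf (Q k)" for h k using supp_hist[OF that] length_hist by auto
    have ne: "set_pmf (Q (Suc k)) \<inter> {l. tl l = h} \<noteq> {}" if "h \<in> set_pmf (Q k)" for h k
    proof -
      have "h \<in> tl ` set_pmf (Q (Suc k))" using that tlQ[of k] by (metis set_map_pmf)
      then show ?thesis by auto
    qed
    have finK: "finite (set_pmf (K h))" for h
    proof (cases "h \<in> set_pmf (Q (length h))")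
      case True
      then show ?thesis using finQ ne by (simp add: K_def cond_def)
    qed (simp add: K_def)
    have pathsQ: "paths K k = Q k" for k
    proof (induction k)
      case 0
      have "set_pmf (Q 0) \<subseteq> {[]}" using lenQ by auto
      then show ?case by (simp add: set_pmf_subset_singleton)
    next
      case (Suc k)
      have "paths K (Suc k) = bind_pmf (Q k) (\<lambda>h. map_pmf (\<lambda>a. a # h) (K h))" by (simp add: Suc)
      also have "\<dots> = bind_pmf (Q k) (\<lambda>h. cond_pmf (Q (Suc k)) {l. tl l = h})"
      proof (rule bind_pmf_cong[OF refl])
        fix h assume h: "h \<in> set_pmf (Q k)"
        have "map_pmf (\<lambda>a. a # h) (K h) = map_pmf (\<lambda>l. hd l # h) (cond_pmf (Q (Suc k)) {l. tl l = h})"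
          using h lenQ[OF h] by (simp add: K_def cond_def map_pmf_comp)
        also have "\<dots> = cond_pmf (Q (Suc k)) {l. tl l = h}"
        proof (rule map_pmf_idI)
          fix l assume "l \<in> set_pmf (cond_pmf (Q (Suc k)) {l. tl l = h})"
          then have l: "l \<in> set_pmf (Q (Suc k))" "tl l = h" using set_cond_pmf[OF ne[OF h]] by auto
          show "hd l # h = l" using lenQ[OF l(1)] l(2) by (cases l) auto
        qed
        finally show "map_pmf (\<lambda>a. a # h) (K h) = cond_pmf (Q (Suc k)) {l. tl l = h}" .
      qed
      also have "\<dots> = Q (Suc k)"
      proof (rule bind_cond_pmf_cancel)
        show "set_pmf (Q (Suc k)) \<inter> {l. tl l = h} \<noteq> {}" if "h \<in> set_pmf (Q k)" for h using ne[OF that] .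
        show "set_pmf (Q k) \<inter> {h. tl l = h} \<noteq> {}" if l: "l \<in> set_pmf (Q (Suc k))" for l
        proof -
          have "tl l \<in> set_pmf (map_pmf tl (Q (Suc k)))" using l by simp
          then show ?thesis unfolding tlQ by auto
        qed
        show "measure_pmf.prob (Q (Suc k)) {y. tl y = h} = measure_pmf.prob (Q k) {x. tl l = x}" if "tl l = h" for h l
        proof -
          have "measure_pmf.prob (Q k) {x. tl l = x} = measure_pmf.prob (map_pmf tl (Q (Suc k))) {h}"
            unfolding tlQ using that by (intro arg_cong[where f = "measure_pmf.prob (Q k)"]) auto
          also have "\<dots> = measure_pmf.prob (Q (Suc k)) {y. tl y = h}" by (simp add: vimage_def)
          finally show ?thesis by simp
        qed
      qed
      finally show ?case .
    qed
    \<comment> \<open>Letters such as \<open>undefined\<close> may carry a first component outside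
      \<open>W\<close>; they are read as zero, so that the steps of the tree take values in
      \<open>W\<close> without exception.\<close>
    define v where "v = (\<lambda>a :: 'a \<times> nat list. if fst a \<in> W then fst a else \<zero>)"
    have vW: "v a \<in> W" for a using W by (simp add: v_def)
    \<comment> \<open>Equal histories end with the same rounded law of the next step, so the
      unrounded probabilities differ by at most \<open>1 / real m\<close>. This is why the law is
      part of the letter.\<close>
    have close: "p (Suc k) x \<omega>' \<le> p (Suc k) x \<omega> + 1 / real m"
      if "\<omega> \<in> space M" "\<omega>' \<in> space M" "hist k \<omega> = hist k \<omega>'" "x \<in> W" for k x \<omega> \<omega>'
    proof (cases k)
      case 0
      have "p 1 x \<omega>' = p 1 x \<omega>"
        using pF[of 1 x] cfD(5) that cfD(3)[of 0] by (intro borel_measurable_trivial_const[of _ "F 0"]) auto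
      then show ?thesis using 0 by simp
    next
      case (Suc j)
      have "r (Suc k) \<omega> = r (Suc k) \<omega>'" using that(3) by (simp add: Suc hist)
      then have "nat \<lfloor>real m * p (Suc k) x \<omega>\<rfloor> = nat \<lfloor>real m * p (Suc k) x \<omega>'\<rfloor>"
        using that(4) ws by (auto simp: r_def)
      then have "\<lfloor>real m * p (Suc k) x \<omega>\<rfloor> = \<lfloor>real m * p (Suc k) x \<omega>'\<rfloor>"
        using p01 by (simp add: nat_eq_iff)
      then have "real m * p (Suc k) x \<omega>' \<le> real m * p (Suc k) x \<omega> + 1" by linarith
      then show ?thesis using m by (simp add: field_simps)
    qed
    \<comment> \<open>The transition probability of the tree averages \<open>p\<close> over the
      event that the history has the given value, and \<open>p\<close> hardly varies on that
      event.\<close>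
    have Kbound: "measure_pmf.prob (K (hist k \<omega>)) {a. v a = x} \<le> p (Suc k) x \<omega> + 1 / real m"
      if \<omega>: "\<omega> \<in> space M" "hist k \<omega> \<in> set_pmf (Q k)" and x: "x \<in> W" for k \<omega> x
    proof -
      let ?h = "hist k \<omega>" and ?c = "p (Suc k) x \<omega> + 1 / real m"
      let ?H = "{\<omega>' \<in> space M. hist k \<omega>' = ?h}"
      have c0: "0 \<le> ?c" using p01 by simp
      have HF: "?H \<in> sets (F k)"
      proof -
        have "hist k -` {?h} \<inter> space (F k) \<in> sets (F k)"
          by (rule measurable_sets[OF measurable_simple_function[OF sfh]]) simp
        moreover have "hist k -` {?h} \<inter> space (F k) = ?H" using cfD(3) by auto
        ultimately show ?thesis by simp
      qed
      have den: "ennreal (measure_pmf.prob (Q (Suc k)) {l. tl l = ?h}) = emeasure M ?H"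
        unfolding lawp by (simp add: hist)
      have "ennreal (measure_pmf.prob (Q (Suc k)) {l. tl l = ?h \<and> v (hd l) = x}) =
          emeasure M {\<omega>' \<in> space M. hist k \<omega>' = ?h \<and> v (d (Suc k) \<omega>', r (Suc (Suc k)) \<omega>') = x}"
        unfolding lawp by (simp add: hist)
      also have "{\<omega>' \<in> space M. hist k \<omega>' = ?h \<and> v (d (Suc k) \<omega>', r (Suc (Suc k)) \<omega>') = x} =
          d (Suc k) -` {x} \<inter> space M \<inter> ?H"
        using dW by (auto simp: v_def)
      also have "emeasure M \<dots> = (\<integral>\<^sup>+\<omega>'\<in>?H. ennreal (p (Suc k) x \<omega>') \<partial>M)"
        using x HF by (intro pint) auto
      also have "\<dots> \<le> (\<integral>\<^sup>+\<omega>'. ennreal ?c * indicator ?H \<omega>' \<partial>M)"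
      proof (intro nn_integral_mono)
        fix \<omega>' assume "\<omega>' \<in> space M"
        then show "ennreal (p (Suc k) x \<omega>') * indicator ?H \<omega>' \<le> ennreal ?c * indicator ?H \<omega>'"
          using close[OF \<omega>(1), of \<omega>' k x] x by (auto simp: indicator_def intro!: ennreal_leI)
      qed
      also have "\<dots> = ennreal ?c * emeasure M ?H"
        using setsF[OF HF] by (simp add: nn_integral_cmult_indicator)
      also have "\<dots> = ennreal (?c * measure_pmf.prob (Q (Suc k)) {l. tl l = ?h})"
        using c0 by (simp add: den[symmetric] ennreal_mult')
      finally have num: "measure_pmf.prob (Q (Suc k)) {l. tl l = ?h \<and> v (hd l) = x} \<le>
          ?c * measure_pmf.prob (Q (Suc k)) {l. tl l = ?h}"
        using c0 by (simp add: ennreal_le_iff)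
      obtain l where l: "l \<in> set_pmf (Q (Suc k))" "tl l = ?h" using ne[OF \<omega>(2)] by auto
      have pos: "0 < measure_pmf.prob (Q (Suc k)) {l. tl l = ?h}"
        using l by (intro measure_pmf_posI[OF l(1)]) auto
      have "measure_pmf.prob (K ?h) {a. v a = x} = measure_pmf.prob (cond_pmf (Q (Suc k)) {l. tl l = ?h}) {l. v (hd l) = x}"
        using \<omega>(2) by (simp add: K_def cond_def length_hist vimage_def)
      also have "\<dots> = measure_pmf.prob (Q (Suc k)) ({l. tl l = ?h} \<inter> {l. v (hd l) = x}) / measure_pmf.prob (Q (Suc k)) {l. tl l = ?h}"
        unfolding cond_pmf.rep_eq[OF ne[OF \<omega>(2)]] using pos
        by (subst measure_uniform_measure) (auto simp: measure_pmf.emeasure_eq_measure)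
      also have "\<dots> \<le> ?c"
        using num pos by (simp add: divide_le_eq Collect_conj_eq)
      finally show ?thesis .
    qed
    define D where "D = (\<lambda>l :: ('a \<times> nat list) list. v (hd l))"
    have Dc: "range D \<subseteq> carrier V"
      unfolding D_def by (rule image_subsetI) (rule subsetD[OF W(2) vW])
    have walk_D: "walk D h bs = vsum (\<lambda>k. v (hd (recent k bs))) (length h)" if "length bs = length h" for h bs
      using that
    proof (induction h arbitrary: bs)
      case (Cons a h)
      then obtain b' bs' where bs: "bs = b' # bs'" "length bs' = length h" by (cases bs) auto
      have "vsum (\<lambda>k. v (hd (recent k (b' # bs')))) (length h) = vsum (\<lambda>k. v (hd (recent k bs'))) (length h)"
        using bs by (intro vsum_cong) (simp add: recent_Cons)
      then show ?case using Cons.IH[OF bs(2)] bs by (simp add: D_def recent_all)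
    qed simp
    have walk_hist: "walk D (hist k \<omega>) (hist k \<omega>) = vsum (\<lambda>k. d k \<omega>) k" if "\<omega> \<in> space M" for k \<omega>
      by (induction k) (use that dW in \<open>auto simp: hist D_def v_def\<close>)
    have "(\<integral>\<^sup>+\<omega>. ennreal (N (vsum (\<lambda>k. d k \<omega>) n) powr b) \<partial>M) = process_moment K D n b"
      unfolding process_moment_def pathsQ law by (intro nn_integral_cong) (simp add: walk_hist)
    also have "\<dots> \<le> ennreal C * decoupled_moment K D n b" by (rule tree[OF finK Dc])
    \<comment> \<open>The process on the tree has exactly the law of the given one. Only the
      decoupled sums differ, and their joint probabilities exceed the true ones by at most
      \<open>real n / real m\<close> for each of finitely many tuples.\<close>
    also have "decoupled_moment K D n b \<le>
        (\<integral>\<^sup>+\<omega>. ennreal (N (vsum (\<lambda>k. e k \<omega>) n) powr b) \<partial>M) + ennreal (real n / real m) * S"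
    proof -
      have inner: "(\<integral>\<^sup>+bs. ennreal (N (walk D h bs) powr b) \<partial>copies K h) =
          (\<Sum>x\<in>X. ennreal (\<Prod>k\<in>{1..n}. measure_pmf.prob (K (recent (k - 1) h)) {a. v a = x k}) * \<Phi> x)"
        if h: "length h = n" for h
      proof -
        have "(\<integral>\<^sup>+bs. ennreal (N (walk D h bs) powr b) \<partial>copies K h) =
            (\<integral>\<^sup>+bs. (\<Sum>x\<in>X. iv (\<forall>k\<in>{1..n}. v (hd (recent k bs)) = x k) * \<Phi> x) \<partial>copies K h)"
        proof (intro nn_integral_cong_AE AE_pmfI)
          fix bs assume "bs \<in> set_pmf (copies K h)"
          then have "walk D h bs = vsum (\<lambda>k. v (hd (recent k bs))) n" using walk_D[of bs h] h by (simp add: length_copies)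
          then show "ennreal (N (walk D h bs) powr b) = (\<Sum>x\<in>X. iv (\<forall>k\<in>{1..n}. v (hd (recent k bs)) = x k) * \<Phi> x)"
            unfolding X_def \<Phi>_def using vW
            by (simp only:) (intro vsum_decompose[OF W(1), of n _ "\<lambda>v. ennreal (N v powr b)"], auto)
        qed
        also have "\<dots> = (\<Sum>x\<in>X. (\<integral>\<^sup>+bs. iv (\<forall>k\<in>{1..n}. v (hd (recent k bs)) = x k) \<partial>copies K h) * \<Phi> x)"
          by (subst nn_integral_sum) (auto simp: nn_integral_multc)
        also have "\<dots> = (\<Sum>x\<in>X. ennreal (\<Prod>k\<in>{1..n}. measure_pmf.prob (K (recent (k - 1) h)) {a. v a = x k}) * \<Phi> x)"
        proof (intro sum.cong refl arg_cong2[where f = times])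
          fix x
          show "(\<integral>\<^sup>+bs. iv (\<forall>k\<in>{1..n}. v (hd (recent k bs)) = x k) \<partial>copies K h) =
              ennreal (\<Prod>k\<in>{1..n}. measure_pmf.prob (K (recent (k - 1) h)) {a. v a = x k})"
            using copies_product[where h = h and P = "\<lambda>k a. v a = x k" and K = K] h by (simp add: nn_integral_iv prod_ennreal)
        qed
        finally show ?thesis .
      qed
      have "decoupled_moment K D n b = (\<integral>\<^sup>+\<omega>. (\<integral>\<^sup>+bs. ennreal (N (walk D (hist n \<omega>) bs) powr b) \<partial>copies K (hist n \<omega>)) \<partial>M)"
        unfolding decoupled_moment_def pathsQ law ..
      also have "\<dots> \<le> (\<integral>\<^sup>+\<omega>. (\<Sum>x\<in>X. ennreal ((\<Prod>k\<in>{1..n}. p k (x k) \<omega>) + real n / real m) * \<Phi> x) \<partial>M)"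
      proof (rule nn_integral_mono_AE)
        have "AE \<omega> in M. \<forall>k\<in>{0..n}. hist k \<omega> \<in> set_pmf (Q k)" by (intro AE_finite_allI hist_supp) simp
        then show "AE \<omega> in M. (\<integral>\<^sup>+bs. ennreal (N (walk D (hist n \<omega>) bs) powr b) \<partial>copies K (hist n \<omega>)) \<le>
            (\<Sum>x\<in>X. ennreal ((\<Prod>k\<in>{1..n}. p k (x k) \<omega>) + real n / real m) * \<Phi> x)"
        proof (rule AE_mp, intro AE_I2 impI)
          fix \<omega> assume \<omega>: "\<omega> \<in> space M" "\<forall>k\<in>{0..n}. hist k \<omega> \<in> set_pmf (Q k)"
          show "(\<integral>\<^sup>+bs. ennreal (N (walk D (hist n \<omega>) bs) powr b) \<partial>copies K (hist n \<omega>)) \<le>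
            (\<Sum>x\<in>X. ennreal ((\<Prod>k\<in>{1..n}. p k (x k) \<omega>) + real n / real m) * \<Phi> x)"
            unfolding inner[OF length_hist]
          proof (intro sum_mono mult_right_mono ennreal_leI)
            fix x assume x: "x \<in> X"
            have "(\<Prod>k\<in>{1..n}. measure_pmf.prob (K (recent (k - 1) (hist n \<omega>))) {a. v a = x k}) \<le>
                (\<Prod>k\<in>{1..n}. p k (x k) \<omega>) + real (card {1..n}) * (1 / real m)"
            proof (rule prod_le_add)
              fix k assume k: "k \<in> {1..n}"
              have "x k \<in> W" using x k by (auto simp: X_def)
              then have "measure_pmf.prob (K (hist (k - 1) \<omega>)) {a. v a = x k} \<le> p (Suc (k - 1)) (x k) \<omega> + 1 / real m"
                using \<omega> k by (intro Kbound) auto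
              moreover have "recent (k - 1) (hist n \<omega>) = hist (k - 1) \<omega>" using k by (intro recent_hist) auto
              ultimately show "0 \<le> p k (x k) \<omega> \<and> p k (x k) \<omega> \<le> 1 \<and>
                  0 \<le> measure_pmf.prob (K (recent (k - 1) (hist n \<omega>))) {a. v a = x k} \<and>
                  measure_pmf.prob (K (recent (k - 1) (hist n \<omega>))) {a. v a = x k} \<le> 1 \<and>
                  measure_pmf.prob (K (recent (k - 1) (hist n \<omega>))) {a. v a = x k} \<le> p k (x k) \<omega> + 1 / real m"
                using k p01 by simp
            qed auto
            then show "(\<Prod>k\<in>{1..n}. measure_pmf.prob (K (recent (k - 1) (hist n \<omega>))) {a. v a = x k}) \<le>
                (\<Prod>k\<in>{1..n}. p k (x k) \<omega>) + real n / real m" by simp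
          qed simp
        qed
      qed
      also have "\<dots> = (\<Sum>x\<in>X. (\<integral>\<^sup>+\<omega>. ennreal (\<Prod>k\<in>{1..n}. p k (x k) \<omega>) + ennreal (real n / real m) \<partial>M) * \<Phi> x)"
      proof -
        have pp: "0 \<le> (\<Prod>k\<in>{1..n}. p k (x k) \<omega>)" for x \<omega> using p01 by (intro prod_nonneg) auto
        have eq: "ennreal ((\<Prod>k\<in>{1..n}. p k (x k) \<omega>) + real n / real m) =
            ennreal (\<Prod>k\<in>{1..n}. p k (x k) \<omega>) + ennreal (real n / real m)" for x \<omega>
          by (rule ennreal_plus[OF pp]) simp
        show ?thesis unfolding eq by (subst nn_integral_sum) (auto simp: nn_integral_multc)
      qed
      also have "\<dots> = (\<Sum>x\<in>X. ((\<integral>\<^sup>+\<omega>. ennreal (\<Prod>k\<in>{1..n}. p k (x k) \<omega>) \<partial>M) + ennreal (real n / real m)) * \<Phi> x)"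
        by (intro sum.cong refl arg_cong2[where f = times]) (subst nn_integral_add, auto simp: emeasure_space_1)
      also have "\<dots> = (\<integral>\<^sup>+\<omega>. ennreal (N (vsum (\<lambda>k. e k \<omega>) n) powr b) \<partial>M) + ennreal (real n / real m) * S"
        unfolding e_moment S_def by (simp add: distrib_right sum.distrib sum_distrib_left)
      finally show ?thesis .
    qed
    finally show ?thesis by (simp add: mult_left_mono)
  qed
  show ?thesis
  proof (rule ennreal_le_epsilon)
    fix \<epsilon> :: real assume "0 < \<epsilon>"
    obtain s where s: "S = ennreal s" "0 \<le> s" using S by (cases S) auto
    obtain m :: nat where m: "C * real n * s / \<epsilon> < real m" using reals_Archimedean2 by blast
    have "0 \<le> C * real n * s / \<epsilon>" using \<open>0 \<le> C\<close> s \<open>0 < \<epsilon>\<close> by simp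
    then have "0 < real m" using m by linarith
    then have m1: "m \<ge> 1" by simp
    let ?Y = "\<integral>\<^sup>+\<omega>. ennreal (N (vsum (\<lambda>k. e k \<omega>) n) powr b) \<partial>M"
    have "ennreal C * (?Y + ennreal (real n / real m) * S) = ennreal C * ?Y + ennreal (C * (real n / real m * s))"
    proof -
      have "ennreal C * (ennreal (real n / real m) * S) = ennreal (C * (real n / real m * s))"
        unfolding s(1) by (simp only: ennreal_mult[symmetric] mult_nonneg_nonneg divide_nonneg_nonneg
          of_nat_0_le_iff \<open>0 \<le> C\<close> s(2))
      then show ?thesis by (simp only: distrib_left)
    qed
    also have "\<dots> \<le> ennreal C * ?Y + ennreal \<epsilon>"
    proof (intro add_left_mono ennreal_leI)
      show "C * (real n / real m * s) \<le> \<epsilon>" using m \<open>0 < real m\<close> \<open>0 < \<epsilon>\<close> by (simp add: field_simps)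
    qed
    finally show "(\<integral>\<^sup>+\<omega>. ennreal (N (vsum (\<lambda>k. d k \<omega>) n) powr b) \<partial>M) \<le> ennreal C * ?Y + ennreal \<epsilon>"
      using approx[OF m1] by (rule order_trans[rotated])
  qed
qed

end

section \<open>From finitely many values to general steps\<close>

lemma sum_powr_le:
  fixes t :: "'i \<Rightarrow> real"
  assumes "finite I" "\<And>i. i \<in> I \<Longrightarrow> 0 \<le> t i" "0 < b"
  shows "(\<Sum>i\<in>I. t i) powr b \<le> real (card I) powr b * (\<Sum>i\<in>I. t i powr b)"
proof (cases "I = {}")
  case False
  then obtain j where j: "j \<in> I" "\<And>i. i \<in> I \<Longrightarrow> t i \<le> t j"
    using Max_in[of "t ` I"] Max_ge[of "t ` I"] assms(1) by (metis (no_types, lifting) finite_imageI image_iff image_is_empty imageI)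
  have "(\<Sum>i\<in>I. t i) \<le> real (card I) * t j" using sum_bounded_above[of I t "t j"] j by simp
  then have "(\<Sum>i\<in>I. t i) powr b \<le> (real (card I) * t j) powr b"
    using assms by (intro powr_mono2 sum_nonneg) auto
  also have "\<dots> = real (card I) powr b * t j powr b" using assms j by (simp add: powr_mult)
  also have "t j powr b \<le> (\<Sum>i\<in>I. t i powr b)" using assms j by (intro member_le_sum) auto
  finally show ?thesis by (simp add: mult_left_mono)
qed simp

text \<open>Taking expectations in the tangency condition shows that \<open>d k\<close> and
  \<open>e k\<close> have the same law, whatever the conditioning \<sigma>-algebras.\<close>

lemma tangent_law:
  fixes \<psi> :: "'a \<Rightarrow> ennreal"
  assumes cf: "complete_filtered_prob_space M F" and tang: "decoupled_tangent M F V d e"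
    and k: "k \<ge> 1" and \<psi>: "\<psi> \<in> borel_measurable (qborel V)"
  shows "(\<integral>\<^sup>+\<omega>. \<psi> (d k \<omega>) \<partial>M) = (\<integral>\<^sup>+\<omega>. \<psi> (e k \<omega>) \<partial>M)"
proof -
  note cfD = complete_filtered_prob_spaceD[OF cf]
  interpret prob_space M by (rule cfD)
  let ?I = "F_infinity M F"
  have subF: "finite_measure_subalgebra M (F (k - 1))" by (intro finite_measure_subalgebraI cfD)
  have subI: "finite_measure_subalgebra M ?I" by (intro finite_measure_subalgebraI subalgebra_F_infinity[OF cf])
  have dF: "d k \<in> F k \<rightarrow>\<^sub>M qborel V" and eM: "e k \<in> M \<rightarrow>\<^sub>M qborel V"
    using tang k separably_valued_measurable unfolding decoupled_tangent_def adapted_def by blast+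
  have dM: "d k \<in> M \<rightarrow>\<^sub>M qborel V" by (rule measurable_from_subalg[OF cfD(2) dF])
  have spF: "space M \<in> sets (F (k - 1))" "space M \<in> sets ?I"
    using cfD(3)[of "k - 1"] sets.top[of "F (k - 1)"] subalgebra_F_infinity(1)[OF cf] sets.top[of ?I]
    by (auto simp: subalgebra_def)
  have "distr M (qborel V) (d k) = distr M (qborel V) (e k)"
  proof (rule measure_eqI)
    fix B assume "B \<in> sets (distr M (qborel V) (d k))"
    then have B: "B \<in> sets (qborel V)" by simp
    let ?d = "d k -` B \<inter> space M" and ?e = "e k -` B \<inter> space M"
    have sets: "?d \<in> sets M" "?e \<in> sets M" using measurable_sets[OF dM B] measurable_sets[OF eM B] by auto
    have "AE \<omega> in M. conditional_prob M (F (k - 1)) ?d \<omega> = conditional_prob M ?I ?e \<omega>"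
      using tang k B unfolding decoupled_tangent_def by blast
    moreover note cond_prob01(1)[OF subF sets(1)] cond_prob01(1)[OF subI sets(2)]
    ultimately have AE: "AE \<omega> in M. cond_prob01 M (F (k - 1)) ?d \<omega> = cond_prob01 M ?I ?e \<omega>"
      by eventually_elim simp
    have "emeasure M ?d = emeasure M (?d \<inter> space M)" by (rule arg_cong[where f = "emeasure M"]) auto
    also have "\<dots> = (\<integral>\<^sup>+\<omega>\<in>space M. ennreal (cond_prob01 M (F (k - 1)) ?d \<omega>) \<partial>M)"
      by (rule cond_prob01(2)[OF subF sets(1) spF(1)])
    also have "\<dots> = (\<integral>\<^sup>+\<omega>\<in>space M. ennreal (cond_prob01 M ?I ?e \<omega>) \<partial>M)"
      using AE by (intro nn_integral_cong_AE) auto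
    also have "\<dots> = emeasure M (?e \<inter> space M)"
      by (rule cond_prob01(2)[OF subI sets(2) spF(2), symmetric])
    also have "\<dots> = emeasure M ?e" by (rule arg_cong[where f = "emeasure M"]) auto
    finally show "emeasure (distr M (qborel V) (d k)) B = emeasure (distr M (qborel V) (e k)) B"
      using B dM eM by (simp add: emeasure_distr)
  qed simp
  then have "(\<integral>\<^sup>+y. \<psi> y \<partial>distr M (qborel V) (d k)) = (\<integral>\<^sup>+y. \<psi> y \<partial>distr M (qborel V) (e k))" by simp
  then show ?thesis using \<psi> dM eM by (simp add: nn_integral_distr)
qed

context f_normed_group
begin

lemma measurable_N_diff: "z \<in> carrier V \<Longrightarrow> (\<lambda>y. N (y \<ominus> z)) \<in> borel_measurable (qborel V)"
proof (rule borel_measurableI_less)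
  fix a assume "z \<in> carrier V"
  moreover have "{y \<in> space (qborel V). N (y \<ominus> z) < a} = nball z a" by (auto simp: nball_def space_qborel)
  ultimately show "{y \<in> space (qborel V). N (y \<ominus> z) < a} \<in> sets (qborel V)"
    using openin_sets_qborel[OF openin_nball[of z a]] by simp
qed

end

context f_normed_double
begin

text \<open>A Borel rounding to one of the first \<open>m\<close> points of a net. Points far from
  all of them go to zero, so the error there is the point itself and is controlled by the tail of
  its moment.\<close>

primrec net_map :: "(nat \<Rightarrow> 'a) \<Rightarrow> real \<Rightarrow> nat \<Rightarrow> 'a \<Rightarrow> 'a" where
  "net_map z \<epsilon> 0 y = \<zero>"
| "net_map z \<epsilon> (Suc m) y = (if N (y \<ominus> z m) < \<epsilon> then z m else net_map z \<epsilon> m y)"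

lemma net_map_range: "net_map z \<epsilon> m y \<in> insert \<zero> (z ` {..<m})"
  by (induction m) (auto simp: less_Suc_eq)

lemma net_map_near: "i < m \<Longrightarrow> N (y \<ominus> z i) < \<epsilon> \<Longrightarrow> N (y \<ominus> net_map z \<epsilon> m y) < \<epsilon>"
  by (induction m) (auto simp: less_Suc_eq)

lemma net_map_far: "(\<And>i. i < m \<Longrightarrow> \<not> N (y \<ominus> z i) < \<epsilon>) \<Longrightarrow> net_map z \<epsilon> m y = \<zero>"
  by (induction m) auto

lemma net_map_measurable:
  assumes "range z \<subseteq> carrier V"
  shows "net_map z \<epsilon> m \<in> qborel V \<rightarrow>\<^sub>M qborel V"
proof (induction m)
  case 0
  show ?case by (simp add: net_map.simps(1)[abs_def] space_qborel)
next
  case (Suc m)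
  have [measurable]: "(\<lambda>y. N (y \<ominus> z m)) \<in> borel_measurable (qborel V)"
    using assms by (intro measurable_N_diff) auto
  have "{y \<in> space (qborel V). N (y \<ominus> z m) < \<epsilon>} \<in> sets (qborel V)" by measurable
  moreover have "z m \<in> space (qborel V)" using assms by (auto simp: space_qborel)
  ultimately have "(\<lambda>y. if N (y \<ominus> z m) < \<epsilon> then z m else net_map z \<epsilon> m y) \<in> qborel V \<rightarrow>\<^sub>M qborel V"
    by (intro measurable_If measurable_const Suc)
  then show ?case by (simp add: net_map.simps(2)[abs_def])
qed

lemma N_vsum_le:
  assumes "\<And>k. k \<in> {1..n} \<Longrightarrow> x k \<in> carrier V" "\<And>k. k \<in> {1..n} \<Longrightarrow> y k \<in> carrier V"
  shows "N (vsum x n) \<le> N (vsum y n) + (\<Sum>k\<in>{1..n}. N (x k \<ominus> y k))"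
proof -
  have "N (vsum x n \<ominus> vsum y n) \<le> (\<Sum>k\<in>{1..n}. N (x k \<ominus> y k))"
    using assms
  proof (induction n)
    case (Suc n)
    have c: "vsum x n \<in> carrier V" "vsum y n \<in> carrier V" "x (Suc n) \<in> carrier V" "y (Suc n) \<in> carrier V"
      using Suc.prems by (auto intro!: vsum_closed)
    have "N (vsum x (Suc n) \<ominus> vsum y (Suc n)) \<le> N (vsum x n \<ominus> vsum y n) + N (x (Suc n) \<ominus> y (Suc n))"
      using c by (simp add: add_minus_add N_add)
    then show ?case using Suc by auto
  qed (simp add: N_zero minus_self)
  moreover have "N (vsum x n) \<le> N (vsum x n \<ominus> vsum y n) + N (vsum y n)"
    using assms by (intro N_le_add_diff vsum_closed) auto
  ultimately show ?thesis by simp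
qed

lemma separably_valued_vsum:
  "(\<And>k. k \<in> {1..n} \<Longrightarrow> separably_valued M V (x k)) \<Longrightarrow> separably_valued M V (\<lambda>\<omega>. vsum (\<lambda>k. x k \<omega>) n)"
  by (induction n) (auto intro!: separably_valued_add separably_valued_const)

lemma vsum_moment_perturb:
  assumes x: "\<And>k. k \<ge> 1 \<Longrightarrow> separably_valued M V (x k)" and y: "\<And>k. k \<ge> 1 \<Longrightarrow> separably_valued M V (y k)"
    and b: "0 < b" and err: "\<And>k. k \<in> {1..n} \<Longrightarrow> (\<integral>\<^sup>+\<omega>. ennreal (N (x k \<omega> \<ominus> y k \<omega>) powr b) \<partial>M) \<le> ennreal c" and "0 \<le> c"
  shows "(\<integral>\<^sup>+\<omega>. ennreal (N (vsum (\<lambda>k. x k \<omega>) n) powr b) \<partial>M) \<le>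
    ennreal (2 powr b) * (\<integral>\<^sup>+\<omega>. ennreal (N (vsum (\<lambda>k. y k \<omega>) n) powr b) \<partial>M) +
    ennreal (2 powr b * (real n powr b * (real n * c)))"
proof -
  have xc: "x k \<omega> \<in> carrier V" and yc: "y k \<omega> \<in> carrier V" if "\<omega> \<in> space M" "k \<in> {1..n}" for k \<omega>
    using separably_valued_carrier[OF x] separably_valued_carrier[OF y] that by auto
  have [measurable]: "(\<lambda>\<omega>. N (vsum (\<lambda>k. y k \<omega>) n)) \<in> borel_measurable M"
    by (intro measurable_N_compose separably_valued_vsum y) simp
  have m [measurable]: "(\<lambda>\<omega>. N (x k \<omega> \<ominus> y k \<omega>)) \<in> borel_measurable M" if "k \<in> {1..n}" for k
    using that by (intro measurable_N_compose separably_valued_diff x y) auto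
  have "(\<integral>\<^sup>+\<omega>. ennreal (N (vsum (\<lambda>k. x k \<omega>) n) powr b) \<partial>M) \<le>
    (\<integral>\<^sup>+\<omega>. ennreal (2 powr b) * ennreal (N (vsum (\<lambda>k. y k \<omega>) n) powr b) +
      ennreal (2 powr b * real n powr b) * (\<Sum>k\<in>{1..n}. ennreal (N (x k \<omega> \<ominus> y k \<omega>) powr b)) \<partial>M)"
  proof (intro nn_integral_mono)
    fix \<omega> assume \<omega>: "\<omega> \<in> space M"
    let ?X = "vsum (\<lambda>k. x k \<omega>) n" and ?Y = "vsum (\<lambda>k. y k \<omega>) n" and ?t = "\<lambda>k. N (x k \<omega> \<ominus> y k \<omega>)"
    have t: "0 \<le> ?t k" if "k \<in> {1..n}" for k using xc yc \<omega> that by (intro N_nonneg) auto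
    have X0: "0 \<le> N ?X" and Y0: "0 \<le> N ?Y" using xc yc \<omega> by (auto intro!: N_nonneg vsum_closed)
    have "N ?X powr b \<le> (N ?Y + (\<Sum>k\<in>{1..n}. ?t k)) powr b"
      using N_vsum_le[of n "\<lambda>k. x k \<omega>" "\<lambda>k. y k \<omega>"] xc yc \<omega> X0 b by (intro powr_mono2) auto
    also have "\<dots> \<le> 2 powr b * (N ?Y powr b + (\<Sum>k\<in>{1..n}. ?t k) powr b)"
      using Y0 t b by (intro powr_add_le sum_nonneg) auto
    also have "\<dots> \<le> 2 powr b * (N ?Y powr b + real n powr b * (\<Sum>k\<in>{1..n}. ?t k powr b))"
      using sum_powr_le[of "{1..n}" ?t b] t b by (intro mult_left_mono add_left_mono) auto
    finally have "ennreal (N ?X powr b) \<le> ennreal (2 powr b * N ?Y powr b + 2 powr b * real n powr b * (\<Sum>k\<in>{1..n}. ?t k powr b))"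
      by (intro ennreal_leI) (simp add: algebra_simps)
    also have "\<dots> = ennreal (2 powr b) * ennreal (N ?Y powr b) + ennreal (2 powr b * real n powr b) * (\<Sum>k\<in>{1..n}. ennreal (?t k powr b))"
      by (simp add: ennreal_plus ennreal_mult sum_nonneg sum_ennreal)
    finally show "ennreal (N ?X powr b) \<le> ennreal (2 powr b) * ennreal (N ?Y powr b) +
      ennreal (2 powr b * real n powr b) * (\<Sum>k\<in>{1..n}. ennreal (?t k powr b))" .
  qed
  also have "\<dots> = ennreal (2 powr b) * (\<integral>\<^sup>+\<omega>. ennreal (N (vsum (\<lambda>k. y k \<omega>) n) powr b) \<partial>M) +
      ennreal (2 powr b * real n powr b) * (\<Sum>k\<in>{1..n}. \<integral>\<^sup>+\<omega>. ennreal (N (x k \<omega> \<ominus> y k \<omega>) powr b) \<partial>M)"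
  proof -
    have "(\<integral>\<^sup>+\<omega>. (\<Sum>k\<in>{1..n}. ennreal (N (x k \<omega> \<ominus> y k \<omega>) powr b)) \<partial>M) =
        (\<Sum>k\<in>{1..n}. \<integral>\<^sup>+\<omega>. ennreal (N (x k \<omega> \<ominus> y k \<omega>) powr b) \<partial>M)"
      using m by (intro nn_integral_sum) auto
    moreover have "(\<lambda>\<omega>. \<Sum>k\<in>{1..n}. ennreal (N (x k \<omega> \<ominus> y k \<omega>) powr b)) \<in> borel_measurable M"
      using m by (intro borel_measurable_sum) auto
    ultimately show ?thesis by (simp add: nn_integral_add nn_integral_cmult)
  qed
  also have "\<dots> \<le> ennreal (2 powr b) * (\<integral>\<^sup>+\<omega>. ennreal (N (vsum (\<lambda>k. y k \<omega>) n) powr b) \<partial>M) +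
      ennreal (2 powr b * real n powr b) * (\<Sum>k\<in>{1..n}. ennreal c)"
    using err by (intro add_left_mono mult_left_mono sum_mono) auto
  also have "ennreal (2 powr b * real n powr b) * (\<Sum>k\<in>{1..n}. ennreal c) = ennreal (2 powr b * (real n powr b * (real n * c)))"
    using \<open>0 \<le> c\<close> by (simp add: ennreal_mult mult.assoc ennreal_of_nat_eq_real_of_nat)
  finally show ?thesis .
qed

text \<open>Rounding both sequences by the same Borel map preserves tangency. The errors for
  \<open>e\<close> need no separate estimate, as \<open>e k\<close> has the law of
  \<open>d k\<close>; hence it suffices that the moments of \<open>d\<close> are finite.\<close>

lemma moment_if_tree:
  fixes C :: real and M :: "'w measure"
  assumes tree: "\<And>(K :: ('a \<times> nat list) list \<Rightarrow> ('a \<times> nat list) pmf) D n.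
      \<lbrakk>\<And>h. finite (set_pmf (K h)); range D \<subseteq> carrier V\<rbrakk>
      \<Longrightarrow> process_moment K D n b \<le> ennreal C * decoupled_moment K D n b"
    and C: "0 \<le> C" and b: "0 < b"
    and cf: "complete_filtered_prob_space M F" and tang: "decoupled_tangent M F V d e"
    and int: "\<And>k. k \<ge> 1 \<Longrightarrow> (\<integral>\<^sup>+\<omega>. ennreal (N (d k \<omega>) powr b) \<partial>M) < \<infinity>"
  shows "(\<integral>\<^sup>+\<omega>. ennreal (N (vsum (\<lambda>k. d k \<omega>) n) powr b) \<partial>M) \<le>
    ennreal (2 powr b * (C * 2 powr b)) * (\<integral>\<^sup>+\<omega>. ennreal (N (vsum (\<lambda>k. e k \<omega>) n) powr b) \<partial>M)"
proof -
  note cfD = complete_filtered_prob_spaceD[OF cf]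
  interpret prob_space M by (rule cfD)
  have dF: "separably_valued (F k) V (d k)" and eM: "separably_valued M V (e k)" if "k \<ge> 1" for k
    using tang that unfolding decoupled_tangent_def adapted_def by blast+
  have dM: "separably_valued M V (d k)" if "k \<ge> 1" for k
    using dF[OF that] measurable_from_subalg[OF cfD(2)] cfD(3)[of k] unfolding separably_valued_def by auto
  note dc = separably_valued_carrier[OF dM] and ec = separably_valued_carrier[OF eM]
  have "\<forall>k. \<exists>A. k \<ge> 1 \<longrightarrow> dense_for A (d k ` space M)" using dM unfolding separably_valued_iff by blast
  then obtain A where A: "\<And>k. k \<ge> 1 \<Longrightarrow> dense_for (A k) (d k ` space M)" by metis
  define Z where "Z = insert \<zero> (\<Union>k\<in>{1..n}. A k)"
  have Z: "countable Z" "Z \<noteq> {}" "Z \<subseteq> carrier V"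
    unfolding Z_def using A by (auto simp: dense_for_def, blast)
  define z where "z = from_nat_into Z"
  have rz: "range z = Z" unfolding z_def using Z by (intro range_from_nat_into)
  then have zc: "range z \<subseteq> carrier V" using Z by simp
  then have zc': "z i \<in> carrier V" for i by auto
  have est: "(\<integral>\<^sup>+\<omega>. ennreal (N (vsum (\<lambda>k. d k \<omega>) n) powr b) \<partial>M) \<le>
      ennreal (2 powr b * (C * 2 powr b)) * (\<integral>\<^sup>+\<omega>. ennreal (N (vsum (\<lambda>k. e k \<omega>) n) powr b) \<partial>M) +
      ennreal ((2 powr b * C + 1) * (2 powr b * (real n powr b * (real n * (2 * \<epsilon> powr b)))))"
    if \<epsilon>: "0 < \<epsilon>" for \<epsilon>
  proof -
    let ?A = "\<lambda>k m. {\<omega> \<in> space M. \<forall>i<m. \<epsilon> \<le> N (d k \<omega> \<ominus> z i)}"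
    have [measurable]: "(\<lambda>\<omega>. N (d k \<omega> \<ominus> z i)) \<in> borel_measurable M" "(\<lambda>\<omega>. N (d k \<omega>)) \<in> borel_measurable M"
      if "k \<ge> 1" for k i
      using dM[OF that] zc' by (auto intro!: measurable_N_compose separably_valued_diff separably_valued_const)
    \<comment> \<open>Every value of \<open>d k\<close> is within \<open>\<epsilon>\<close> of some
      \<open>z i\<close>, so the events of being far from the first \<open>m\<close> points shrink
      to the empty set. The finite moment serves as the dominating function.\<close>
    have tail: "\<forall>\<^sub>F m in sequentially. (\<integral>\<^sup>+\<omega>. indicator (?A k m) \<omega> * ennreal (N (d k \<omega>) powr b) \<partial>M) < ennreal (\<epsilon> powr b)"
      if k: "k \<in> {1..n}" for k
    proof -
      have k1: "k \<ge> 1" using k by simp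
      note [measurable] = \<open>\<And>k i. k \<ge> 1 \<Longrightarrow> (\<lambda>\<omega>. N (d k \<omega> \<ominus> z i)) \<in> borel_measurable M\<close>[OF k1]
        \<open>\<And>k. k \<ge> 1 \<Longrightarrow> (\<lambda>\<omega>. N (d k \<omega>)) \<in> borel_measurable M\<close>[OF k1]
      have "(\<lambda>m. \<integral>\<^sup>+\<omega>. indicator (?A k m) \<omega> * ennreal (N (d k \<omega>) powr b) \<partial>M) \<longlonglongrightarrow> (\<integral>\<^sup>+\<omega>. 0 \<partial>M)"
      proof (rule nn_integral_dominated_convergence[where w = "\<lambda>\<omega>. ennreal (N (d k \<omega>) powr b)"])
        show "AE \<omega> in M. (\<lambda>m. indicator (?A k m) \<omega> * ennreal (N (d k \<omega>) powr b)) \<longlonglongrightarrow> 0"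
        proof (rule AE_I2)
          fix \<omega> assume \<omega>: "\<omega> \<in> space M"
          obtain c where c: "c \<in> A k" "N (d k \<omega> \<ominus> c) < \<epsilon>" using dense_forD[OF A[OF k1], of "d k \<omega>" \<epsilon>] \<omega> \<epsilon> by auto
          then have "c \<in> range z" unfolding rz Z_def using k by auto
          then obtain i where i: "c = z i" by auto
          have "\<forall>\<^sub>F m in sequentially. indicator (?A k m) \<omega> * ennreal (N (d k \<omega>) powr b) = 0"
            using eventually_gt_at_top[of i]
          proof eventually_elim
            case (elim m)
            then have "\<omega> \<notin> ?A k m" using c i by (auto simp: not_le)
            then show ?case by simp
          qed
          then show "(\<lambda>m. indicator (?A k m) \<omega> * ennreal (N (d k \<omega>) powr b)) \<longlonglongrightarrow> 0" by (rule tendsto_eventually)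
        qed
        show "AE \<omega> in M. indicator (?A k m) \<omega> * ennreal (N (d k \<omega>) powr b) \<le> ennreal (N (d k \<omega>) powr b)" for m
          by (auto simp: indicator_def)
      qed (use int[OF k1] in simp_all)
      then show ?thesis using \<epsilon> by (intro order_tendstoD(2)) auto
    qed
    then have "\<forall>\<^sub>F m in sequentially. \<forall>k\<in>{1..n}. (\<integral>\<^sup>+\<omega>. indicator (?A k m) \<omega> * ennreal (N (d k \<omega>) powr b) \<partial>M) < ennreal (\<epsilon> powr b)"
      by (intro eventually_ball_finite ballI) auto
    then obtain m where m: "\<And>k. k \<in> {1..n} \<Longrightarrow>
        (\<integral>\<^sup>+\<omega>. indicator (?A k m) \<omega> * ennreal (N (d k \<omega>) powr b) \<partial>M) < ennreal (\<epsilon> powr b)"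
      unfolding eventually_sequentially by blast
    define \<phi> where "\<phi> = net_map z \<epsilon> m"
    define W where "W = insert \<zero> (z ` {..<m})"
    have W: "finite W" "W \<subseteq> carrier V" "\<zero> \<in> W" using zc' by (auto simp: W_def)
    have \<phi>W: "\<phi> y \<in> W" for y unfolding \<phi>_def W_def by (rule net_map_range)
    have \<phi>m: "\<phi> \<in> qborel V \<rightarrow>\<^sub>M qborel V" unfolding \<phi>_def by (rule net_map_measurable[OF zc])
    have \<phi>sv: "separably_valued L V (\<lambda>\<omega>. \<phi> (x \<omega>))" if "separably_valued L V x" for L :: "'w measure" and x
    proof (rule separably_valued_countable_range)
      show "(\<lambda>\<omega>. \<phi> (x \<omega>)) \<in> L \<rightarrow>\<^sub>M qborel V" by (rule measurable_compose[OF separably_valued_measurable[OF that] \<phi>m])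
      have "(\<lambda>\<omega>. \<phi> (x \<omega>)) ` space L \<subseteq> W" using \<phi>W by auto
      then show "countable ((\<lambda>\<omega>. \<phi> (x \<omega>)) ` space L)" using W(1) by (meson countable_finite finite_subset)
    qed
    have \<phi>tang: "decoupled_tangent M F V (\<lambda>k \<omega>. \<phi> (d k \<omega>)) (\<lambda>k \<omega>. \<phi> (e k \<omega>))"
      by (rule decoupled_tangent_map[OF cf tang \<phi>m]) (auto intro!: \<phi>sv dF eM)
    have errd: "(\<integral>\<^sup>+\<omega>. ennreal (N (d k \<omega> \<ominus> \<phi> (d k \<omega>)) powr b) \<partial>M) \<le> ennreal (2 * \<epsilon> powr b)" if k: "k \<in> {1..n}" for k
    proof -
      have k1: "k \<ge> 1" using k by simp
      have "(\<integral>\<^sup>+\<omega>. ennreal (N (d k \<omega> \<ominus> \<phi> (d k \<omega>)) powr b) \<partial>M) \<le>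
          (\<integral>\<^sup>+\<omega>. ennreal (\<epsilon> powr b) + indicator (?A k m) \<omega> * ennreal (N (d k \<omega>) powr b) \<partial>M)"
      proof (intro nn_integral_mono)
        fix \<omega> assume \<omega>: "\<omega> \<in> space M"
        have cl: "d k \<omega> \<in> carrier V" "\<phi> (d k \<omega>) \<in> carrier V" using dc[OF k1 \<omega>] \<phi>W W by auto
        show "ennreal (N (d k \<omega> \<ominus> \<phi> (d k \<omega>)) powr b) \<le> ennreal (\<epsilon> powr b) + indicator (?A k m) \<omega> * ennreal (N (d k \<omega>) powr b)"
        proof (cases "\<exists>i<m. N (d k \<omega> \<ominus> z i) < \<epsilon>")
          case True
          then have "N (d k \<omega> \<ominus> \<phi> (d k \<omega>)) < \<epsilon>" unfolding \<phi>_def using net_map_near by blast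
          then have "ennreal (N (d k \<omega> \<ominus> \<phi> (d k \<omega>)) powr b) \<le> ennreal (\<epsilon> powr b)"
            using N_nonneg cl b by (intro ennreal_leI powr_mono2) auto
          then show ?thesis by (simp add: add_increasing2)
        next
          case False
          then have "\<phi> (d k \<omega>) = \<zero>" unfolding \<phi>_def by (intro net_map_far) auto
          moreover have "\<forall>i<m. \<epsilon> \<le> N (d k \<omega> \<ominus> z i)" using False by (meson not_less)
          then have "indicator (?A k m) \<omega> = (1 :: ennreal)" using \<omega> by simp
          ultimately show ?thesis using cl by (simp add: minus_zero_right)
        qed
      qed
      also have "\<dots> = ennreal (\<epsilon> powr b) + (\<integral>\<^sup>+\<omega>. indicator (?A k m) \<omega> * ennreal (N (d k \<omega>) powr b) \<partial>M)"
      proof -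
        note [measurable] = \<open>\<And>k i. k \<ge> 1 \<Longrightarrow> (\<lambda>\<omega>. N (d k \<omega> \<ominus> z i)) \<in> borel_measurable M\<close>[OF k1]
          \<open>\<And>k. k \<ge> 1 \<Longrightarrow> (\<lambda>\<omega>. N (d k \<omega>)) \<in> borel_measurable M\<close>[OF k1]
        have m: "(\<lambda>\<omega>. indicator (?A k m) \<omega> * ennreal (N (d k \<omega>) powr b)) \<in> borel_measurable M" by measurable
        show ?thesis by (subst nn_integral_add[OF _ m]) (simp_all add: emeasure_space_1)
      qed
      also have "\<dots> \<le> ennreal (\<epsilon> powr b) + ennreal (\<epsilon> powr b)" by (intro add_left_mono less_imp_le m k)
      also have "\<dots> = ennreal (2 * \<epsilon> powr b)" by (simp flip: ennreal_plus del: ennreal_plus)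
      finally show ?thesis .
    qed
    \<comment> \<open>The net was built from the ranges of the \<open>d k\<close>, and
      \<open>e k\<close> may leave their closure at some outcomes. The estimate passes through the
      equality of laws instead of a pointwise argument.\<close>
    have erre: "(\<integral>\<^sup>+\<omega>. ennreal (N (\<phi> (e k \<omega>) \<ominus> e k \<omega>) powr b) \<partial>M) \<le> ennreal (2 * \<epsilon> powr b)" if k: "k \<in> {1..n}" for k
    proof -
      have k1: "k \<ge> 1" using k by simp
      let ?\<psi> = "\<lambda>y. ennreal (N (y \<ominus> \<phi> y) powr b)"
      have N1: "(\<lambda>y. N (y \<ominus> w)) \<in> borel_measurable (qborel V)" if "w \<in> W" for w
        using that W by (intro measurable_N_diff) auto
      have "(\<lambda>y. N (y \<ominus> \<phi> y)) \<in> borel_measurable (qborel V)"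
      proof (rule borel_measurableI_less)
        fix a
        have "{y \<in> space (qborel V). N (y \<ominus> \<phi> y) < a} =
            (\<Union>w\<in>W. (\<phi> -` {w} \<inter> space (qborel V)) \<inter> {y \<in> space (qborel V). N (y \<ominus> w) < a})"
          using \<phi>W by auto
        also have "\<dots> \<in> sets (qborel V)"
        proof (rule sets.finite_UN[OF W(1)], rule sets.Int)
          fix w assume w: "w \<in> W"
          show "\<phi> -` {w} \<inter> space (qborel V) \<in> sets (qborel V)"
            using w W by (intro measurable_sets[OF \<phi>m] singleton_sets_qborel) auto
          show "{y \<in> space (qborel V). N (y \<ominus> w) < a} \<in> sets (qborel V)" using N1[OF w] by simp
        qed
        finally show "{y \<in> space (qborel V). N (y \<ominus> \<phi> y) < a} \<in> sets (qborel V)" .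
      qed
      then have "(\<integral>\<^sup>+\<omega>. ?\<psi> (d k \<omega>) \<partial>M) = (\<integral>\<^sup>+\<omega>. ?\<psi> (e k \<omega>) \<partial>M)"
        by (intro tangent_law[OF cf tang k1]) simp
      moreover have "(\<integral>\<^sup>+\<omega>. ennreal (N (\<phi> (e k \<omega>) \<ominus> e k \<omega>) powr b) \<partial>M) = (\<integral>\<^sup>+\<omega>. ?\<psi> (e k \<omega>) \<partial>M)"
      proof (intro nn_integral_cong)
        fix \<omega> assume "\<omega> \<in> space M"
        then have "N (\<phi> (e k \<omega>) \<ominus> e k \<omega>) = N (e k \<omega> \<ominus> \<phi> (e k \<omega>))"
          using ec[OF k1] \<phi>W W by (intro N_diff_commute) auto
        then show "ennreal (N (\<phi> (e k \<omega>) \<ominus> e k \<omega>) powr b) = ?\<psi> (e k \<omega>)" by simp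
      qed
      ultimately show ?thesis using errd[OF k] by simp
    qed
    let ?X = "\<lambda>x. \<integral>\<^sup>+\<omega>. ennreal (N (vsum (\<lambda>k. x k \<omega>) n) powr b) \<partial>M"
    let ?c = "2 powr b * (real n powr b * (real n * (2 * \<epsilon> powr b)))"
    have c0: "0 \<le> ?c" by simp
    have 1: "?X d \<le> ennreal (2 powr b) * ?X (\<lambda>k \<omega>. \<phi> (d k \<omega>)) + ennreal ?c"
      by (rule vsum_moment_perturb[OF dM \<phi>sv[OF dM] b errd]) auto
    have 2: "?X (\<lambda>k \<omega>. \<phi> (d k \<omega>)) \<le> ennreal C * ?X (\<lambda>k \<omega>. \<phi> (e k \<omega>))"
      by (rule finite_valued_moment[OF tree C b cf \<phi>tang W]) (simp_all add: \<phi>W)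
    have 3: "?X (\<lambda>k \<omega>. \<phi> (e k \<omega>)) \<le> ennreal (2 powr b) * ?X e + ennreal ?c"
      by (rule vsum_moment_perturb[OF \<phi>sv[OF eM] eM b erre]) auto
    have "?X d \<le> ennreal (2 powr b) * (ennreal C * (ennreal (2 powr b) * ?X e + ennreal ?c)) + ennreal ?c"
      by (rule order_trans[OF 1]) (intro add_right_mono mult_left_mono order_trans[OF 2] 3; simp)
    also have "\<dots> = ennreal (2 powr b * (C * 2 powr b)) * ?X e + ennreal ((2 powr b * C + 1) * ?c)"
      using C by (simp add: distrib_left distrib_right ennreal_mult ennreal_plus mult.assoc add.assoc)
    finally show ?thesis .
  qed
  show ?thesis
  proof (rule ennreal_le_epsilon)
    fix \<delta> :: real assume "0 < \<delta>"
    \<comment> \<open>The coefficient of \<open>\<epsilon> powr b\<close> in the error term of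
      \<open>est\<close>; dividing by \<open>\<kappa> + 1\<close> below avoids a zero
      denominator.\<close>
    define \<kappa> where "\<kappa> = (2 powr b * C + 1) * (2 powr b * (real n powr b * (real n * 2)))"
    have "0 \<le> \<kappa>" using C by (simp add: \<kappa>_def)
    define \<epsilon> where "\<epsilon> = (\<delta> / (\<kappa> + 1)) powr (1 / b)"
    have "0 < \<epsilon>" using \<open>0 < \<delta>\<close> \<open>0 \<le> \<kappa>\<close> by (simp add: \<epsilon>_def)
    have "\<epsilon> powr b = \<delta> / (\<kappa> + 1)" using b \<open>0 < \<delta>\<close> \<open>0 \<le> \<kappa>\<close> by (simp add: \<epsilon>_def powr_powr)
    then have "(\<kappa> + 1) * \<epsilon> powr b = \<delta>" using \<open>0 \<le> \<kappa>\<close> by simp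
    then have "\<kappa> * \<epsilon> powr b \<le> \<delta>" using powr_ge_zero[of \<epsilon> b] by (simp only: distrib_right)
    then have "ennreal ((2 powr b * C + 1) * (2 powr b * (real n powr b * (real n * (2 * \<epsilon> powr b))))) \<le> ennreal \<delta>"
      by (intro ennreal_leI) (simp add: \<kappa>_def mult.assoc)
    then show "(\<integral>\<^sup>+\<omega>. ennreal (N (vsum (\<lambda>k. d k \<omega>) n) powr b) \<partial>M) \<le>
        ennreal (2 powr b * (C * 2 powr b)) * (\<integral>\<^sup>+\<omega>. ennreal (N (vsum (\<lambda>k. e k \<omega>) n) powr b) \<partial>M) + ennreal \<delta>"
      using est[OF \<open>0 < \<epsilon>\<close>] by (meson add_left_mono order_trans)
  qed
qed

section \<open>Extrapolation for the quasi-norm\<close>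

lemma N_powr_le_qnorm: "x \<in> carrier V \<Longrightarrow> 0 < p \<Longrightarrow> N x powr (p / r) \<le> qnorm V x powr p"
proof -
  assume x: "x \<in> carrier V" and p: "0 < p"
  have "N x powr (p / r) \<le> (qnorm V x powr r) powr (p / r)"
    using N_le_qnorm[OF x] N_nonneg[OF x] p r_pos by (intro powr_mono2) auto
  then show ?thesis using r_pos by (simp add: powr_powr)
qed

lemma qnorm_powr_le_N: "x \<in> carrier V \<Longrightarrow> 0 < p \<Longrightarrow> qnorm V x powr p \<le> 2 powr (p / r) * N x powr (p / r)"
proof -
  assume x: "x \<in> carrier V" and p: "0 < p"
  have "(qnorm V x powr r) powr (p / r) \<le> (2 * N x) powr (p / r)"
    using qnorm_le_N[OF x] p r_pos by (intro powr_mono2) auto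
  then show ?thesis using r_pos N_nonneg[OF x] by (simp add: powr_powr powr_mult)
qed

lemma vsum_differences:
  assumes "\<And>k. f k \<in> carrier V" "f 0 = \<zero>"
  shows "vsum (\<lambda>k. f k \<ominus> f (k - 1)) n = f n"
proof (induction n)
  case (Suc n)
  have "f n \<oplus> (f (Suc n) \<ominus> f n) = f (Suc n)"
    using assms add_minus_cancel[of "f (Suc n)" "f n"] by (simp add: a_comm)
  moreover have "vsum (\<lambda>k. f k \<ominus> f (k - 1)) (Suc n) = vsum (\<lambda>k. f k \<ominus> f (k - 1)) n \<oplus> (f (Suc n) \<ominus> f n)" by simp
  ultimately show ?case by (simp only: Suc.IH)
qed (simp add: assms)

text \<open>The chain is: decoupling with exponent \<open>p\<close> in \<open>V\<close>, trees with
  exponent \<open>a\<close> for \<open>N\<close>, trees with exponent \<open>b\<close>, and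
  arbitrary spaces with exponent \<open>q\<close>. Passing between \<open>qnorm\<close> and
  \<open>N\<close> costs powers of 2 at both ends.\<close>

lemma decoupling_bound_extrapolate:
  assumes inf: "(UNIV :: real set) \<lesssim> (UNIV :: 'w set)"
    and bound: "decoupling_bound TYPE('w) V p D" and p: "0 < p" and q: "0 < q"
  shows "\<exists>D'. decoupling_bound TYPE('w) V q D'"
proof -
  define a b where "a = p / r" and "b = q / r"
  have ab: "0 < a" "0 < b" using p q r_pos by (auto simp: a_def b_def)
  \<comment> \<open>The letters have the type \<open>'a \<times> nat list\<close> of the
    approximating trees, paired once more for symmetrization.\<close>
  have "process_moment K d n a \<le> ennreal (D powr p * 2 powr a) * decoupled_moment K d n a"
    if fin: "\<And>h. finite (set_pmf (K h))" and d: "range d \<subseteq> carrier V"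
    for K :: "(('a \<times> nat list) \<times> ('a \<times> nat list)) list \<Rightarrow> _" and d n
  proof -
    note wc = walk_closed[OF d]
    have "process_moment K d n a \<le> (\<integral>\<^sup>+h. ennreal (qnorm V (walk d h h) powr p) \<partial>paths K n)"
      unfolding process_moment_def a_def by (intro nn_integral_mono ennreal_leI N_powr_le_qnorm wc p)
    also have "\<dots> \<le> ennreal (D powr p) * (\<integral>\<^sup>+h. \<integral>\<^sup>+bs. ennreal (qnorm V (walk d h bs) powr p) \<partial>copies K h \<partial>paths K n)"
      by (rule tree_inequality_if_decoupling_bound[OF inf bound p fin d])
    also have "\<dots> \<le> ennreal (D powr p) * (\<integral>\<^sup>+h. \<integral>\<^sup>+bs. ennreal (2 powr a) * ennreal (N (walk d h bs) powr a) \<partial>copies K h \<partial>paths K n)"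
      unfolding a_def using qnorm_powr_le_N[OF wc p]
      by (intro mult_left_mono nn_integral_mono) (auto simp flip: ennreal_mult' intro!: ennreal_leI)
    also have "\<dots> = ennreal (D powr p * 2 powr a) * decoupled_moment K d n a"
      by (simp add: decoupled_moment_def nn_integral_cmult ennreal_mult' mult.assoc)
    finally show ?thesis .
  qed
  from extrapolation[OF ab _ this]
  obtain C where C: "0 \<le> C" and tree: "\<And>(K :: ('a \<times> nat list) list \<Rightarrow> ('a \<times> nat list) pmf) d n.
      \<lbrakk>\<And>h. finite (set_pmf (K h)); range d \<subseteq> carrier V\<rbrakk> \<Longrightarrow> process_moment K d n b \<le> ennreal C * decoupled_moment K d n b"
    by auto
  define c where "c = 2 powr b * (2 powr b * (C * 2 powr b))"
  have "0 \<le> c" using C by (simp add: c_def)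
  have "decoupling_bound TYPE('w) V q (c powr (1 / q))"
    unfolding decoupling_bound_def
  proof (intro conjI allI impI)
    fix M :: "'w measure" and F f g and n :: nat
    assume cf: "complete_filtered_prob_space M F" and ds: "decoupled_sum M F V f g"
      and fin: "\<forall>n\<ge>1. Lp_norm q M V (f n) < \<infinity>" and n: "n \<ge> 1"
    note cfD = complete_filtered_prob_spaceD[OF cf]
    let ?d = "\<lambda>k \<omega>. f k \<omega> \<ominus> f (k - 1) \<omega>" and ?e = "\<lambda>k \<omega>. g k \<omega> \<ominus> g (k - 1) \<omega>"
    have tang: "decoupled_tangent M F V ?d ?e" and zero: "f 0 = (\<lambda>\<omega>. \<zero>)" "g 0 = (\<lambda>\<omega>. \<zero>)"
      using ds by (auto simp: decoupled_sum_def)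
    have fsv: "separably_valued M V (f k)" for k
    proof (cases "k = 0")
      case False
      then have "separably_valued (F k) V (f k)" using ds by (auto simp: decoupled_sum_def adapted_def)
      then show ?thesis using measurable_from_subalg[OF cfD(2)] cfD(3)[of k] unfolding separably_valued_def by auto
    qed (simp add: zero separably_valued_const)
    have gsv: "separably_valued M V (g k)" for k
      using ds zero separably_valued_const[of \<zero>] by (cases "k = 0") (auto simp: decoupled_sum_def)
    note fc = separably_valued_carrier[OF fsv] and gc = separably_valued_carrier[OF gsv]
    have vf: "vsum (\<lambda>k. ?d k \<omega>) n = f n \<omega>" if "\<omega> \<in> space M" for \<omega> n
      by (rule vsum_differences[of "\<lambda>k. f k \<omega>"]) (use fc that zero in simp_all)
    have vg: "vsum (\<lambda>k. ?e k \<omega>) n = g n \<omega>" if "\<omega> \<in> space M" for \<omega> n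
      by (rule vsum_differences[of "\<lambda>k. g k \<omega>"]) (use gc that zero in simp_all)
    have Nf: "(\<integral>\<^sup>+\<omega>. ennreal (N (f k \<omega>) powr b) \<partial>M) < \<infinity>" for k
    proof (cases "k = 0")
      case False
      have "(\<integral>\<^sup>+\<omega>. ennreal (N (f k \<omega>) powr b) \<partial>M) \<le> (\<integral>\<^sup>+\<omega>. ennreal (qnorm V (f k \<omega>) powr q) \<partial>M)"
        unfolding b_def by (intro nn_integral_mono ennreal_leI N_powr_le_qnorm fc q)
      also have "\<dots> < \<infinity>"
      proof -
        have "Lp_norm q M V (f k) < \<infinity>" using fin False by simp
        then show ?thesis by (simp only: Lp_norm_finite_iff)
      qed
      finally show ?thesis .
    qed (use ab in \<open>simp add: zero N_zero\<close>)
    have int: "(\<integral>\<^sup>+\<omega>. ennreal (N (?d k \<omega>) powr b) \<partial>M) < \<infinity>" for k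
    proof -
      have "(\<integral>\<^sup>+\<omega>. ennreal (N (?d k \<omega>) powr b) \<partial>M) \<le>
        (\<integral>\<^sup>+\<omega>. ennreal (2 powr b) * (ennreal (N (f k \<omega>) powr b) + ennreal (N (f (k - 1) \<omega>) powr b)) \<partial>M)"
        using fc ab by (intro nn_integral_mono N_powr_add N_diff minus_closed) auto
      also have "\<dots> = ennreal (2 powr b) * ((\<integral>\<^sup>+\<omega>. ennreal (N (f k \<omega>) powr b) \<partial>M) + (\<integral>\<^sup>+\<omega>. ennreal (N (f (k - 1) \<omega>) powr b) \<partial>M))"
      proof -
        have [measurable]: "(\<lambda>\<omega>. N (f j \<omega>)) \<in> borel_measurable M" for j by (intro measurable_N_compose fsv)
        show ?thesis by (subst nn_integral_cmult, measurable) (subst nn_integral_add, auto)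
      qed
      also have "\<dots> < \<infinity>" using Nf[of k] Nf[of "k - 1"] by (simp add: ennreal_mult_less_top)
      finally show ?thesis .
    qed
    have [measurable]: "(\<lambda>\<omega>. N (f n \<omega>)) \<in> borel_measurable M" "(\<lambda>\<omega>. N (g n \<omega>)) \<in> borel_measurable M"
      by (intro measurable_N_compose fsv gsv)+
    have "(\<integral>\<^sup>+\<omega>. ennreal (qnorm V (f n \<omega>) powr q) \<partial>M) \<le> (\<integral>\<^sup>+\<omega>. ennreal (2 powr b) * ennreal (N (f n \<omega>) powr b) \<partial>M)"
      unfolding b_def using qnorm_powr_le_N[OF fc q]
      by (intro nn_integral_mono) (auto simp flip: ennreal_mult' intro!: ennreal_leI)
    also have "\<dots> = ennreal (2 powr b) * (\<integral>\<^sup>+\<omega>. ennreal (N (vsum (\<lambda>k. ?d k \<omega>) n) powr b) \<partial>M)"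
    proof -
      have "(\<integral>\<^sup>+\<omega>. ennreal (N (f n \<omega>) powr b) \<partial>M) = (\<integral>\<^sup>+\<omega>. ennreal (N (vsum (\<lambda>k. ?d k \<omega>) n) powr b) \<partial>M)"
        by (intro nn_integral_cong) (simp only: vf)
      then show ?thesis by (simp add: nn_integral_cmult)
    qed
    also have "\<dots> \<le> ennreal (2 powr b) * (ennreal (2 powr b * (C * 2 powr b)) * (\<integral>\<^sup>+\<omega>. ennreal (N (vsum (\<lambda>k. ?e k \<omega>) n) powr b) \<partial>M))"
      by (intro mult_left_mono moment_if_tree[OF tree C ab(2) cf tang int]) auto
    also have "\<dots> = ennreal c * (\<integral>\<^sup>+\<omega>. ennreal (N (g n \<omega>) powr b) \<partial>M)"
    proof -
      have "(\<integral>\<^sup>+\<omega>. ennreal (N (vsum (\<lambda>k. ?e k \<omega>) n) powr b) \<partial>M) = (\<integral>\<^sup>+\<omega>. ennreal (N (g n \<omega>) powr b) \<partial>M)"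
        by (intro nn_integral_cong) (simp only: vg)
      then show ?thesis using C by (simp add: c_def ennreal_mult mult.assoc)
    qed
    also have "\<dots> \<le> ennreal c * (\<integral>\<^sup>+\<omega>. ennreal (qnorm V (g n \<omega>) powr q) \<partial>M)"
      unfolding b_def by (intro mult_left_mono nn_integral_mono ennreal_leI N_powr_le_qnorm gc q) auto
    also have "c = (c powr (1 / q)) powr q" using q \<open>0 \<le> c\<close> by (simp add: powr_powr)
    finally show "Lp_norm q M V (f n) \<le> ennreal (c powr (1 / q)) * Lp_norm q M V (g n)"
      using q by (subst Lp_norm_le_iff) auto
  qed simp
  then show ?thesis ..
qed

end

text \<open>Homogeneity gives \<open>qnorm V (x \<oplus> x) = 2 * qnorm V x\<close>; the factor 2 in
  \<open>N_double\<close> is the price of passing from \<open>qnorm\<close> back to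
  \<open>N\<close>.\<close>

lemma (in quasi_banach) f_normed_double_exists: "\<exists>N r. f_normed_double V N r"
proof -
  interpret quasi_normed_group V by (rule quasi_normed_group)
  obtain N r where "f_normed_group V N r" using f_norm_exists by blast
  then interpret f_normed_group V N r .
  have "f_normed_double V N r"
  proof
    fix x assume x: "x \<in> carrier V"
    have "x \<oplus> x = (1 + 1) \<odot> x"
      using smult_l_distr[of 1 1 x] smult_one[OF x] x by (simp add: real_scalars_def)
    then have q2: "qnorm V (x \<oplus> x) = 2 * qnorm V x" using qnorm_smult[OF x, of "1 + 1"] by simp
    have "N x \<le> qnorm V x powr r" by (rule N_le_qnorm[OF x])
    also have "\<dots> \<le> qnorm V (x \<oplus> x) powr r"
      unfolding q2 using qnorm_ge_0[OF x] r_pos by (intro powr_mono2) auto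
    also have "\<dots> \<le> 2 * N (x \<oplus> x)" using x by (intro qnorm_le_N) auto
    finally show "N x \<le> 2 * N (x \<oplus> x)" .
  qed
  then show ?thesis by blast
qed

section \<open>Representatives of classes in \<open>L\<^sup>q(S;Y)\<close>\<close>

context quasi_banach
begin

lemma complete_f_norm:
  assumes "f_normed_group V N r" and u: "\<And>n. u n \<in> carrier V"
    and cauchy: "\<And>\<epsilon>. 0 < \<epsilon> \<Longrightarrow> \<exists>K. \<forall>m\<ge>K. \<forall>n\<ge>K. N (u m \<ominus> u n) < \<epsilon>"
  shows "\<exists>l\<in>carrier V. (\<lambda>n. N (u n \<ominus> l)) \<longlonglongrightarrow> 0"
proof -
  interpret f_normed_group V N r by fact
  have "\<exists>K. \<forall>m\<ge>K. \<forall>n\<ge>K. qnorm V (u m \<ominus> u n) < \<epsilon>" if \<epsilon>: "0 < \<epsilon>" for \<epsilon>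
  proof -
    have "0 < \<epsilon> powr r / 2" using \<epsilon> by simp
    then obtain K where "\<forall>m\<ge>K. \<forall>n\<ge>K. N (u m \<ominus> u n) < \<epsilon> powr r / 2" using cauchy by blast
    then show ?thesis using u \<epsilon> by (intro exI[of _ K] allI impI qnorm_lessI) (auto simp: field_simps)
  qed
  then obtain l where l: "l \<in> carrier V" "(\<lambda>n. qnorm V (u n \<ominus> l)) \<longlonglongrightarrow> 0" using complete u by blast
  have "(\<lambda>n. N (u n \<ominus> l)) \<longlonglongrightarrow> 0"
  proof (rule tendsto_sandwich[OF _ _ tendsto_const])
    show "(\<lambda>n. qnorm V (u n \<ominus> l) powr r) \<longlonglongrightarrow> 0"
      using l u r_pos qnorm_ge_0 by (intro tendsto_zero_powrI[OF l(2) tendsto_const]) auto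
  qed (use l u N_nonneg N_le_qnorm in auto)
  then show ?thesis using l by blast
qed

end

text \<open>A quasi-norm need not be Borel measurable, and the moments in \<open>J\<close> require
  that it is. Completeness is stated for \<open>N\<close> because pointwise limits of
  representatives are taken in that metric.\<close>

locale lq_setting = f_normed_double Y N r for Y :: "'y qnormed" (structure) and N r +
  fixes S :: "'s measure" and q :: real
  assumes q_pos: "0 < q"
    and qnorm_measurable: "qnorm Y \<in> borel_measurable (qborel Y)"
    and complete_N: "\<lbrakk>\<And>n::nat. u n \<in> carrier Y; \<And>\<epsilon>. 0 < \<epsilon> \<Longrightarrow> \<exists>K. \<forall>m\<ge>K. \<forall>n\<ge>K. N (u m \<ominus> u n) < \<epsilon>\<rbrakk>
      \<Longrightarrow> \<exists>l\<in>carrier Y. (\<lambda>n. N (u n \<ominus> l)) \<longlonglongrightarrow> 0"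
begin

abbreviation "X \<equiv> Lq_space q S Y"
abbreviation "L \<equiv> Lq_functions q S Y"
definition "J f = (\<integral>\<^sup>+s. ennreal (qnorm Y (f s) powr q) \<partial>S)"
definition "cls f = ae_rel q S Y `` {f}"

lemma L_iff: "f \<in> L \<longleftrightarrow> separably_valued S Y f \<and> J f < \<infinity>"
  unfolding Lq_functions_def mem_Collect_eq Lp_norm_finite_iff J_def ..

lemma L_sv: "f \<in> L \<Longrightarrow> separably_valued S Y f" and L_J: "f \<in> L \<Longrightarrow> J f < \<infinity>"
  by (auto simp: L_iff)

lemma L_carrier: "f \<in> L \<Longrightarrow> s \<in> space S \<Longrightarrow> f s \<in> carrier Y"
  by (rule separably_valued_carrier[OF L_sv])

lemma measurable_qnorm_compose: "separably_valued M Y f \<Longrightarrow> (\<lambda>x. qnorm Y (f x)) \<in> borel_measurable M"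
  by (rule measurable_compose[OF separably_valued_measurable qnorm_measurable])

lemma J_cong_AE: "AE s in S. f s = g s \<Longrightarrow> J f = J g"
  unfolding J_def by (intro nn_integral_cong_AE) auto

lemma J_add_bound: "\<exists>K\<ge>0. \<forall>f g. separably_valued S Y f \<longrightarrow> separably_valued S Y g \<longrightarrow>
    J (\<lambda>s. f s \<oplus> g s) \<le> ennreal K * (J f + J g)"
proof -
  obtain C0 where C0: "\<And>x y. \<lbrakk>x \<in> carrier Y; y \<in> carrier Y\<rbrakk> \<Longrightarrow> qnorm Y (x \<oplus> y) \<le> C0 * (qnorm Y x + qnorm Y y)"
    using qnorm_triangle by auto
  define C where "C = max C0 0"
  have C: "qnorm Y (x \<oplus> y) \<le> C * (qnorm Y x + qnorm Y y)" if "x \<in> carrier Y" "y \<in> carrier Y" for x y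
    using C0[OF that] qnorm_ge_0 that unfolding C_def
    by (meson add_nonneg_nonneg max.cobounded1 mult_right_mono order_trans)
  have "J (\<lambda>s. f s \<oplus> g s) \<le> ennreal (C powr q * 2 powr q) * (J f + J g)"
    if f: "separably_valued S Y f" and g: "separably_valued S Y g" for f g
  proof -
    note fc = separably_valued_carrier[OF f] and gc = separably_valued_carrier[OF g]
    have [measurable]: "(\<lambda>s. qnorm Y (f s)) \<in> borel_measurable S" "(\<lambda>s. qnorm Y (g s)) \<in> borel_measurable S"
      using f g by (auto intro!: measurable_qnorm_compose)
    have "J (\<lambda>s. f s \<oplus> g s) \<le> (\<integral>\<^sup>+s. ennreal (C powr q * 2 powr q) * (ennreal (qnorm Y (f s) powr q) + ennreal (qnorm Y (g s) powr q)) \<partial>S)"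
      unfolding J_def
    proof (intro nn_integral_mono)
      fix s assume s: "s \<in> space S"
      let ?a = "qnorm Y (f s)" and ?b = "qnorm Y (g s)"
      have ab: "0 \<le> ?a" "0 \<le> ?b" using fc gc s qnorm_ge_0 by auto
      have "qnorm Y (f s \<oplus> g s) powr q \<le> (C * (?a + ?b)) powr q"
        using C fc gc s q_pos qnorm_ge_0 by (intro powr_mono2) auto
      also have "\<dots> = C powr q * (?a + ?b) powr q" using ab by (simp add: powr_mult C_def)
      also have "\<dots> \<le> C powr q * (2 powr q * (?a powr q + ?b powr q))"
        using ab q_pos by (intro mult_left_mono powr_add_le) auto
      finally have "ennreal (qnorm Y (f s \<oplus> g s) powr q) \<le> ennreal (C powr q * 2 powr q * (?a powr q + ?b powr q))"
        by (intro ennreal_leI) (simp add: mult.assoc)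
      then show "ennreal (qnorm Y (f s \<oplus> g s) powr q) \<le> ennreal (C powr q * 2 powr q) * (ennreal (?a powr q) + ennreal (?b powr q))"
        by (simp add: ennreal_mult ennreal_plus)
    qed
    also have "\<dots> = ennreal (C powr q * 2 powr q) * (J f + J g)"
      unfolding J_def by (simp add: nn_integral_cmult nn_integral_add)
    finally show ?thesis .
  qed
  then show ?thesis by (intro exI[of _ "C powr q * 2 powr q"]) auto
qed

lemma add_L: "f \<in> L \<Longrightarrow> g \<in> L \<Longrightarrow> (\<lambda>s. f s \<oplus> g s) \<in> L"
proof -
  assume fg: "f \<in> L" "g \<in> L"
  obtain K where "J (\<lambda>s. f s \<oplus> g s) \<le> ennreal K * (J f + J g)" using J_add_bound fg L_sv by blast
  also have "\<dots> < \<infinity>" using fg L_J by (simp add: ennreal_mult_less_top)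
  finally show ?thesis using separably_valued_add[OF fg[THEN L_sv]] unfolding L_iff by blast
qed

lemma J_minus: "separably_valued S Y f \<Longrightarrow> J (\<lambda>s. \<ominus> f s) = J f"
  unfolding J_def by (intro nn_integral_cong) (simp add: qnorm_minus separably_valued_carrier)

lemma minus_L: "f \<in> L \<Longrightarrow> (\<lambda>s. \<ominus> f s) \<in> L"
  by (simp add: L_iff J_minus separably_valued_minus)

lemma zero_L: "(\<lambda>s. \<zero>) \<in> L"
  using q_pos qnorm_0_iff[of \<zero>] by (simp add: L_iff J_def separably_valued_const)

lemma diff_L: "f \<in> L \<Longrightarrow> g \<in> L \<Longrightarrow> (\<lambda>s. f s \<ominus> g s) \<in> L"
  unfolding minus_eq by (intro add_L minus_L)

lemma mem_cls: "g \<in> cls f \<longleftrightarrow> f \<in> L \<and> g \<in> L \<and> (AE s in S. f s = g s)"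
  by (auto simp: cls_def ae_rel_def)

lemma cls_self: "f \<in> L \<Longrightarrow> f \<in> cls f"
  by (simp add: mem_cls)

lemma cls_eqI:
  assumes "f \<in> L" "g \<in> L" "AE s in S. f s = g s" shows "cls f = cls g"
proof -
  have "h \<in> cls f \<longleftrightarrow> h \<in> cls g" for h
    unfolding mem_cls using assms by (auto elim: eventually_elim2)
  then show ?thesis by blast
qed

lemma carrier_X: "carrier X = cls ` L"
  unfolding Lq_space_def quotient_def cls_def by auto

lemma cls_add:
  assumes f: "f \<in> L" and g: "g \<in> L" shows "cls f \<oplus>\<^bsub>X\<^esub> cls g = cls (\<lambda>s. f s \<oplus> g s)"
proof -
  have "cls (\<lambda>s. f' s \<oplus> g' s) = cls (\<lambda>s. f s \<oplus> g s)" if "f' \<in> cls f" "g' \<in> cls g" for f' g'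
    using that by (intro cls_eqI add_L) (auto simp: mem_cls elim: eventually_elim2)
  then have "(\<Union>f'\<in>cls f. \<Union>g'\<in>cls g. cls (\<lambda>s. f' s \<oplus> g' s)) = cls (\<lambda>s. f s \<oplus> g s)"
    using cls_self[OF f] cls_self[OF g] by blast
  then show ?thesis by (simp add: Lq_space_def cls_def)
qed

lemma zero_X: "\<zero>\<^bsub>X\<^esub> = cls (\<lambda>s. \<zero>)"
  by (simp add: Lq_space_def cls_def)

lemma ennreal_qnorm_X: "f \<in> L \<Longrightarrow> ennreal (qnorm X (cls f) powr q) = J f"
  and qnorm_X_nonneg: "f \<in> L \<Longrightarrow> 0 \<le> qnorm X (cls f)"
proof -
  assume f: "f \<in> L"
  have Lp: "Lp_norm q S Y g = ennreal (enn2real (J g) powr (1 / q))" if "g \<in> L" for g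
    using L_J[OF that] by (simp add: Lp_norm_def J_def Let_def less_top)
  have "(\<lambda>g. enn2real (Lp_norm q S Y g)) ` cls f = {enn2real (J f) powr (1 / q)}"
  proof -
    have "enn2real (Lp_norm q S Y g) = enn2real (J f) powr (1 / q)" if "g \<in> cls f" for g
    proof -
      have "J f = J g" using that by (intro J_cong_AE) (simp add: mem_cls)
      then show ?thesis using that Lp[of g] by (simp add: mem_cls)
    qed
    then show ?thesis using cls_self[OF f] by (auto simp: image_iff intro!: bexI[of _ f])
  qed
  then have eq: "qnorm X (cls f) = enn2real (J f) powr (1 / q)" by (simp add: Lq_space_def)
  show "0 \<le> qnorm X (cls f)" by (simp add: eq)
  show "ennreal (qnorm X (cls f) powr q) = J f"
    using q_pos L_J[OF f] by (simp add: eq powr_powr)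
qed

lemma abelian_group_X: "abelian_group X"
proof (rule abelian_groupI)
  fix x y z assume "x \<in> carrier X" "y \<in> carrier X" "z \<in> carrier X"
  then obtain f g h where [simp]: "x = cls f" "y = cls g" "z = cls h" and fgh: "f \<in> L" "g \<in> L" "h \<in> L"
    by (auto simp: carrier_X)
  note c = L_carrier
  show "x \<oplus>\<^bsub>X\<^esub> y \<in> carrier X" using fgh by (simp add: cls_add carrier_X add_L)
  show "x \<oplus>\<^bsub>X\<^esub> y \<oplus>\<^bsub>X\<^esub> z = x \<oplus>\<^bsub>X\<^esub> (y \<oplus>\<^bsub>X\<^esub> z)"
    using fgh c by (simp add: cls_add add_L) (intro cls_eqI AE_I2, simp_all add: add_L a_assoc)
  show "x \<oplus>\<^bsub>X\<^esub> y = y \<oplus>\<^bsub>X\<^esub> x"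
    using fgh c by (simp add: cls_add) (intro cls_eqI AE_I2, simp_all add: add_L a_comm)
next
  show "\<zero>\<^bsub>X\<^esub> \<in> carrier X" using zero_L by (simp add: zero_X carrier_X)
  fix x assume "x \<in> carrier X"
  then obtain f where [simp]: "x = cls f" and f: "f \<in> L" by (auto simp: carrier_X)
  show "\<zero>\<^bsub>X\<^esub> \<oplus>\<^bsub>X\<^esub> x = x"
    using f zero_L L_carrier by (simp add: zero_X cls_add) (intro cls_eqI AE_I2, simp_all add: add_L)
  show "\<exists>y\<in>carrier X. y \<oplus>\<^bsub>X\<^esub> x = \<zero>\<^bsub>X\<^esub>"
    using f zero_L L_carrier
    by (intro bexI[of _ "cls (\<lambda>s. \<ominus> f s)"])
      (simp add: zero_X cls_add minus_L, intro cls_eqI AE_I2, simp_all add: add_L minus_L l_neg carrier_X)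
qed

lemma cls_minus: "f \<in> L \<Longrightarrow> \<ominus>\<^bsub>X\<^esub> cls f = cls (\<lambda>s. \<ominus> f s)"
proof -
  interpret X: abelian_group X by (rule abelian_group_X)
  assume f: "f \<in> L"
  show ?thesis
  proof (rule X.minus_equality)
    show "cls (\<lambda>s. \<ominus> f s) \<oplus>\<^bsub>X\<^esub> cls f = \<zero>\<^bsub>X\<^esub>"
      using f zero_L L_carrier
      by (simp add: zero_X cls_add minus_L) (intro cls_eqI AE_I2, simp_all add: add_L minus_L l_neg)
  qed (use f minus_L in \<open>auto simp: carrier_X\<close>)
qed

lemma cls_diff: "f \<in> L \<Longrightarrow> g \<in> L \<Longrightarrow> cls f \<ominus>\<^bsub>X\<^esub> cls g = cls (\<lambda>s. f s \<ominus> g s)"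
  using cls_minus[of g] cls_add[of f "\<lambda>s. \<ominus> g s"] minus_L[of g] by (simp add: a_minus_def)

lemma quasi_normed_group_X: "quasi_normed_group X"
proof -
  interpret X: abelian_group X by (rule abelian_group_X)
  show ?thesis
  proof
    fix x assume "x \<in> carrier X"
    then obtain f where [simp]: "x = cls f" and f: "f \<in> L" by (auto simp: carrier_X)
    show nonneg: "0 \<le> qnorm X x" using qnorm_X_nonneg[OF f] by simp
    have [measurable]: "(\<lambda>s. qnorm Y (f s)) \<in> borel_measurable S" by (rule measurable_qnorm_compose[OF L_sv[OF f]])
    have "qnorm X x = 0 \<longleftrightarrow> ennreal (qnorm X x powr q) = 0" using q_pos nonneg by auto
    also have "\<dots> \<longleftrightarrow> (AE s in S. ennreal (qnorm Y (f s) powr q) = 0)"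
      unfolding \<open>x = cls f\<close> ennreal_qnorm_X[OF f] J_def by (rule nn_integral_0_iff_AE) measurable
    also have "\<dots> \<longleftrightarrow> (AE s in S. f s = \<zero>)"
      using L_carrier[OF f] q_pos qnorm_0_iff by (intro AE_cong) (simp add: ennreal_eq_0_iff)
    also have "\<dots> \<longleftrightarrow> x = \<zero>\<^bsub>X\<^esub>"
    proof
      assume "AE s in S. f s = \<zero>"
      then show "x = \<zero>\<^bsub>X\<^esub>" unfolding zero_X \<open>x = cls f\<close> by (intro cls_eqI f zero_L)
    next
      assume "x = \<zero>\<^bsub>X\<^esub>"
      then have "f \<in> cls (\<lambda>s. \<zero>)" using cls_self[OF f] by (simp add: zero_X)
      then have "AE s in S. \<zero> = f s" by (simp add: mem_cls)
      then show "AE s in S. f s = \<zero>" by eventually_elim simp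
    qed
    finally show "qnorm X x = 0 \<longleftrightarrow> x = \<zero>\<^bsub>X\<^esub>" .
    have "ennreal (qnorm X (\<ominus>\<^bsub>X\<^esub> x) powr q) = ennreal (qnorm X x powr q)"
      using f by (simp add: cls_minus ennreal_qnorm_X minus_L J_minus L_sv)
    then have "qnorm X (\<ominus>\<^bsub>X\<^esub> x) powr q = qnorm X x powr q" by simp
    then have "(qnorm X (\<ominus>\<^bsub>X\<^esub> x) powr q) powr (1 / q) = (qnorm X x powr q) powr (1 / q)" by simp
    then show "qnorm X (\<ominus>\<^bsub>X\<^esub> x) = qnorm X x"
      using q_pos nonneg qnorm_X_nonneg[OF minus_L[OF f]] f by (simp add: powr_powr cls_minus)
  next
    obtain K where K: "0 \<le> K" "\<And>f g. separably_valued S Y f \<Longrightarrow> separably_valued S Y g \<Longrightarrow>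
      J (\<lambda>s. f s \<oplus> g s) \<le> ennreal K * (J f + J g)" using J_add_bound by blast
    let ?C = "K powr (1 / q) * 2 powr (1 / q)"
    have "qnorm X (x \<oplus>\<^bsub>X\<^esub> y) \<le> ?C * (qnorm X x + qnorm X y)" if xy: "x \<in> carrier X" "y \<in> carrier X" for x y
    proof -
      obtain f g where [simp]: "x = cls f" "y = cls g" and fg: "f \<in> L" "g \<in> L" using xy by (auto simp: carrier_X)
      let ?a = "qnorm X x" and ?b = "qnorm X y" and ?c = "qnorm X (x \<oplus>\<^bsub>X\<^esub> y)"
      have nn: "0 \<le> ?a" "0 \<le> ?b" "0 \<le> ?c" using qnorm_X_nonneg add_L fg by (auto simp: cls_add)
      have "ennreal (?c powr q) \<le> ennreal K * (ennreal (?a powr q) + ennreal (?b powr q))"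
        using K(2)[of f g] fg L_sv by (simp add: cls_add ennreal_qnorm_X add_L)
      also have "\<dots> = ennreal (K * (?a powr q + ?b powr q))" using K(1) by (simp add: ennreal_mult ennreal_plus)
      finally have "?c powr q \<le> K * (?a powr q + ?b powr q)" using K(1) by (simp add: ennreal_le_iff)
      then have "(?c powr q) powr (1 / q) \<le> (K * (?a powr q + ?b powr q)) powr (1 / q)"
        using q_pos by (intro powr_mono2) auto
      also have "\<dots> = K powr (1 / q) * (?a powr q + ?b powr q) powr (1 / q)" using K(1) by (intro powr_mult)
      also have "\<dots> \<le> K powr (1 / q) * (2 powr (1 / q) * ((?a powr q) powr (1 / q) + (?b powr q) powr (1 / q)))"
        using q_pos by (intro mult_left_mono powr_add_le) auto
      finally show ?thesis using q_pos nn by (simp add: powr_powr mult.assoc)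
    qed
    then show "\<exists>C. \<forall>x\<in>carrier X. \<forall>y\<in>carrier X. qnorm X (x \<oplus>\<^bsub>X\<^esub> y) \<le> C * (qnorm X x + qnorm X y)" by blast
  qed
qed

lemma f_normed_group_X: "\<exists>NX rX. f_normed_group X NX rX"
  by (rule quasi_normed_group.f_norm_exists[OF quasi_normed_group_X])

text \<open>
  The value \<open>ev x s\<close> is the limit of the representatives of rapidly approximating classes from a
  countable dense set; \<open>S0\<close> is the union of the supports of these countably many representatives.
\<close>

lemma evaluation:
  assumes "f_normed_group X NX rX" and C: "f_normed_group.dense_for X NX C R"
  shows "\<exists>ev S0. separably_valued (qborel X \<Otimes>\<^sub>M S) Y (\<lambda>(x, s). ev x s) \<and>
    (\<forall>x s. ev x s \<in> carrier Y) \<and> (\<forall>x\<in>R. ev x \<in> L \<and> cls (ev x) = x) \<and>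
    S0 \<in> sets S \<and> sigma_finite_measure (density S (indicator S0)) \<and>
    (\<forall>x. \<forall>s\<in>space S - S0. ev x s = \<zero>)"
proof -
  interpret X: f_normed_group X NX rX by fact
  define CC where "CC = insert \<zero>\<^bsub>X\<^esub> C"
  have CC: "countable CC" "CC \<noteq> {}" "CC \<subseteq> carrier X"
    using C by (auto simp: CC_def X.dense_for_def)
  define c where "c = from_nat_into CC"
  have rc: "range c = CC" unfolding c_def using CC by (intro range_from_nat_into)
  then have cc: "c i \<in> carrier X" for i using CC by auto
  then have "\<exists>f\<in>L. c i = cls f" for i unfolding carrier_X by auto
  then obtain \<rho> where \<rho>: "\<And>i. \<rho> i \<in> L" "\<And>i. c i = cls (\<rho> i)" by metis
  \<comment> \<open>With this radius a class within \<open>\<delta> k\<close> of \<open>x\<close> in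
    \<open>NX\<close> differs from it by at most 2^-k in the \<open>q\<close>-th power of the
    \<open>L^q\<close> quasi-norm. The exponent converts \<open>NX\<close> to that power, and the
    division by 2 offsets the factor in \<open>qnorm_le_N\<close>.\<close>
  define \<delta> where "\<delta> = (\<lambda>k::nat. ((1 / 2) ^ k) powr (rX / q) / 2)"
  have \<delta>0: "0 < \<delta> k" for k by (simp add: \<delta>_def)
  \<comment> \<open>Choosing the least index makes the approximation depend measurably on the class,
    with countably many values.\<close>
  define \<psi> where "\<psi> = (\<lambda>k x. LEAST i. NX (x \<ominus>\<^bsub>X\<^esub> c i) < \<delta> k)"
  have \<psi>m [measurable]: "\<psi> k \<in> qborel X \<rightarrow>\<^sub>M count_space UNIV" for k
  proof -
    have [measurable]: "(\<lambda>x. NX (x \<ominus>\<^bsub>X\<^esub> c i)) \<in> borel_measurable (qborel X)" for i by (rule X.measurable_N_diff[OF cc])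
    show ?thesis unfolding \<psi>_def by measurable
  qed
  define u where "u = (\<lambda>k (x, s). \<rho> (\<psi> k x) s)"
  let ?P = "qborel X \<Otimes>\<^sub>M S"
  have usv: "separably_valued ?P Y (u k)" for k
  proof -
    have "(\<lambda>z. (\<lambda>i z. \<rho> i (snd z)) (\<psi> k (fst z)) z) \<in> ?P \<rightarrow>\<^sub>M qborel Y"
    proof (rule measurable_compose_countable)
      show "(\<lambda>z. \<rho> i (snd z)) \<in> ?P \<rightarrow>\<^sub>M qborel Y" for i
        by (rule measurable_compose[OF measurable_snd separably_valued_measurable[OF L_sv[OF \<rho>(1)]]])
    qed measurable
    moreover have "u k = (\<lambda>z. (\<lambda>i z. \<rho> i (snd z)) (\<psi> k (fst z)) z)" by (auto simp: u_def)
    ultimately have um: "u k \<in> ?P \<rightarrow>\<^sub>M qborel Y" by simp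
    have "\<forall>i. \<exists>A. dense_for A (\<rho> i ` space S)" using L_sv[OF \<rho>(1)] unfolding separably_valued_iff by blast
    then obtain A where A: "\<And>i. dense_for (A i) (\<rho> i ` space S)" by metis
    have "dense_for (\<Union>i. A i) (\<Union>i. \<rho> i ` space S)" by (rule dense_for_UN) (auto simp: A)
    then have "dense_for (\<Union>i. A i) (u k ` space ?P)"
      by (rule dense_for_subset) (auto simp: u_def space_pair_measure)
    then show ?thesis using um unfolding separably_valued_iff by blast
  qed
  have uc: "u k z \<in> carrier Y" if "z \<in> space ?P" for k z by (rule separably_valued_carrier[OF usv that])
  define lim where "lim = (\<lambda>z l. l \<in> carrier Y \<and> (\<lambda>k. N (u k z \<ominus> l)) \<longlonglongrightarrow> 0)"
  \<comment> \<open>The default zero makes \<open>ev\<close> total; representatives that fail to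
    converge at a point are harmless, as for classes in \<open>R\<close> this happens on a null set
    only.\<close>
  define ev where "ev = (\<lambda>x s. if \<exists>l. lim (x, s) l then SOME l. lim (x, s) l else \<zero>)"
  have ev_lim: "lim (x, s) (ev x s)" if "\<exists>l. lim (x, s) l" for x s
    using that unfolding ev_def by (auto intro: someI_ex)
  have evc: "ev x s \<in> carrier Y" for x s
    using ev_lim[of x s] by (cases "\<exists>l. lim (x, s) l") (auto simp: lim_def ev_def)
  have lim_unique: "l = l'" if z: "z \<in> space ?P" and l: "lim z l" "lim z l'" for z l l'
  proof -
    have "(\<lambda>k. N (u k z \<ominus> l) + N (u k z \<ominus> l')) \<longlonglongrightarrow> 0 + 0" using l by (intro tendsto_add) (auto simp: lim_def)
    moreover have "N (l \<ominus> l') \<le> N (u k z \<ominus> l) + N (u k z \<ominus> l')" for k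
      using N_diff_triangle[of l "u k z" l'] N_diff_commute[of l "u k z"] uc[OF z] l by (auto simp: lim_def)
    ultimately have "N (l \<ominus> l') \<le> 0" by (intro LIMSEQ_le_const[of _ 0]) auto
    then have "N (l \<ominus> l') = 0" using N_nonneg[of "l \<ominus> l'"] l by (auto simp: lim_def)
    then have "l \<ominus> l' = \<zero>" using N_eq_0D l by (auto simp: lim_def)
    then show ?thesis using add_minus_cancel[of l l'] l by (auto simp: lim_def)
  qed
  \<comment> \<open>The Cauchy condition with countably many tolerances, hence measurable in
    \<open>z\<close>; by completeness it holds exactly where a limit exists.\<close>
  define G where "G = (\<lambda>z. \<forall>i. \<exists>K. \<forall>m\<ge>K. \<forall>n\<ge>K. N (u m z \<ominus> u n z) < 1 / real (Suc i))"
  have lim_iff: "(\<exists>l. lim z l) \<longleftrightarrow> G z" if z: "z \<in> space ?P" for z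
  proof
    assume "\<exists>l. lim z l"
    then obtain l where l: "l \<in> carrier Y" "(\<lambda>k. N (u k z \<ominus> l)) \<longlonglongrightarrow> 0" by (auto simp: lim_def)
    show "G z"
      unfolding G_def
    proof
      fix i
      have "\<forall>\<^sub>F k in sequentially. N (u k z \<ominus> l) < 1 / real (Suc i) / 2"
        using order_tendstoD(2)[OF l(2), of "1 / real (Suc i) / 2"] by simp
      then obtain K where K: "\<And>k. k \<ge> K \<Longrightarrow> N (u k z \<ominus> l) < 1 / real (Suc i) / 2" by (auto simp: eventually_sequentially)
      have "N (u m z \<ominus> u n z) < 1 / real (Suc i)" if "m \<ge> K" "n \<ge> K" for m n
      proof -
        have "N (u m z \<ominus> u n z) \<le> N (u m z \<ominus> l) + N (l \<ominus> u n z)" using uc[OF z] l by (intro N_diff_triangle) auto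
        also have "N (l \<ominus> u n z) = N (u n z \<ominus> l)" using uc[OF z] l by (intro N_diff_commute) auto
        also have "N (u m z \<ominus> l) + N (u n z \<ominus> l) < 1 / real (Suc i) / 2 + 1 / real (Suc i) / 2"
          by (intro add_strict_mono K that)
        finally show ?thesis by (simp only: field_sum_of_halves)
      qed
      then show "\<exists>K. \<forall>m\<ge>K. \<forall>n\<ge>K. N (u m z \<ominus> u n z) < 1 / real (Suc i)" by blast
    qed
  next
    assume G: "G z"
    have "\<exists>l\<in>carrier Y. (\<lambda>n. N (u n z \<ominus> l)) \<longlonglongrightarrow> 0"
    proof (rule complete_N)
      fix \<epsilon> :: real assume "0 < \<epsilon>"
      then obtain i where i: "1 / real (Suc i) < \<epsilon>" using nat_ex_less by blast
      obtain K where "\<And>m n. m \<ge> K \<Longrightarrow> n \<ge> K \<Longrightarrow> N (u m z \<ominus> u n z) < 1 / real (Suc i)" using G unfolding G_def by blast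
      then show "\<exists>K. \<forall>m\<ge>K. \<forall>n\<ge>K. N (u m z \<ominus> u n z) < \<epsilon>" using i by (meson order_less_trans)
    qed (rule uc[OF z])
    then show "\<exists>l. lim z l" by (auto simp: lim_def)
  qed
  have evsv: "separably_valued ?P Y (\<lambda>(x, s). ev x s)"
  proof (rule separably_valued_lim)
    have [measurable]: "(\<lambda>z. N (u m z \<ominus> u n z)) \<in> borel_measurable ?P" for m n
      by (intro measurable_N_compose separably_valued_diff usv)
    have "Measurable.pred ?P G" unfolding G_def by measurable
    then show "separably_valued ?P Y (\<lambda>z. if G z then u k z else \<zero>)" for k
      by (intro separably_valued_if usv separably_valued_const) auto
    show "(case z of (x, s) \<Rightarrow> ev x s) \<in> carrier Y" for z using evc by (cases z) auto
    fix z assume z: "z \<in> space ?P"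
    obtain x s where xs: "z = (x, s)" by (cases z)
    show "(\<lambda>k. N ((if G z then u k z else \<zero>) \<ominus> (case z of (x, s) \<Rightarrow> ev x s))) \<longlonglongrightarrow> 0"
    proof (cases "G z")
      case True
      then have "\<exists>l. lim z l" using lim_iff[OF z] by simp
      then have "lim z (ev x s)" using ev_lim[of x s] by (simp add: xs)
      then show ?thesis using True by (simp add: xs lim_def)
    next
      case False
      then have "ev x s = \<zero>" using lim_iff[OF z] by (auto simp: ev_def xs)
      then show ?thesis using False by (simp add: xs minus_self N_zero)
    qed
  qed
  have sec: "(\<lambda>s. (x, s)) \<in> S \<rightarrow>\<^sub>M ?P" if "x \<in> carrier X" for x
    using that by (intro measurable_Pair1') (simp add: space_qborel)
  have cls_ev: "ev x \<in> L \<and> cls (ev x) = x" if xR: "x \<in> R" for x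
  proof -
    have x: "x \<in> carrier X" using xR C by (auto simp: X.dense_for_def)
    then obtain f where f: "f \<in> L" "x = cls f" by (auto simp: carrier_X)
    let ?t = "\<lambda>k s. qnorm Y (f s \<ominus> u k (x, s)) powr q"
    \<comment> \<open>The bounds are summable over \<open>k\<close>, so the sum of the
      \<open>q\<close>-th powers of the errors is finite at almost every \<open>s\<close>, and the
      chosen representatives converge there to \<open>f s\<close>.\<close>
    have close: "(\<integral>\<^sup>+s. ennreal (?t k s) \<partial>S) \<le> ennreal ((1 / 2) ^ k)" for k
    proof -
      obtain y where y: "y \<in> C" "NX (x \<ominus>\<^bsub>X\<^esub> y) < \<delta> k" using X.dense_forD[OF C xR \<delta>0] by blast
      then have "y \<in> range c" unfolding rc CC_def by simp
      then obtain i where "y = c i" ..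
      then have "NX (x \<ominus>\<^bsub>X\<^esub> c i) < \<delta> k" using y by simp
      then have "NX (x \<ominus>\<^bsub>X\<^esub> c (\<psi> k x)) < \<delta> k"
        unfolding \<psi>_def by (rule LeastI[of "\<lambda>i. NX (x \<ominus>\<^bsub>X\<^esub> c i) < \<delta> k"])
      then have NX: "2 * NX (x \<ominus>\<^bsub>X\<^esub> c (\<psi> k x)) \<le> ((1 / 2) ^ k) powr (rX / q)" by (simp add: \<delta>_def)
      have xc: "x \<ominus>\<^bsub>X\<^esub> c (\<psi> k x) \<in> carrier X" using x cc by simp
      have "qnorm X (x \<ominus>\<^bsub>X\<^esub> c (\<psi> k x)) powr rX \<le> ((1 / 2) ^ k) powr (rX / q)"
        using X.qnorm_le_N[OF xc] NX by linarith
      then have "(qnorm X (x \<ominus>\<^bsub>X\<^esub> c (\<psi> k x)) powr rX) powr (q / rX) \<le> (((1 / 2) ^ k) powr (rX / q)) powr (q / rX)"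
        using q_pos X.r_pos by (intro powr_mono2) auto
      then have le: "qnorm X (x \<ominus>\<^bsub>X\<^esub> c (\<psi> k x)) powr q \<le> (1 / 2) ^ k"
        using q_pos X.r_pos by (simp add: powr_powr)
      have "(\<integral>\<^sup>+s. ennreal (?t k s) \<partial>S) = J (\<lambda>s. f s \<ominus> \<rho> (\<psi> k x) s)" by (simp add: J_def u_def)
      also have "\<dots> = ennreal (qnorm X (x \<ominus>\<^bsub>X\<^esub> c (\<psi> k x)) powr q)"
        using f \<rho> by (simp add: cls_diff ennreal_qnorm_X diff_L)
      finally show ?thesis using le by (simp add: ennreal_leI)
    qed
    have usec: "separably_valued S Y (\<lambda>s. u k (x, s))" for k by (rule separably_valued_compose[OF usv sec[OF x]])
    have tm [measurable]: "(\<lambda>s. qnorm Y (f s \<ominus> u k (x, s))) \<in> borel_measurable S" for k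
      by (intro measurable_qnorm_compose separably_valued_diff L_sv f usec)
    have "(\<integral>\<^sup>+s. (\<Sum>k. ennreal (?t k s)) \<partial>S) = (\<Sum>k. \<integral>\<^sup>+s. ennreal (?t k s) \<partial>S)"
      by (rule nn_integral_suminf) measurable
    also have "\<dots> \<le> (\<Sum>k. ennreal ((1 / 2) ^ k))" by (intro suminf_le close) auto
    also have "\<dots> = ennreal (\<Sum>k. (1 / 2) ^ k)" by (rule suminf_ennreal2) (auto intro!: summable_geometric)
    finally have "(\<integral>\<^sup>+s. (\<Sum>k. ennreal (?t k s)) \<partial>S) \<noteq> \<infinity>" by (auto simp: top_unique)
    then have "AE s in S. (\<Sum>k. ennreal (?t k s)) \<noteq> \<infinity>" by (intro nn_integral_PInf_AE) measurable
    then have AE: "AE s in S. f s = ev x s"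
    proof (rule AE_mp, intro AE_I2 impI)
      fix s assume s: "s \<in> space S" and fin: "(\<Sum>k. ennreal (?t k s)) \<noteq> \<infinity>"
      have z: "(x, s) \<in> space ?P" using x s by (simp add: space_pair_measure space_qborel)
      have fs: "f s \<in> carrier Y" using L_carrier[OF f(1) s] .
      have "summable (\<lambda>k. ?t k s)" using fin by (intro summable_suminf_not_top) auto
      then have t: "(\<lambda>k. ?t k s) \<longlonglongrightarrow> 0" by (rule summable_LIMSEQ_zero)
      have t0: "(\<lambda>k. ?t k s powr (r / q)) \<longlonglongrightarrow> 0"
        by (rule tendsto_zero_powrI[OF t tendsto_const]) (use q_pos r_pos in simp_all)
      have "(\<lambda>k. N (u k (x, s) \<ominus> f s)) \<longlonglongrightarrow> 0"
      proof (rule tendsto_sandwich[OF _ _ tendsto_const t0])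
        show "\<forall>\<^sub>F k in sequentially. 0 \<le> N (u k (x, s) \<ominus> f s)" using uc[OF z] fs N_nonneg by simp
        have "N (u k (x, s) \<ominus> f s) \<le> ?t k s powr (r / q)" for k
        proof -
          have "N (u k (x, s) \<ominus> f s) = N (f s \<ominus> u k (x, s))" by (rule N_diff_commute[OF uc[OF z] fs])
          also have "\<dots> \<le> qnorm Y (f s \<ominus> u k (x, s)) powr r" by (intro N_le_qnorm minus_closed fs uc[OF z])
          also have "\<dots> = ?t k s powr (r / q)" using q_pos by (simp add: powr_powr)
          finally show ?thesis .
        qed
        then show "\<forall>\<^sub>F k in sequentially. N (u k (x, s) \<ominus> f s) \<le> ?t k s powr (r / q)" by simp
      qed
      then have l: "lim (x, s) (f s)" using fs by (simp add: lim_def)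
      then have "lim (x, s) (ev x s)" using ev_lim by blast
      then show "f s = ev x s" by (rule lim_unique[OF z l])
    qed
    have "J (ev x) = J f" using AE by (intro J_cong_AE) (auto elim: eventually_mono)
    moreover have "separably_valued S Y (ev x)" using separably_valued_compose[OF evsv sec[OF x]] by simp
    ultimately have evL: "ev x \<in> L" using f by (simp add: L_iff)
    have "cls (ev x) = x" by (rule trans[OF cls_eqI[OF f(1) evL AE, symmetric] f(2)[symmetric]])
    then show ?thesis using evL by blast
  qed
  let ?B = "\<lambda>(i, j). {s \<in> space S. 1 / real (Suc j) \<le> qnorm Y (\<rho> i s) powr q}"
  have \<rho>m [measurable]: "(\<lambda>s. qnorm Y (\<rho> i s)) \<in> borel_measurable S" for i by (rule measurable_qnorm_compose[OF L_sv[OF \<rho>(1)]])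
  have Bs: "?B ij \<in> sets S" for ij by (cases ij) simp
  \<comment> \<open>Each set in this countable union has finite measure by Markov's inequality.
    Restricting \<open>S\<close> to it gives a \<sigma>-finite measure, and outside it all
    representatives vanish, so \<open>ev\<close> vanishes too.\<close>
  define S0 where "S0 = (\<Union>ij. ?B ij)"
  have S0: "S0 \<in> sets S" unfolding S0_def using Bs by (intro sets.countable_UN) auto
  have Bfin: "emeasure S (?B ij) < \<infinity>" for ij
  proof -
    obtain i j where ij: "ij = (i, j)" by (cases ij)
    have "emeasure S (?B ij) = (\<integral>\<^sup>+s. indicator (?B ij) s \<partial>S)" using Bs by simp
    also have "\<dots> \<le> (\<integral>\<^sup>+s. ennreal (real (Suc j)) * ennreal (qnorm Y (\<rho> i s) powr q) \<partial>S)"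
    proof (intro nn_integral_mono)
      fix s
      show "indicator (?B ij) s \<le> ennreal (real (Suc j)) * ennreal (qnorm Y (\<rho> i s) powr q)"
      proof (cases "s \<in> ?B ij")
        case True
        then have "1 \<le> real (Suc j) * qnorm Y (\<rho> i s) powr q" by (simp add: ij field_simps)
        then have "ennreal 1 \<le> ennreal (real (Suc j) * qnorm Y (\<rho> i s) powr q)" by (rule ennreal_leI)
        also have "\<dots> = ennreal (real (Suc j)) * ennreal (qnorm Y (\<rho> i s) powr q)" by (rule ennreal_mult') simp
        finally show ?thesis using True by (simp only: indicator_simps ennreal_1)
      next
        case False
        then have "indicator (?B ij) s = (0 :: ennreal)" by (rule indicator_simps)
        then show ?thesis by (simp only: zero_le)
      qed
    qed
    also have "\<dots> = ennreal (real (Suc j)) * J (\<rho> i)" unfolding J_def by (rule nn_integral_cmult) measurable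
    also have "\<dots> < \<infinity>" using L_J[OF \<rho>(1)] by (simp add: ennreal_mult_less_top)
    finally show ?thesis .
  qed
  have S0_zero: "\<rho> i s = \<zero>" if "s \<in> space S - S0" for i s
  proof (rule ccontr)
    assume "\<rho> i s \<noteq> \<zero>"
    moreover have "\<rho> i s \<in> carrier Y" using that L_carrier[OF \<rho>(1)] by simp
    ultimately have "0 < qnorm Y (\<rho> i s)" using qnorm_0_iff[of "\<rho> i s"] qnorm_ge_0[of "\<rho> i s"] by simp
    then have "0 < qnorm Y (\<rho> i s) powr q" by simp
    then obtain j where "1 / real (Suc j) < qnorm Y (\<rho> i s) powr q" using nat_ex_less by blast
    then have "s \<in> ?B (i, j)" using that by simp
    then show False using that unfolding S0_def by blast
  qed
  have ev0: "ev x s = \<zero>" if s: "s \<in> space S - S0" for x s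
  proof -
    have u0: "u k (x, s) = \<zero>" for k using S0_zero[OF s] by (simp add: u_def)
    have "lim (x, s) \<zero>" using u0 by (simp add: lim_def minus_self N_zero)
    then have "lim (x, s) (ev x s)" using ev_lim by blast
    then have "(\<lambda>k::nat. N (\<zero> \<ominus> ev x s)) \<longlonglongrightarrow> 0" by (simp add: lim_def u0)
    then have "N (\<zero> \<ominus> ev x s) = 0" by (simp add: LIMSEQ_const_iff)
    then have "N (ev x s) = 0" using N_minus[OF evc] evc by (simp add: minus_eq)
    then show ?thesis using N_eq_0D evc by blast
  qed
  have "sigma_finite_measure (density S (indicator S0))"
  proof
    let ?\<A> = "insert (space S - S0) (range ?B)"
    show "\<exists>A. countable A \<and> A \<subseteq> sets (density S (indicator S0)) \<and> \<Union>A = space (density S (indicator S0)) \<and>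
        (\<forall>a\<in>A. emeasure (density S (indicator S0)) a \<noteq> \<infinity>)"
    proof (intro exI[of _ ?\<A>] conjI ballI)
      show "countable ?\<A>" by simp
      show "?\<A> \<subseteq> sets (density S (indicator S0))" using Bs S0 by auto
      show "\<Union>?\<A> = space (density S (indicator S0))"
      proof -
        have "\<Union>?\<A> = (space S - S0) \<union> S0" unfolding S0_def by simp
        then show ?thesis using sets.sets_into_space[OF S0] by auto
      qed
      fix a assume a: "a \<in> ?\<A>"
      have as: "a \<in> sets S" using a Bs S0 by auto
      have eq: "emeasure (density S (indicator S0)) a = emeasure S (S0 \<inter> a)"
        using S0 as by (rule emeasure_restricted)
      show "emeasure (density S (indicator S0)) a \<noteq> \<infinity>"
      proof (cases "a = space S - S0")
        case True
        then have "S0 \<inter> a = {}" by auto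
        then show ?thesis unfolding eq by simp
      next
        case False
        then obtain ij where "a = ?B ij" using a by auto
        then have "emeasure S (S0 \<inter> a) \<le> emeasure S (?B ij)" using Bs by (simp add: emeasure_mono)
        also have "\<dots> < \<infinity>" by (rule Bfin)
        finally show ?thesis unfolding eq by simp
      qed
    qed
  qed
  then show ?thesis using evsv evc cls_ev S0 ev0 by blast
qed

end

section \<open>Decoupling constants\<close>

lemma separably_valued_subalgebra:
  assumes "subalgebra M G" "separably_valued G V f" shows "separably_valued M V f"
proof -
  have "space G = space M" using assms(1) by (simp add: subalgebra_def)
  moreover have "f \<in> G \<rightarrow>\<^sub>M qborel V" using assms(2) by (simp add: separably_valued_def)
  then have "f \<in> M \<rightarrow>\<^sub>M qborel V" by (rule measurable_from_subalg[OF assms(1)])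
  ultimately show ?thesis using assms(2) by (simp add: separably_valued_def)
qed

context lq_setting
begin

text \<open>
  Evaluation at a fixed point \<open>s\<close> is a Borel map from \<open>L\<^sup>q(S;Y)\<close> to \<open>Y\<close>, so the steps evaluated
  at \<open>s\<close> are again decoupled tangent, for every \<open>s\<close>; it remains to integrate over \<open>s\<close>.
\<close>

lemma decoupling_bound_X:
  assumes bound: "decoupling_bound TYPE('w) Y q D"
  shows "decoupling_bound TYPE('w) X q D"
  unfolding decoupling_bound_def
proof (intro conjI allI impI)
  show D0: "0 \<le> D" using bound by (simp add: decoupling_bound_def)
  fix M :: "'w measure" and F f g and n :: nat
  assume cf: "complete_filtered_prob_space M F" and ds: "decoupled_sum M F X f g"
    and fin: "\<forall>n\<ge>1. Lp_norm q M X (f n) < \<infinity>" and n: "n \<ge> 1"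
  note cfD = complete_filtered_prob_spaceD[OF cf]
  interpret M: prob_space M by (rule cfD)
  obtain NX rX where FX: "f_normed_group X NX rX" using f_normed_group_X by blast
  interpret X: f_normed_group X NX rX by (rule FX)
  define d where "d = (\<lambda>k \<omega>. f k \<omega> \<ominus>\<^bsub>X\<^esub> f (k - 1) \<omega>)"
  define e where "e = (\<lambda>k \<omega>. g k \<omega> \<ominus>\<^bsub>X\<^esub> g (k - 1) \<omega>)"
  have tang: "decoupled_tangent M F X d e" and zero: "f 0 = (\<lambda>\<omega>. \<zero>\<^bsub>X\<^esub>)" "g 0 = (\<lambda>\<omega>. \<zero>\<^bsub>X\<^esub>)"
    using ds by (auto simp: decoupled_sum_def d_def e_def)
  have dF: "separably_valued (F k) X (d k)" and eM: "separably_valued M X (e k)" if "k \<ge> 1" for k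
    using tang that by (auto simp: decoupled_tangent_def adapted_def)
  have dM: "separably_valued M X (d k)" if "k \<ge> 1" for k
    by (rule separably_valued_subalgebra[OF cfD(2) dF[OF that]])
  have fM: "separably_valued M X (f k)" if "k \<ge> 1" for k
    using ds that separably_valued_subalgebra[OF cfD(2), of k X "f k"] by (auto simp: decoupled_sum_def adapted_def)
  have gM: "separably_valued M X (g k)" if "k \<ge> 1" for k
    using ds that by (auto simp: decoupled_sum_def)
  have fc: "f k \<omega> \<in> carrier X" and gc: "g k \<omega> \<in> carrier X" if "\<omega> \<in> space M" for k \<omega>
    using separably_valued_carrier[OF fM that] separably_valued_carrier[OF gM that] zero by (cases "k = 0"; simp)+
  have "\<forall>k. \<exists>A. k \<ge> 1 \<longrightarrow> X.dense_for A (d k ` space M)" "\<forall>k. \<exists>A. k \<ge> 1 \<longrightarrow> X.dense_for A (e k ` space M)"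
    using dM eM unfolding X.separably_valued_iff by blast+
  then obtain A B where A: "\<And>k. k \<ge> 1 \<Longrightarrow> X.dense_for (A k) (d k ` space M)"
    and B: "\<And>k. k \<ge> 1 \<Longrightarrow> X.dense_for (B k) (e k ` space M)" by metis
  \<comment> \<open>All steps and all copies at all times range in one separable set, so a single
    evaluation map serves the whole argument.\<close>
  define R where "R = (\<Union>k\<in>{1..}. d k ` space M) \<union> (\<Union>k\<in>{1..}. e k ` space M)"
  have "X.dense_for (\<Union>i. if i then \<Union>k\<in>{1..}. A k else \<Union>k\<in>{1..}. B k)
      (\<Union>i. if i then \<Union>k\<in>{1..}. d k ` space M else \<Union>k\<in>{1..}. e k ` space M)"
  proof (rule X.dense_for_UN)
    fix i
    have "X.dense_for (\<Union>k\<in>{1..}. A k) (\<Union>k\<in>{1..}. d k ` space M)" by (rule X.dense_for_UN) (auto intro: A)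
    moreover have "X.dense_for (\<Union>k\<in>{1..}. B k) (\<Union>k\<in>{1..}. e k ` space M)" by (rule X.dense_for_UN) (auto intro: B)
    ultimately show "X.dense_for (if i then \<Union>k\<in>{1..}. A k else \<Union>k\<in>{1..}. B k)
      (if i then \<Union>k\<in>{1..}. d k ` space M else \<Union>k\<in>{1..}. e k ` space M)" by simp
  qed simp
  then have R: "X.dense_for (\<Union>i. if i then \<Union>k\<in>{1..}. A k else \<Union>k\<in>{1..}. B k) R"
    by (rule X.dense_for_subset) (auto simp: R_def)
  obtain ev S0 where E: "separably_valued (qborel X \<Otimes>\<^sub>M S) Y (\<lambda>(x, s). ev x s) \<and>
      (\<forall>x s. ev x s \<in> carrier Y) \<and> (\<forall>x\<in>R. ev x \<in> L \<and> cls (ev x) = x) \<and>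
      S0 \<in> sets S \<and> sigma_finite_measure (density S (indicator S0)) \<and>
      (\<forall>x. \<forall>s\<in>space S - S0. ev x s = \<zero>)"
    using evaluation[OF FX R] by (elim exE)
  note evsv = E[THEN conjunct1]
  have evc: "ev x s \<in> carrier Y" and evR: "x \<in> R \<Longrightarrow> ev x \<in> L \<and> cls (ev x) = x"
    and ev0: "s \<in> space S - S0 \<Longrightarrow> ev x s = \<zero>" for x s
    using E by simp_all
  have S0: "S0 \<in> sets S" "sigma_finite_measure (density S (indicator S0))" using E by simp_all
  \<comment> \<open>Fubini is applied to \<open>\<nu>\<close> and \<open>M\<close>; \<open>S\<close>
    itself need not be \<sigma>-finite. No mass of the integrands is lost, as they vanish off
    \<open>S0\<close>.\<close>
  define \<nu> where "\<nu> = density S (indicator S0)"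
  interpret \<nu>: sigma_finite_measure \<nu> using S0(2) by (simp add: \<nu>_def)
  interpret P: pair_sigma_finite \<nu> M ..
  have sets\<nu>: "sets \<nu> = sets S" and space\<nu>: "space \<nu> = space S" by (simp_all add: \<nu>_def)
  have evs: "separably_valued (qborel X) Y (\<lambda>x. ev x s)" if "s \<in> space S" for s
    using separably_valued_compose[OF evsv measurable_Pair2'[OF that, of "qborel X"]] by simp
  define fs where "fs = (\<lambda>s k \<omega>. vsum (\<lambda>j. ev (d j \<omega>) s) k)"
  define gs where "gs = (\<lambda>s k \<omega>. vsum (\<lambda>j. ev (e j \<omega>) s) k)"
  have step: "ev (x (Suc j)) s = vsum (\<lambda>i. ev (x i) s) (Suc j) \<ominus> vsum (\<lambda>i. ev (x i) s) j" for x j s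
  proof -
    have v: "vsum (\<lambda>i. ev (x i) s) j \<in> carrier Y" by (intro vsum_closed evc)
    then have "vsum (\<lambda>i. ev (x i) s) (Suc j) = ev (x (Suc j)) s \<oplus> vsum (\<lambda>i. ev (x i) s) j"
      using evc by (simp add: a_comm)
    then show ?thesis using v evc by (simp only: minus_eq a_assoc r_neg r_zero a_inv_closed)
  qed
  have dsum: "decoupled_sum M F Y (fs s) (gs s)" if s: "s \<in> space S" for s
  proof -
    have svd: "separably_valued (F k) Y (\<lambda>\<omega>. ev (d k \<omega>) s)" if "k \<ge> 1" for k
      by (rule separably_valued_compose[OF evs[OF s] separably_valued_measurable[OF dF[OF that]]])
    have sve: "separably_valued M Y (\<lambda>\<omega>. ev (e k \<omega>) s)" if "k \<ge> 1" for k
      by (rule separably_valued_compose[OF evs[OF s] separably_valued_measurable[OF eM[OF that]]])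
    have "decoupled_tangent M F Y (\<lambda>k \<omega>. ev (d k \<omega>) s) (\<lambda>k \<omega>. ev (e k \<omega>) s)"
      by (rule decoupled_tangent_map[OF cf tang separably_valued_measurable[OF evs[OF s]]]) (auto intro: svd sve)
    moreover have "ev (d k \<omega>) s = fs s k \<omega> \<ominus> fs s (k - 1) \<omega>" "ev (e k \<omega>) s = gs s k \<omega> \<ominus> gs s (k - 1) \<omega>" if "k \<ge> 1" for k \<omega>
    proof -
      obtain j where j: "k = Suc j" using \<open>k \<ge> 1\<close> by (cases k) auto
      show "ev (d k \<omega>) s = fs s k \<omega> \<ominus> fs s (k - 1) \<omega>" "ev (e k \<omega>) s = gs s k \<omega> \<ominus> gs s (k - 1) \<omega>"
        unfolding fs_def gs_def j diff_Suc_1 by (rule step)+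
    qed
    ultimately have "decoupled_tangent M F Y (\<lambda>k \<omega>. fs s k \<omega> \<ominus> fs s (k - 1) \<omega>) (\<lambda>k \<omega>. gs s k \<omega> \<ominus> gs s (k - 1) \<omega>)"
      by (rule decoupled_tangent_transfer[OF cf])
    moreover have "separably_valued (F k) Y (fs s k)" for k
      unfolding fs_def
    proof (rule separably_valued_vsum)
      fix j assume "j \<in> {1..k}"
      then show "separably_valued (F k) Y (\<lambda>\<omega>. ev (d j \<omega>) s)"
        using svd[of j] by (intro separably_valued_subalgebra[OF cfD(4)[of j k]]) auto
    qed
    moreover have "separably_valued M Y (gs s k)" for k
      unfolding gs_def by (rule separably_valued_vsum) (auto intro: sve)
    moreover have "fs s 0 = (\<lambda>\<omega>. \<zero>)" "gs s 0 = (\<lambda>\<omega>. \<zero>)" by (auto simp: fs_def gs_def)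
    ultimately show ?thesis by (simp add: decoupled_sum_def adapted_def)
  qed
  \<comment> \<open>Evaluation is not additive pointwise, so the sums are not evaluated themselves.
    Instead the evaluated steps are added up, and the result represents the class of the
    sum.\<close>
  have rep: "(\<lambda>s. vsum (\<lambda>j. ev (x j) s) k) \<in> L \<and> cls (\<lambda>s. vsum (\<lambda>j. ev (x j) s) k) = y k"
    if "\<And>j. j \<ge> 1 \<Longrightarrow> x j \<in> R" "y 0 = \<zero>\<^bsub>X\<^esub>" "\<And>j. y j \<in> carrier X" "\<And>j. j \<ge> 1 \<Longrightarrow> x j = y j \<ominus>\<^bsub>X\<^esub> y (j - 1)" for x y k
  proof (induction k)
    case 0
    show ?case using zero_L that(2) by (simp add: zero_X)
  next
    case (Suc k)
    have "x (Suc k) \<in> R" using that(1) by simp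
    moreover have "y (Suc k) = y k \<oplus>\<^bsub>X\<^esub> x (Suc k)"
      using that(3,4) X.add_minus_cancel[of "y (Suc k)" "y k"] X.a_comm[of "y k" "x (Suc k)"] by simp
    ultimately show ?case
      using Suc evR[of "x (Suc k)"] add_L[of "\<lambda>s. vsum (\<lambda>j. ev (x j) s) k" "ev (x (Suc k))"]
        cls_add[of "\<lambda>s. vsum (\<lambda>j. ev (x j) s) k" "ev (x (Suc k))"] by simp
  qed
  have norm_eq: "ennreal (qnorm X (y k) powr q) = (\<integral>\<^sup>+s. ennreal (qnorm Y (vsum (\<lambda>j. ev (x j) s) k) powr q) \<partial>\<nu>)"
    if "\<And>j. j \<ge> 1 \<Longrightarrow> x j \<in> R" "y 0 = \<zero>\<^bsub>X\<^esub>" "\<And>j. y j \<in> carrier X" "\<And>j. j \<ge> 1 \<Longrightarrow> x j = y j \<ominus>\<^bsub>X\<^esub> y (j - 1)" for x y k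
  proof -
    let ?h = "\<lambda>s. vsum (\<lambda>j. ev (x j) s) k"
    have h: "?h \<in> L" "cls ?h = y k" using rep[of x y k] that by auto
    have [measurable]: "(\<lambda>s. qnorm Y (?h s)) \<in> borel_measurable S" by (rule measurable_qnorm_compose[OF L_sv[OF h(1)]])
    have "?h s = \<zero>" if "s \<in> space S - S0" for s by (induction k) (simp_all add: ev0[OF that])
    then have "ennreal (qnorm Y (?h s) powr q) = 0" if "s \<in> space S - S0" for s
      using that qnorm_0_iff[of \<zero>] q_pos by simp
    then have "J ?h = (\<integral>\<^sup>+s. indicator S0 s * ennreal (qnorm Y (?h s) powr q) \<partial>S)"
      unfolding J_def by (intro nn_integral_cong) (auto simp: indicator_def)
    also have "\<dots> = (\<integral>\<^sup>+s. ennreal (qnorm Y (?h s) powr q) \<partial>\<nu>)"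
      unfolding \<nu>_def using S0(1) by (subst nn_integral_density) auto
    finally show ?thesis using ennreal_qnorm_X[OF h(1)] h(2) by simp
  qed
  define hf where "hf = (\<lambda>k (s, \<omega>). ennreal (qnorm Y (fs s k \<omega>) powr q))"
  define hg where "hg = (\<lambda>k (s, \<omega>). ennreal (qnorm Y (gs s k \<omega>) powr q))"
  have joint: "(\<lambda>z. ennreal (qnorm Y (vsum (\<lambda>j. ev (x j (snd z)) (fst z)) k) powr q)) \<in> borel_measurable (\<nu> \<Otimes>\<^sub>M M)"
    if x: "\<And>j. j \<ge> 1 \<Longrightarrow> separably_valued M X (x j)" for x k
  proof -
    have "separably_valued (\<nu> \<Otimes>\<^sub>M M) Y (\<lambda>z. vsum (\<lambda>j. ev (x j (snd z)) (fst z)) k)"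
    proof (rule separably_valued_vsum)
      fix j assume "j \<in> {1..k}"
      then have [measurable]: "x j \<in> M \<rightarrow>\<^sub>M qborel X" using x separably_valued_measurable by auto
      have [measurable]: "(\<lambda>s. s) \<in> \<nu> \<rightarrow>\<^sub>M S" by (rule measurable_ident_sets[OF sets\<nu>])
      have "(\<lambda>z. (x j (snd z), (\<lambda>s. s) (fst z))) \<in> \<nu> \<Otimes>\<^sub>M M \<rightarrow>\<^sub>M qborel X \<Otimes>\<^sub>M S" by measurable
      from separably_valued_compose[OF evsv this]
      show "separably_valued (\<nu> \<Otimes>\<^sub>M M) Y (\<lambda>z. ev (x j (snd z)) (fst z))" by simp
    qed
    from measurable_qnorm_compose[OF this] show ?thesis by simp
  qed
  have hfm [measurable]: "hf k \<in> borel_measurable (\<nu> \<Otimes>\<^sub>M M)" for k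
    using joint[of d k] dM by (simp add: hf_def fs_def case_prod_unfold)
  have hgm [measurable]: "hg k \<in> borel_measurable (\<nu> \<Otimes>\<^sub>M M)" for k
    using joint[of e k] eM by (simp add: hg_def gs_def case_prod_unfold)
  have If: "(\<integral>\<^sup>+\<omega>. ennreal (qnorm X (f k \<omega>) powr q) \<partial>M) = (\<integral>\<^sup>+s. (\<integral>\<^sup>+\<omega>. hf k (s, \<omega>) \<partial>M) \<partial>\<nu>)" for k
  proof -
    have "(\<integral>\<^sup>+\<omega>. ennreal (qnorm X (f k \<omega>) powr q) \<partial>M) = (\<integral>\<^sup>+\<omega>. (\<integral>\<^sup>+s. hf k (s, \<omega>) \<partial>\<nu>) \<partial>M)"
    proof (intro nn_integral_cong)
      fix \<omega> assume \<omega>: "\<omega> \<in> space M"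
      show "ennreal (qnorm X (f k \<omega>) powr q) = (\<integral>\<^sup>+s. hf k (s, \<omega>) \<partial>\<nu>)"
        unfolding hf_def fs_def prod.case
        by (rule norm_eq[of "\<lambda>j. d j \<omega>" "\<lambda>j. f j \<omega>"]) (use \<omega> fc zero in \<open>auto simp: R_def d_def\<close>)
    qed
    also have "\<dots> = (\<integral>\<^sup>+s. (\<integral>\<^sup>+\<omega>. hf k (s, \<omega>) \<partial>M) \<partial>\<nu>)" by (rule P.Fubini[OF hfm])
    finally show ?thesis .
  qed
  have Ig: "(\<integral>\<^sup>+\<omega>. ennreal (qnorm X (g k \<omega>) powr q) \<partial>M) = (\<integral>\<^sup>+s. (\<integral>\<^sup>+\<omega>. hg k (s, \<omega>) \<partial>M) \<partial>\<nu>)" for k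
  proof -
    have "(\<integral>\<^sup>+\<omega>. ennreal (qnorm X (g k \<omega>) powr q) \<partial>M) = (\<integral>\<^sup>+\<omega>. (\<integral>\<^sup>+s. hg k (s, \<omega>) \<partial>\<nu>) \<partial>M)"
    proof (intro nn_integral_cong)
      fix \<omega> assume \<omega>: "\<omega> \<in> space M"
      show "ennreal (qnorm X (g k \<omega>) powr q) = (\<integral>\<^sup>+s. hg k (s, \<omega>) \<partial>\<nu>)"
        unfolding hg_def gs_def prod.case
        by (rule norm_eq[of "\<lambda>j. e j \<omega>" "\<lambda>j. g j \<omega>"]) (use \<omega> gc zero in \<open>auto simp: R_def e_def\<close>)
    qed
    also have "\<dots> = (\<integral>\<^sup>+s. (\<integral>\<^sup>+\<omega>. hg k (s, \<omega>) \<partial>M) \<partial>\<nu>)" by (rule P.Fubini[OF hgm])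
    finally show ?thesis .
  qed
  \<comment> \<open>The inequality in \<open>Y\<close> may be used only if the evaluated process has
    finite moments at all times. This holds for almost every \<open>s\<close>, simultaneously for
    the countably many times.\<close>
  have AEk: "AE s in \<nu>. (\<integral>\<^sup>+\<omega>. hf k (s, \<omega>) \<partial>M) \<noteq> \<infinity>" if "k \<ge> 1" for k
  proof (rule nn_integral_PInf_AE)
    show "(\<lambda>s. \<integral>\<^sup>+\<omega>. hf k (s, \<omega>) \<partial>M) \<in> borel_measurable \<nu>" by (rule M.borel_measurable_nn_integral_fst[OF hfm])
    show "(\<integral>\<^sup>+s. (\<integral>\<^sup>+\<omega>. hf k (s, \<omega>) \<partial>M) \<partial>\<nu>) \<noteq> \<infinity>"
    proof -
      have "Lp_norm q M X (f k) < \<infinity>" using fin that by simp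
      then show ?thesis unfolding If[symmetric] Lp_norm_finite_iff by (rule less_imp_neq)
    qed
  qed
  have "AE s in \<nu>. \<forall>k. k \<ge> 1 \<longrightarrow> (\<integral>\<^sup>+\<omega>. hf k (s, \<omega>) \<partial>M) \<noteq> \<infinity>"
    unfolding AE_all_countable by (intro allI AE_impI AEk)
  then have "AE s in \<nu>. (\<integral>\<^sup>+\<omega>. hf n (s, \<omega>) \<partial>M) \<le> ennreal (D powr q) * (\<integral>\<^sup>+\<omega>. hg n (s, \<omega>) \<partial>M)"
  proof (rule AE_mp, intro AE_I2 impI)
    fix s assume "s \<in> space \<nu>" and finite: "\<forall>k. k \<ge> 1 \<longrightarrow> (\<integral>\<^sup>+\<omega>. hf k (s, \<omega>) \<partial>M) \<noteq> \<infinity>"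
    then have s: "s \<in> space S" by (simp add: space\<nu>)
    have finY: "Lp_norm q M Y (fs s k) < \<infinity>" if "k \<ge> 1" for k
      unfolding Lp_norm_finite_iff using finite that by (simp add: hf_def less_top)
    have "Lp_norm q M Y (fs s n) \<le> ennreal D * Lp_norm q M Y (gs s n)"
      by (rule bound[unfolded decoupling_bound_def, THEN conjunct2, rule_format, OF cf dsum[OF s] finY n])
    then show "(\<integral>\<^sup>+\<omega>. hf n (s, \<omega>) \<partial>M) \<le> ennreal (D powr q) * (\<integral>\<^sup>+\<omega>. hg n (s, \<omega>) \<partial>M)"
      unfolding Lp_norm_le_iff[OF q_pos D0] by (simp add: hf_def hg_def)
  qed
  then have "(\<integral>\<^sup>+\<omega>. ennreal (qnorm X (f n \<omega>) powr q) \<partial>M) \<le> (\<integral>\<^sup>+s. ennreal (D powr q) * (\<integral>\<^sup>+\<omega>. hg n (s, \<omega>) \<partial>M) \<partial>\<nu>)"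
    unfolding If by (rule nn_integral_mono_AE)
  also have "\<dots> = ennreal (D powr q) * (\<integral>\<^sup>+\<omega>. ennreal (qnorm X (g n \<omega>) powr q) \<partial>M)"
    unfolding Ig by (rule nn_integral_cmult) (rule M.borel_measurable_nn_integral_fst[OF hgm])
  finally show "Lp_norm q M X (f n) \<le> ennreal D * Lp_norm q M X (g n)"
    unfolding Lp_norm_le_iff[OF q_pos D0] .
qed

section \<open>The embedding of \<open>Y\<close> by a set of finite positive measure\<close>

definition embed :: "'s set \<Rightarrow> 'y \<Rightarrow> ('s \<Rightarrow> 'y) set" where
  "embed A y = cls (\<lambda>s. if s \<in> A then y else \<zero>)"

context
  fixes A :: "'s set"
  assumes A: "A \<in> sets S" "0 < emeasure S A" "emeasure S A < \<infinity>"
begin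

lemma measure_A_pos: "0 < measure S A"
  using A by (simp add: measure_def enn2real_positive_iff)

lemma step_J: "y \<in> carrier Y \<Longrightarrow> J (\<lambda>s. if s \<in> A then y else \<zero>) = ennreal (measure S A * qnorm Y y powr q)"
proof -
  assume y: "y \<in> carrier Y"
  have "J (\<lambda>s. if s \<in> A then y else \<zero>) = (\<integral>\<^sup>+s. ennreal (qnorm Y y powr q) * indicator A s \<partial>S)"
    unfolding J_def using qnorm_0_iff[of \<zero>] q_pos by (intro nn_integral_cong) (auto simp: indicator_def)
  also have "\<dots> = ennreal (qnorm Y y powr q) * ennreal (measure S A)"
    using A by (simp add: nn_integral_cmult_indicator emeasure_eq_ennreal_measure less_top)
  finally show ?thesis by (simp add: ennreal_mult' mult.commute)
qed

lemma step_L: "y \<in> carrier Y \<Longrightarrow> (\<lambda>s. if s \<in> A then y else \<zero>) \<in> L"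
proof -
  assume y: "y \<in> carrier Y"
  have "Measurable.pred S (\<lambda>s. s \<in> A)" using A(1) by measurable
  then have "separably_valued S Y (\<lambda>s. if s \<in> A then y else \<zero>)"
    using y by (intro separably_valued_if separably_valued_const) auto
  then show ?thesis using step_J[OF y] by (simp add: L_iff)
qed

lemma embed_carrier: "y \<in> carrier Y \<Longrightarrow> embed A y \<in> carrier X"
  using step_L by (auto simp: embed_def carrier_X)

lemma qnorm_embed_powr: "y \<in> carrier Y \<Longrightarrow> qnorm X (embed A y) powr q = measure S A * qnorm Y y powr q"
proof -
  assume y: "y \<in> carrier Y"
  have "ennreal (qnorm X (embed A y) powr q) = ennreal (measure S A * qnorm Y y powr q)"
    unfolding embed_def by (simp add: ennreal_qnorm_X step_L y step_J)
  then show ?thesis by simp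
qed

lemma embed_diff: "x \<in> carrier Y \<Longrightarrow> y \<in> carrier Y \<Longrightarrow> embed A x \<ominus>\<^bsub>X\<^esub> embed A y = embed A (x \<ominus> y)"
proof -
  assume xy: "x \<in> carrier Y" "y \<in> carrier Y"
  have "(\<lambda>s. (if s \<in> A then x else \<zero>) \<ominus> (if s \<in> A then y else \<zero>)) = (\<lambda>s. if s \<in> A then x \<ominus> y else \<zero>)"
    by (auto simp: minus_self)
  then show ?thesis using xy by (simp add: embed_def cls_diff step_L)
qed

lemma embed_zero: "embed A \<zero> = \<zero>\<^bsub>X\<^esub>"
  by (simp add: embed_def zero_X)

lemma qnorm_embed_less:
  assumes "y \<in> carrier Y" "0 < \<epsilon>" "qnorm Y y < \<epsilon> / measure S A powr (1 / q)"
  shows "qnorm X (embed A y) < \<epsilon>"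
proof -
  note m = measure_A_pos
  have nn: "0 \<le> qnorm X (embed A y)" using qnorm_X_nonneg[OF step_L[OF assms(1)]] by (simp add: embed_def)
  have "(qnorm X (embed A y) powr q) powr (1 / q) = (measure S A * qnorm Y y powr q) powr (1 / q)"
    using qnorm_embed_powr[OF assms(1)] by simp
  then have "qnorm X (embed A y) = measure S A powr (1 / q) * qnorm Y y"
    using q_pos nn qnorm_ge_0[OF assms(1)] m by (simp add: powr_powr powr_mult)
  also have "\<dots> < \<epsilon>" using assms(3) m by (simp add: field_simps)
  finally show ?thesis .
qed

text \<open>The embedding multiplies the quasi-norm by the constant
  \<open>measure S A powr (1 / q)\<close> and respects differences, so it is continuous and hence
  Borel.\<close>

lemma embed_measurable: "embed A \<in> qborel Y \<rightarrow>\<^sub>M qborel X"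
proof (rule measurable_qborelI)
  fix U assume U: "openin (qtopology X) U"
  have "openin (qtopology Y) (embed A -` U \<inter> carrier Y)"
    unfolding openin_qtopology
  proof (intro conjI ballI)
    fix x assume x: "x \<in> embed A -` U \<inter> carrier Y"
    then obtain \<epsilon> where \<epsilon>: "\<epsilon> > 0" "\<And>z. z \<in> carrier X \<Longrightarrow> qnorm X (z \<ominus>\<^bsub>X\<^esub> embed A x) < \<epsilon> \<Longrightarrow> z \<in> U"
      using U unfolding openin_qtopology by blast
    have "embed A y \<in> U" if "y \<in> carrier Y" "qnorm Y (y \<ominus> x) < \<epsilon> / measure S A powr (1 / q)" for y
      using that x \<epsilon>(1) by (intro \<epsilon>(2)) (auto simp: embed_carrier embed_diff intro!: qnorm_embed_less)
    then show "\<exists>\<epsilon>>0. \<forall>y\<in>carrier Y. qnorm Y (y \<ominus> x) < \<epsilon> \<longrightarrow> y \<in> embed A -` U \<inter> carrier Y"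
      using \<epsilon>(1) measure_A_pos by (intro exI[of _ "\<epsilon> / measure S A powr (1 / q)"]) auto
  qed simp
  then show "embed A -` U \<inter> space (qborel Y) \<in> sets (qborel Y)"
    using openin_sets_qborel by (simp add: space_qborel)
qed (simp add: space_qborel embed_carrier)

lemma embed_separably_valued: "separably_valued M Y f \<Longrightarrow> separably_valued M X (\<lambda>\<omega>. embed A (f \<omega>))"
proof -
  assume f: "separably_valued M Y f"
  obtain NX rX where FX: "f_normed_group X NX rX" using f_normed_group_X by blast
  interpret X: f_normed_group X NX rX by (rule FX)
  obtain C where C: "dense_for C (f ` space M)" using f unfolding separably_valued_iff by blast
  have "X.dense_for (embed A ` C) ((\<lambda>\<omega>. embed A (f \<omega>)) ` space M)"
    unfolding X.dense_for_def
  proof (intro conjI ballI allI impI)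
    show "countable (embed A ` C)" "embed A ` C \<subseteq> carrier X" "(\<lambda>\<omega>. embed A (f \<omega>)) ` space M \<subseteq> carrier X"
      using C separably_valued_carrier[OF f] embed_carrier by (auto simp: dense_for_def)
    fix x and e :: real assume "x \<in> (\<lambda>\<omega>. embed A (f \<omega>)) ` space M" and e: "e > 0"
    then obtain \<omega> where \<omega>: "\<omega> \<in> space M" "x = embed A (f \<omega>)" by auto
    define \<epsilon> where "\<epsilon> = e powr (1 / rX) / measure S A powr (1 / q)"
    have "0 < \<epsilon>" using e measure_A_pos by (simp add: \<epsilon>_def)
    then obtain c where c: "c \<in> C" "N (f \<omega> \<ominus> c) < \<epsilon> powr r / 2"
      using dense_forD[OF C, of "f \<omega>" "\<epsilon> powr r / 2"] \<omega>(1) by auto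
    have cl: "f \<omega> \<in> carrier Y" "c \<in> carrier Y" using separably_valued_carrier[OF f \<omega>(1)] dense_for_carrier[OF C c(1)] by auto
    have "qnorm Y (f \<omega> \<ominus> c) < \<epsilon>" using cl c \<open>0 < \<epsilon>\<close> by (intro qnorm_lessI) auto
    then have "qnorm X (embed A (f \<omega> \<ominus> c)) < e powr (1 / rX)"
      using cl e by (intro qnorm_embed_less) (auto simp: \<epsilon>_def)
    then have "NX (x \<ominus>\<^bsub>X\<^esub> embed A c) < e"
      using cl e \<omega>(2) by (simp add: embed_diff) (intro X.N_lessI embed_carrier, auto)
    then show "\<exists>c\<in>embed A ` C. NX (x \<ominus>\<^bsub>X\<^esub> c) < e" using c(1) by blast
  qed
  then show ?thesis
    using measurable_compose[OF separably_valued_measurable[OF f] embed_measurable]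
    unfolding X.separably_valued_iff by blast
qed

text \<open>The moments of the process and of the decoupled sum are both multiplied by
  \<open>measure S A\<close>, which cancels, so the constant \<open>D\<close> is kept
  exactly.\<close>

lemma decoupling_bound_Y:
  assumes bound: "decoupling_bound TYPE('w) X q D"
  shows "decoupling_bound TYPE('w) Y q D"
  unfolding decoupling_bound_def
proof (intro conjI allI impI)
  show D0: "0 \<le> D" using bound by (simp add: decoupling_bound_def)
  fix M :: "'w measure" and F f g and n :: nat
  assume cf: "complete_filtered_prob_space M F" and ds: "decoupled_sum M F Y f g"
    and fin: "\<forall>n\<ge>1. Lp_norm q M Y (f n) < \<infinity>" and n: "n \<ge> 1"
  note cfD = complete_filtered_prob_spaceD[OF cf]
  let ?m = "measure S A"
  have zero: "f 0 = (\<lambda>\<omega>. \<zero>)" "g 0 = (\<lambda>\<omega>. \<zero>)" using ds by (auto simp: decoupled_sum_def)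
  have tang: "decoupled_tangent M F Y (\<lambda>k \<omega>. f k \<omega> \<ominus> f (k - 1) \<omega>) (\<lambda>k \<omega>. g k \<omega> \<ominus> g (k - 1) \<omega>)"
    using ds by (simp add: decoupled_sum_def)
  have fF: "separably_valued (F k) Y (f k)" and gM: "separably_valued M Y (g k)" if "k \<ge> 1" for k
    using ds that by (auto simp: decoupled_sum_def adapted_def)
  have fM: "separably_valued M Y (f k)" if "k \<ge> 1" for k
    by (rule separably_valued_subalgebra[OF cfD(2) fF[OF that]])
  have fc: "f k \<omega> \<in> carrier Y" and gc: "g k \<omega> \<in> carrier Y" if "\<omega> \<in> space M" for k \<omega>
    using separably_valued_carrier[OF fM that] separably_valued_carrier[OF gM that] zero by (cases "k = 0"; simp)+
  have "decoupled_tangent M F X (\<lambda>k \<omega>. embed A (f k \<omega> \<ominus> f (k - 1) \<omega>)) (\<lambda>k \<omega>. embed A (g k \<omega> \<ominus> g (k - 1) \<omega>))"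
    using tang by (intro decoupled_tangent_map[OF cf tang embed_measurable])
      (auto intro!: embed_separably_valued simp: decoupled_tangent_def adapted_def)
  then have "decoupled_tangent M F X (\<lambda>k \<omega>. embed A (f k \<omega>) \<ominus>\<^bsub>X\<^esub> embed A (f (k - 1) \<omega>))
      (\<lambda>k \<omega>. embed A (g k \<omega>) \<ominus>\<^bsub>X\<^esub> embed A (g (k - 1) \<omega>))"
    by (rule decoupled_tangent_transfer[OF cf]) (simp_all add: embed_diff fc gc)
  then have dsX: "decoupled_sum M F X (\<lambda>k \<omega>. embed A (f k \<omega>)) (\<lambda>k \<omega>. embed A (g k \<omega>))"
    using fF gM by (auto simp: decoupled_sum_def adapted_def zero embed_zero intro!: embed_separably_valued)
  have I: "(\<integral>\<^sup>+\<omega>. ennreal (qnorm X (embed A (h \<omega>)) powr q) \<partial>M) = ennreal ?m * (\<integral>\<^sup>+\<omega>. ennreal (qnorm Y (h \<omega>) powr q) \<partial>M)"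
    if h: "separably_valued M Y h" for h
  proof -
    have [measurable]: "(\<lambda>\<omega>. qnorm Y (h \<omega>)) \<in> borel_measurable M" by (rule measurable_qnorm_compose[OF h])
    have "(\<integral>\<^sup>+\<omega>. ennreal (qnorm X (embed A (h \<omega>)) powr q) \<partial>M) = (\<integral>\<^sup>+\<omega>. ennreal ?m * ennreal (qnorm Y (h \<omega>) powr q) \<partial>M)"
      using separably_valued_carrier[OF h] by (intro nn_integral_cong) (simp add: qnorm_embed_powr ennreal_mult')
    then show ?thesis by (simp add: nn_integral_cmult)
  qed
  have finX: "Lp_norm q M X (\<lambda>\<omega>. embed A (f k \<omega>)) < \<infinity>" if "k \<ge> 1" for k
  proof -
    have "Lp_norm q M Y (f k) < \<infinity>" using fin that by simp
    then show ?thesis unfolding Lp_norm_finite_iff I[OF fM[OF that]] by (simp add: ennreal_mult_less_top)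
  qed
  have "Lp_norm q M X (\<lambda>\<omega>. embed A (f n \<omega>)) \<le> ennreal D * Lp_norm q M X (\<lambda>\<omega>. embed A (g n \<omega>))"
    by (rule bound[unfolded decoupling_bound_def, THEN conjunct2, rule_format, OF cf dsX finX n])
  then have "ennreal ?m * (\<integral>\<^sup>+\<omega>. ennreal (qnorm Y (f n \<omega>) powr q) \<partial>M) \<le>
      ennreal (D powr q) * (ennreal ?m * (\<integral>\<^sup>+\<omega>. ennreal (qnorm Y (g n \<omega>) powr q) \<partial>M))"
    unfolding Lp_norm_le_iff[OF q_pos D0] I[OF fM[OF n]] I[OF gM[OF n]] .
  then have "ennreal (1 / ?m) * (ennreal ?m * (\<integral>\<^sup>+\<omega>. ennreal (qnorm Y (f n \<omega>) powr q) \<partial>M)) \<le>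
      ennreal (1 / ?m) * (ennreal (D powr q) * (ennreal ?m * (\<integral>\<^sup>+\<omega>. ennreal (qnorm Y (g n \<omega>) powr q) \<partial>M)))"
    by (rule mult_left_mono) simp
  moreover have cancel: "ennreal (1 / ?m) * (ennreal ?m * x) = x" for x
    using measure_A_pos by (simp add: mult.assoc[symmetric] ennreal_mult'[symmetric])
  ultimately have "(\<integral>\<^sup>+\<omega>. ennreal (qnorm Y (f n \<omega>) powr q) \<partial>M) \<le>
      ennreal (D powr q) * (\<integral>\<^sup>+\<omega>. ennreal (qnorm Y (g n \<omega>) powr q) \<partial>M)"
    by (simp only: mult.left_commute[of "ennreal (D powr q)" "ennreal ?m"] cancel)
  then show "Lp_norm q M Y (f n) \<le> ennreal D * Lp_norm q M Y (g n)"
    unfolding Lp_norm_le_iff[OF q_pos D0] .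
qed

end

end

text \<open>The constants agree because for the exponent \<open>p\<close> both spaces admit exactly
  the same \<open>D\<close>; only the first claim goes through the lossy extrapolation. If every
  measurable set had measure 0 or infinity, all elements of \<open>L^p(S;Y)\<close> would vanish
  almost everywhere and \<open>Y\<close> could not be embedded, hence the condition in front of the
  equality.\<close>

theorem corollary4p6:
  fixes Y :: "'y qnormed" and S :: "'s measure" and q :: real
  assumes "(UNIV :: real set) \<lesssim> (UNIV :: 'w set)"
    and "quasi_banach Y"
    and "qnorm Y \<in> borel_measurable (qborel Y)"
    and "decoupling_inequality TYPE('w) Y"
    and "emeasure S (space S) \<noteq> 0"
    and "0 < q"
  shows "decoupling_inequality TYPE('w) (Lq_space q S Y) \<and>
    ((\<exists>A\<in>sets S. 0 < emeasure S A \<and> emeasure S A < \<infinity>) \<longrightarrow>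
      (\<forall>p>0. decoupling_const TYPE('w) (Lq_space p S Y) p = decoupling_const TYPE('w) Y p))"
proof -
  interpret quasi_banach Y by fact
  obtain N r where "f_normed_double Y N r" using f_normed_double_exists by blast
  then interpret Y: f_normed_double Y N r .
  have lq: "lq_setting Y N r p" if "0 < p" for p
    by unfold_locales (use that assms(3) complete_f_norm[OF Y.f_normed_group_axioms] in auto)
  obtain p0 D0 where p0: "0 < p0" "decoupling_bound TYPE('w) Y p0 D0"
    using assms(4) by (auto simp: decoupling_inequality_def decoupling_inequality_for_def)
  then obtain D where "decoupling_bound TYPE('w) Y q D"
    using Y.decoupling_bound_extrapolate[OF assms(1) p0(2,1) assms(6)] by blast
  then have "decoupling_bound TYPE('w) (Lq_space q S Y) q D"
    by (rule lq_setting.decoupling_bound_X[OF lq[OF assms(6)]])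
  then have "decoupling_inequality TYPE('w) (Lq_space q S Y)"
    using assms(6) by (auto simp: decoupling_inequality_def decoupling_inequality_for_def)
  moreover have "decoupling_const TYPE('w) (Lq_space p S Y) p = decoupling_const TYPE('w) Y p"
    if A: "A \<in> sets S" "0 < emeasure S A" "emeasure S A < \<infinity>" and p: "0 < p" for A p
  proof -
    have "decoupling_bound TYPE('w) (Lq_space p S Y) p D \<longleftrightarrow> decoupling_bound TYPE('w) Y p D" for D
      using lq_setting.decoupling_bound_X[OF lq[OF p]] lq_setting.decoupling_bound_Y[OF lq[OF p] A] by blast
    then show ?thesis by (simp add: decoupling_const_def)
  qed
  ultimately show ?thesis by blast
qed

end
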